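(* For every $K \in \mathbb{N}$, the class of deterministic, well-formed, cons-free programs with data order $K$ characterises $\mathsf{EXPTIME}_K$: a decision problem $X \subseteq \{0,1\}^+$ is accepted by some deterministic, well-formed, cons-free program with data order $K$ if and only if $X \in \mathsf{EXPTIME}_K$.
   Context: Types are built from a finite set $\mathcal{S}$ of sorts (containing $\mathsf{bool}$ and $\mathsf{list}$) by $\sigma ::= \iota \mid \sigma \times \tau \mid \sigma \Rightarrow \tau$, with $\Rightarrow$ right-associative. Type order: $\mathrm{ord}(\iota)=0$ for sorts, $\mathrm{ord}(\sigma\times\tau)=\max(\mathrm{ord}(\sigma),\mathrm{ord}(\tau))$, $\mathrm{ord}(\sigma\Rightarrow\tau)=\max(\mathrm{ord}(\sigma)+1,\mathrm{ord}(\tau))$. Write $\kappa$ for a type that is a sort or a product; every type is uniquely $\sigma_1\Rightarrow\cdots\Rightarrow\sigma_m\Rightarrow\kappa$. Syntax. Fix pairwise disjoint sets of variables, data constructors $\mathcal{C}$ (containing $\mathsf{true},\mathsf{false}$) and defined symbols $\mathcal{D}$. Patterns: $\ell ::= x \mid c\,\ell_1\cdots\ell_m$ ($c\in\mathcal{C}$). Expressions: $s ::= x \mid c \mid f \mid \mathsf{if}\ s_1\ \mathsf{then}\ s_2\ \mathsf{else}\ s_3 \mid \mathsf{choose}\ s_1\cdots s_n \mid (s,t) \mid s\,t$ (application left-associative). A program is a finite list of clauses $f\,\ell_1\cdots\ell_k = s$ with $f \in \mathcal{D}$; its main function $f_1$ is the defined symbol of the first clause. Sub-expressions: $s \unrhd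 t$ iff $s = t$ or $s \rhd t$, where $(s_1,s_2)\rhd t$, $\mathsf{if}\ s_1\ \mathsf{then}\ s_2\ \mathsf{else}\ s_3 \rhd t$ and $\mathsf{choose}\ s_1\cdots s_n\rhd t$ hold if $s_i \unrhd t$ for some $i$, and $s_1\,s_2 \rhd t$ holds if $s_1 \rhd t$ or $s_2 \unrhd t$. Typing. A program is well-typed if there is an assignment $\mathcal{F}$ of simple types to $\mathcal{C}\cup\mathcal{D}$ such that: $f_1 : \kappa_1\Rightarrow\cdots\Rightarrow\kappa_M\Rightarrow\kappa$ with all $\kappa_i,\kappa$ of order $0$; each $c\in\mathcal{C}$ has type $\kappa_1\Rightarrow\cdots\Rightarrow\kappa_m\Rightarrow\iota$ with $\iota$ a sort and all $\kappa_i$ of order $0$; and for every clause $f\,\ell_1\cdots\ell_k=s$, all variables of $s$ occur in the left-hand side, each variable occurs at most once in the left-hand side, and there is a type environment $\Gamma$ for the left-hand side variables under which both sides have the same type (standard simple typing: $(s,t):\sigma\times\tau$, application of $\sigma\Rightarrow\tau$ to $\sigma$ gives $\tau$, $\mathsf{if}$ needs a $\mathsf{bool}$ condition and two branches of a common type, $\mathsf{choose}$ needs all arguments of a common type). It is well-formed if moreover constructors always occur fully applied and all clauses with the same root $f$ have the same number $\mathrm{arity}(f)$ of arguments. A program has data order $K$ if all clauses can be typed with environments assigning every variable a type of order $\le K$. A program is deterministic if $\mathsf{choose}$ does not occur in it. Semantics. Data expressions $d ::= c\,d_1\cdots d_m \mid (d,d')$; values $v ::= d \mid (v,w) \mid f\,v_1\cdots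 v_n$ with $n<\mathrm{arity}(f)$; environments $\gamma$ map variables to values and $\ell\gamma$ is instantiation. Judgements $p,\gamma\vdash s\to w$, $p,\gamma\vdash^{\mathrm{if}} d,s_2,s_3\to w$ and $p\vdash^{\mathrm{call}} f\,v_1\cdots v_n\to w$ are derived by: $p,\gamma\vdash x\to\gamma(x)$; $p,\gamma\vdash f\to w$ if $p\vdash^{\mathrm{call}} f\to w$; $p,\gamma\vdash c\,s_1\cdots s_m\to c\,b_1\cdots b_m$ if $p,\gamma\vdash s_i\to b_i$ for all $i$; $p,\gamma\vdash(s,t)\to(v,w)$ if $p,\gamma\vdash s\to v$ and $p,\gamma\vdash t\to w$; $p,\gamma\vdash \mathsf{choose}\ s_1\cdots s_n\to w$ if $p,\gamma\vdash s_i\to w$ for some $i$; $p,\gamma\vdash\mathsf{if}\ s_1\ \mathsf{then}\ s_2\ \mathsf{else}\ s_3\to w$ if $p,\gamma\vdash s_1\to d$ and $p,\gamma\vdash^{\mathrm{if}} d,s_2,s_3\to w$, where $p,\gamma\vdash^{\mathrm{if}}\mathsf{true},s_2,s_3\to w$ if $p,\gamma\vdash s_2\to w$ and $p,\gamma\vdash^{\mathrm{if}}\mathsf{false},s_2,s_3\to w$ if $p,\gamma\vdash s_3\to w$; $p,\gamma\vdash s\,t\to w$ if $p,\gamma\vdash s\to f\,v_1\cdots v_n$, $p,\gamma\vdash t\to v_{n+1}$ and $p\vdash^{\mathrm{call}} f\,v_1\cdots v_{n+1}\to w$; $p\vdash^{\mathrm{call}} f\,v_1\cdots v_n\to f\,v_1\cdots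 v_n$ if $n<\mathrm{arity}(f)$; $p\vdash^{\mathrm{call}} f\,v_1\cdots v_k\to w$ if $p,\gamma\vdash s\to w$ where $f\,\ell_1\cdots\ell_k=s$ is the first clause of $p$ for which there is $\gamma$ with domain the left-hand side variables and $v_i=\ell_i\gamma$ for all $i$. Finally $[\![p]\!](d_1,\dots,d_M)\mapsto b$ iff $p,[x_1:=d_1,\dots,x_M:=d_M]\vdash f_1\,x_1\cdots x_M\to b$. Cons-freeness. A clause $f\,\ell_1\cdots\ell_k=s$ is cons-free if every $t$ with $s\unrhd t$ of the form $c\,s_1\cdots s_m$ with $c\in\mathcal{C}$ is a data expression or satisfies $\ell_i\unrhd t$ for some $i$; a program is cons-free if all its clauses are. Acceptance and complexity. Consider programs with constructors $\mathsf{true},\mathsf{false}:\mathsf{bool}$, $[]:\mathsf{list}$, infix $::\ :\mathsf{bool}\Rightarrow\mathsf{list}\Rightarrow\mathsf{list}$ and main function of type $\mathsf{list}\Rightarrow\mathsf{bool}$. Such a program accepts $a_1\cdots a_n\in\{0,1\}^*$ if $[\![p]\!](\overline{a_1}::\cdots::\overline{a_n}::[])\mapsto\mathsf{true}$, where $\overline{1}=\mathsf{true}$, $\overline{0}=\mathsf{false}$; it accepts the decision problem consisting of all strings it accepts. $\exp_2^0(n)=n$, $\exp_2^{K+1}(n)=2^{\exp_2^K(n)}$. $\mathsf{TIME}(h(n))$ is the set of $X\subseteq\{0,1\}^+$ decided by some deterministic single-tape Turing machine which, for some constant $a>0$, reaches its accept or reject state within $a\cdot h(n)$ steps on every input of length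 $n\ge1$. $\mathsf{EXPTIME}_K=\bigcup_{a,b\in\mathbb{N}}\mathsf{TIME}(\exp_2^K(a\cdot n^b))$ (so $\mathsf{EXPTIME}_0=\mathsf{P}$, $\mathsf{EXPTIME}_1=\mathsf{EXP}$). A class of programs characterises a complexity class $\mathcal{K}$ if the decision problems accepted by programs in the class are exactly the members of $\mathcal{K}$. *)

theory Defs
  imports Main
begin

datatype sty = TSort string | TProd sty sty | TArr sty sty

fun ord :: "sty \<Rightarrow> nat" where
  "ord (TSort _) = 0"
| "ord (TProd a b) = max (ord a) (ord b)"
| "ord (TArr a b) = max (ord a + 1) (ord b)"

fun targs :: "sty \<Rightarrow> sty list" where
  "targs (TArr a b) = a # targs b"
| "targs _ = []"

fun tres :: "sty \<Rightarrow> sty" where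
  "tres (TArr a b) = tres b"
| "tres t = t"

fun is_sort :: "sty \<Rightarrow> bool" where
  "is_sort (TSort _) = True"
| "is_sort _ = False"

text \<open>Variables, constructors and defined symbols are strings; they are kept
  disjoint by the constructor tags of the expression datatype.\<close>

datatype pat = PVar string | PCon string "pat list"

datatype expr = Var string | Con string | Fun string
  | If expr expr expr | Choose "expr list" | Pair expr expr | App expr expr

datatype clause = Clause (cfun: string) (cpats: "pat list") (crhs: expr)

type_synonym program = "clause list"

definition apps :: "expr \<Rightarrow> expr list \<Rightarrow> expr" where
  "apps h ss = foldl App h ss"

fun pat_expr :: "pat \<Rightarrow> expr" where
  "pat_expr (PVar x) = Var x"
| "pat_expr (PCon c ls) = apps (Con c) (map pat_expr ls)"

definition lhs :: "clause \<Rightarrow> expr" where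
  "lhs cl = apps (Fun (cfun cl)) (map pat_expr (cpats cl))"

fun pat_vars :: "pat \<Rightarrow> string list" where
  "pat_vars (PVar x) = [x]"
| "pat_vars (PCon c ls) = concat (map pat_vars ls)"

definition lhs_vars :: "clause \<Rightarrow> string list" where
  "lhs_vars cl = concat (map pat_vars (cpats cl))"

fun expr_vars :: "expr \<Rightarrow> string set" where
  "expr_vars (Var x) = {x}"
| "expr_vars (Con c) = {}"
| "expr_vars (Fun f) = {}"
| "expr_vars (If a b c) = expr_vars a \<union> expr_vars b \<union> expr_vars c"
| "expr_vars (Choose ss) = (\<Union>s\<in>set ss. expr_vars s)"
| "expr_vars (Pair a b) = expr_vars a \<union> expr_vars b"
| "expr_vars (App a b) = expr_vars a \<union> expr_vars b"

fun has_choose :: "expr \<Rightarrow> bool" where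
  "has_choose (Choose ss) = True"
| "has_choose (If a b c) = (has_choose a \<or> has_choose b \<or> has_choose c)"
| "has_choose (Pair a b) = (has_choose a \<or> has_choose b)"
| "has_choose (App a b) = (has_choose a \<or> has_choose b)"
| "has_choose _ = False"

definition main_fun :: "program \<Rightarrow> string" where
  "main_fun p = cfun (hd p)"

text \<open>Strict sub-expression relation (s \<rhd> t) exactly as in the paper; note
  that for an application s1 s2 the term s1 itself is not a sub-expression.\<close>
inductive ssub :: "expr \<Rightarrow> expr \<Rightarrow> bool" where
  "s1 = t \<or> ssub s1 t \<Longrightarrow> ssub (Pair s1 s2) t"
| "s2 = t \<or> ssub s2 t \<Longrightarrow> ssub (Pair s1 s2) t"
| "s1 = t \<or> ssub s1 t \<Longrightarrow> ssub (If s1 s2 s3) t"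
| "s2 = t \<or> ssub s2 t \<Longrightarrow> ssub (If s1 s2 s3) t"
| "s3 = t \<or> ssub s3 t \<Longrightarrow> ssub (If s1 s2 s3) t"
| "s \<in> set ss \<Longrightarrow> s = t \<or> ssub s t \<Longrightarrow> ssub (Choose ss) t"
| "ssub s1 t \<Longrightarrow> ssub (App s1 s2) t"
| "s2 = t \<or> ssub s2 t \<Longrightarrow> ssub (App s1 s2) t"

definition sub :: "expr \<Rightarrow> expr \<Rightarrow> bool" where
  "sub s t \<longleftrightarrow> s = t \<or> ssub s t"

inductive has_type :: "(string \<Rightarrow> sty) \<Rightarrow> (string \<Rightarrow> sty) \<Rightarrow> (string \<Rightarrow> sty) \<Rightarrow> expr \<Rightarrow> sty \<Rightarrow> bool"
  for Fc Fd where
  "has_type Fc Fd \<Gamma> (Var x) (\<Gamma> x)"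
| "has_type Fc Fd \<Gamma> (Con c) (Fc c)"
| "has_type Fc Fd \<Gamma> (Fun f) (Fd f)"
| "has_type Fc Fd \<Gamma> a (TSort ''bool'') \<Longrightarrow> has_type Fc Fd \<Gamma> b \<tau> \<Longrightarrow> has_type Fc Fd \<Gamma> c \<tau>
     \<Longrightarrow> has_type Fc Fd \<Gamma> (If a b c) \<tau>"
| "\<forall>s\<in>set ss. has_type Fc Fd \<Gamma> s \<tau> \<Longrightarrow> has_type Fc Fd \<Gamma> (Choose ss) \<tau>"
| "has_type Fc Fd \<Gamma> a \<sigma> \<Longrightarrow> has_type Fc Fd \<Gamma> b \<tau> \<Longrightarrow> has_type Fc Fd \<Gamma> (Pair a b) (TProd \<sigma> \<tau>)"
| "has_type Fc Fd \<Gamma> s (TArr \<sigma> \<tau>) \<Longrightarrow> has_type Fc Fd \<Gamma> t \<sigma> \<Longrightarrow> has_type Fc Fd \<Gamma> (App s t) \<tau>"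

definition typed_data_order :: "(string \<Rightarrow> sty) \<Rightarrow> (string \<Rightarrow> sty) \<Rightarrow> program \<Rightarrow> nat \<Rightarrow> bool" where
  "typed_data_order Fc Fd p K \<longleftrightarrow>
     p \<noteq> [] \<and>
     (\<forall>\<sigma>\<in>set (targs (Fd (main_fun p))). ord \<sigma> = 0) \<and> ord (tres (Fd (main_fun p))) = 0 \<and>
     (\<forall>c. (\<forall>\<sigma>\<in>set (targs (Fc c)). ord \<sigma> = 0) \<and> is_sort (tres (Fc c))) \<and>
     (\<forall>cl\<in>set p.
        expr_vars (crhs cl) \<subseteq> set (lhs_vars cl) \<and> distinct (lhs_vars cl) \<and>
        (\<exists>\<Gamma> \<tau>. (\<forall>x\<in>set (lhs_vars cl). ord (\<Gamma> x) \<le> K) \<and>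
              has_type Fc Fd \<Gamma> (lhs cl) \<tau> \<and> has_type Fc Fd \<Gamma> (crhs cl) \<tau>))"

text \<open>Constructors occur fully applied: fa ar n e checks e when applied to n
  further arguments.\<close>
fun fa :: "(string \<Rightarrow> nat) \<Rightarrow> nat \<Rightarrow> expr \<Rightarrow> bool" where
  "fa ar n (Var x) = True"
| "fa ar n (Con c) = (n = ar c)"
| "fa ar n (Fun f) = True"
| "fa ar n (If a b c) = (fa ar 0 a \<and> fa ar 0 b \<and> fa ar 0 c)"
| "fa ar n (Choose ss) = (\<forall>s\<in>set ss. fa ar 0 s)"
| "fa ar n (Pair a b) = (fa ar 0 a \<and> fa ar 0 b)"
| "fa ar n (App s t) = (fa ar (Suc n) s \<and> fa ar 0 t)"

definition well_formed :: "(string \<Rightarrow> sty) \<Rightarrow> program \<Rightarrow> bool" where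
  "well_formed Fc p \<longleftrightarrow>
     (\<forall>cl\<in>set p. fa (\<lambda>c. length (targs (Fc c))) 0 (lhs cl)
               \<and> fa (\<lambda>c. length (targs (Fc c))) 0 (crhs cl)) \<and>
     (\<forall>cl1\<in>set p. \<forall>cl2\<in>set p. cfun cl1 = cfun cl2 \<longrightarrow> length (cpats cl1) = length (cpats cl2))"

definition deterministic :: "program \<Rightarrow> bool" where
  "deterministic p \<longleftrightarrow> (\<forall>cl\<in>set p. \<not> has_choose (crhs cl))"

inductive is_data :: "expr \<Rightarrow> bool" where
  "\<forall>d\<in>set ds. is_data d \<Longrightarrow> is_data (apps (Con c) ds)"
| "is_data a \<Longrightarrow> is_data b \<Longrightarrow> is_data (Pair a b)"

definition cons_free_clause :: "clause \<Rightarrow> bool" where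
  "cons_free_clause cl \<longleftrightarrow>
     (\<forall>t c ss. sub (crhs cl) t \<and> t = apps (Con c) ss \<longrightarrow>
        is_data t \<or> (\<exists>l\<in>set (cpats cl). sub (pat_expr l) t))"

definition cons_free :: "program \<Rightarrow> bool" where
  "cons_free p \<longleftrightarrow> (\<forall>cl\<in>set p. cons_free_clause cl)"

datatype val = VCon string "val list" | VPair val val | VFun string "val list"

fun inst :: "(string \<Rightarrow> val) \<Rightarrow> pat \<Rightarrow> val" where
  "inst \<gamma> (PVar x) = \<gamma> x"
| "inst \<gamma> (PCon c ls) = VCon c (map (inst \<gamma>) ls)"

definition arity :: "program \<Rightarrow> string \<Rightarrow> nat" where
  "arity p f = (case find (\<lambda>cl. cfun cl = f) p of Some cl \<Rightarrow> length (cpats cl) | None \<Rightarrow> 0)"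

definition matches :: "clause \<Rightarrow> string \<Rightarrow> val list \<Rightarrow> bool" where
  "matches cl f vs \<longleftrightarrow> cfun cl = f \<and> (\<exists>\<gamma>. map (inst \<gamma>) (cpats cl) = vs)"

definition first_clause :: "program \<Rightarrow> string \<Rightarrow> val list \<Rightarrow> nat \<Rightarrow> bool" where
  "first_clause p f vs i \<longleftrightarrow> i < length p \<and> matches (p ! i) f vs \<and> (\<forall>j<i. \<not> matches (p ! j) f vs)"

inductive eval :: "program \<Rightarrow> (string \<Rightarrow> val) \<Rightarrow> expr \<Rightarrow> val \<Rightarrow> bool"
  and call :: "program \<Rightarrow> string \<Rightarrow> val list \<Rightarrow> val \<Rightarrow> bool"
  for p where
  ev_var: "eval p \<gamma> (Var x) (\<gamma> x)"
| ev_fun: "call p f [] w \<Longrightarrow> eval p \<gamma> (Fun f) w"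
| ev_con: "list_all2 (eval p \<gamma>) ss bs \<Longrightarrow> eval p \<gamma> (apps (Con c) ss) (VCon c bs)"
| ev_pair: "eval p \<gamma> s v \<Longrightarrow> eval p \<gamma> t w \<Longrightarrow> eval p \<gamma> (Pair s t) (VPair v w)"
| ev_choose: "i < length ss \<Longrightarrow> eval p \<gamma> (ss ! i) w \<Longrightarrow> eval p \<gamma> (Choose ss) w"
| ev_if_true: "eval p \<gamma> s1 (VCon ''true'' []) \<Longrightarrow> eval p \<gamma> s2 w \<Longrightarrow> eval p \<gamma> (If s1 s2 s3) w"
| ev_if_false: "eval p \<gamma> s1 (VCon ''false'' []) \<Longrightarrow> eval p \<gamma> s3 w \<Longrightarrow> eval p \<gamma> (If s1 s2 s3) w"
| ev_app: "eval p \<gamma> s (VFun f vs) \<Longrightarrow> eval p \<gamma> t v \<Longrightarrow> call p f (vs @ [v]) w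
           \<Longrightarrow> eval p \<gamma> (App s t) w"
| call_partial: "length vs < arity p f \<Longrightarrow> call p f vs (VFun f vs)"
| call_clause: "first_clause p f vs i \<Longrightarrow> map (inst \<delta>) (cpats (p ! i)) = vs
           \<Longrightarrow> eval p \<delta> (crhs (p ! i)) w \<Longrightarrow> call p f vs w"

definition bool_val :: "bool \<Rightarrow> val" where
  "bool_val b = VCon (if b then ''true'' else ''false'') []"

definition input_val :: "bool list \<Rightarrow> val" where
  "input_val w = foldr (\<lambda>a l. VCon ''cons'' [bool_val a, l]) w (VCon ''nil'' [])"

definition io_signature :: "(string \<Rightarrow> sty) \<Rightarrow> (string \<Rightarrow> sty) \<Rightarrow> program \<Rightarrow> bool" where
  "io_signature Fc Fd p \<longleftrightarrow>
     Fc ''true'' = TSort ''bool'' \<and> Fc ''false'' = TSort ''bool'' \<and> Fc ''nil'' = TSort ''list'' \<and>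
     Fc ''cons'' = TArr (TSort ''bool'') (TArr (TSort ''list'') (TSort ''list'')) \<and>
     Fd (main_fun p) = TArr (TSort ''list'') (TSort ''bool'')"

definition accepts :: "program \<Rightarrow> bool list \<Rightarrow> bool" where
  "accepts p w \<longleftrightarrow> eval p (\<lambda>_. input_val w) (App (Fun (main_fun p)) (Var ''x'')) (VCon ''true'' [])"

definition lang :: "program \<Rightarrow> bool list set" where
  "lang p = {w. accepts p w}"

definition det_wf_cf_prog :: "nat \<Rightarrow> program \<Rightarrow> bool" where
  "det_wf_cf_prog K p \<longleftrightarrow> deterministic p \<and> cons_free p \<and>
     (\<exists>Fc Fd. typed_data_order Fc Fd p K \<and> well_formed Fc p \<and> io_signature Fc Fd p)"

datatype dir = Lft | Rgt | Stay

text \<open>Single-tape deterministic TM with states and symbols coded as naturals;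
  symbol 0 is the blank, 1 encodes input bit 0, 2 encodes input bit 1.
  The tape is two-way infinite.\<close>
record tm =
  tm_states :: "nat set"
  tm_syms :: "nat set"
  tm_start :: nat
  tm_acc :: nat
  tm_rej :: nat
  tm_delta :: "nat \<Rightarrow> nat \<Rightarrow> nat \<times> nat \<times> dir"

definition valid_tm :: "tm \<Rightarrow> bool" where
  "valid_tm M \<longleftrightarrow> finite (tm_states M) \<and> finite (tm_syms M) \<and> {0,1,2} \<subseteq> tm_syms M \<and>
     tm_start M \<in> tm_states M \<and> tm_acc M \<in> tm_states M \<and> tm_rej M \<in> tm_states M \<and>
     tm_acc M \<noteq> tm_rej M \<and>
     (\<forall>q\<in>tm_states M. \<forall>a\<in>tm_syms M. case tm_delta M q a of (q', b, d) \<Rightarrow>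
          q' \<in> tm_states M \<and> b \<in> tm_syms M)"

type_synonym config = "nat \<times> (int \<Rightarrow> nat) \<times> int"

fun shift :: "dir \<Rightarrow> int" where
  "shift Lft = -1" | "shift Rgt = 1" | "shift Stay = 0"

definition tm_step :: "tm \<Rightarrow> config \<Rightarrow> config" where
  "tm_step M c = (case c of (q, T, h) \<Rightarrow>
     if q = tm_acc M \<or> q = tm_rej M then (q, T, h)
     else (case tm_delta M q (T h) of (q', b, d) \<Rightarrow> (q', T(h := b), h + shift d)))"

definition tm_init :: "tm \<Rightarrow> bool list \<Rightarrow> config" where
  "tm_init M w = (tm_start M,
     (\<lambda>i. if 0 \<le> i \<and> nat i < length w then (if w ! nat i then 2 else 1) else 0), 0)"

definition TIME :: "(nat \<Rightarrow> nat) \<Rightarrow> bool list set set" where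
  "TIME h = {X. (\<forall>w\<in>X. w \<noteq> []) \<and>
     (\<exists>M. valid_tm M \<and> (\<exists>a::nat. a > 0 \<and> (\<forall>w. w \<noteq> [] \<longrightarrow>
        (\<exists>t\<le>a * h (length w). fst ((tm_step M ^^ t) (tm_init M w))
             = (if w \<in> X then tm_acc M else tm_rej M)))))}"

fun exp2 :: "nat \<Rightarrow> nat \<Rightarrow> nat" where
  "exp2 0 n = n"
| "exp2 (Suc K) n = 2 ^ exp2 K n"

definition EXPTIME :: "nat \<Rightarrow> bool list set set" where
  "EXPTIME K = (\<Union>a. \<Union>b. TIME (\<lambda>n. exp2 K (a * n ^ b)))"

end

theory Submission
  imports Defs "HOL-Library.Countable"
begin

text \<open>A cons-free program only handles data that are suffixes of its input or constants of the program, so a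
  value can be replaced by the finite set of observations that can be made of it: data are observed as themselves,
  and a function by pairs of a list of observations of its argument and an observation of its result. Types of order
  \<open>K\<close> have at most \<open>K\<close>-fold exponentially many such observations, and the observations of all clauses form a least
  fixed point, which is computed by iteration within the growth rate. Soundness of the fixed point
  uses determinism, since each observation of a function value comes from a separate run.

  Conversely, a deterministic machine is simulated by recomputing the content of a cell at a given time from three cells at
  the previous time. This only needs counters with a test for zero, a predecessor and a largest number;
  a counter up to \<open>2 ^ m\<close> is a function that maps counters up to \<open>m\<close> to bits, which raises the data order by one.\<close>

subsection \<open>Iterated-exponential growth rates\<close>

text \<open>The count works because one exponential is saved and then spent: for
  \<open>K > 0\<close> a functional argument of order at most \<open>K\<close> has only (K-1)-fold
  exponentially many observations, so its codes, which are sets of them, are K-fold exponentially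
  many, and so are the facts about calls. For a least fixed point the rules must be monotone; an
  application therefore accepts any set of observations that hold of the argument, not just the full
  set, and call facts are never negated. As evaluation is call by value, being defined is an
  observation of its own. The time bound must hold for a concrete single-tape machine. The growth
  rates are closed under sums and products, so polynomial overhead is harmless: numbers are kept in
  unary, and every access walks from the left end and back. In the other direction the program
  cannot build data. The input, carried along through the calls, is the only source of large digits,
  and acceptance has to be read off one fixed cell, at the largest representable position and
  time.\<close>

definition bnd :: "nat \<Rightarrow> (nat \<Rightarrow> nat) \<Rightarrow> bool" where
  "bnd K f \<longleftrightarrow> (\<exists>a b. \<forall>n\<ge>1. f n \<le> exp2 K (a * n ^ b))"

lemma exp2_strict: "exp2 K x + 1 \<le> exp2 K (x + 1)"
proof (induction K)
  case (Suc K)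
  have "(2::nat) ^ exp2 K x + 1 \<le> 2 ^ exp2 K x * 2" by simp
  also have "\<dots> = 2 ^ (exp2 K x + 1)" by simp
  also have "\<dots> \<le> 2 ^ exp2 K (x + 1)" using Suc by (intro power_increasing) auto
  finally show ?case by simp
qed simp

lemma exp2_mono: "x \<le> y \<Longrightarrow> exp2 K x \<le> exp2 K y"
  by (induction K) (auto intro: power_increasing)

lemma exp2_ge: "x \<le> exp2 K x"
proof (induction K)
  case (Suc K)
  have "exp2 K x < 2 ^ exp2 K x" by (rule less_exp)
  then show ?case using Suc by (simp add: less_imp_le order.strict_trans1)
qed simp

text \<open>At level 0 this is plain doubling; above it, adding 1 to the argument already doubles
  the outermost power. The argument \<open>2 * z + 1\<close> covers both cases, also at
  \<open>z = 0\<close>.\<close>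

lemma exp2_double: "2 * exp2 K z \<le> exp2 K (2 * z + 1)"
proof (cases K)
  case (Suc K')
  have "exp2 K' z + 1 \<le> exp2 K' (2 * z + 1)"
    using exp2_strict[of K' z] exp2_mono[of "z + 1" "2 * z + 1" K'] by simp
  then have "(2::nat) ^ (exp2 K' z + 1) \<le> 2 ^ exp2 K' (2 * z + 1)" by (intro power_increasing) auto
  then show ?thesis using Suc by simp
qed simp

lemma exp2_add: "exp2 K x + exp2 K y \<le> exp2 K (2 * (x + y) + 1)"
  using exp2_mono[of x "x + y" K] exp2_mono[of y "x + y" K] exp2_double[of K "x + y"] by linarith

text \<open>A product of towers is a tower over a sum one level down; the square is there for level
  0, where the product is polynomial.\<close>

lemma exp2_mult: "exp2 K x * exp2 K y \<le> exp2 K ((2 * (x + y) + 1) ^ 2)"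
proof (cases K)
  case 0
  have "x * y \<le> (2 * (x + y) + 1) ^ 2" by (simp add: power2_eq_square algebra_simps)
  then show ?thesis using 0 by simp
next
  case (Suc K')
  have "exp2 K' x + exp2 K' y \<le> exp2 K' ((2 * (x + y) + 1) ^ 2)"
    using exp2_add[of K' x y] exp2_mono[of "2 * (x + y) + 1" "(2 * (x + y) + 1) ^ 2" K']
    by (simp add: power2_eq_square)
  then have "(2::nat) ^ (exp2 K' x + exp2 K' y) \<le> 2 ^ exp2 K' ((2 * (x + y) + 1) ^ 2)"
    by (intro power_increasing) auto
  then show ?thesis using Suc by (simp add: power_add)
qed

lemma bnd_mono: "bnd K g \<Longrightarrow> (\<And>n. n \<ge> 1 \<Longrightarrow> f n \<le> g n) \<Longrightarrow> bnd K f"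
  unfolding bnd_def by (meson order_trans)

text \<open>Brings the sum that arises in \<open>exp2_add\<close> and \<open>exp2_mult\<close> back
  to a single monomial, the shape that \<open>bnd\<close> demands; this is why \<open>bnd\<close>
  ignores \<open>n = 0\<close>.\<close>

lemma poly_sum_le:
  assumes "(n::nat) \<ge> 1"
  shows "2 * (a * n ^ b + c * n ^ d) + 1 \<le> (2 * (a + c) + 1) * n ^ (b + d)"
proof -
  have "a * n ^ b \<le> a * n ^ (b + d)" "c * n ^ d \<le> c * n ^ (b + d)" "1 \<le> n ^ (b + d)"
    using assms by (auto intro!: mult_left_mono power_increasing)
  then show ?thesis unfolding distrib_left distrib_right by linarith
qed

lemma bnd_add [intro]: assumes "bnd K f" "bnd K g" shows "bnd K (\<lambda>n. f n + g n)"
proof -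
  obtain a b c d where f: "\<And>n. n \<ge> 1 \<Longrightarrow> f n \<le> exp2 K (a * n ^ b)"
    and g: "\<And>n. n \<ge> 1 \<Longrightarrow> g n \<le> exp2 K (c * n ^ d)"
    using assms unfolding bnd_def by blast
  have "f n + g n \<le> exp2 K ((2 * (a + c) + 1) * n ^ (b + d))" if "n \<ge> 1" for n
    using f[OF that] g[OF that] exp2_add[of K "a * n ^ b" "c * n ^ d"]
      exp2_mono[OF poly_sum_le[OF that, of a b c d], of K] by linarith
  then show ?thesis unfolding bnd_def by blast
qed

lemma bnd_mult [intro]: assumes "bnd K f" "bnd K g" shows "bnd K (\<lambda>n. f n * g n)"
proof -
  obtain a b c d where f: "\<And>n. n \<ge> 1 \<Longrightarrow> f n \<le> exp2 K (a * n ^ b)"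
    and g: "\<And>n. n \<ge> 1 \<Longrightarrow> g n \<le> exp2 K (c * n ^ d)"
    using assms unfolding bnd_def by blast
  have "f n * g n \<le> exp2 K ((2 * (a + c) + 1) ^ 2 * n ^ ((b + d) * 2))" if n: "n \<ge> 1" for n
  proof -
    have "f n * g n \<le> exp2 K (a * n ^ b) * exp2 K (c * n ^ d)"
      using f[OF n] g[OF n] by (rule mult_mono) auto
    also have "\<dots> \<le> exp2 K ((2 * (a * n ^ b + c * n ^ d) + 1) ^ 2)" by (rule exp2_mult)
    also have "\<dots> \<le> exp2 K (((2 * (a + c) + 1) * n ^ (b + d)) ^ 2)"
      by (intro exp2_mono power_mono poly_sum_le n) auto
    also have "\<dots> = exp2 K ((2 * (a + c) + 1) ^ 2 * n ^ ((b + d) * 2))"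
      by (simp only: power_mult_distrib power_mult)
    finally show ?thesis .
  qed
  then show ?thesis unfolding bnd_def by blast
qed

lemma bnd_const [intro, simp]: "bnd K (\<lambda>_. c)"
  unfolding bnd_def by (rule exI[of _ c], rule exI[of _ 0]) (simp add: exp2_ge)

lemma bnd_id [intro, simp]: "bnd K (\<lambda>n. n)"
  unfolding bnd_def by (rule exI[of _ 1], rule exI[of _ 1]) (simp add: exp2_ge)

lemma bnd_Suc [intro]: "bnd K f \<Longrightarrow> bnd K (\<lambda>n. Suc (f n))"
  using bnd_add[of K f "\<lambda>_. 1"] by simp

lemma bnd_pow2: "bnd K f \<Longrightarrow> bnd (Suc K) (\<lambda>n. 2 ^ f n)"
  unfolding bnd_def by (auto intro!: power_increasing)

lemma bnd_lift: assumes "bnd K f" "K \<le> K'" shows "bnd K' f"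
proof -
  have "bnd (Suc k) f" if "bnd k f" for k
    by (rule bnd_mono[OF bnd_pow2[OF that]]) (auto intro: less_imp_le[OF less_exp])
  with assms(2,1) show ?thesis by (induction rule: dec_induct) auto
qed

subsection \<open>A track language compiled to single-tape machines\<close>

text \<open>A track is read as a number, namely the first position that is not set.
  \<open>SET r m b\<close> writes \<open>b\<close> on track \<open>m\<close> at the position given by track \<open>r\<close>; the tests of \<open>IF\<close> and
  \<open>WHILE\<close> read track \<open>m\<close> there. So \<open>SET r r True\<close> increments and \<open>IF x y\<close> tests \<open>x < y\<close>.
  The step count of the semantics is the one of the compiled machine.\<close>

datatype com = SKIP | SET nat nat bool | RESET nat | SEQ com com
  | IF nat nat com com | WHILE nat nat com

instance com :: countable by countable_datatype

type_synonym tracks = "nat \<Rightarrow> nat \<Rightarrow> bool"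

definition isval :: "tracks \<Rightarrow> nat \<Rightarrow> nat \<Rightarrow> bool" where
  "isval s r x \<longleftrightarrow> (\<forall>y<x. s r y) \<and> \<not> s r x"

text \<open>The cost \<open>2 * x + 2\<close> is a walk of \<open>x\<close> squares to the first
  gap, one step that acts and turns there, and \<open>x + 1\<close> steps home, the last of which
  turns round on square -1.\<close>

inductive bs :: "com \<Rightarrow> tracks \<Rightarrow> nat \<Rightarrow> tracks \<Rightarrow> bool" where
  bs_skip: "bs SKIP s 1 s"
| bs_set: "isval s r x \<Longrightarrow> bs (SET r m b) s (2 * x + 2) (s(m := (s m)(x := b)))"
| bs_reset: "isval s r x \<Longrightarrow> bs (RESET r) s (2 * x + 2) (s(r := (\<lambda>i. s r i \<and> x \<le> i)))"
| bs_seq: "bs a s t1 s1 \<Longrightarrow> bs b s1 t2 s2 \<Longrightarrow> bs (SEQ a b) s (1 + t1 + t2) s2"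
| bs_if_true: "isval s r x \<Longrightarrow> s m x \<Longrightarrow> bs a s t s' \<Longrightarrow> bs (IF r m a b) s (2 * x + 2 + t) s'"
| bs_if_false: "isval s r x \<Longrightarrow> \<not> s m x \<Longrightarrow> bs b s t s' \<Longrightarrow> bs (IF r m a b) s (2 * x + 2 + t) s'"
| bs_while_true: "isval s r x \<Longrightarrow> s m x \<Longrightarrow> bs a s t1 s1 \<Longrightarrow> bs (WHILE r m a) s1 t2 s2
    \<Longrightarrow> bs (WHILE r m a) s (2 * x + 2 + t1 + t2) s2"
| bs_while_false: "isval s r x \<Longrightarrow> \<not> s m x \<Longrightarrow> bs (WHILE r m a) s (2 * x + 2) s"

section \<open>Finite control of the compiled machine\<close>

datatype ctl = Run "com list" | Back nat bool "com list" | Acc | Rej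

instance ctl :: countable by countable_datatype

text \<open>On the way back no position needs to be remembered: the head runs over the set squares
  of track \<open>r\<close> and turns at square -1, which is blank. \<open>RESET\<close> clears
  during that return. \<open>z\<close> is the track whose bit at square 0 decides
  acceptance.\<close>

fun ctl_step :: "nat \<Rightarrow> ctl \<Rightarrow> nat \<Rightarrow> ctl \<times> nat \<times> dir" where
  "ctl_step z (Run []) a = (if bit a z then Acc else Rej, a, Stay)"
| "ctl_step z (Run (SKIP # k)) a = (Run k, a, Stay)"
| "ctl_step z (Run (SEQ c1 c2 # k)) a = (Run (c1 # c2 # k), a, Stay)"
| "ctl_step z (Run (SET r m b # k)) a = (if bit a r then (Run (SET r m b # k), a, Rgt)
     else (Back r False k, if b then set_bit m a else unset_bit m a, Lft))"
| "ctl_step z (Run (RESET r # k)) a = (if bit a r then (Run (RESET r # k), a, Rgt)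
     else (Back r True k, a, Lft))"
| "ctl_step z (Run (IF r m c1 c2 # k)) a = (if bit a r then (Run (IF r m c1 c2 # k), a, Rgt)
     else (Back r False ((if bit a m then c1 else c2) # k), a, Lft))"
| "ctl_step z (Run (WHILE r m c # k)) a = (if bit a r then (Run (WHILE r m c # k), a, Rgt)
     else (Back r False (if bit a m then c # WHILE r m c # k else k), a, Lft))"
| "ctl_step z (Back r clr k) a = (if bit a r then (Back r clr k, if clr then unset_bit r a else a, Lft)
     else (Run k, a, Rgt))"
| "ctl_step z q a = (q, a, Stay)"

text \<open>The continuations that arise while \<open>c\<close> is run before \<open>k\<close>.\<close>

fun conts :: "com \<Rightarrow> com list \<Rightarrow> com list set" where
  "conts (SEQ a b) k = insert (SEQ a b # k) (conts a (b # k) \<union> conts b k)"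
| "conts (IF r m a b) k = insert (IF r m a b # k) (conts a k \<union> conts b k)"
| "conts (WHILE r m a) k = insert (WHILE r m a # k) (conts a (WHILE r m a # k))"
| "conts c k = {c # k}"

fun trk :: "com \<Rightarrow> nat" where
  "trk SKIP = 0"
| "trk (SET r m b) = Suc (max r m)"
| "trk (RESET r) = Suc r"
| "trk (SEQ a b) = max (trk a) (trk b)"
| "trk (IF r m a b) = max (Suc (max r m)) (max (trk a) (trk b))"
| "trk (WHILE r m a) = max (Suc (max r m)) (trk a)"

lemma finite_conts: "finite (conts c k)"
  by (induction c arbitrary: k) auto

lemma conts_self: "c # k \<in> conts c k"
  by (cases c) auto

fun succs :: "com list \<Rightarrow> com list set" where
  "succs [] = {}"
| "succs (SEQ a b # k) = {a # b # k}"
| "succs (IF r m a b # k) = {a # k, b # k}"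
| "succs (WHILE r m a # k) = {a # WHILE r m a # k, k}"
| "succs (c # k) = {k}"

text \<open>A loop returns to its own continuation instead of lengthening it, and the other
  successors start with a smaller command; so everything reachable before \<open>k\<close> stays in
  a finite set, which gives the machine finitely many states.\<close>

lemma conts_succs: "x \<in> conts c k \<Longrightarrow> succs x \<subseteq> insert k (conts c k)"
proof (induction c arbitrary: k x)
  case (SEQ a b)
  then consider "x = SEQ a b # k" | "x \<in> conts a (b # k)" | "x \<in> conts b k" by auto
  then show ?case
    by cases (use SEQ.IH conts_self[of a "b # k"] conts_self[of b k] in fastforce)+
next
  case (IF r m a b)
  then consider "x = IF r m a b # k" | "x \<in> conts a k" | "x \<in> conts b k" by auto
  then show ?case
    by cases (use IF.IH conts_self[of a k] conts_self[of b k] in fastforce)+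
next
  case (WHILE r m a)
  then consider "x = WHILE r m a # k" | "x \<in> conts a (WHILE r m a # k)" by auto
  then show ?case
    by cases (use WHILE.IH conts_self[of a "WHILE r m a # k"] in fastforce)+
qed auto

lemma conts_trk: "x \<in> conts c k \<Longrightarrow> \<exists>h k'. x = h # k' \<and> trk h \<le> trk c"
  by (induction c arbitrary: k) (auto, (metis max.coboundedI1 max.coboundedI2)+)

definition ctl_states :: "com \<Rightarrow> ctl set" where
  "ctl_states c = Run ` insert [] (conts c []) \<union>
     (\<lambda>(r, b, k). Back r b k) ` ({..<trk c} \<times> UNIV \<times> insert [] (conts c [])) \<union> {Acc, Rej}"

lemma finite_ctl_states: "finite (ctl_states c)"
  unfolding ctl_states_def by (intro finite_UnI finite_imageI finite_cartesian_product) (auto simp: finite_conts)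

lemma less_pow2_iff: "(a::nat) < 2 ^ D \<longleftrightarrow> (\<forall>m\<ge>D. \<not> bit a m)"
proof
  assume "a < 2 ^ D"
  then have "take_bit D a = a" by (simp add: take_bit_nat_eq_self_iff)
  then show "\<forall>m\<ge>D. \<not> bit a m" by (metis bit_take_bit_iff not_le)
next
  assume "\<forall>m\<ge>D. \<not> bit a m"
  then have "take_bit D a = a" by (intro bit_eqI) (auto simp: bit_take_bit_iff not_less[symmetric])
  then show "a < 2 ^ D" by (simp add: take_bit_nat_eq_self_iff)
qed

lemma ctl_states_step:
  assumes "q \<in> ctl_states c" "a < 2 ^ D" "trk c \<le> D" "ctl_step z q a = (q', a', d)"
  shows "q' \<in> ctl_states c \<and> a' < 2 ^ D"
proof -
  let ?S = "insert [] (conts c [])"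
  have sets: "set_bit m a < 2 ^ D" "unset_bit m a < 2 ^ D" if "m < D" for m
    using assms(2) that unfolding less_pow2_iff
    by (auto simp: bit_set_bit_iff bit_unset_bit_iff)
  have unset: "unset_bit m a < 2 ^ D" for m
    using assms(2) unfolding less_pow2_iff by (auto simp: bit_unset_bit_iff)
  have runI: "Run k \<in> ctl_states c" if "k \<in> ?S" for k
    using that unfolding ctl_states_def by blast
  have backI: "Back r b k \<in> ctl_states c" if "r < trk c" "k \<in> ?S" for r b k
    using that unfolding ctl_states_def by (intro UnI1 UnI2 image_eqI[where x = "(r, b, k)"]) auto
  have halts: "Acc \<in> ctl_states c" "Rej \<in> ctl_states c" unfolding ctl_states_def by auto
  from assms(1) consider (run) k where "q = Run k" "k \<in> ?S"
    | (bk) r b k where "q = Back r b k" "r < trk c" "k \<in> ?S" | (halt) "q = Acc \<or> q = Rej"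
    unfolding ctl_states_def by (elim UnE imageE) auto
  then show ?thesis
  proof cases
    case run
    show ?thesis
    proof (cases "k = []")
      case True
      then show ?thesis using assms run halts by (auto split: if_splits)
    next
      case False
      then have kc: "k \<in> conts c []" using run by auto
      then obtain h k' where h: "k = h # k'" "trk h \<le> trk c" using conts_trk by blast
      have ss: "succs k \<subseteq> ?S" using conts_succs[OF kc] .
      show ?thesis
        using assms(2-4) run h ss sets
        by (cases h) (auto split: if_splits intro!: runI backI)
    qed
  next
    case bk
    then show ?thesis using bk assms(2,4) unset by (auto split: if_splits intro!: runI backI)
  next
    case halt
    then show ?thesis using assms halts by auto
  qed
qed

text \<open>\<open>max 2\<close> keeps the input symbols 1 and 2, which set bits 0 and 1, in the
  alphabet even if the command uses fewer tracks.\<close>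

definition compile :: "nat \<Rightarrow> com \<Rightarrow> tm" where
  "compile z c = \<lparr> tm_states = to_nat ` ctl_states c, tm_syms = {a. a < 2 ^ max 2 (trk c)},
     tm_start = to_nat (Run [c]), tm_acc = to_nat Acc, tm_rej = to_nat Rej,
     tm_delta = (\<lambda>q a. case ctl_step z (from_nat q) a of (q', b, d) \<Rightarrow> (to_nat q', b, d)) \<rparr>"

lemma valid_compile: "valid_tm (compile z c)"
proof -
  have "{0, 1, 2} \<subseteq> {a::nat. a < 2 ^ max 2 (trk c)}"
    using power_increasing[of 2 "max 2 (trk c)" "2::nat"] by auto
  moreover have "Run [c] \<in> ctl_states c" "Acc \<in> ctl_states c" "Rej \<in> ctl_states c"
    unfolding ctl_states_def using conts_self[of c "[]"] by auto
  moreover have "case tm_delta (compile z c) q a of (q', b, d) \<Rightarrow>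
          q' \<in> tm_states (compile z c) \<and> b \<in> tm_syms (compile z c)"
    if qa: "q \<in> tm_states (compile z c)" "a \<in> tm_syms (compile z c)" for q a
  proof -
    obtain q0 where q0: "q0 \<in> ctl_states c" "q = to_nat q0" using qa unfolding compile_def by auto
    obtain q1 b d where s: "ctl_step z q0 a = (q1, b, d)" by (metis prod_cases3)
    show ?thesis using ctl_states_step[OF q0(1) _ _ s, of "max 2 (trk c)"] qa q0 s
      by (auto simp: compile_def)
  qed
  ultimately show ?thesis
    unfolding valid_tm_def by (auto simp: compile_def finite_ctl_states)
qed

text \<open>A symbol is the number whose bits are the tracks at that square. The absence of bits
  left of square 0 is what stops \<open>Back\<close>.\<close>

definition tape_of :: "tracks \<Rightarrow> (int \<Rightarrow> nat) \<Rightarrow> bool" where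
  "tape_of s T \<longleftrightarrow> (\<forall>i m. bit (T i) m \<longleftrightarrow> 0 \<le> i \<and> s m (nat i))"

abbreviation conf :: "ctl \<Rightarrow> (int \<Rightarrow> nat) \<Rightarrow> int \<Rightarrow> config" where
  "conf q T h \<equiv> (to_nat q, T, h)"

lemma tm_step_compile:
  "q \<noteq> Acc \<Longrightarrow> q \<noteq> Rej \<Longrightarrow> tm_step (compile z c) (conf q T h) =
    (case ctl_step z q (T h) of (q', b, d) \<Rightarrow> conf q' (T(h := b)) (h + shift d))"
  by (auto simp: tm_step_def compile_def split: prod.splits)

section \<open>Simulation of commands on the tape\<close>

definition steps :: "nat \<Rightarrow> com \<Rightarrow> nat \<Rightarrow> config \<Rightarrow> config \<Rightarrow> bool" where
  "steps z c t x y \<longleftrightarrow> (tm_step (compile z c) ^^ t) x = y"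

lemma steps_0: "steps z c 0 x x" by (simp add: steps_def)

lemma steps_trans: "steps z c t1 x y \<Longrightarrow> steps z c t2 y w \<Longrightarrow> steps z c (t1 + t2) x w"
  unfolding steps_def by (subst add.commute) (simp add: funpow_add)

lemma steps_1: "q \<noteq> Acc \<Longrightarrow> q \<noteq> Rej \<Longrightarrow> ctl_step z q (T h) = (q', b, d) \<Longrightarrow>
   steps z c 1 (conf q T h) (conf q' (T(h := b)) (h + shift d))"
  by (simp add: steps_def tm_step_compile)

lemma forward:
  assumes "tape_of s T" "isval s r x"
    and move: "\<And>a. bit a r \<Longrightarrow> ctl_step z (Run (i # k)) a = (Run (i # k), a, Rgt)"
  shows "y \<le> x \<Longrightarrow> steps z c y (conf (Run (i # k)) T 0) (conf (Run (i # k)) T (int y))"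
proof (induction y)
  case (Suc y)
  have "bit (T (int y)) r" using assms(1,2) Suc.prems by (auto simp: tape_of_def isval_def)
  then have "ctl_step z (Run (i # k)) (T (int y)) = (Run (i # k), T (int y), Rgt)" by (rule move)
  then have "steps z c 1 (conf (Run (i # k)) T (int y)) (conf (Run (i # k)) T (int (Suc y)))"
    using steps_1[of "Run (i # k)" z T "int y" "Run (i # k)" "T (int y)" Rgt c] by (simp add: add.commute)
  then show ?case using steps_trans[OF Suc.IH] Suc.prems by fastforce
qed (simp add: steps_0)

lemma backward:
  assumes "tape_of s T" "\<forall>y<x. s r y"
  shows "\<exists>T'. tape_of (if clr then s(r := (\<lambda>i. s r i \<and> x \<le> i)) else s) T' \<and>
    steps z c (x + 1) (conf (Back r clr k) T (int x - 1)) (conf (Run k) T' 0)"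
  using assms
proof (induction x arbitrary: s T)
  case 0
  have "\<not> bit (T (-1)) r" using 0 by (auto simp: tape_of_def)
  then have "ctl_step z (Back r clr k) (T (-1)) = (Run k, T (-1), Rgt)" by simp
  then show ?case using 0 steps_1[of "Back r clr k" z T "-1" "Run k" "T (-1)" Rgt c]
    by (intro exI[of _ T]) (auto simp: fun_upd_def)
next
  case (Suc x)
  have b: "bit (T (int x)) r" using Suc.prems by (auto simp: tape_of_def)
  let ?a = "if clr then unset_bit r (T (int x)) else T (int x)"
  let ?s = "if clr then s(r := (s r)(x := False)) else s"
  let ?T = "T(int x := ?a)"
  have st: "steps z c 1 (conf (Back r clr k) T (int x)) (conf (Back r clr k) ?T (int x - 1))"
    using b steps_1[of "Back r clr k" z T "int x" "Back r clr k" ?a Lft c] by simp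
  have T: "tape_of ?s ?T" using Suc.prems(1)
    by (auto simp: tape_of_def bit_unset_bit_iff)
  have "\<forall>y<x. ?s r y" using Suc.prems(2) by auto
  from Suc.IH[OF T this] obtain T' where T': "tape_of (if clr then ?s(r := (\<lambda>i. ?s r i \<and> x \<le> i)) else ?s) T'"
    "steps z c (x + 1) (conf (Back r clr k) ?T (int x - 1)) (conf (Run k) T' 0)" by blast
  have "(if clr then ?s(r := (\<lambda>i. ?s r i \<and> x \<le> i)) else ?s)
      = (if clr then s(r := (\<lambda>i. s r i \<and> Suc x \<le> i)) else s)"
    by (auto intro!: ext)
  then show ?case using steps_trans[OF st T'(2)] T'(1) by (intro exI[of _ T']) auto
qed

text \<open>The excursion shared by \<open>SET\<close>, \<open>RESET\<close>, \<open>IF\<close> and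
  \<open>WHILE\<close>. The action at the gap leads to \<open>s1\<close>, which must still have
  track \<open>r\<close> set below \<open>x\<close>, since otherwise the return would stop too
  early.\<close>

lemma access:
  assumes T: "tape_of s T" and v: "isval s r x"
    and move: "\<And>a. bit a r \<Longrightarrow> ctl_step z (Run (i # k)) a = (Run (i # k), a, Rgt)"
    and act: "ctl_step z (Run (i # k)) (T (int x)) = (Back r clr k', a', Lft)"
    and T1: "tape_of s1 (T(int x := a'))" and s1: "\<forall>y<x. s1 r y"
  shows "\<exists>T'. tape_of (if clr then s1(r := (\<lambda>i. s1 r i \<and> x \<le> i)) else s1) T' \<and>
    steps z c (2 * x + 2) (conf (Run (i # k)) T 0) (conf (Run k') T' 0)"
proof -
  have "steps z c x (conf (Run (i # k)) T 0) (conf (Run (i # k)) T (int x))"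
    using forward[OF T v move, of x] by simp
  moreover have "steps z c 1 (conf (Run (i # k)) T (int x)) (conf (Back r clr k') (T(int x := a')) (int x - 1))"
    using steps_1[of "Run (i # k)" z T "int x" "Back r clr k'" a' Lft c] act by simp
  moreover obtain T' where T': "tape_of (if clr then s1(r := (\<lambda>i. s1 r i \<and> x \<le> i)) else s1) T'"
    "steps z c (x + 1) (conf (Back r clr k') (T(int x := a')) (int x - 1)) (conf (Run k') T' 0)"
    using backward[OF T1 s1] by blast
  ultimately have "steps z c (x + 1 + (x + 1)) (conf (Run (i # k)) T 0) (conf (Run k') T' 0)"
    using steps_trans by blast
  then show ?thesis using T'(1) by (intro exI[of _ T']) (simp add: mult_2)
qed

lemma bs_sim:
  assumes "bs p s t s'" "tape_of s T"
  shows "\<exists>T'. tape_of s' T' \<and> steps z c t (conf (Run (p # k)) T 0) (conf (Run k) T' 0)"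
  using assms
proof (induction arbitrary: T k)
  case (bs_skip s)
  have "steps z c 1 (conf (Run (SKIP # k)) T 0) (conf (Run k) T 0)"
    using steps_1[of "Run (SKIP # k)" z T 0 "Run k" "T 0" Stay c] by simp
  then show ?case using bs_skip by blast
next
  case (bs_set s r x m b)
  let ?a = "if b then set_bit m (T (int x)) else unset_bit m (T (int x))"
  have "\<not> bit (T (int x)) r" using bs_set by (auto simp: tape_of_def isval_def)
  then have act: "ctl_step z (Run (SET r m b # k)) (T (int x)) = (Back r False k, ?a, Lft)" by simp
  have t: "tape_of (s(m := (s m)(x := b))) (T(int x := ?a))"
    using bs_set by (auto simp: tape_of_def bit_set_bit_iff bit_unset_bit_iff)
  have "\<forall>y<x. (s(m := (s m)(x := b))) r y" using bs_set(1) by (auto simp: isval_def)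
  then show ?case using access[OF bs_set(2,1) _ act t, of c] by (simp add: fun_upd_def)
next
  case (bs_reset s r x)
  have "\<not> bit (T (int x)) r" using bs_reset by (auto simp: tape_of_def isval_def)
  then have act: "ctl_step z (Run (RESET r # k)) (T (int x)) = (Back r True k, T (int x), Lft)" by simp
  show ?case using access[OF bs_reset(2,1) _ act, of s c] bs_reset
    by (auto simp: isval_def fun_upd_def)
next
  case (bs_seq a s t1 s1 b t2 s2)
  have 1: "steps z c 1 (conf (Run (SEQ a b # k)) T 0) (conf (Run (a # b # k)) T 0)"
    using steps_1[of "Run (SEQ a b # k)" z T 0 "Run (a # b # k)" "T 0" Stay c] by simp
  obtain T1 where T1: "tape_of s1 T1" "steps z c t1 (conf (Run (a # b # k)) T 0) (conf (Run (b # k)) T1 0)"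
    using bs_seq.IH(1)[OF bs_seq.prems] by blast
  obtain T2 where T2: "tape_of s2 T2" "steps z c t2 (conf (Run (b # k)) T1 0) (conf (Run k) T2 0)"
    using bs_seq.IH(2)[OF T1(1)] by blast
  show ?case using T2(1) steps_trans[OF steps_trans[OF 1 T1(2)] T2(2)] by blast
next
  case (bs_if_true s r x m a t s' b)
  have b: "\<not> bit (T (int x)) r" "bit (T (int x)) m" using bs_if_true by (auto simp: tape_of_def isval_def)
  then have act: "ctl_step z (Run (IF r m a b # k)) (T (int x)) = (Back r False (a # k), T (int x), Lft)" by simp
  obtain T1 where T1: "tape_of s T1" "steps z c (2 * x + 2) (conf (Run (IF r m a b # k)) T 0) (conf (Run (a # k)) T1 0)"
    using access[OF bs_if_true.prems bs_if_true(1) _ act, of s c] bs_if_true by (auto simp: isval_def)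
  then show ?case using bs_if_true.IH[OF T1(1), of k] steps_trans[OF T1(2)] by blast
next
  case (bs_if_false s r x m b t s' a)
  have b: "\<not> bit (T (int x)) r" "\<not> bit (T (int x)) m" using bs_if_false by (auto simp: tape_of_def isval_def)
  then have act: "ctl_step z (Run (IF r m a b # k)) (T (int x)) = (Back r False (b # k), T (int x), Lft)" by simp
  obtain T1 where T1: "tape_of s T1" "steps z c (2 * x + 2) (conf (Run (IF r m a b # k)) T 0) (conf (Run (b # k)) T1 0)"
    using access[OF bs_if_false.prems bs_if_false(1) _ act, of s c] bs_if_false by (auto simp: isval_def)
  then show ?case using bs_if_false.IH[OF T1(1), of k] steps_trans[OF T1(2)] by blast
next
  case (bs_while_true s r x m a t1 s1 t2 s2)
  have b: "\<not> bit (T (int x)) r" "bit (T (int x)) m" using bs_while_true by (auto simp: tape_of_def isval_def)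
  then have act: "ctl_step z (Run (WHILE r m a # k)) (T (int x))
      = (Back r False (a # WHILE r m a # k), T (int x), Lft)" by simp
  obtain T1 where T1: "tape_of s T1"
    "steps z c (2 * x + 2) (conf (Run (WHILE r m a # k)) T 0) (conf (Run (a # WHILE r m a # k)) T1 0)"
    using access[OF bs_while_true.prems bs_while_true(1) _ act, of s c] bs_while_true by (auto simp: isval_def)
  obtain T2 where T2: "tape_of s1 T2"
    "steps z c t1 (conf (Run (a # WHILE r m a # k)) T1 0) (conf (Run (WHILE r m a # k)) T2 0)"
    using bs_while_true.IH(1)[OF T1(1)] by blast
  obtain T3 where T3: "tape_of s2 T3" "steps z c t2 (conf (Run (WHILE r m a # k)) T2 0) (conf (Run k) T3 0)"
    using bs_while_true.IH(2)[OF T2(1)] by blast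
  show ?case using T3(1) steps_trans[OF steps_trans[OF T1(2) T2(2)] T3(2)] by blast
next
  case (bs_while_false s r x m a)
  have b: "\<not> bit (T (int x)) r" "\<not> bit (T (int x)) m" using bs_while_false by (auto simp: tape_of_def isval_def)
  then have act: "ctl_step z (Run (WHILE r m a # k)) (T (int x)) = (Back r False k, T (int x), Lft)" by simp
  show ?case using access[OF bs_while_false.prems bs_while_false(1) _ act, of s c] bs_while_false
    by (auto simp: isval_def)
qed

text \<open>The input symbols 1 and 2, read in binary, set bit 0 for the letter \<open>False\<close>
  and bit 1 for \<open>True\<close>.\<close>

definition init_tracks :: "bool list \<Rightarrow> tracks" where
  "init_tracks w m i \<longleftrightarrow> i < length w \<and> (m = 0 \<and> \<not> w ! i \<or> m = 1 \<and> w ! i)"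

lemma tape_of_init: "tape_of (init_tracks w) (fst (snd (tm_init M w)))"
proof -
  have 1: "bit (Suc 0) m \<longleftrightarrow> m = 0" for m by (metis One_nat_def bit_1_iff)
  have 2: "bit (2::nat) m \<longleftrightarrow> m = 1" for m
    using bit_exp_iff[of 1 m, where 'a=nat] by auto
  show ?thesis unfolding tape_of_def init_tracks_def tm_init_def by (auto simp: 1 2)
qed

lemma com_EXPTIME:
  assumes "bnd K B" and nonempty: "\<forall>w\<in>X. w \<noteq> []"
    and run: "\<And>w. w \<noteq> [] \<Longrightarrow> \<exists>t s. bs c (init_tracks w) t s \<and> t \<le> B (length w) \<and> (s z 0 \<longleftrightarrow> w \<in> X)"
  shows "X \<in> EXPTIME K"
proof -
  \<comment> \<open>One step more than the command takes: \<open>Run []\<close> still has to turn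
    into the verdict.\<close>
  obtain a b where ab: "\<And>n. n \<ge> 1 \<Longrightarrow> Suc (B n) \<le> exp2 K (a * n ^ b)"
    using bnd_Suc[OF assms(1)] unfolding bnd_def by blast
  have "\<exists>t\<le>1 * exp2 K (a * length w ^ b). fst ((tm_step (compile z c) ^^ t) (tm_init (compile z c) w))
             = (if w \<in> X then tm_acc (compile z c) else tm_rej (compile z c))" if w: "w \<noteq> []" for w
  proof -
    obtain t s where t: "bs c (init_tracks w) t s" "t \<le> B (length w)" "s z 0 \<longleftrightarrow> w \<in> X" using run[OF w] by blast
    obtain T where i: "tm_init (compile z c) w = conf (Run [c]) T 0" and T: "tape_of (init_tracks w) T"
      using tape_of_init[of w "compile z c"] by (auto simp: tm_init_def compile_def)
    obtain T' where T': "tape_of s T'" "steps z c t (conf (Run [c]) T 0) (conf (Run []) T' 0)"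
      using bs_sim[OF t(1) T] by blast
    have "steps z c 1 (conf (Run []) T' 0) (conf (if w \<in> X then Acc else Rej) T' 0)"
      using steps_1[of "Run []" z T' 0 "if w \<in> X then Acc else Rej" "T' 0" Stay c] T'(1) t(3)
      by (simp add: tape_of_def)
    from steps_trans[OF T'(2) this]
    have "fst ((tm_step (compile z c) ^^ (t + 1)) (tm_init (compile z c) w)) = to_nat (if w \<in> X then Acc else Rej)"
      by (simp only: steps_def i fst_conv)
    moreover have "t + 1 \<le> 1 * exp2 K (a * length w ^ b)"
      using ab[of "length w"] t(2) w by (cases w) auto
    moreover have "to_nat (if w \<in> X then Acc else Rej)
        = (if w \<in> X then tm_acc (compile z c) else tm_rej (compile z c))"
      by (simp add: compile_def)
    ultimately show ?thesis by (intro exI[of _ "t + 1"] conjI) (simp_all only:)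
  qed
  then have "X \<in> TIME (\<lambda>n. exp2 K (a * n ^ b))"
    unfolding TIME_def mem_Collect_eq
    by - (rule conjI[OF nonempty], rule exI[of _ "compile z c"], rule conjI[OF valid_compile],
        rule exI[of _ 1], rule conjI[OF zero_less_one], blast)
  then show ?thesis unfolding EXPTIME_def by blast
qed

subsection \<open>Number functions computed within the growth rate\<close>

definition runs :: "com \<Rightarrow> tracks \<Rightarrow> nat \<Rightarrow> tracks \<Rightarrow> bool" where
  "runs c s B s' \<longleftrightarrow> (\<exists>t\<le>B. bs c s t s')"

lemma runs_mono: "runs c s B s' \<Longrightarrow> B \<le> B' \<Longrightarrow> runs c s B' s'"
  unfolding runs_def by (meson order_trans)

lemma runs_skip: "runs SKIP s 1 s"
  unfolding runs_def using bs_skip by blast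

lemma runs_seq: "runs a s B1 s1 \<Longrightarrow> runs b s1 B2 s2 \<Longrightarrow> runs (SEQ a b) s (1 + B1 + B2) s2"
  unfolding runs_def using bs_seq by (meson add_mono order_refl)

lemma runs_if:
  assumes "isval s r x" "s m x \<Longrightarrow> runs a s B s'" "\<not> s m x \<Longrightarrow> runs b s B s'"
  shows "runs (IF r m a b) s (2 * x + 2 + B) s'"
  using assms bs_if_true[OF assms(1)] bs_if_false[OF assms(1)] unfolding runs_def
  by (cases "s m x") (meson add_left_mono)+

text \<open>A uniform bound \<open>V\<close> on the tested positions and \<open>B\<close> on the
  passes turns the exact step count into a product, which \<open>bnd_mult\<close> can absorb. There
  is one test more than there are passes.\<close>

lemma runs_while:
  assumes "\<And>i. i < N \<Longrightarrow> isval (S i) r (x i) \<and> S i m (x i) \<and> x i \<le> V \<and> runs c (S i) B (S (Suc i))"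
    and "isval (S N) r (x N)" "\<not> S N m (x N)" "x N \<le> V"
  shows "runs (WHILE r m c) (S 0) ((N + 1) * (2 * V + 2 + B)) (S N)"
  using assms
proof (induction N arbitrary: S x)
  case 0
  then show ?case using bs_while_false[of "S 0" r "x 0" m c] unfolding runs_def
    by (intro exI[of _ "2 * x 0 + 2"]) auto
next
  case (Suc N)
  have "runs (WHILE r m c) (S (Suc 0)) ((N + 1) * (2 * V + 2 + B)) (S (Suc N))"
    by (rule Suc.IH[of "\<lambda>i. S (Suc i)" "\<lambda>i. x (Suc i)"]) (use Suc.prems in auto)
  then obtain t2 where t2: "t2 \<le> (N + 1) * (2 * V + 2 + B)" "bs (WHILE r m c) (S (Suc 0)) t2 (S (Suc N))"
    unfolding runs_def by blast
  have 0: "isval (S 0) r (x 0)" "S 0 m (x 0)" "x 0 \<le> V" "runs c (S 0) B (S (Suc 0))"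
    using Suc.prems(1)[of 0] by auto
  then obtain t1 where t1: "t1 \<le> B" "bs c (S 0) t1 (S (Suc 0))" unfolding runs_def by blast
  have "bs (WHILE r m c) (S 0) (2 * x 0 + 2 + t1 + t2) (S (Suc N))"
    using bs_while_true[OF 0(1,2) t1(2) t2(2)] .
  moreover have "2 * x 0 + 2 + t1 + t2 \<le> (Suc N + 1) * (2 * V + 2 + B)"
    using t1(1) t2(1) 0(3) by simp
  ultimately show ?case unfolding runs_def by blast
qed

text \<open>Tracks 0 and 1 hold the input, tracks 2 to \<open>F + 1\<close> the memory \<open>M\<close>, and the following tracks
  hold registers.\<close>

locale track_machine =
  fixes K F :: nat
begin

definition reg :: "nat \<Rightarrow> nat" where "reg i = F + 2 + i"

text \<open>Registers past the end of \<open>rs\<close> read as empty, that is as 0, so clearing the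
  last register amounts to dropping it from the list (\<open>st_snoc0\<close>).\<close>

definition st :: "bool list \<Rightarrow> tracks \<Rightarrow> nat list \<Rightarrow> tracks" where
  "st w M rs m x = (if m < 2 then init_tracks w m x else if m < F + 2 then M (m - 2) x
     else m - (F + 2) < length rs \<and> x < rs ! (m - (F + 2)))"

lemma st_reg: "st w M rs (reg i) x \<longleftrightarrow> i < length rs \<and> x < rs ! i"
  by (simp add: st_def reg_def)

lemma st_input: "st w M rs 0 x \<longleftrightarrow> x < length w \<and> \<not> w ! x" "st w M rs (Suc 0) x \<longleftrightarrow> x < length w \<and> w ! x"
  by (auto simp: st_def init_tracks_def)

lemma st_mem: "j < F \<Longrightarrow> st w M rs (j + 2) x \<longleftrightarrow> M j x"
  by (simp add: st_def)

lemma isval_reg: "i < length rs \<Longrightarrow> isval (st w M rs) (reg i) (rs ! i)"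
  by (simp add: isval_def st_reg)

lemma isval_reg0: "length rs \<le> i \<Longrightarrow> isval (st w M rs) (reg i) 0"
  by (simp add: isval_def st_reg)

lemma st_snoc0: "st w M (rs @ [0]) = st w M rs"
  by (intro ext) (auto simp: st_def nth_append)

lemma st_upd: "i < length rs \<Longrightarrow> (st w M rs)(reg i := (\<lambda>x. x < v)) = st w M (rs[i := v])"
  by (intro ext) (auto simp: st_def reg_def nth_list_update)

lemma st_upd_mem: "j < F \<Longrightarrow> (st w M rs)(j + 2 := P) = st w (M(j := P)) rs"
  by (intro ext) (auto simp: st_def)

lemma reg_eq [simp]: "reg i = reg j \<longleftrightarrow> i = j"
  by (simp add: reg_def)

abbreviation "INC i \<equiv> SET (reg i) (reg i) True"
abbreviation "CLR i \<equiv> RESET (reg i)"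

lemma runs_inc: assumes "i < length rs" "rs ! i \<le> V"
  shows "runs (INC i) (st w M rs) (2 * V + 2) (st w M (rs[i := Suc (rs ! i)]))"
proof -
  have "((st w M rs) (reg i))(rs ! i := True) = (\<lambda>x. x < Suc (rs ! i))"
    using assms by (intro ext) (auto simp: st_reg)
  then show ?thesis
    using bs_set[OF isval_reg[OF assms(1), of w M], of "reg i" True] assms st_upd[OF assms(1)]
    unfolding runs_def by (intro exI[of _ "2 * rs ! i + 2"]) auto
qed

lemma runs_clr: assumes "i < length rs" "rs ! i \<le> V"
  shows "runs (CLR i) (st w M rs) (2 * V + 2) (st w M (rs[i := 0]))"
proof -
  have "(\<lambda>x. st w M rs (reg i) x \<and> rs ! i \<le> x) = (\<lambda>x. x < 0)"
    using assms by (intro ext) (auto simp: st_reg)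
  then show ?thesis
    using bs_reset[OF isval_reg[OF assms(1), of w M]] assms st_upd[OF assms(1), of w M 0]
    unfolding runs_def by (intro exI[of _ "2 * rs ! i + 2"]) auto
qed

lemma runs_copy:
  assumes "i < length rs" "j < length rs" "i \<noteq> j" "rs ! i = 0" "rs ! j \<le> V"
  shows "runs (WHILE (reg i) (reg j) (INC i)) (st w M rs) ((V + 1) * (4 * V + 4)) (st w M (rs[i := rs ! j]))"
proof -
  have "runs (WHILE (reg i) (reg j) (INC i)) (st w M (rs[i := 0])) ((rs ! j + 1) * (2 * V + 2 + (2 * V + 2)))
      (st w M (rs[i := rs ! j]))"
  proof (rule runs_while[of "rs ! j" "\<lambda>k. st w M (rs[i := k])" _ "\<lambda>k. k"], goal_cases)
    case (1 k)
    then show ?case using assms runs_inc[of i "rs[i := k]" V w M] isval_reg[of i "rs[i := k]" w M]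
      by (auto simp: st_reg)
  qed (use assms isval_reg[of i "rs[i := rs ! j]" w M] in \<open>auto simp: st_reg\<close>)
  moreover have "rs[i := 0] = rs" using assms by (metis list_update_id)
  moreover have "(rs ! j + 1) * (2 * V + 2 + (2 * V + 2)) \<le> (V + 1) * (4 * V + 4)"
    using assms by (intro mult_mono) auto
  ultimately show ?thesis using runs_mono by metis
qed

definition MOVE :: "nat \<Rightarrow> nat \<Rightarrow> com" where
  "MOVE i j = SEQ (CLR i) (SEQ (WHILE (reg i) (reg j) (INC i)) (CLR j))"

lemma runs_move:
  assumes "i < length rs" "j < length rs" "i \<noteq> j" "rs ! i \<le> V" "rs ! j \<le> V"
  shows "runs (MOVE i j) (st w M rs) ((V + 1) * (4 * V + 4) + 4 * V + 6) (st w M (rs[i := rs ! j, j := 0]))"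
proof -
  have 1: "runs (CLR i) (st w M rs) (2 * V + 2) (st w M (rs[i := 0]))"
    using assms runs_clr by blast
  have 2: "runs (WHILE (reg i) (reg j) (INC i)) (st w M (rs[i := 0])) ((V + 1) * (4 * V + 4)) (st w M (rs[i := rs ! j]))"
    using runs_copy[of i "rs[i := 0]" j V w M] assms by simp
  have 3: "runs (CLR j) (st w M (rs[i := rs ! j])) (2 * V + 2) (st w M (rs[i := rs ! j, j := 0]))"
    using runs_clr[of j "rs[i := rs ! j]" V w M] assms by simp
  show ?thesis unfolding MOVE_def
    by (rule runs_mono[OF runs_seq[OF 1 runs_seq[OF 2 3]]]) simp
qed

type_synonym func = "bool list \<Rightarrow> tracks \<Rightarrow> nat list \<Rightarrow> nat"

definition bounded :: "(nat \<Rightarrow> nat) \<Rightarrow> nat \<Rightarrow> bool list \<Rightarrow> nat list \<Rightarrow> bool" where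
  "bounded V d w rs \<longleftrightarrow> w \<noteq> [] \<and> length rs = d \<and> (\<forall>x\<in>set rs. x \<le> V (length w))"

lemma bounded_nth: "bounded V d w rs \<Longrightarrow> i < d \<Longrightarrow> rs ! i \<le> V (length w)"
  by (auto simp: bounded_def)

lemma bounded_mono: "bounded V d w rs \<Longrightarrow> V (length w) \<le> V' (length w) \<Longrightarrow> bounded V' d w rs"
  unfolding bounded_def by (meson order_trans)

lemma bounded_snoc: "bounded V d w rs \<Longrightarrow> x \<le> V (length w) \<Longrightarrow> bounded V (Suc d) w (rs @ [x])"
  by (auto simp: bounded_def)

text \<open>Stack discipline: the result is pushed as the next register and all scratch registers
  are 0 again. \<open>T\<close> bounds running time and result alike, so that the result can itself
  be a register of a further computation.\<close>

definition computes :: "com \<Rightarrow> nat \<Rightarrow> func \<Rightarrow> (nat \<Rightarrow> nat) \<Rightarrow> (nat \<Rightarrow> nat) \<Rightarrow> bool" where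
  "computes c d f V T \<longleftrightarrow> (\<forall>w M rs. bounded V d w rs \<longrightarrow> f w M rs \<le> T (length w) \<and>
     runs c (st w M rs) (T (length w)) (st w M (rs @ [f w M rs])))"

text \<open>The command is chosen before \<open>V\<close>: one machine has to serve all inputs,
  while a nested computation such as the one in \<open>cmpd_let\<close> meets registers with a
  larger bound than the one it started from.\<close>

definition cmpd :: "nat \<Rightarrow> func \<Rightarrow> bool" where
  "cmpd d f \<longleftrightarrow> (\<exists>c. \<forall>V. bnd K V \<longrightarrow> (\<exists>T. bnd K T \<and> computes c d f V T))"

text \<open>\<open>computable a f\<close>: the \<open>a\<close>-ary function \<open>f\<close> is computable whichever registers hold its arguments.\<close>

definition computable :: "nat \<Rightarrow> func \<Rightarrow> bool" where
  "computable a f \<longleftrightarrow> (\<forall>d is. length is = a \<longrightarrow> set is \<subseteq> {..<d} \<longrightarrow> cmpd d (\<lambda>w M rs. f w M (map ((!) rs) is)))"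

section \<open>Expressions over a stack of registers\<close>

lemma cmpd_cong:
  assumes "cmpd d g" "\<And>w M rs. w \<noteq> [] \<Longrightarrow> length rs = d \<Longrightarrow> f w M rs = g w M rs"
  shows "cmpd d f"
proof -
  have "computes c d f V T" if "computes c d g V T" for c V T
    using that assms(2) unfolding computes_def by (auto simp: bounded_def)
  then show ?thesis using assms(1) unfolding cmpd_def by meson
qed

lemmas bnd_rules = bnd_add bnd_mult bnd_Suc bnd_const bnd_id

lemma cmpd_zero: "cmpd d (\<lambda>_ _ _. 0)"
proof -
  have "computes SKIP d (\<lambda>_ _ _. 0) V (\<lambda>_. 1)" for V
    unfolding computes_def using runs_skip by (auto simp: st_snoc0)
  then show ?thesis unfolding cmpd_def using bnd_const by blast
qed

lemma cmpd_suc: assumes "cmpd d f" shows "cmpd d (\<lambda>w M rs. Suc (f w M rs))"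
proof -
  obtain c where c: "\<And>V. bnd K V \<Longrightarrow> \<exists>T. bnd K T \<and> computes c d f V T" using assms unfolding cmpd_def by blast
  have "\<exists>T. bnd K T \<and> computes (SEQ c (INC d)) d (\<lambda>w M rs. Suc (f w M rs)) V T" if V: "bnd K V" for V
  proof -
    obtain T where T: "bnd K T" "computes c d f V T" using c[OF V] by blast
    have "runs (SEQ c (INC d)) (st w M rs) (1 + T (length w) + (2 * T (length w) + 2)) (st w M (rs @ [Suc (f w M rs)]))"
      and "Suc (f w M rs) \<le> 1 + T (length w) + (2 * T (length w) + 2)"
      if "bounded V d w rs" for w M rs
    proof -
      have 1: "f w M rs \<le> T (length w)" "runs c (st w M rs) (T (length w)) (st w M (rs @ [f w M rs]))"
        using T(2) that unfolding computes_def by auto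
      have "runs (INC d) (st w M (rs @ [f w M rs])) (2 * T (length w) + 2) (st w M (rs @ [Suc (f w M rs)]))"
        using runs_inc[of d "rs @ [f w M rs]" "T (length w)" w M] that 1(1)
        by (auto simp: bounded_def nth_append)
      from runs_seq[OF 1(2) this] 1(1)
      show "runs (SEQ c (INC d)) (st w M rs) (1 + T (length w) + (2 * T (length w) + 2)) (st w M (rs @ [Suc (f w M rs)]))"
        "Suc (f w M rs) \<le> 1 + T (length w) + (2 * T (length w) + 2)" by auto
    qed
    then have "computes (SEQ c (INC d)) d (\<lambda>w M rs. Suc (f w M rs)) V (\<lambda>n. 1 + T n + (2 * T n + 2))"
      unfolding computes_def by blast
    moreover have "bnd K (\<lambda>n. 1 + T n + (2 * T n + 2))" by (intro bnd_rules T(1))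
    ultimately show ?thesis by blast
  qed
  then show ?thesis unfolding cmpd_def by blast
qed

lemma cmpd_var: assumes "i < d" shows "cmpd d (\<lambda>w M rs. rs ! i)"
proof -
  let ?c = "WHILE (reg d) (reg i) (INC d)"
  have "\<exists>T. bnd K T \<and> computes ?c d (\<lambda>w M rs. rs ! i) V T" if V: "bnd K V" for V
  proof -
    have "runs ?c (st w M rs) ((V (length w) + 1) * (4 * V (length w) + 4)) (st w M (rs @ [rs ! i]))"
      if b: "bounded V d w rs" for w M rs
      using runs_copy[of d "rs @ [0]" i "V (length w)" w M] assms b bounded_nth[OF b assms]
      by (auto simp: bounded_def nth_append st_snoc0)
    then have "computes ?c d (\<lambda>w M rs. rs ! i) V (\<lambda>n. (V n + 1) * (4 * V n + 4))"
      unfolding computes_def using bounded_nth[OF _ assms] by fastforce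
    moreover have "bnd K (\<lambda>n. (V n + 1) * (4 * V n + 4))" by (intro bnd_rules V)
    ultimately show ?thesis by blast
  qed
  then show ?thesis unfolding cmpd_def by blast
qed

lemma cmpd_let:
  assumes "cmpd d g" "cmpd (Suc d) (\<lambda>w M rs. h w M (take d rs) (rs ! d))"
  shows "cmpd d (\<lambda>w M rs. h w M rs (g w M rs))"
proof -
  let ?h = "\<lambda>w M rs. h w M (take d rs) (rs ! d)"
  obtain c1 where c1: "\<And>V. bnd K V \<Longrightarrow> \<exists>T. bnd K T \<and> computes c1 d g V T" using assms(1) unfolding cmpd_def by blast
  obtain c2 where c2: "\<And>V. bnd K V \<Longrightarrow> \<exists>T. bnd K T \<and> computes c2 (Suc d) ?h V T"
    using assms(2) unfolding cmpd_def by blast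
  let ?c = "SEQ c1 (SEQ c2 (MOVE d (Suc d)))"
  have "\<exists>T. bnd K T \<and> computes ?c d (\<lambda>w M rs. h w M rs (g w M rs)) V T" if V: "bnd K V" for V
  proof -
    obtain T1 where T1: "bnd K T1" "computes c1 d g V T1" using c1[OF V] by blast
    have "bnd K (\<lambda>n. V n + T1 n)" by (intro bnd_rules V T1(1))
    then obtain T2 where T2: "bnd K T2" "computes c2 (Suc d) ?h (\<lambda>n. V n + T1 n) T2" using c2 by blast
    define U where "U n = T1 n + T2 n" for n
    let ?T = "\<lambda>n. 1 + T1 n + (1 + T2 n + ((U n + 1) * (4 * U n + 4) + 4 * U n + 6))"
    have "h w M rs (g w M rs) \<le> ?T (length w) \<and> runs ?c (st w M rs) (?T (length w)) (st w M (rs @ [h w M rs (g w M rs)]))"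
      if b: "bounded V d w rs" for w M rs
    proof -
      let ?g = "g w M rs"
      have 1: "?g \<le> T1 (length w)" "runs c1 (st w M rs) (T1 (length w)) (st w M (rs @ [?g]))"
        using T1(2) b unfolding computes_def by auto
      have "bounded (\<lambda>n. V n + T1 n) (Suc d) w (rs @ [?g])"
        using 1(1) bounded_mono[OF b] by (intro bounded_snoc) auto
      moreover have "?h w M (rs @ [?g]) = h w M rs ?g" using b by (auto simp: bounded_def nth_append)
      ultimately have 2: "h w M rs ?g \<le> T2 (length w)"
        "runs c2 (st w M (rs @ [?g])) (T2 (length w)) (st w M ((rs @ [?g]) @ [h w M rs ?g]))"
        using T2(2) unfolding computes_def by metis+
      have "rs @ [h w M rs ?g, 0] = (rs @ [h w M rs ?g]) @ [0]" by simp
      then have e: "st w M (rs @ [h w M rs ?g, 0]) = st w M (rs @ [h w M rs ?g])" using st_snoc0 by metis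
      have 3: "runs (MOVE d (Suc d)) (st w M ((rs @ [?g]) @ [h w M rs ?g]))
          ((U (length w) + 1) * (4 * U (length w) + 4) + 4 * U (length w) + 6) (st w M (rs @ [h w M rs ?g]))"
        using runs_move[of d "(rs @ [?g]) @ [h w M rs ?g]" "Suc d" "U (length w)" w M] b 1(1) 2(1)
        by (auto simp: bounded_def nth_append list_update_append U_def e)
      show ?thesis using runs_seq[OF 1(2) runs_seq[OF 2(2) 3]] 2(1) by auto
    qed
    then have "computes ?c d (\<lambda>w M rs. h w M rs (g w M rs)) V ?T" unfolding computes_def by blast
    moreover have "bnd K ?T" unfolding U_def by (intro bnd_rules T1(1) T2(1))
    ultimately show ?thesis by blast
  qed
  then show ?thesis unfolding cmpd_def by blast
qed

lemma cmpd_ite: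
  assumes "cmpd d (\<lambda>w M rs. of_bool (P w M rs))" "cmpd d x" "cmpd d y"
  shows "cmpd d (\<lambda>w M rs. if P w M rs then x w M rs else y w M rs)"
proof -
  let ?p = "\<lambda>w M rs. of_bool (P w M rs)"
  obtain c1 where c1: "\<And>V. bnd K V \<Longrightarrow> \<exists>T. bnd K T \<and> computes c1 d ?p V T" using assms(1) unfolding cmpd_def by blast
  obtain c2 where c2: "\<And>V. bnd K V \<Longrightarrow> \<exists>T. bnd K T \<and> computes c2 d x V T" using assms(2) unfolding cmpd_def by blast
  obtain c3 where c3: "\<And>V. bnd K V \<Longrightarrow> \<exists>T. bnd K T \<and> computes c3 d y V T" using assms(3) unfolding cmpd_def by blast
  \<comment> \<open>Register \<open>Suc d\<close> is empty and thus reads 0, so the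
    \<open>IF\<close> asks whether register \<open>d\<close> is positive. The branches start from a
    stack without the test value: it is cleared in the first branch and is 0 in the second.\<close>
  let ?c = "SEQ c1 (IF (reg (Suc d)) (reg d) (SEQ (CLR d) c2) c3)"
  let ?f = "\<lambda>w M rs. if P w M rs then x w M rs else y w M rs"
  have "\<exists>T. bnd K T \<and> computes ?c d ?f V T" if V: "bnd K V" for V
  proof -
    obtain T1 where T1: "bnd K T1" "computes c1 d ?p V T1" using c1[OF V] by blast
    obtain T2 where T2: "bnd K T2" "computes c2 d x V T2" using c2[OF V] by blast
    obtain T3 where T3: "bnd K T3" "computes c3 d y V T3" using c3[OF V] by blast
    let ?T = "\<lambda>n. 1 + T1 n + (2 * 0 + 2 + (5 + T2 n + T3 n))"
    have "?f w M rs \<le> ?T (length w) \<and> runs ?c (st w M rs) (?T (length w)) (st w M (rs @ [?f w M rs]))"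
      if b: "bounded V d w rs" for w M rs
    proof -
      have d: "length rs = d" using b by (simp add: bounded_def)
      let ?s = "st w M (rs @ [?p w M rs])"
      have 1: "runs c1 (st w M rs) (T1 (length w)) ?s" using T1(2) b unfolding computes_def by auto
      have 2: "x w M rs \<le> T2 (length w)" "runs c2 (st w M rs) (T2 (length w)) (st w M (rs @ [x w M rs]))"
        using T2(2) b unfolding computes_def by auto
      have 3: "y w M rs \<le> T3 (length w)" "runs c3 (st w M rs) (T3 (length w)) (st w M (rs @ [y w M rs]))"
        using T3(2) b unfolding computes_def by auto
      have v: "isval ?s (reg (Suc d)) 0" using isval_reg0 d by simp
      have c: "?s (reg d) 0 \<longleftrightarrow> P w M rs" using d by (simp add: st_reg nth_append)
      have yes: "runs (SEQ (CLR d) c2) ?s (5 + T2 (length w) + T3 (length w)) (st w M (rs @ [?f w M rs]))"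
        if "P w M rs"
      proof -
        have "runs (CLR d) ?s (2 * 1 + 2) (st w M rs)"
          using runs_clr[of d "rs @ [?p w M rs]" 1 w M] d
          by (simp add: st_snoc0 nth_append list_update_append del: of_bool_eq_iff split del: if_split)
        from runs_seq[OF this 2(2)] show ?thesis using that by (auto elim: runs_mono)
      qed
      have no: "runs c3 ?s (5 + T2 (length w) + T3 (length w)) (st w M (rs @ [?f w M rs]))"
        if "\<not> P w M rs" using 3(2) that by (auto simp: st_snoc0 elim: runs_mono)
      have "runs (IF (reg (Suc d)) (reg d) (SEQ (CLR d) c2) c3) ?s (2 * 0 + 2 + (5 + T2 (length w) + T3 (length w)))
          (st w M (rs @ [?f w M rs]))"
        by (rule runs_if[OF v]) (use c yes no in auto)
      from runs_seq[OF 1 this] show ?thesis using 2(1) 3(1) by auto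
    qed
    then have "computes ?c d ?f V ?T" unfolding computes_def by blast
    moreover have "bnd K ?T" by (intro bnd_rules T1(1) T2(1) T3(1))
    ultimately show ?thesis by blast
  qed
  then show ?thesis unfolding cmpd_def by blast
qed

text \<open>Reads a track at the position held in a register: with a register track as
  \<open>m\<close> this compares two registers, with an input or memory track it is a
  lookup.\<close>

lemma cmpd_test:
  assumes "i < d" and P: "\<And>w M rs. length rs = d \<Longrightarrow> st w M rs m (rs ! i) \<longleftrightarrow> P w M rs"
  shows "cmpd d (\<lambda>w M rs. of_bool (P w M rs))"
proof -
  let ?c = "IF (reg i) m (INC d) SKIP"
  have "\<exists>T. bnd K T \<and> computes ?c d (\<lambda>w M rs. of_bool (P w M rs)) V T" if V: "bnd K V" for V
  proof -
    let ?T = "\<lambda>n. 2 * V n + 2 + 2"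
    have "runs ?c (st w M rs) (?T (length w)) (st w M (rs @ [of_bool (P w M rs)]))"
      if b: "bounded V d w rs" for w M rs
    proof -
      have d: "length rs = d" using b by (simp add: bounded_def)
      have v: "isval (st w M rs) (reg i) (rs ! i)" using isval_reg assms(1) d by simp
      have inc: "runs (INC d) (st w M rs) 2 (st w M (rs @ [1]))"
        using runs_inc[of d "rs @ [0]" 0 w M] d by (simp add: st_snoc0 nth_append list_update_append numeral_2_eq_2)
      have "runs ?c (st w M rs) (2 * rs ! i + 2 + 2) (st w M (rs @ [of_bool (P w M rs)]))"
        by (rule runs_if[OF v]) (use P[OF d, of w M] inc runs_mono[OF runs_skip, of 2] in \<open>auto simp: st_snoc0\<close>)
      then show ?thesis by (rule runs_mono) (use bounded_nth[OF b assms(1)] in simp)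
    qed
    then have "computes ?c d (\<lambda>w M rs. of_bool (P w M rs)) V ?T" unfolding computes_def by auto
    moreover have "bnd K ?T" by (intro bnd_rules V)
    ultimately show ?thesis by blast
  qed
  then show ?thesis unfolding cmpd_def by blast
qed

text \<open>Bounded recursion: \<open>bd\<close> keeps the intermediate values inside the growth
  rate, which iteration alone would not. Register \<open>d\<close> holds the number of rounds,
  \<open>d + 1\<close> the counter, \<open>d + 2\<close> the accumulator, and \<open>d + 3\<close>
  its next value before it is moved down.\<close>

lemma cmpd_rec:
  assumes b: "cmpd d b" and i: "cmpd (d + 2) (\<lambda>w M rs. i w M (take d rs))"
    and g: "cmpd (d + 3) (\<lambda>w M rs. g w M (take d rs) (rs ! (d + 1)) (rs ! (d + 2)))"
    and bd: "\<And>V. bnd K V \<Longrightarrow> \<exists>U. bnd K U \<and> (\<forall>w M rs k. bounded V d w rs \<longrightarrow> k \<le> b w M rs \<longrightarrow>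
        rec_nat (i w M rs) (g w M rs) k \<le> U (length w))"
  shows "cmpd d (\<lambda>w M rs. rec_nat (i w M rs) (g w M rs) (b w M rs))"
proof -
  let ?i = "\<lambda>w M rs. i w M (take d rs)"
  let ?g = "\<lambda>w M rs. g w M (take d rs) (rs ! (d + 1)) (rs ! (d + 2))"
  obtain c1 where c1: "\<And>V. bnd K V \<Longrightarrow> \<exists>T. bnd K T \<and> computes c1 d b V T" using b unfolding cmpd_def by blast
  obtain c2 where c2: "\<And>V. bnd K V \<Longrightarrow> \<exists>T. bnd K T \<and> computes c2 (d + 2) ?i V T" using i unfolding cmpd_def by blast
  obtain c3 where c3: "\<And>V. bnd K V \<Longrightarrow> \<exists>T. bnd K T \<and> computes c3 (d + 3) ?g V T" using g unfolding cmpd_def by blast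
  let ?body = "SEQ c3 (SEQ (MOVE (d + 2) (d + 3)) (INC (d + 1)))"
  let ?c = "SEQ c1 (SEQ c2 (SEQ (WHILE (reg (d + 1)) (reg d) ?body) (SEQ (MOVE d (d + 2)) (CLR (d + 1)))))"
  let ?f = "\<lambda>w M rs. rec_nat (i w M rs) (g w M rs) (b w M rs)"
  have "\<exists>T. bnd K T \<and> computes ?c d ?f V T" if V: "bnd K V" for V
  proof -
    obtain T1 where T1: "bnd K T1" "computes c1 d b V T1" using c1[OF V] by blast
    have V2: "bnd K (\<lambda>n. V n + T1 n)" by (intro bnd_rules V T1(1))
    then obtain T2 where T2: "bnd K T2" "computes c2 (d + 2) ?i (\<lambda>n. V n + T1 n) T2" using c2 by blast
    obtain U where U: "bnd K U" "\<And>w M rs k. bounded V d w rs \<Longrightarrow> k \<le> b w M rs \<Longrightarrow>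
        rec_nat (i w M rs) (g w M rs) k \<le> U (length w)" using bd[OF V] by blast
    have V3: "bnd K (\<lambda>n. V n + T1 n + U n)" by (intro bnd_rules V T1(1) U(1))
    then obtain T3 where T3: "bnd K T3" "computes c3 (d + 3) ?g (\<lambda>n. V n + T1 n + U n) T3" using c3 by blast
    define W where "W n = T1 n + U n" for n
    define Bm where "Bm n = (W n + 1) * (4 * W n + 4) + 4 * W n + 6" for n
    define Bb where "Bb n = 1 + T3 n + (1 + Bm n + (2 * W n + 2))" for n
    define Bw where "Bw n = (T1 n + 1) * (2 * W n + 2 + Bb n)" for n
    define T where "T n = 1 + T1 n + (1 + T2 n + (1 + Bw n + (1 + Bm n + (2 * W n + 2)))) + U n" for n
    have "?f w M rs \<le> T (length w) \<and> runs ?c (st w M rs) (T (length w)) (st w M (rs @ [?f w M rs]))"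
      if bo: "bounded V d w rs" for w M rs
    proof -
      have d: "length rs = d" using bo by (simp add: bounded_def)
      let ?n = "length w"
      let ?N = "b w M rs"
      let ?a = "rec_nat (i w M rs) (g w M rs)"
      let ?S = "\<lambda>k. st w M (rs @ [?N, k, ?a k])"
      have N: "?N \<le> T1 ?n" and r1: "runs c1 (st w M rs) (T1 ?n) (st w M (rs @ [?N]))"
        using T1(2) bo unfolding computes_def by auto
      have "bounded (\<lambda>n. V n + T1 n) (d + 2) w (rs @ [?N, 0])"
        using bo N by (auto simp: bounded_def trans_le_add1)
      moreover have "st w M (rs @ [?N, 0]) = st w M (rs @ [?N])" using st_snoc0[of w M "rs @ [?N]"] by simp
      moreover have "?i w M (rs @ [?N, 0]) = i w M rs" using d by simp
      ultimately have r2: "runs c2 (st w M (rs @ [?N])) (T2 ?n) (?S 0)"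
        using T2(2)[unfolded computes_def, rule_format, of w "rs @ [?N, 0]" M] by simp
      have step: "runs ?body (?S k) (Bb ?n) (?S (Suc k))" if k: "k < ?N" for k
      proof -
        have ak: "?a k \<le> U ?n" "?a (Suc k) \<le> U ?n" using U(2)[OF bo] k by (metis less_imp_le Suc_leI)+
        have "bounded (\<lambda>n. V n + T1 n + U n) (d + 3) w (rs @ [?N, k, ?a k])"
          using bo N k ak by (auto simp: bounded_def trans_le_add1)
        moreover have "?g w M (rs @ [?N, k, ?a k]) = ?a (Suc k)" using d by (simp add: nth_append)
        ultimately have b1: "runs c3 (?S k) (T3 ?n) (st w M (rs @ [?N, k, ?a k, ?a (Suc k)]))"
          using T3(2)[unfolded computes_def, rule_format, of w "rs @ [?N, k, ?a k]" M] by simp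
        have "rs @ [?N, k, ?a (Suc k), 0] = (rs @ [?N, k, ?a (Suc k)]) @ [0]" by simp
        then have e: "st w M (rs @ [?N, k, ?a (Suc k), 0]) = st w M (rs @ [?N, k, ?a (Suc k)])"
          using st_snoc0 by metis
        have b2: "runs (MOVE (d + 2) (d + 3)) (st w M (rs @ [?N, k, ?a k, ?a (Suc k)])) (Bm ?n)
            (st w M (rs @ [?N, k, ?a (Suc k)]))"
          unfolding Bm_def e[symmetric]
          using runs_move[of "d + 2" "rs @ [?N, k, ?a k, ?a (Suc k)]" "d + 3" "W ?n" w M] d ak
          by (simp add: nth_append list_update_append W_def numeral_eq_Suc)
        have b3: "runs (INC (d + 1)) (st w M (rs @ [?N, k, ?a (Suc k)])) (2 * W ?n + 2) (?S (Suc k))"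
          using runs_inc[of "d + 1" "rs @ [?N, k, ?a (Suc k)]" "W ?n" w M] d k N
          by (simp add: nth_append list_update_append W_def)
        show ?thesis unfolding Bb_def by (rule runs_seq[OF b1 runs_seq[OF b2 b3]])
      qed
      have r3: "runs (WHILE (reg (d + 1)) (reg d) ?body) (?S 0) (Bw ?n) (?S ?N)"
      proof -
        have "runs (WHILE (reg (d + 1)) (reg d) ?body) (?S 0) ((?N + 1) * (2 * W ?n + 2 + Bb ?n)) (?S ?N)"
          by (rule runs_while[of ?N ?S _ "\<lambda>k. k"])
            (use step d N isval_reg[of "d + 1" "rs @ [?N, _, ?a _]" w M] in
              \<open>auto simp: st_reg nth_append W_def\<close>)
        then show ?thesis by (rule runs_mono) (unfold Bw_def, intro mult_le_mono1, simp add: N)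
      qed
      have aN: "?a ?N \<le> U ?n" using U(2)[OF bo] by blast
      have r4: "runs (MOVE d (d + 2)) (?S ?N) (Bm ?n) (st w M (rs @ [?a ?N, ?N, 0]))"
        unfolding Bm_def
        using runs_move[of d "rs @ [?N, ?N, ?a ?N]" "d + 2" "W ?n" w M] d aN N
        by (simp add: nth_append list_update_append W_def numeral_eq_Suc)
      have e: "st w M (rs @ [?a ?N, 0, 0]) = st w M (rs @ [?a ?N])"
        using st_snoc0[of w M "rs @ [?a ?N, 0]"] st_snoc0[of w M "rs @ [?a ?N]"] by simp
      have r5: "runs (CLR (d + 1)) (st w M (rs @ [?a ?N, ?N, 0])) (2 * W ?n + 2) (st w M (rs @ [?a ?N]))"
        using runs_clr[of "d + 1" "rs @ [?a ?N, ?N, 0]" "W ?n" w M] d N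
        by (simp add: nth_append list_update_append W_def e)
      have "runs ?c (st w M rs) (1 + T1 ?n + (1 + T2 ?n + (1 + Bw ?n + (1 + Bm ?n + (2 * W ?n + 2)))))
          (st w M (rs @ [?a ?N]))"
        by (rule runs_seq[OF r1 runs_seq[OF r2 runs_seq[OF r3 runs_seq[OF r4 r5]]]])
      then show ?thesis using aN by (auto simp: T_def elim: runs_mono)
    qed
    then have "computes ?c d ?f V T" unfolding computes_def by blast
    moreover have "bnd K T" unfolding T_def Bw_def Bb_def Bm_def W_def
      by (intro bnd_rules T1(1) T2(1) T3(1) U(1))
    ultimately show ?thesis by blast
  qed
  then show ?thesis unfolding cmpd_def by blast
qed

text \<open>The word has no end marker; a position lies inside it iff track 0 or track 1 is set
  there. \<open>?chk\<close> stores this as a flag in register \<open>d + 1\<close>, and the loop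
  test asks whether the flag exceeds the empty register \<open>d + 2\<close>.\<close>

lemma cmpd_length: "cmpd d (\<lambda>w M rs. length w)"
proof -
  let ?chk = "SEQ (CLR (d + 1)) (IF (reg d) 0 (INC (d + 1)) (IF (reg d) (Suc 0) (INC (d + 1)) SKIP))"
  let ?c = "SEQ ?chk (WHILE (reg (d + 2)) (reg (d + 1)) (SEQ (INC d) ?chk))"
  let ?T = "\<lambda>n. 1 + (4 * n + 15) + (n + 1) * (2 * 0 + 2 + (1 + (2 * n + 2) + (4 * n + 15)))"
  have "runs ?c (st w M rs) (?T (length w)) (st w M (rs @ [length w]))"
    if b: "w \<noteq> []" "length rs = d" for w M rs
  proof -
    let ?n = "length w"
    let ?S = "\<lambda>k. st w M (rs @ [k, of_bool (k < ?n)])"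
    have chk: "runs ?chk (st w M (rs @ [k, v])) (4 * ?n + 15) (?S k)" if k: "k \<le> ?n" "v \<le> 1" for k v
    proof -
      let ?s = "st w M (rs @ [k, 0])"
      have 1: "runs (CLR (d + 1)) (st w M (rs @ [k, v])) (2 * 1 + 2) ?s"
        using runs_clr[of "d + 1" "rs @ [k, v]" 1 w M] b k by (simp add: nth_append list_update_append)
      have v: "isval ?s (reg d) k" using isval_reg[of d "rs @ [k, 0]" w M] b by (simp add: nth_append)
      have inc: "runs (INC (d + 1)) ?s 2 (st w M (rs @ [k, 1]))"
        using runs_inc[of "d + 1" "rs @ [k, 0]" 0 w M] b
        by (simp add: nth_append list_update_append numeral_2_eq_2)
      have 2: "runs (IF (reg d) 0 (INC (d + 1)) (IF (reg d) (Suc 0) (INC (d + 1)) SKIP)) ?s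
          (2 * k + 2 + (2 * k + 2 + 2)) (?S k)"
      proof (rule runs_if[OF v])
        assume "?s 0 k"
        then show "runs (INC (d + 1)) ?s (2 * k + 2 + 2) (?S k)"
          using inc by (auto simp: st_input elim: runs_mono)
      next
        assume "\<not> ?s 0 k"
        then show "runs (IF (reg d) (Suc 0) (INC (d + 1)) SKIP) ?s (2 * k + 2 + 2) (?S k)"
          using inc runs_mono[OF runs_skip, of 2 ?s] by (intro runs_if[OF v]) (auto simp: st_input)
      qed
      show ?thesis by (rule runs_mono[OF runs_seq[OF 1 2]]) (use k in simp)
    qed
    have z: "st w M (rs @ [0, 0]) = st w M rs"
      using st_snoc0[of w M "rs @ [0]"] st_snoc0[of w M rs] by simp
    have 1: "runs ?chk (st w M rs) (4 * ?n + 15) (?S 0)" using chk[of 0 0] z by simp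
    have step: "runs (SEQ (INC d) ?chk) (?S k) (1 + (2 * ?n + 2) + (4 * ?n + 15)) (?S (Suc k))" if "k < ?n" for k
    proof -
      have "runs (INC d) (?S k) (2 * ?n + 2) (st w M (rs @ [Suc k, 1]))"
        using runs_inc[of d "rs @ [k, 1]" ?n w M] b that by (simp add: nth_append list_update_append)
      from runs_seq[OF this chk] that show ?thesis by simp
    qed
    have 2: "runs (WHILE (reg (d + 2)) (reg (d + 1)) (SEQ (INC d) ?chk)) (?S 0)
        ((?n + 1) * (2 * 0 + 2 + (1 + (2 * ?n + 2) + (4 * ?n + 15)))) (?S ?n)"
      by (rule runs_while[of ?n ?S _ "\<lambda>_. 0"])
        (use step b in \<open>auto simp: st_reg nth_append intro!: isval_reg0\<close>)
    have "?S ?n = st w M (rs @ [?n])" using st_snoc0[of w M "rs @ [?n]"] by simp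
    then show ?thesis using runs_seq[OF 1 2] by simp
  qed
  then have "computes ?c d (\<lambda>w M rs. length w) V ?T" for V
    unfolding computes_def by (auto simp: bounded_def)
  moreover have "bnd K ?T" by (intro bnd_rules)
  ultimately show ?thesis unfolding cmpd_def by blast
qed

section \<open>Closure properties for arbitrary argument registers\<close>

lemma cmpd_comp: "computable a f \<Longrightarrow> cmpd a f"
  unfolding computable_def
  by (drule spec[of _ a], drule spec[of _ "[0..<a]"]) (auto elim!: cmpd_cong simp: map_nth)

lemma comp_cong:
  assumes "computable a g" "\<And>w M xs. w \<noteq> [] \<Longrightarrow> length xs = a \<Longrightarrow> f w M xs = g w M xs"
  shows "computable a f"
  using assms unfolding computable_def by (metis (no_types, lifting) cmpd_cong length_map)

lemma comp_zero: "computable a (\<lambda>_ _ _. 0)"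
  by (simp add: computable_def cmpd_zero)

lemma comp_suc: "computable a f \<Longrightarrow> computable a (\<lambda>w M xs. Suc (f w M xs))"
  by (simp add: computable_def cmpd_suc)

lemma comp_const: "computable a (\<lambda>_ _ _. k)"
  by (induction k) (auto intro: comp_zero comp_suc)

lemma comp_length: "computable a (\<lambda>w M xs. length w)"
  by (simp add: computable_def cmpd_length)

lemma comp_var: "i < a \<Longrightarrow> computable a (\<lambda>w M xs. xs ! i)"
  unfolding computable_def by (auto intro!: cmpd_cong[OF cmpd_var, of "_ ! i"] dest!: subsetD[OF _ nth_mem])

lemma comp_rename:
  assumes "computable a f" "length js = a" "set js \<subseteq> {..<b}"
  shows "computable b (\<lambda>w M xs. f w M (map ((!) xs) js))"
  unfolding computable_def
proof (intro allI impI)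
  fix d :: nat and "is" :: "nat list" assume i: "length is = b" "set is \<subseteq> {..<d}"
  have "cmpd d (\<lambda>w M rs. f w M (map ((!) rs) (map ((!) is) js)))"
  proof (rule assms(1)[unfolded computable_def, rule_format])
    show "length (map ((!) is) js) = a" using assms(2) by simp
    have "is ! j < d" if "j \<in> set js" for j
    proof -
      have "is ! j \<in> set is" using that assms(3) i(1) by (intro nth_mem) auto
      then show ?thesis using i(2) by auto
    qed
    then show "set (map ((!) is) js) \<subseteq> {..<d}" by auto
  qed
  moreover have "map ((!) rs) (map ((!) is) js) = map ((!) (map ((!) rs) is)) js" for rs :: "nat list"
    using assms(3) i(1) by auto
  ultimately show "cmpd d (\<lambda>w M rs. f w M (map ((!) (map ((!) rs) is)) js))"
    by (elim cmpd_cong) metis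
qed

lemma comp_weaken: assumes "computable a f" "a \<le> b" shows "computable b (\<lambda>w M xs. f w M (take a xs))"
proof (rule comp_cong[OF comp_rename[OF assms(1), of "[0..<a]" b]])
  fix w :: "bool list" and M :: tracks and xs :: "nat list" assume "length xs = b"
  then have "take a xs = map ((!) xs) [0..<a]" using assms(2) by (intro nth_equalityI) auto
  then show "f w M (take a xs) = f w M (map ((!) xs) [0..<a])" by simp
qed (use assms in auto)

lemma map_nth_take:
  assumes "set is \<subseteq> {..<d}" shows "map ((!) (take d rs)) is = map ((!) rs) is"
  using assms by (intro map_cong refl nth_take) auto

lemma comp_let:
  assumes g: "computable a g" and h: "computable (Suc a) (\<lambda>w M xs. h w M (take a xs) (xs ! a))"
  shows "computable a (\<lambda>w M xs. h w M xs (g w M xs))"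
  unfolding computable_def
proof (intro allI impI)
  fix d :: nat and "is" :: "nat list" assume i: "length is = a" "set is \<subseteq> {..<d}"
  have "cmpd d (\<lambda>w M rs. g w M (map ((!) rs) is))" using g i by (simp add: computable_def)
  moreover have "cmpd (Suc d) (\<lambda>w M rs. h w M (map ((!) (take d rs)) is) (rs ! d))"
    using h[unfolded computable_def, rule_format, of "is @ [d]" "Suc d"] i
    by (simp add: nth_append less_Suc_eq map_nth_take[OF i(2)] subset_iff)
  ultimately show "cmpd d (\<lambda>w M rs. h w M (map ((!) rs) is) (g w M (map ((!) rs) is)))"
    by (rule cmpd_let)
qed

lemma comp_rec:
  assumes b: "computable a b" and i: "computable a i"
    and g: "computable (a + 2) (\<lambda>w M xs. g w M (take a xs) (xs ! a) (xs ! Suc a))"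
    and bd: "\<And>V. bnd K V \<Longrightarrow> \<exists>U. bnd K U \<and> (\<forall>w M xs k. bounded V a w xs \<longrightarrow> k \<le> b w M xs \<longrightarrow>
        rec_nat (i w M xs) (g w M xs) k \<le> U (length w))"
  shows "computable a (\<lambda>w M xs. rec_nat (i w M xs) (g w M xs) (b w M xs))"
  unfolding computable_def
proof (intro allI impI)
  fix d :: nat and "is" :: "nat list" assume is_: "length is = a" "set is \<subseteq> {..<d}"
  let ?m = "\<lambda>rs. map ((!) rs) is"
  have sub: "set is \<subseteq> {..<d + k}" for k using is_(2) by (auto dest: subsetD)
  have 1: "cmpd d (\<lambda>w M rs. b w M (?m rs))" using b is_ by (simp add: computable_def)
  have 2: "cmpd (d + 2) (\<lambda>w M rs. i w M (?m (take d rs)))"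
    using i[unfolded computable_def, rule_format, OF is_(1) sub[of 2]]
    by (simp only: map_nth_take[OF is_(2)])
  \<comment> \<open>Register \<open>d\<close> holds the number of rounds, so the counter and the
    accumulator are \<open>d + 1\<close> and \<open>d + 2\<close>.\<close>
  have 3: "cmpd (d + 3) (\<lambda>w M rs. g w M (?m (take d rs)) (rs ! (d + 1)) (rs ! (d + 2)))"
  proof (rule cmpd_cong[OF g[unfolded computable_def, rule_format, of "is @ [d + 1, d + 2]" "d + 3"]])
    fix w :: "bool list" and M :: tracks and rs :: "nat list" assume "length rs = d + 3"
    then show "g w M (?m (take d rs)) (rs ! (d + 1)) (rs ! (d + 2)) =
      g w M (take a (map ((!) rs) (is @ [d + 1, d + 2]))) (map ((!) rs) (is @ [d + 1, d + 2]) ! a)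
        (map ((!) rs) (is @ [d + 1, d + 2]) ! Suc a)"
      using is_ by (simp add: nth_append map_nth_take[OF is_(2)] del: map_eq_conv)
  qed (use is_ sub[of 3] in auto)
  have 4: "\<exists>U. bnd K U \<and> (\<forall>w M rs k. bounded V d w rs \<longrightarrow> k \<le> b w M (?m rs) \<longrightarrow>
        rec_nat (i w M (?m rs)) (g w M (?m rs)) k \<le> U (length w))" if V: "bnd K V" for V
  proof -
    obtain U where U: "bnd K U" "\<And>w M xs k. bounded V a w xs \<Longrightarrow> k \<le> b w M xs \<Longrightarrow>
        rec_nat (i w M xs) (g w M xs) k \<le> U (length w)" using bd[OF V] by blast
    have "bounded V a w (?m rs)" if "bounded V d w rs" for w rs
      using that is_ unfolding bounded_def by (auto dest!: subsetD)
    then show ?thesis using U by blast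
  qed
  show "cmpd d (\<lambda>w M rs. rec_nat (i w M (?m rs)) (g w M (?m rs)) (b w M (?m rs)))"
    by (rule cmpd_rec[OF 1 2 3 4])
qed

section \<open>Decidable predicates and bounded arithmetic\<close>

abbreviation pcomp :: "nat \<Rightarrow> (bool list \<Rightarrow> tracks \<Rightarrow> nat list \<Rightarrow> bool) \<Rightarrow> bool" where
  "pcomp a P \<equiv> computable a (\<lambda>w M xs. of_bool (P w M xs))"

lemma comp_ite: "pcomp a P \<Longrightarrow> computable a x \<Longrightarrow> computable a y \<Longrightarrow> computable a (\<lambda>w M xs. if P w M xs then x w M xs else y w M xs)"
  unfolding computable_def by (intro allI impI cmpd_ite) auto

lemma pcomp_ite: assumes "pcomp a P" "pcomp a Q" "pcomp a R"
  shows "pcomp a (\<lambda>w M xs. if P w M xs then Q w M xs else R w M xs)"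
  by (rule comp_cong[OF comp_ite[OF assms]]) auto

lemma pcomp_const: "pcomp a (\<lambda>_ _ _. b)"
  by (rule comp_const)

lemma pcomp_not: assumes "pcomp a P" shows "pcomp a (\<lambda>w M xs. \<not> P w M xs)"
  by (rule comp_cong[OF pcomp_ite[OF assms pcomp_const[of _ False] pcomp_const[of _ True]]]) auto

lemma pcomp_conj: assumes "pcomp a P" "pcomp a Q" shows "pcomp a (\<lambda>w M xs. P w M xs \<and> Q w M xs)"
  by (rule comp_cong[OF pcomp_ite[OF assms pcomp_const[of _ False]]]) auto

lemma pcomp_disj: assumes "pcomp a P" "pcomp a Q" shows "pcomp a (\<lambda>w M xs. P w M xs \<or> Q w M xs)"
  by (rule comp_cong[OF pcomp_ite[OF assms(1) pcomp_const[of _ True] assms(2)]]) auto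

lemma pcomp_imp: assumes "pcomp a P" "pcomp a Q" shows "pcomp a (\<lambda>w M xs. P w M xs \<longrightarrow> Q w M xs)"
  by (rule comp_cong[OF pcomp_disj[OF pcomp_not[OF assms(1)] assms(2)]]) auto

lemma comp_op2:
  assumes h: "computable 2 (\<lambda>w M xs. h w M (xs ! 0) (xs ! 1))" and f: "computable a f" and g: "computable a g"
  shows "computable a (\<lambda>w M xs. h w M (f w M xs) (g w M xs))"
proof (rule comp_let[OF f])
  have "computable (Suc a) (\<lambda>w M xs. g w M (take a xs))" by (rule comp_weaken[OF g]) simp
  then show "computable (Suc a) (\<lambda>w M xs. h w M (xs ! a) (g w M (take a xs)))"
  proof (rule comp_let)
    show "computable (Suc (Suc a)) (\<lambda>w M xs. h w M (take (Suc a) xs ! a) (xs ! Suc a))"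
      using comp_rename[OF h, of "[a, Suc a]" "Suc (Suc a)"] by simp
  qed
qed

lemma comp_op1:
  assumes h: "computable 1 (\<lambda>w M xs. h w M (xs ! 0))" and f: "computable a f"
  shows "computable a (\<lambda>w M xs. h w M (f w M xs))"
  by (rule comp_let[OF f]) (use comp_rename[OF h, of "[a]" "Suc a"] in simp)

text \<open>Variables bound by quantifiers are appended behind the arguments. Here the last argument
  of \<open>h\<close> is substituted while \<open>h\<close> goes on seeing only the first
  \<open>k\<close>, so a predicate treated once can be used at any quantifier depth.\<close>

lemma comp_env:
  assumes h: "computable (Suc k) (\<lambda>w M xs. h w M (take k xs) (xs ! k))" and f: "computable a f" and "k \<le> a"
  shows "computable a (\<lambda>w M xs. h w M (take k xs) (f w M xs))"
proof (rule comp_let[OF f])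
  show "computable (Suc a) (\<lambda>w M xs. h w M (take k (take a xs)) (xs ! a))"
  proof (rule comp_cong[OF comp_rename[OF h, of "[0..<k] @ [a]" "Suc a"]])
    fix w :: "bool list" and M :: tracks and xs :: "nat list" assume l: "length xs = Suc a"
    have "take k xs = map ((!) xs) [0..<k]" using assms(3) l by (intro nth_equalityI) auto
    then show "h w M (take k (take a xs)) (xs ! a) = h w M (take k (map ((!) xs) ([0..<k] @ [a])))
        (map ((!) xs) ([0..<k] @ [a]) ! k)"
      using assms(3) by (simp add: nth_append min_absorb1)
  qed (use assms(3) in auto)
qed

lemma pcomp_less: assumes "computable a f" "computable a g" shows "pcomp a (\<lambda>w M xs. f w M xs < g w M xs)"
proof (rule comp_op2[OF _ assms])
  show "pcomp 2 (\<lambda>w M xs. xs ! 0 < xs ! 1)"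
    unfolding computable_def
  proof (intro allI impI)
    fix d :: nat and "is" :: "nat list" assume "length is = (2::nat)" "set is \<subseteq> {..<d}"
    then obtain i j where "is = [i, j]" "i < d" "j < d" by (auto simp: length_Suc_conv numeral_2_eq_2)
    then show "cmpd d (\<lambda>w M rs. of_bool (map ((!) rs) is ! 0 < map ((!) rs) is ! 1))"
      using cmpd_test[of i d "reg j" "\<lambda>w M rs. rs ! i < rs ! j"] by (auto simp: st_reg)
  qed
qed

lemma pcomp_eq: assumes "computable a f" "computable a g" shows "pcomp a (\<lambda>w M xs. f w M xs = g w M xs)"
  by (rule comp_cong[OF pcomp_conj[OF pcomp_not[OF pcomp_less[OF assms]] pcomp_not[OF pcomp_less[OF assms(2,1)]]]]) auto

lemma pcomp_test1:
  assumes "computable a f" "\<And>w M rs x. st w M rs m x \<longleftrightarrow> P w M x"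
  shows "pcomp a (\<lambda>w M xs. P w M (f w M xs))"
proof (rule comp_op1[OF _ assms(1)])
  show "pcomp 1 (\<lambda>w M xs. P w M (xs ! 0))"
    unfolding computable_def
  proof (intro allI impI)
    fix d :: nat and "is" :: "nat list" assume "length is = (1::nat)" "set is \<subseteq> {..<d}"
    then obtain i where "is = [i]" "i < d" by (auto simp: length_Suc_conv)
    then show "cmpd d (\<lambda>w M rs. of_bool (P w M (map ((!) rs) is ! 0)))"
      using cmpd_test[of i d m "\<lambda>w M rs. P w M (rs ! i)"] assms(2) by auto
  qed
qed

lemma pcomp_mem: "computable a f \<Longrightarrow> j < F \<Longrightarrow> pcomp a (\<lambda>w M xs. M j (f w M xs))"
  by (rule pcomp_test1[of _ _ "j + 2" "\<lambda>w M. M j"]) (simp_all only: st_mem)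

lemma pcomp_input: assumes "computable a f" shows "pcomp a (\<lambda>w M xs. f w M xs < length w \<and> w ! f w M xs)"
  by (rule pcomp_test1[OF assms, of "Suc 0" "\<lambda>w M x. x < length w \<and> w ! x"]) (auto simp: st_input)

text \<open>The search is a recursion with a 0/1 accumulator that never stops early; the bound
  required by \<open>comp_rec\<close> is therefore the constant 1.\<close>

lemma pcomp_ex:
  assumes b: "computable a b" and P: "pcomp (Suc a) (\<lambda>w M xs. P w M (take a xs) (xs ! a))"
  shows "pcomp a (\<lambda>w M xs. \<exists>x<b w M xs. P w M xs x)"
proof -
  let ?g = "\<lambda>w M xs x (acc::nat). of_bool (P w M xs x \<or> 0 < acc) :: nat"
  have r: "rec_nat 0 (?g w M xs) n = of_bool (\<exists>x<n. P w M xs x)" for w M xs n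
    by (induction n) (auto simp: less_Suc_eq)
  have "computable a (\<lambda>w M xs. rec_nat 0 (?g w M xs) (b w M xs))"
  proof (rule comp_rec[OF b comp_zero])
    have "pcomp (a + 2) (\<lambda>w M xs. P w M (take a (take (Suc a) xs)) (take (Suc a) xs ! a))"
      by (rule comp_weaken[OF P]) simp
    then have "pcomp (a + 2) (\<lambda>w M xs. P w M (take a xs) (xs ! a))" by (simp add: min_absorb1)
    moreover have "pcomp (a + 2) (\<lambda>w M xs. 0 < xs ! Suc a)"
      by (intro pcomp_less comp_zero comp_var) simp
    ultimately show "pcomp (a + 2) (\<lambda>w M xs. P w M (take a xs) (xs ! a) \<or> 0 < xs ! Suc a)"
      by (rule pcomp_disj)
  qed (use r bnd_const[of K 1] in \<open>auto intro!: exI[of _ "\<lambda>_. 1"]\<close>)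
  then show ?thesis by (simp only: r)
qed

lemma pcomp_all:
  assumes b: "computable a b" and P: "pcomp (Suc a) (\<lambda>w M xs. P w M (take a xs) (xs ! a))"
  shows "pcomp a (\<lambda>w M xs. \<forall>x<b w M xs. P w M xs x)"
  by (rule comp_cong[OF pcomp_not[OF pcomp_ex[OF b pcomp_not[OF P]]]]) auto

lemma bounded_nths: "bounded V a w xs \<Longrightarrow> i < a \<Longrightarrow> xs ! i \<le> V (length w)"
  by (auto simp: bounded_def)

lemma comp_add: assumes "computable a f" "computable a g" shows "computable a (\<lambda>w M xs. f w M xs + g w M xs)"
proof (rule comp_op2[OF _ assms])
  have r: "rec_nat x (\<lambda>_. Suc) n = x + n" for x n by (induction n) auto
  have "computable 2 (\<lambda>w M xs. rec_nat (xs ! 0) (\<lambda>_. Suc) (xs ! 1))"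
  proof (rule comp_rec)
    fix V assume V: "bnd K V"
    have "xs ! 0 + k \<le> V (length w) + V (length w)" if "bounded V 2 w xs" "k \<le> xs ! 1" for w xs k
      using bounded_nths[OF that(1), of 0] bounded_nths[OF that(1), of 1] that(2) by (intro add_mono) auto
    then show "\<exists>U. bnd K U \<and> (\<forall>w M xs k. bounded V 2 w xs \<longrightarrow> k \<le> xs ! 1 \<longrightarrow> rec_nat (xs ! 0) (\<lambda>_. Suc) k \<le> U (length w))"
      unfolding r using bnd_add[OF V V] by blast
  qed (auto intro!: comp_var comp_suc)
  then show "computable 2 (\<lambda>w M xs. xs ! 0 + xs ! 1)" by (simp add: r)
qed

lemma comp_mult: assumes "computable a f" "computable a g" shows "computable a (\<lambda>w M xs. f w M xs * g w M xs)"
proof (rule comp_op2[OF _ assms])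
  have r: "rec_nat 0 (\<lambda>_ acc. acc + x) n = x * n" for x n :: nat by (induction n) auto
  have "computable 2 (\<lambda>w M xs. rec_nat 0 (\<lambda>_ acc. acc + xs ! 0) (xs ! 1))"
  proof (rule comp_rec)
    fix V assume V: "bnd K V"
    have "xs ! 0 * k \<le> V (length w) * V (length w)" if "bounded V 2 w xs" "k \<le> xs ! 1" for w xs k
      using bounded_nths[OF that(1), of 0] bounded_nths[OF that(1), of 1] that(2) by (intro mult_mono) auto
    then show "\<exists>U. bnd K U \<and> (\<forall>w M xs k. bounded V 2 w xs \<longrightarrow> k \<le> xs ! 1 \<longrightarrow>
        rec_nat 0 (\<lambda>_ acc. acc + xs ! 0) k \<le> U (length w))"
      unfolding r using bnd_mult[OF V V] by blast
  qed (auto intro!: comp_var comp_zero comp_add[of _ "\<lambda>w M xs. xs ! _" "\<lambda>w M xs. xs ! _"])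
  then show "computable 2 (\<lambda>w M xs. xs ! 0 * xs ! 1)" by (simp add: r)
qed

text \<open>The growth rate is not closed under powers of two, so the bound on the power is a
  hypothesis. It will hold because only arguments of order at most \<open>K\<close> are coded by
  sets.\<close>

lemma comp_pow2:
  assumes "computable a f" "bnd K (\<lambda>n. 2 ^ B n)" "\<And>w M xs. w \<noteq> [] \<Longrightarrow> f w M xs \<le> B (length w)"
  shows "computable a (\<lambda>w M xs. 2 ^ f w M xs)"
proof -
  have r: "rec_nat 1 (\<lambda>_ acc. acc + acc) n = (2::nat) ^ n" for n by (induction n) auto
  have "computable a (\<lambda>w M xs. rec_nat 1 (\<lambda>_ acc. acc + acc) (f w M xs))"
  proof (rule comp_rec[OF assms(1) comp_const])
    fix V
    have "(2::nat) ^ k \<le> 2 ^ B (length w)" if "bounded V a w xs" "k \<le> f w M xs" for w M xs k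
      using that assms(3)[of w M xs] by (intro power_increasing) (auto simp: bounded_def)
    then show "\<exists>U. bnd K U \<and> (\<forall>w M xs k. bounded V a w xs \<longrightarrow> k \<le> f w M xs \<longrightarrow>
        rec_nat 1 (\<lambda>_ acc. acc + acc) k \<le> U (length w))"
      unfolding r using assms(2) by blast
  qed (auto intro!: comp_add comp_var)
  then show ?thesis by (simp only: r)
qed

lemma comp_diff: assumes "computable a f" "computable a g" shows "computable a (\<lambda>w M xs. f w M xs - g w M xs)"
proof (rule comp_op2[OF _ assms])
  have p: "rec_nat 0 (\<lambda>i _. i) n = n - 1" for n :: nat by (induction n) auto
  have "computable 1 (\<lambda>w M xs. rec_nat 0 (\<lambda>i _. i) (xs ! 0))"
  proof (rule comp_rec)
    fix V assume V: "bnd K V"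
    have "k - 1 \<le> V (length w)" if "bounded V 1 w xs" "k \<le> xs ! 0" for w xs k
      using bounded_nths[OF that(1), of 0] that(2) by auto
    then show "\<exists>U. bnd K U \<and> (\<forall>w M xs k. bounded V 1 w xs \<longrightarrow> k \<le> xs ! 0 \<longrightarrow> rec_nat 0 (\<lambda>i _. i) k \<le> U (length w))"
      unfolding p using V by blast
  qed (auto intro!: comp_var comp_zero)
  then have pred: "computable 1 (\<lambda>w M xs. xs ! 0 - 1)" by (simp add: p)
  have r: "rec_nat x (\<lambda>_ acc. acc - 1) n = x - n" for x n :: nat by (induction n) auto
  have "computable 2 (\<lambda>w M xs. rec_nat (xs ! 0) (\<lambda>_ acc. acc - 1) (xs ! 1))"
  proof (rule comp_rec)
    fix V assume V: "bnd K V"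
    have "xs ! 0 - k \<le> V (length w)" if "bounded V 2 w xs" for w xs k
      using bounded_nths[OF that(1), of 0] by auto
    then show "\<exists>U. bnd K U \<and> (\<forall>w M xs k. bounded V 2 w xs \<longrightarrow> k \<le> xs ! 1 \<longrightarrow> rec_nat (xs ! 0) (\<lambda>_ acc. acc - 1) k \<le> U (length w))"
      unfolding r using V by blast
  next
    show "computable (2 + 2) (\<lambda>w M xs. xs ! Suc 2 - 1)"
      by (rule comp_op1[OF pred, of _ "\<lambda>w M xs. xs ! Suc 2"]) (simp add: comp_var)
  qed (auto intro!: comp_var)
  then show "computable 2 (\<lambda>w M xs. xs ! 0 - xs ! 1)" by (simp only: r)
qed

text \<open>Rests on \<open>Suc n div 2 = n - n div 2\<close>, so the recursion needs no parity
  flag.\<close>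

lemma comp_half: assumes "computable a f" shows "computable a (\<lambda>w M xs. f w M xs div 2)"
proof (rule comp_op1[OF _ assms])
  have r: "rec_nat 0 (\<lambda>i acc. i - acc) n = n div 2" for n :: nat
    by (induction n) auto
  have "computable 1 (\<lambda>w M xs. rec_nat 0 (\<lambda>i acc. i - acc) (xs ! 0))"
  proof (rule comp_rec)
    fix V assume V: "bnd K V"
    have "k div 2 \<le> V (length w)" if "bounded V 1 w xs" "k \<le> xs ! 0" for w xs k
      using bounded_nths[OF that(1), of 0] that(2) by auto
    then show "\<exists>U. bnd K U \<and> (\<forall>w M xs k. bounded V 1 w xs \<longrightarrow> k \<le> xs ! 0 \<longrightarrow> rec_nat 0 (\<lambda>i acc. i - acc) k \<le> U (length w))"
      unfolding r using V by blast
  qed (auto intro!: comp_var comp_zero comp_diff[of _ "\<lambda>w M xs. xs ! _" "\<lambda>w M xs. xs ! _"])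
  then show "computable 1 (\<lambda>w M xs. xs ! 0 div 2)" by (simp add: r)
qed

lemma pcomp_bit: assumes "computable a f" "computable a g" shows "pcomp a (\<lambda>w M xs. bit (f w M xs) (g w M xs))"
proof (rule comp_op2[OF _ assms])
  have r: "rec_nat x (\<lambda>_ acc. acc div 2) n = x div 2 ^ n" for x n :: nat
    by (induction n) (auto simp: div_mult2_eq[symmetric] mult.commute)
  have "computable 2 (\<lambda>w M xs. rec_nat (xs ! 0) (\<lambda>_ acc. acc div 2) (xs ! 1))"
  proof (rule comp_rec)
    fix V assume V: "bnd K V"
    have "xs ! 0 div 2 ^ k \<le> V (length w)" if "bounded V 2 w xs" for w xs k
      using bounded_nths[OF that(1), of 0] div_le_dividend[of "xs ! 0" "2 ^ k"] by (metis order_trans zero_less_numeral)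
    then show "\<exists>U. bnd K U \<and> (\<forall>w M xs k. bounded V 2 w xs \<longrightarrow> k \<le> xs ! 1 \<longrightarrow> rec_nat (xs ! 0) (\<lambda>_ acc. acc div 2) k \<le> U (length w))"
      unfolding r using V by blast
  qed (auto intro!: comp_var comp_half)
  then have shift: "computable 2 (\<lambda>w M xs. xs ! 0 div 2 ^ (xs ! 1))" by (simp add: r)
  show "pcomp 2 (\<lambda>w M xs. bit (xs ! 0) (xs ! 1))"
  proof (rule comp_cong)
    show "pcomp 2 (\<lambda>w M xs. \<not> xs ! 0 div 2 ^ (xs ! 1) div 2 + xs ! 0 div 2 ^ (xs ! 1) div 2 = xs ! 0 div 2 ^ (xs ! 1))"
      by (intro pcomp_not pcomp_eq comp_add comp_half shift)
    fix w :: "bool list" and M :: tracks and xs :: "nat list"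
    have "odd y \<longleftrightarrow> y div 2 + y div 2 \<noteq> y" for y :: nat by presburger
    then show "of_bool (bit (xs ! 0) (xs ! 1)) =
      (of_bool (\<not> xs ! 0 div 2 ^ (xs ! 1) div 2 + xs ! 0 div 2 ^ (xs ! 1) div 2 = xs ! 0 div 2 ^ (xs ! 1)) :: nat)"
      by (simp add: bit_iff_odd)
  qed
qed

end

subsection \<open>Least fixed points over bounded universes\<close>

context track_machine
begin

definition updates :: "nat \<Rightarrow> (bool list \<Rightarrow> tracks \<Rightarrow> nat list \<Rightarrow> tracks) \<Rightarrow> bool" where
  "updates d G \<longleftrightarrow> (\<exists>c. \<forall>V. bnd K V \<longrightarrow> (\<exists>T. bnd K T \<and> (\<forall>w M rs. bounded V d w rs \<longrightarrow>
     runs c (st w M rs) (T (length w)) (st w (G w M rs) rs))))"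

lemma updates_skip: "updates d (\<lambda>w M rs. M)"
  unfolding updates_def using runs_skip bnd_const[of K 1] by blast

lemma updates_seq:
  assumes "updates d G" "updates d H"
  shows "updates d (\<lambda>w M rs. H w (G w M rs) rs)"
proof -
  obtain c1 where c1: "\<And>V. bnd K V \<Longrightarrow> \<exists>T. bnd K T \<and> (\<forall>w M rs. bounded V d w rs \<longrightarrow>
     runs c1 (st w M rs) (T (length w)) (st w (G w M rs) rs))" using assms(1) unfolding updates_def by blast
  obtain c2 where c2: "\<And>V. bnd K V \<Longrightarrow> \<exists>T. bnd K T \<and> (\<forall>w M rs. bounded V d w rs \<longrightarrow>
     runs c2 (st w M rs) (T (length w)) (st w (H w M rs) rs))" using assms(2) unfolding updates_def by blast
  have "\<exists>T. bnd K T \<and> (\<forall>w M rs. bounded V d w rs \<longrightarrow>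
     runs (SEQ c1 c2) (st w M rs) (T (length w)) (st w (H w (G w M rs) rs) rs))" if V: "bnd K V" for V
  proof -
    obtain T1 where T1: "bnd K T1" "\<And>w M rs. bounded V d w rs \<Longrightarrow>
      runs c1 (st w M rs) (T1 (length w)) (st w (G w M rs) rs)" using c1[OF V] by blast
    obtain T2 where T2: "bnd K T2" "\<And>w M rs. bounded V d w rs \<Longrightarrow>
      runs c2 (st w M rs) (T2 (length w)) (st w (H w M rs) rs)" using c2[OF V] by blast
    have "bnd K (\<lambda>n. 1 + T1 n + T2 n)" by (intro bnd_rules T1 T2)
    then show ?thesis using runs_seq[OF T1(2) T2(2)]
      by (intro exI[of _ "\<lambda>n. 1 + T1 n + T2 n"]) blast
  qed
  then show ?thesis unfolding updates_def by blast
qed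

lemma updates_set:
  assumes "cmpd d (\<lambda>w M rs. of_bool (P w M rs))" "i < d" "j < F"
  shows "updates d (\<lambda>w M rs. if P w M rs then M(j := (M j)(rs ! i := True)) else M)"
proof -
  let ?p = "\<lambda>w M rs. of_bool (P w M rs)"
  let ?G = "\<lambda>w M rs. if P w M rs then M(j := (M j)(rs ! i := True)) else M"
  obtain c where c: "\<And>V. bnd K V \<Longrightarrow> \<exists>T. bnd K T \<and> computes c d ?p V T" using assms(1) unfolding cmpd_def by blast
  let ?c = "SEQ c (IF (reg (Suc d)) (reg d) (SEQ (CLR d) (SET (reg i) (j + 2) True)) SKIP)"
  have "\<exists>T. bnd K T \<and> (\<forall>w M rs. bounded V d w rs \<longrightarrow>
     runs ?c (st w M rs) (T (length w)) (st w (?G w M rs) rs))" if V: "bnd K V" for V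
  proof -
    obtain T where T: "bnd K T" "computes c d ?p V T" using c[OF V] by blast
    let ?T = "\<lambda>n. 1 + T n + (2 * 0 + 2 + (1 + 4 + (2 * V n + 2)))"
    have "runs ?c (st w M rs) (?T (length w)) (st w (?G w M rs) rs)" if b: "bounded V d w rs" for w M rs
    proof -
      have d: "length rs = d" using b by (simp add: bounded_def)
      let ?s = "st w M (rs @ [?p w M rs])"
      have 1: "runs c (st w M rs) (T (length w)) ?s" using T(2) b unfolding computes_def by auto
      have v: "isval ?s (reg (Suc d)) 0" using isval_reg0 d by simp
      have c: "?s (reg d) 0 \<longleftrightarrow> P w M rs" using d by (simp add: st_reg nth_append)
      have "runs (IF (reg (Suc d)) (reg d) (SEQ (CLR d) (SET (reg i) (j + 2) True)) SKIP) ?s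
          (2 * 0 + 2 + (1 + 4 + (2 * V (length w) + 2))) (st w (?G w M rs) rs)"
      proof (rule runs_if[OF v])
        assume "?s (reg d) 0"
        then have P: "P w M rs" using c by simp
        have a: "runs (CLR d) ?s (2 * 1 + 2) (st w M rs)"
          using runs_clr[of d "rs @ [1]" 1 w M] d P by (simp add: st_snoc0 nth_append list_update_append)
        have i: "i < length rs" using d assms(2) by simp
        have "(st w M rs)(j + 2 := (st w M rs (j + 2))(rs ! i := True)) = st w (M(j := (M j)(rs ! i := True))) rs"
        proof -
          have "st w M rs (j + 2) = M j" by (intro ext) (rule st_mem[OF assms(3)])
          then show ?thesis using st_upd_mem[OF assms(3)] by simp
        qed
        then have "runs (SET (reg i) (j + 2) True) (st w M rs) (2 * V (length w) + 2) (st w (?G w M rs) rs)"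
          using bs_set[OF isval_reg[OF i, of w M], of "j + 2" True] bounded_nth[OF b assms(2)] P
          unfolding runs_def by (intro exI[of _ "2 * rs ! i + 2"]) auto
        from runs_seq[OF a this] show "runs (SEQ (CLR d) (SET (reg i) (j + 2) True)) ?s
          (1 + 4 + (2 * V (length w) + 2)) (st w (?G w M rs) rs)" by simp
      next
        assume "\<not> ?s (reg d) 0"
        then have "\<not> P w M rs" using c by simp
        then show "runs SKIP ?s (1 + 4 + (2 * V (length w) + 2)) (st w (?G w M rs) rs)"
          using runs_mono[OF runs_skip] by (simp add: st_snoc0)
      qed
      from runs_seq[OF 1 this] show ?thesis .
    qed
    moreover have "bnd K ?T" by (intro bnd_rules T(1) V)
    ultimately show ?thesis by blast
  qed
  then show ?thesis unfolding updates_def by blast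
qed

text \<open>The bound is evaluated once before the loop, so the body may change memory on which
  \<open>b\<close> depends.\<close>

lemma updates_for:
  assumes "cmpd d b" "updates (d + 2) G"
  shows "updates d (\<lambda>w M rs. rec_nat M (\<lambda>x M'. G w M' (rs @ [b w M rs, x])) (b w M rs))"
proof -
  obtain c1 where c1: "\<And>V. bnd K V \<Longrightarrow> \<exists>T. bnd K T \<and> computes c1 d b V T" using assms(1) unfolding cmpd_def by blast
  obtain c2 where c2: "\<And>V. bnd K V \<Longrightarrow> \<exists>T. bnd K T \<and> (\<forall>w M rs. bounded V (d + 2) w rs \<longrightarrow>
     runs c2 (st w M rs) (T (length w)) (st w (G w M rs) rs))" using assms(2) unfolding updates_def by blast
  let ?body = "SEQ c2 (INC (d + 1))"
  let ?c = "SEQ c1 (SEQ (WHILE (reg (d + 1)) (reg d) ?body) (SEQ (CLR d) (CLR (d + 1))))"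
  let ?G = "\<lambda>w M rs. rec_nat M (\<lambda>x M'. G w M' (rs @ [b w M rs, x])) (b w M rs)"
  have "\<exists>T. bnd K T \<and> (\<forall>w M rs. bounded V d w rs \<longrightarrow>
     runs ?c (st w M rs) (T (length w)) (st w (?G w M rs) rs))" if V: "bnd K V" for V
  proof -
    obtain T1 where T1: "bnd K T1" "computes c1 d b V T1" using c1[OF V] by blast
    have "bnd K (\<lambda>n. V n + T1 n)" by (intro bnd_rules V T1(1))
    then obtain T2 where T2: "bnd K T2" "\<And>w M rs. bounded (\<lambda>n. V n + T1 n) (d + 2) w rs \<Longrightarrow>
      runs c2 (st w M rs) (T2 (length w)) (st w (G w M rs) rs)" using c2 by blast
    define Bb where "Bb n = 1 + T2 n + (2 * T1 n + 2)" for n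
    define Bw where "Bw n = (T1 n + 1) * (2 * T1 n + 2 + Bb n)" for n
    let ?T = "\<lambda>n. 1 + T1 n + (1 + Bw n + (1 + (2 * T1 n + 2) + (2 * T1 n + 2)))"
    have "runs ?c (st w M rs) (?T (length w)) (st w (?G w M rs) rs)" if bo: "bounded V d w rs" for w M rs
    proof -
      have d: "length rs = d" using bo by (simp add: bounded_def)
      let ?n = "length w"
      let ?N = "b w M rs"
      let ?M = "rec_nat M (\<lambda>x M'. G w M' (rs @ [?N, x]))"
      let ?S = "\<lambda>k. st w (?M k) (rs @ [?N, k])"
      have N: "?N \<le> T1 ?n" and r1: "runs c1 (st w M rs) (T1 ?n) (st w M (rs @ [?N]))"
        using T1(2) bo unfolding computes_def by auto
      have r1': "runs c1 (st w M rs) (T1 ?n) (?S 0)"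
        using r1 st_snoc0[of w M "rs @ [?N]"] by simp
      have step: "runs ?body (?S k) (Bb ?n) (?S (Suc k))" if k: "k < ?N" for k
      proof -
        have "bounded (\<lambda>n. V n + T1 n) (d + 2) w (rs @ [?N, k])"
          using bo N k by (auto simp: bounded_def trans_le_add1)
        from T2(2)[OF this, of "?M k"]
        have b1: "runs c2 (?S k) (T2 ?n) (st w (?M (Suc k)) (rs @ [?N, k]))" by simp
        have b2: "runs (INC (d + 1)) (st w (?M (Suc k)) (rs @ [?N, k])) (2 * T1 ?n + 2) (?S (Suc k))"
          using runs_inc[of "d + 1" "rs @ [?N, k]" "T1 ?n" w "?M (Suc k)"] d k N
          by (simp add: nth_append list_update_append)
        show ?thesis unfolding Bb_def by (rule runs_seq[OF b1 b2])
      qed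
      have r2: "runs (WHILE (reg (d + 1)) (reg d) ?body) (?S 0) (Bw ?n) (?S ?N)"
      proof -
        have v: "isval (?S k) (reg (d + 1)) k" for k
          using isval_reg[of "d + 1" "rs @ [?N, k]" w "?M k"] d by (simp add: nth_append)
        have "runs (WHILE (reg (d + 1)) (reg d) ?body) (?S 0) ((?N + 1) * (2 * T1 ?n + 2 + Bb ?n)) (?S ?N)"
          by (rule runs_while[of ?N ?S _ "\<lambda>k. k"])
            (use step d N v in \<open>auto simp: st_reg nth_append\<close>)
        then show ?thesis by (rule runs_mono) (unfold Bw_def, intro mult_le_mono1, simp add: N)
      qed
      have r3: "runs (CLR d) (?S ?N) (2 * T1 ?n + 2) (st w (?M ?N) (rs @ [0, ?N]))"
        using runs_clr[of d "rs @ [?N, ?N]" "T1 ?n" w "?M ?N"] d N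
        by (simp add: nth_append list_update_append)
      have r4: "runs (CLR (d + 1)) (st w (?M ?N) (rs @ [0, ?N])) (2 * T1 ?n + 2) (st w (?M ?N) rs)"
        using runs_clr[of "d + 1" "rs @ [0, ?N]" "T1 ?n" w "?M ?N"] d N
          st_snoc0[of w "?M ?N" "rs @ [0]"] st_snoc0[of w "?M ?N" rs]
        by (simp add: nth_append list_update_append)
      show ?thesis by (rule runs_seq[OF r1' runs_seq[OF r2 runs_seq[OF r3 r4]]])
    qed
    moreover have "bnd K ?T" unfolding Bw_def Bb_def by (intro bnd_rules T1(1) T2(1))
    ultimately show ?thesis by blast
  qed
  then show ?thesis unfolding updates_def by blast
qed

lemma updates_cong:
  assumes "updates d G" "\<And>w M rs. length rs = d \<Longrightarrow> H w M rs = G w M rs"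
  shows "updates d H"
proof -
  have "H w M rs = G w M rs" if "bounded V d w rs" for V w M rs
    using that assms(2) by (simp add: bounded_def)
  then show ?thesis using assms(1) unfolding updates_def by metis
qed

lemma rec_nat_fold: "rec_nat x f n = fold f [0..<n] x"
  by (induction n) auto

lemma updates_fold:
  assumes "\<And>j. j \<in> set js \<Longrightarrow> updates d (G j)"
  shows "updates d (\<lambda>w M rs. fold (\<lambda>j M. G j w M rs) js M)"
  using assms
proof (induction js)
  case (Cons j js)
  show ?case using updates_seq[OF Cons.prems[of j] Cons.IH] Cons.prems by simp
qed (simp add: updates_skip)

end

locale fixpoint_iteration =
  fixes F :: nat and m :: "nat \<Rightarrow> nat" and \<Phi> :: "nat \<Rightarrow> tracks \<Rightarrow> nat \<Rightarrow> bool"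
  assumes mono: "\<And>M M' j x. M \<le> M' \<Longrightarrow> \<Phi> j M x \<Longrightarrow> \<Phi> j M' x"
begin

definition "step \<equiv> \<lambda>j x M. if \<Phi> j M x then M(j := (M j)(x := True)) else M"
text \<open>Chaotic iteration: a fact is inserted as soon as it is found and may be used within the
  same sweep. Monotonicity keeps this below the least fixed point, and no second copy of the memory
  is needed.\<close>

definition "sweep \<equiv> \<lambda>M. fold (\<lambda>j M. fold (step j) [0..<m j] M) [0..<F] M"

text \<open>\<open>\<Phi>\<close> is applied to some set \<open>M\<close> of derived facts and not
  to the predicate itself, since its monotonicity is only a locale assumption;
  \<open>derivedI\<close> recovers the direct form.\<close>

inductive derived :: tracks where
  derived_intro: "j < F \<Longrightarrow> x < m j \<Longrightarrow> (\<And>i y. M i y \<Longrightarrow> derived i y) \<Longrightarrow> \<Phi> j M x \<Longrightarrow> derived j x"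

lemma derivedI: "j < F \<Longrightarrow> x < m j \<Longrightarrow> \<Phi> j derived x \<Longrightarrow> derived j x"
  using derived_intro by blast

lemma le_step: "M \<le> step j x M"
  by (auto simp: step_def le_fun_def)

lemma fold_increasing: "(\<And>x M. (M::tracks) \<le> f x M) \<Longrightarrow> M \<le> fold f xs M"
proof (induction xs arbitrary: M)
  case (Cons x xs)
  have "M \<le> f x M" by (rule Cons.prems)
  also have "\<dots> \<le> fold f xs (f x M)" by (rule Cons.IH[OF Cons.prems])
  finally show ?case by simp
qed simp

lemma le_sweep: "M \<le> sweep M"
  unfolding sweep_def by (intro fold_increasing le_step)

lemma fold_invariant: "(\<And>x M. x \<in> set xs \<Longrightarrow> P M \<Longrightarrow> P (f x M)) \<Longrightarrow> P M \<Longrightarrow> P (fold f xs M)"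
  by (induction xs arbitrary: M) auto

lemma step_derived: "j < F \<Longrightarrow> x < m j \<Longrightarrow> M \<le> derived \<Longrightarrow> step j x M \<le> derived"
  by (auto simp: step_def le_fun_def intro: derived_intro)

lemma sweep_derived: "M \<le> derived \<Longrightarrow> sweep M \<le> derived"
  unfolding sweep_def by (intro fold_invariant[where P = "\<lambda>M. M \<le> derived"] step_derived) auto

lemma fold_fixed:
  assumes "\<And>x M. (M::tracks) \<le> f x M" "fold f xs M = M" "x \<in> set xs"
  shows "f x M = M"
  using assms(2,3)
proof (induction xs)
  case (Cons y ys)
  have "f y M \<le> M" using fold_increasing[of f "f y M" ys] assms(1) Cons.prems(1) by auto
  then have "f y M = M" using assms(1) by (meson antisym)
  then show ?case using Cons by auto
qed simp

text \<open>Steps only add facts, so in an idle sweep every single step was idle. Hence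
  \<open>M\<close> is closed under \<open>\<Phi>\<close> and contains the least fixed point.\<close>

lemma sweep_fixed:
  assumes "sweep M = M" "M \<le> derived" shows "M = derived"
proof (rule antisym[OF assms(2)])
  have closed: "M j x" if "j < F" "x < m j" "\<Phi> j M x" for j x
  proof -
    have "fold (step j) [0..<m j] M = M"
    proof (rule fold_fixed[of "\<lambda>j. fold (step j) [0..<m j]" "[0..<F]" M j])
      show "N \<le> fold (step i) [0..<m i] N" for i N by (intro fold_increasing le_step)
    qed (use assms(1) that in \<open>auto simp: sweep_def\<close>)
    then have "step j x M = M" using fold_fixed[of "step j" "[0..<m j]" M x] le_step that by auto
    then show ?thesis using that(3) by (metis (full_types) step_def fun_upd_same)
  qed
  have "derived j x \<Longrightarrow> M j x" for j x
  proof (induction rule: derived.induct)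
    case (derived_intro j x M')
    then show ?case using closed mono[of M' M] by (auto simp: le_fun_def)
  qed
  then show "derived \<le> M" by (simp add: le_fun_def)
qed

text \<open>A sweep that is not idle adds a fact, and only \<open>\<Sum>j<F. m j\<close> facts
  exist; so one of the first \<open>Suc (\<Sum>j<F. m j)\<close> sweeps is idle.\<close>

lemma sweep_iterate: "(sweep ^^ Suc (\<Sum>j<F. m j)) (\<lambda>_ _. False) = derived"
proof -
  define A where "A k = (sweep ^^ k) (\<lambda>_ _. False)" for k
  let ?U = "Sigma {..<F} (\<lambda>j. {..<m j})"
  define C where "C k = card {(j, x). A k j x}" for k
  have A_Suc: "A (Suc k) = sweep (A k)" for k by (simp add: A_def)
  have le: "A k \<le> derived" for k
  proof (induction k)
    case (Suc k)
    then show ?case using sweep_derived unfolding A_Suc by blast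
  qed (simp add: A_def le_fun_def)
  have sub: "{(j, x). A k j x} \<subseteq> ?U" for k
    using le[of k] by (fastforce simp: le_fun_def elim: derived.cases)
  have fin: "finite {(j, x). A k j x}" for k using sub finite_subset by blast
  have C: "C k \<le> (\<Sum>j<F. m j)" for k
    unfolding C_def using card_mono[OF _ sub] by simp
  \<comment> \<open>Either one of the first \<open>Suc n\<close> sweeps was idle, or each of them
    added a fact, so that at least \<open>Suc n\<close> facts are present.\<close>
  have inc: "\<exists>k\<le>n. A (Suc k) = A k \<or> n < C (Suc n)" for n
  proof (induction n)
    case 0
    show ?case
    proof (cases "A 1 = A 0")
      case False
      then obtain j x where "A 1 j x" by (auto simp: A_def fun_eq_iff)
      then have "0 < C 1" unfolding C_def using fin by (subst card_gt_0_iff) auto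
      then show ?thesis by auto
    qed auto
  next
    case (Suc n)
    show ?case
    proof (cases "\<exists>k\<le>Suc n. A (Suc k) = A k")
      case False
      then have "n < C (Suc n)" using Suc by (meson le_SucI)
      moreover have "{(j, x). A (Suc n) j x} \<subset> {(j, x). A (Suc (Suc n)) j x}"
      proof -
        have "{(j, x). A (Suc n) j x} \<subseteq> {(j, x). A (Suc (Suc n)) j x}"
          using le_sweep[of "A (Suc n)"] unfolding A_Suc[of "Suc n", symmetric] by (auto simp: le_fun_def)
        moreover have "A (Suc n) \<noteq> A (Suc (Suc n))" using False by (metis order_refl)
        then have "{(j, x). A (Suc n) j x} \<noteq> {(j, x). A (Suc (Suc n)) j x}"
          by (auto simp: fun_eq_iff set_eq_iff)
        ultimately show ?thesis by blast
      qed
      then have "C (Suc n) < C (Suc (Suc n))" unfolding C_def by (intro psubset_card_mono fin)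
      ultimately show ?thesis by auto
    qed auto
  qed
  obtain k where k: "k \<le> (\<Sum>j<F. m j)" "A (Suc k) = A k"
    using inc[of "\<Sum>j<F. m j"] C[of "Suc (\<Sum>j<F. m j)"] by auto
  have "A k = derived" using sweep_fixed[OF _ le] k(2) A_Suc by simp
  moreover have "A (k + i) = A k" for i by (induction i) (use A_Suc k(2) in auto)
  ultimately have "A (Suc (\<Sum>j<F. m j)) = derived"
    using k(1) by (metis add.commute le_Suc_eq le_add_diff_inverse2)
  then show ?thesis by (simp add: A_def)
qed

end

text \<open>Both the entries visited by a sweep and the number of sweeps are governed by
  \<open>\<Sum>j<F. m j\<close>, so the total time is a product of functions in
  \<open>bnd K\<close>. The sizes and tests need to be computable only with the memory as an
  oracle.\<close>

theorem (in track_machine) fixpoint_EXPTIME: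
  fixes m :: "nat \<Rightarrow> bool list \<Rightarrow> nat" and \<Phi> :: "nat \<Rightarrow> bool list \<Rightarrow> tracks \<Rightarrow> nat \<Rightarrow> bool"
  assumes mono: "\<And>w M M' j x. M \<le> M' \<Longrightarrow> \<Phi> j w M x \<Longrightarrow> \<Phi> j w M' x"
    and m: "\<And>j. j < F \<Longrightarrow> computable 0 (\<lambda>w M xs. m j w)"
    and \<Phi>: "\<And>j. j < F \<Longrightarrow> pcomp 1 (\<lambda>w M xs. \<Phi> j w M (xs ! 0))"
    and acc: "pcomp 0 (\<lambda>w M xs. acc w M)"
  shows "{w. w \<noteq> [] \<and> acc w (fixpoint_iteration.derived F (\<lambda>j. m j w) (\<lambda>j. \<Phi> j w))} \<in> EXPTIME K"
proof -
  interpret fixpoint_iteration F "\<lambda>j. m j w" "\<lambda>j. \<Phi> j w" for w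
    by unfold_locales (rule mono)
  have mm: "cmpd d (\<lambda>w M rs. m j w)" if "j < F" for j d
    using m[OF that] unfolding computable_def by simp
  \<comment> \<open>Registers 0 and 1 hold bound and counter of the sweeps, 2 and 3 those of the
    loop over \<open>x\<close>; hence the index 3.\<close>
  have "updates 4 (\<lambda>w M rs. step w j (rs ! 3) M)" if "j < F" for j
  proof -
    have "cmpd 4 (\<lambda>w M rs. of_bool (\<Phi> j w M (rs ! 3)))"
      using \<Phi>[OF that, unfolded computable_def, rule_format, of "[3]" 4] by simp
    from updates_set[OF this _ that, of 3] show ?thesis by (simp add: step_def)
  qed
  then have "updates 2 (\<lambda>w M rs. fold (step w j) [0..<m j w] M)" if "j < F" for j
  proof -
    have 4: "(4::nat) = 2 + 2" by simp
    have "updates 2 (\<lambda>w M rs. rec_nat M (\<lambda>x M'. step w j ((rs @ [m j w, x]) ! 3) M') (m j w))"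
      by (rule updates_for[OF mm[OF that]]) (use \<open>\<And>j. j < F \<Longrightarrow> updates 4 _\<close> that in simp)
    then show ?thesis by (rule updates_cong) (simp add: nth_append rec_nat_fold)
  qed
  then have "updates 2 (\<lambda>w M rs. sweep w M)"
    unfolding sweep_def by (intro updates_fold) auto
  then have u2: "updates (0 + 2) (\<lambda>w M rs. sweep w M)" by (simp only: add_0)
  have sum: "computable 0 (\<lambda>w M xs. \<Sum>j<n. m j w)" if "n \<le> F" for n
    using that by (induction n) (auto intro!: comp_add m comp_zero)
  have "updates 0 (\<lambda>w M rs. rec_nat M (\<lambda>_. sweep w) (Suc (\<Sum>j<F. m j w)))"
    by (rule updates_for[OF cmpd_suc[OF cmpd_comp[OF sum]] u2]) simp
  moreover have "rec_nat M (\<lambda>_. sweep w) k = (sweep w ^^ k) M" for w M k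
    by (induction k) auto
  ultimately have "updates 0 (\<lambda>w M rs. (sweep w ^^ Suc (\<Sum>j<F. m j w)) M)" by simp
  then obtain c where "\<And>V. bnd K V \<Longrightarrow> (\<exists>T. bnd K T \<and> (\<forall>w M rs. bounded V 0 w rs \<longrightarrow>
     runs c (st w M rs) (T (length w)) (st w ((sweep w ^^ Suc (\<Sum>j<F. m j w)) M) rs)))"
    unfolding updates_def by blast
  from this[OF bnd_const] obtain T where T: "bnd K T" "\<And>w M. w \<noteq> [] \<Longrightarrow>
     runs c (st w M []) (T (length w)) (st w ((sweep w ^^ Suc (\<Sum>j<F. m j w)) M) [])"
    by (auto simp: bounded_def)
  obtain c' where "\<And>V. bnd K V \<Longrightarrow> \<exists>T. bnd K T \<and> computes c' 0 (\<lambda>w M rs. of_bool (acc w M)) V T"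
    using cmpd_comp[OF acc] unfolding cmpd_def by blast
  from this[OF bnd_const] obtain T' where T': "bnd K T'"
    "\<And>w M. w \<noteq> [] \<Longrightarrow> runs c' (st w M []) (T' (length w)) (st w M [of_bool (acc w M)])"
    by (auto simp: computes_def bounded_def)
  have init: "init_tracks w = st w (\<lambda>_ _. False) []" for w
    by (intro ext) (auto simp: st_def init_tracks_def)
  show ?thesis
  proof (rule com_EXPTIME[where c = "SEQ c c'" and z = "reg 0" and B = "\<lambda>n. 1 + T n + T' n"])
    show "bnd K (\<lambda>n. 1 + T n + T' n)" by (intro bnd_rules T(1) T'(1))
    fix w :: "bool list" assume w: "w \<noteq> []"
    have "runs (SEQ c c') (init_tracks w) (1 + T (length w) + T' (length w))
        (st w (derived w) [of_bool (acc w (derived w))])"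
      using runs_seq[OF T(2)[OF w] T'(2)[OF w], of "\<lambda>_ _. False"] unfolding init sweep_iterate .
    then obtain t where t: "t \<le> 1 + T (length w) + T' (length w)"
      "bs (SEQ c c') (init_tracks w) t (st w (derived w) [of_bool (acc w (derived w))])"
      unfolding runs_def by blast
    moreover have "st w (derived w) [of_bool (acc w (derived w))] (reg 0) 0 \<longleftrightarrow> acc w (derived w)"
      by (simp add: st_reg)
    ultimately show "\<exists>t s. bs (SEQ c c') (init_tracks w) t s \<and> t \<le> 1 + T (length w) + T' (length w) \<and>
        (s (reg 0) 0 \<longleftrightarrow> w \<in> {w. w \<noteq> [] \<and> acc w (derived w)})"
      using w by blast
  qed auto
qed

subsection \<open>Syntax and typing\<close>

lemma apps_Nil [simp]: "apps h [] = h"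
  and apps_snoc [simp]: "apps h (ss @ [s]) = App (apps h ss) s"
  by (simp_all add: apps_def)

fun conhead :: "expr \<Rightarrow> bool" where
  "conhead (Con c) = True"
| "conhead (App s t) = conhead s"
| "conhead _ = False"

lemma conhead_apps: "conhead (apps (Con c) ss)"
  by (induction ss rule: rev_induct) auto

lemma conheadE: "conhead e \<Longrightarrow> \<exists>c ss. e = apps (Con c) ss"
proof (induction e)
  case (Con c)
  show ?case using apps_Nil by metis
next
  case (App s t)
  then show ?case using apps_snoc by (metis conhead.simps(2))
qed auto

lemma apps_Con_inject: "apps (Con c) ss = apps (Con d) ts \<longleftrightarrow> c = d \<and> ss = ts"
proof (induction ss arbitrary: ts rule: rev_induct)
  case Nil
  then show ?case by (cases ts rule: rev_cases) auto
next
  case (snoc s ss)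
  then show ?case by (cases ts rule: rev_cases) auto
qed

lemma apps_Con_neq [simp]:
  "apps (Con c) ss \<noteq> Var x" "apps (Con c) ss \<noteq> Fun f" "apps (Con c) ss \<noteq> Pair a b"
  "apps (Con c) ss \<noteq> If a b d" "apps (Con c) ss \<noteq> Choose es"
  by (cases ss rule: rev_cases; simp)+

lemmas apps_Con_neq' [simp] = apps_Con_neq[symmetric]

lemma has_type_appsD:
  "has_type Fc Fd G (apps h ss) \<tau> \<Longrightarrow>
    \<exists>\<sigma>s. length \<sigma>s = length ss \<and> has_type Fc Fd G h (foldr TArr \<sigma>s \<tau>) \<and> (\<forall>i<length ss. has_type Fc Fd G (ss ! i) (\<sigma>s ! i))"
proof (induction ss arbitrary: \<tau> rule: rev_induct)
  case (snoc s ss)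
  then obtain \<sigma> where s: "has_type Fc Fd G (apps h ss) (TArr \<sigma> \<tau>)" "has_type Fc Fd G s \<sigma>"
    by (auto elim: has_type.cases)
  from snoc.IH[OF s(1)] obtain \<sigma>s where "length \<sigma>s = length ss" "has_type Fc Fd G h (foldr TArr \<sigma>s (TArr \<sigma> \<tau>))"
    "\<forall>i<length ss. has_type Fc Fd G (ss ! i) (\<sigma>s ! i)" by blast
  then show ?case using s(2) by (intro exI[of _ "\<sigma>s @ [\<sigma>]"]) (auto simp: nth_append)
qed auto

inductive_cases has_type_ConE: "has_type Fc Fd G (Con c) \<tau>"
inductive_cases has_type_FunE: "has_type Fc Fd G (Fun c) \<tau>"
inductive_cases has_type_VarE: "has_type Fc Fd G (Var c) \<tau>"
inductive_cases has_type_IfE: "has_type Fc Fd G (If a b c) \<tau>"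
inductive_cases has_type_PairE: "has_type Fc Fd G (Pair a b) \<tau>"
inductive_cases has_type_AppE: "has_type Fc Fd G (App a b) \<tau>"

lemma targs_foldr: "targs (foldr TArr \<sigma>s \<tau>) = \<sigma>s @ targs \<tau>"
  by (induction \<sigma>s) auto

lemma tres_foldr: "tres (foldr TArr \<sigma>s \<tau>) = tres \<tau>"
  by (induction \<sigma>s) auto

fun is_arr :: "sty \<Rightarrow> bool" where
  "is_arr (TArr a b) = True"
| "is_arr _ = False"

lemma is_sort_tres: "targs t = [] \<Longrightarrow> tres t = t"
  by (cases t) auto

lemma inst_eq_vars: "inst g l = inst g' l \<Longrightarrow> x \<in> set (pat_vars l) \<Longrightarrow> g x = g' x"
  by (induction l) auto

lemma inst_cong: "(\<And>x. x \<in> set (pat_vars l) \<Longrightarrow> g x = g' x) \<Longrightarrow> inst g l = inst g' l"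
  by (induction l) auto

text \<open>Linearity lets the substitutions that match the single patterns be merged into one, so
  matching can be decided argument by argument.\<close>

lemma ex_inst_list:
  assumes "distinct (concat (map pat_vars ls))" "length ls = length vs"
    "\<And>i. i < length ls \<Longrightarrow> \<exists>g. inst g (ls ! i) = vs ! i"
  shows "\<exists>g. map (inst g) ls = vs"
  using assms
proof (induction ls arbitrary: vs)
  case (Cons l ls)
  then obtain v vs' where vs: "vs = v # vs'" by (cases vs) auto
  obtain g where g: "inst g l = v" using Cons.prems(3)[of 0] vs by auto
  have "\<And>i. i < length ls \<Longrightarrow> \<exists>g. inst g (ls ! i) = vs' ! i" using Cons.prems(3)[of "Suc _"] vs by auto
  then obtain g' where g': "map (inst g') ls = vs'" using Cons.IH[of vs'] Cons.prems(1,2) vs by auto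
  let ?h = "\<lambda>x. if x \<in> set (pat_vars l) then g x else g' x"
  have "inst ?h l = v" using g inst_cong[of l ?h g] by simp
  moreover have "inst ?h l' = inst g' l'" if "l' \<in> set ls" for l'
    using that Cons.prems(1) by (intro inst_cong) auto
  ultimately show ?case using g' vs by (intro exI[of _ ?h]) auto
qed simp

lemma ex_inst_iff:
  assumes "distinct (concat (map pat_vars ls))"
  shows "(\<exists>g. map (inst g) ls = vs) \<longleftrightarrow> length ls = length vs \<and> (\<forall>i<length ls. \<exists>g. inst g (ls ! i) = vs ! i)"
  using ex_inst_list[OF assms] by auto

lemma ssub_apps_Con: "ssub (apps (Con c) ss) t \<Longrightarrow> \<exists>s\<in>set ss. sub s t"
proof (induction ss rule: rev_induct)
  case Nil
  then show ?case by (auto elim: ssub.cases)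
next
  case (snoc s ss)
  then have "ssub (App (apps (Con c) ss) s) t" by simp
  then show ?case using snoc.IH by (auto elim!: ssub.cases[of "App _ _"] simp: sub_def)
qed

lemma ssub_apps_ConI: "s \<in> set ss \<Longrightarrow> sub s t \<Longrightarrow> ssub (apps (Con c) ss) t"
proof (induction ss rule: rev_induct)
  case (snoc s' ss)
  then show ?case by (auto simp: sub_def intro: ssub.intros)
qed simp

lemma ssub_Var: "\<not> ssub (Var x) t"
  by (auto elim: ssub.cases)

lemma sub_pat_var: "x \<in> set (pat_vars l) \<Longrightarrow> sub (pat_expr l) (Var x)"
proof (induction l)
  case (PCon c ls)
  then obtain l where "l \<in> set ls" "x \<in> set (pat_vars l)" by auto
  then show ?case using PCon.IH ssub_apps_ConI[of "pat_expr l" "map pat_expr ls"] by (auto simp: sub_def)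
qed (simp add: sub_def)

subsection \<open>Evaluation of constructor terms and determinism\<close>

lemma eval_con_inv:
  "eval p g (apps (Con c) ss) v \<Longrightarrow> \<exists>bs. v = VCon c bs \<and> list_all2 (eval p g) ss bs"
proof (induction ss arbitrary: v rule: rev_induct)
  case Nil
  then have "eval p g (Con c) v" by simp
  then show ?case
  proof cases
    case (ev_con ss bs d)
    then have "d = c \<and> ss = []" using apps_Con_inject[of c "[]" d ss] by simp
    then show ?thesis using ev_con by auto
  qed
next
  case (snoc s ss)
  then have "eval p g (App (apps (Con c) ss) s) v" by simp
  then show ?case
  proof cases
    case (ev_con ts bs d)
    then have "d = c \<and> ts = ss @ [s]" using apps_Con_inject[of c "ss @ [s]" d ts] by simp
    then show ?thesis using ev_con by auto
  next
    case (ev_app f vs v')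
    then show ?thesis using snoc.IH by fastforce
  qed
qed

text \<open>Both \<open>ev_con\<close> and \<open>ev_app\<close> can have an \<open>App\<close> as
  subject. They exclude each other because a constructor head never evaluates to a function.\<close>

lemma not_conhead_VFun: "eval p g e (VFun f vs) \<Longrightarrow> \<not> conhead e"
  using conheadE eval_con_inv by (metis val.distinct(3))

inductive_cases eval_VarE: "eval p g (Var x) v"
inductive_cases eval_FunE: "eval p g (Fun x) v"
inductive_cases eval_IfE: "eval p g (If a b c) v"
inductive_cases eval_PairE: "eval p g (Pair a b) v"
inductive_cases eval_AppE: "eval p g (App a b) v"

lemma eval_pat: "eval p g (pat_expr l) (inst g l)"
proof (induction l)
  case (PVar x)
  then show ?case by (simp add: ev_var)
next
  case (PCon c ls)
  then have "list_all2 (eval p g) (map pat_expr ls) (map (inst g) ls)"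
    by (simp add: list_all2_conv_all_nth)
  then show ?case by (simp add: ev_con)
qed

lemma eval_pat_unique: "eval p g (pat_expr l) v \<Longrightarrow> v = inst g l"
proof (induction l arbitrary: v)
  case (PVar x)
  then show ?case by (auto elim: eval_VarE)
next
  case (PCon c ls)
  then obtain bs where "v = VCon c bs" "list_all2 (eval p g) (map pat_expr ls) bs"
    using eval_con_inv by fastforce
  then show ?case using PCon.IH by (auto simp: list_all2_conv_all_nth intro!: nth_equalityI)
qed

fun dval :: "expr \<Rightarrow> val" where
  "dval (Con c) = VCon c []"
| "dval (App s t) = (case dval s of VCon c vs \<Rightarrow> VCon c (vs @ [dval t]) | v \<Rightarrow> v)"
| "dval (Pair a b) = VPair (dval a) (dval b)"
| "dval _ = VFun [] []"

lemma dval_apps: "dval (apps (Con c) ss) = VCon c (map dval ss)"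
  by (induction ss rule: rev_induct) auto

lemma eval_data: "is_data e \<Longrightarrow> eval p g e (dval e)"
proof (induction rule: is_data.induct)
  case (1 ds c)
  then have "list_all2 (eval p g) ds (map dval ds)" by (simp add: list_all2_conv_all_nth)
  then show ?case by (simp add: dval_apps ev_con)
qed (simp add: ev_pair)

lemma eval_data_unique: "is_data e \<Longrightarrow> eval p g e v \<Longrightarrow> v = dval e"
proof (induction arbitrary: v rule: is_data.induct)
  case (1 ds c)
  then obtain bs where "v = VCon c bs" "list_all2 (eval p g) ds bs" using eval_con_inv by blast
  then show ?case using 1 by (auto simp: list_all2_conv_all_nth dval_apps intro!: nth_equalityI)
next
  case (2 a b)
  from 2(5) show ?case
  proof cases
    case (ev_con ss bs c)
    then show ?thesis by simp
  qed (use 2 in auto)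
qed

lemma has_choose_apps: "has_choose (apps h ss) \<longleftrightarrow> has_choose h \<or> (\<exists>s\<in>set ss. has_choose s)"
  by (induction ss rule: rev_induct) auto

lemma expr_vars_apps: "expr_vars (apps h ss) = expr_vars h \<union> (\<Union>s\<in>set ss. expr_vars s)"
  by (induction ss rule: rev_induct) auto

lemma first_clause_unique: "first_clause p f vs i \<Longrightarrow> first_clause p f vs j \<Longrightarrow> i = j"
  unfolding first_clause_def by (meson linorder_neqE_nat)

locale program =
  fixes p :: program
  assumes det: "\<And>cl. cl \<in> set p \<Longrightarrow> \<not> has_choose (crhs cl)"
    and rhs_vars: "\<And>cl. cl \<in> set p \<Longrightarrow> expr_vars (crhs cl) \<subseteq> set (lhs_vars cl)"
    and same_arity: "\<And>cl cl'. cl \<in> set p \<Longrightarrow> cl' \<in> set p \<Longrightarrow> cfun cl = cfun cl' \<Longrightarrow>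
        length (cpats cl) = length (cpats cl')"
begin

lemma arity_clause: assumes "cl \<in> set p" shows "arity p (cfun cl) = length (cpats cl)"
proof -
  obtain cl' where "find (\<lambda>c. cfun c = cfun cl) p = Some cl'"
    using assms by (cases "find (\<lambda>c. cfun c = cfun cl) p") (auto simp: find_None_iff)
  moreover from this have "cl' \<in> set p" "cfun cl' = cfun cl" by (auto simp: find_Some_iff)
  ultimately show ?thesis using same_arity[of cl' cl] assms by (simp add: arity_def)
qed

lemma arity_pos: assumes "0 < arity p f" shows "\<exists>cl\<in>set p. cfun cl = f"
proof -
  obtain cl where "find (\<lambda>cl. cfun cl = f) p = Some cl"
    using assms by (cases "find (\<lambda>cl. cfun cl = f) p") (auto simp: arity_def)
  then obtain i where "i < length p" "cfun (p ! i) = f" by (auto simp: find_Some_iff)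
  then show ?thesis using nth_mem by blast
qed

lemma first_clause_arity:
  assumes "first_clause p f vs i" shows "length vs = arity p f"
proof -
  obtain g where "i < length p" "cfun (p ! i) = f" "map (inst g) (cpats (p ! i)) = vs"
    using assms unfolding first_clause_def matches_def by blast
  then show ?thesis using arity_clause[OF nth_mem[of i p]] by auto
qed

text \<open>The environments may differ outside the variables of \<open>e\<close>, because matching
  a clause determines its environment only on the variables of the left-hand side.\<close>

lemma eval_call_det:
  "eval p g e v \<Longrightarrow> (\<forall>g' v'. \<not> has_choose e \<longrightarrow> (\<forall>x\<in>expr_vars e. g x = g' x) \<longrightarrow> eval p g' e v' \<longrightarrow> v' = v)"
  "call p f vs v \<Longrightarrow> (\<forall>v'. call p f vs v' \<longrightarrow> v' = v)"
proof (induction rule: eval_call.inducts)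
  case (ev_var g x)
  then show ?case by (auto elim: eval_VarE)
next
  case (ev_fun f w g)
  show ?case
  proof (intro allI impI)
    fix g' v' assume "eval p g' (Fun f) v'"
    then have "call p f [] v'" by cases auto
    then show "v' = w" using ev_fun.IH by blast
  qed
next
  case (ev_con g ss bs c)
  show ?case
  proof (intro allI impI)
    fix g' v' assume a: "\<not> has_choose (apps (Con c) ss)" "\<forall>x\<in>expr_vars (apps (Con c) ss). g x = g' x"
      "eval p g' (apps (Con c) ss) v'"
    obtain bs' where bs': "v' = VCon c bs'" "list_all2 (eval p g') ss bs'" using eval_con_inv[OF a(3)] by blast
    have "bs' ! i = bs ! i" if "i < length ss" for i
    proof -
      have m: "ss ! i \<in> set ss" using that by simp
      then have "\<not> has_choose (ss ! i)" "\<forall>x\<in>expr_vars (ss ! i). g x = g' x"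
        using a(1,2) unfolding has_choose_apps expr_vars_apps by blast+
      moreover have "eval p g' (ss ! i) (bs' ! i)" using bs'(2) that by (simp add: list_all2_conv_all_nth)
      ultimately show ?thesis using ev_con that unfolding list_all2_conv_all_nth by blast
    qed
    moreover have "length bs' = length ss" "length bs = length ss"
      using bs'(2) ev_con by (auto dest: list_all2_lengthD)
    ultimately have "bs' = bs" by (intro nth_equalityI) auto
    then show "v' = VCon c bs" using bs'(1) by simp
  qed
next
  case (ev_pair g s v t w)
  note IH = ev_pair.IH
  show ?case
  proof (intro allI impI)
    fix g' v' assume a: "\<not> has_choose (Pair s t)" "\<forall>x\<in>expr_vars (Pair s t). g x = g' x" "eval p g' (Pair s t) v'"
    from a(3) show "v' = VPair v w"
    proof cases
      case (ev_con ss bs c)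
      then show ?thesis by simp
    next
      case (ev_pair v1 w1)
      moreover have "v1 = v" "w1 = w" using IH(2)[THEN spec[of _ g'], THEN spec[of _ v1]] IH(4)[THEN spec[of _ g'], THEN spec[of _ w1]] a(1,2) ev_pair(2,3) by auto
      ultimately show ?thesis by simp
    qed
  qed
next
  case (ev_if_true g s1 s2 w s3)
  show ?case
  proof (intro allI impI)
    fix g' v' assume a: "\<not> has_choose (If s1 s2 s3)" "\<forall>x\<in>expr_vars (If s1 s2 s3). g x = g' x" "eval p g' (If s1 s2 s3) v'"
    have 1: "eval p g' s1 v \<Longrightarrow> v = VCon ''true'' []" and 2: "eval p g' s2 v \<Longrightarrow> v = w" for v
      using ev_if_true.IH(2)[THEN spec[of _ g'], THEN spec[of _ v]] ev_if_true.IH(4)[THEN spec[of _ g'], THEN spec[of _ v]] a(1,2) by auto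
    from a(3) show "v' = w"
    proof cases
      case (ev_con ss bs c)
      then show ?thesis by simp
    qed (use 1 2 in fastforce)+
  qed
next
  case (ev_if_false g s1 s3 w s2)
  show ?case
  proof (intro allI impI)
    fix g' v' assume a: "\<not> has_choose (If s1 s2 s3)" "\<forall>x\<in>expr_vars (If s1 s2 s3). g x = g' x" "eval p g' (If s1 s2 s3) v'"
    have 1: "eval p g' s1 v \<Longrightarrow> v = VCon ''false'' []" and 2: "eval p g' s3 v \<Longrightarrow> v = w" for v
      using ev_if_false.IH(2)[THEN spec[of _ g'], THEN spec[of _ v]] ev_if_false.IH(4)[THEN spec[of _ g'], THEN spec[of _ v]] a(1,2) by auto
    from a(3) show "v' = w"
    proof cases
      case (ev_con ss bs c)
      then show ?thesis by simp
    qed (use 1 2 in fastforce)+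
  qed
next
  case (ev_app g s f vs t v w)
  show ?case
  proof (intro allI impI)
    fix g' v' assume a: "\<not> has_choose (App s t)" "\<forall>x\<in>expr_vars (App s t). g x = g' x" "eval p g' (App s t) v'"
    have s: "eval p g' s u \<Longrightarrow> u = VFun f vs" and t: "eval p g' t u \<Longrightarrow> u = v"
      and c: "call p f (vs @ [v]) u \<Longrightarrow> u = w" for u
      using ev_app.IH(2)[THEN spec[of _ g'], THEN spec[of _ u]] ev_app.IH(4)[THEN spec[of _ g'], THEN spec[of _ u]] ev_app.IH(6)[THEN spec[of _ u]] a(1,2)
      by auto
    from a(3) show "v' = w"
    proof cases
      case (ev_con ss bs c)
      then have "conhead s" using conhead_apps[of c ss] conhead.simps(2) by metis
      then show ?thesis using not_conhead_VFun[OF ev_app.IH(1)] by simp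
    next
      case (ev_app f' vs' u)
      then show ?thesis using s t c by blast
    qed
  qed
next
  case (call_partial vs f)
  show ?case
  proof (intro allI impI)
    fix v' assume "call p f vs v'"
    then show "v' = VFun f vs"
    proof cases
      case (call_clause i d)
      then show ?thesis using first_clause_arity[of f vs i] call_partial by simp
    qed simp
  qed
next
  case (call_clause f vs i d w)
  note fc = call_clause(1,2) and IH = call_clause(4)
  show ?case
  proof (intro allI impI)
    fix v' assume "call p f vs v'"
    then show "v' = w"
    proof cases
      case call_partial
      then show ?thesis using first_clause_arity[OF fc(1)] by simp
    next
      case (call_clause j d')
      have j: "j = i" using first_clause_unique call_clause(1) fc(1) by blast
      have m: "p ! i \<in> set p" using fc(1) by (auto simp: first_clause_def)
      have "map (inst d) (cpats (p ! i)) = map (inst d') (cpats (p ! i))"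
        using call_clause(2) j fc(2) by simp
      then have "d x = d' x" if "x \<in> set (lhs_vars (p ! i))" for x
        using that inst_eq_vars[of d _ d' x] unfolding lhs_vars_def by auto
      then show ?thesis
        using call_clause(3) j det[OF m] rhs_vars[OF m] IH by blast
    qed
  qed
next
  case (ev_choose i ss g w)
  show ?case by simp
qed

lemma eval_det: "eval p g e v \<Longrightarrow> eval p g e v' \<Longrightarrow> \<not> has_choose e \<Longrightarrow> v' = v"
  using eval_call_det(1) by blast

lemma matches_iff:
  assumes "distinct (lhs_vars cl)"
  shows "matches cl f vs \<longleftrightarrow> cfun cl = f \<and> length (cpats cl) = length vs \<and>
    (\<forall>i<length vs. \<exists>g. inst g (cpats cl ! i) = vs ! i)"
  using ex_inst_iff[of "cpats cl" vs] assms unfolding matches_def lhs_vars_def by metis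

end

subsection \<open>Observations\<close>

text \<open>The observations of a type are numbered. A data value is observed as its code; a function of
  type \<open>s \<Rightarrow> t\<close> is observed to be defined (number 0) or to map every argument with code \<open>A\<close> to a value
  with observation \<open>u\<close> (number \<open>pr s A u\<close>). The code of an argument of functional type is a set of
  observations, written in binary. Arguments of order above \<open>K\<close> are never passed.\<close>

fun msz :: "nat \<Rightarrow> nat \<Rightarrow> sty \<Rightarrow> nat" where
  "msz K D (TSort _) = D"
| "msz K D (TProd _ _) = 1"
| "msz K D (TArr s t) = Suc (if ord s \<le> K then (if is_arr s then 2 ^ msz K D s else msz K D s) * msz K D t else 0)"

definition asz :: "nat \<Rightarrow> nat \<Rightarrow> sty \<Rightarrow> nat" where
  "asz K D s = (if is_arr s then 2 ^ msz K D s else msz K D s)"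

lemma msz_arr: "msz K D (TArr s t) = Suc (if ord s \<le> K then asz K D s * msz K D t else 0)"
  by (simp add: asz_def)

lemma msz_pos: "0 < D \<Longrightarrow> 0 < msz K D s"
  by (cases s) auto

lemma asz_pos: "0 < D \<Longrightarrow> 0 < asz K D s"
  by (simp add: asz_def msz_pos)

definition pr :: "nat \<Rightarrow> nat \<Rightarrow> sty \<Rightarrow> nat \<Rightarrow> nat \<Rightarrow> nat" where
  "pr K D s A u = Suc (A + asz K D s * u)"

lemma pr_inject: "A < asz K D s \<Longrightarrow> B < asz K D s \<Longrightarrow> pr K D s A u = pr K D s B v \<longleftrightarrow> A = B \<and> u = v"
proof
  assume *: "A < asz K D s" "B < asz K D s" "pr K D s A u = pr K D s B v"
  then have "(A + asz K D s * u) mod asz K D s = (B + asz K D s * v) mod asz K D s"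
    "(A + asz K D s * u) div asz K D s = (B + asz K D s * v) div asz K D s" by (simp_all add: pr_def)
  with * show "A = B \<and> u = v" by simp
qed simp

lemma pr_less: assumes "A < asz K D s" "u < msz K D t" "ord s \<le> K" shows "pr K D s A u < msz K D (TArr s t)"
proof -
  have "A + asz K D s * u < asz K D s + asz K D s * u" using assms(1) by simp
  also have "\<dots> = asz K D s * Suc u" by simp
  also have "\<dots> \<le> asz K D s * msz K D t" using assms(2) by (intro mult_le_mono2) simp
  finally show ?thesis using assms(3) by (simp only: msz_arr pr_def) simp
qed

text \<open>Hence the search for the inner observation in \<open>peel\<close> can be bounded by the
  outer one.\<close>

lemma less_pr: "0 < D \<Longrightarrow> u < pr K D s A u"
proof -
  assume "0 < D"
  then have "1 * u \<le> asz K D s * u" by (intro mult_le_mono1) (use asz_pos[of D K s] in simp)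
  then have "u < Suc (A + asz K D s * u)" by linarith
  then show ?thesis by (simp add: pr_def)
qed

definition curry :: "nat \<Rightarrow> nat \<Rightarrow> sty list \<Rightarrow> nat list \<Rightarrow> nat \<Rightarrow> nat" where
  "curry K D ss As u = foldr (\<lambda>(s, A) u. pr K D s A u) (zip ss As) u"

lemma curry_Nil [simp]: "curry K D ss [] u = u"
  and curry_Cons [simp]: "curry K D (s # ss) (A # As) u = pr K D s A (curry K D ss As u)"
  by (simp_all add: curry_def)

lemma curry_snoc:
  assumes "length As < length ss"
  shows "curry K D ss (As @ [A]) u = curry K D ss As (pr K D (ss ! length As) A u)"
proof -
  have "zip ss (As @ [A]) = zip ss As @ [(ss ! length As, A)]"
    using assms by (intro nth_equalityI) (auto simp: nth_append less_Suc_eq)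
  then show ?thesis by (simp add: curry_def)
qed

fun tdrop :: "nat \<Rightarrow> sty \<Rightarrow> sty" where
  "tdrop (Suc n) (TArr s t) = tdrop n t"
| "tdrop _ t = t"

lemma tdrop_0 [simp]: "tdrop 0 t = t" by (cases t) auto

lemma tdrop_foldr: "tdrop (length ss) (foldr TArr ss t) = t"
  by (induction ss) auto

lemma tdrop_Suc: "tdrop n t = TArr s r \<Longrightarrow> n < length (targs t) \<and> targs t ! n = s \<and> tdrop (Suc n) t = r"
proof (induction n arbitrary: t)
  case (Suc n)
  then show ?case by (cases t) auto
qed auto

lemma tdrop_arr: "n < length (targs t) \<Longrightarrow> tdrop n t = TArr (targs t ! n) (tdrop (Suc n) t)"
proof (induction n arbitrary: t)
  case 0
  then show ?case by (cases t) auto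
next
  case (Suc n)
  then show ?case by (cases t) auto
qed

lemma ex_bits: "\<exists>a::nat. a < 2 ^ m \<and> (\<forall>u<m. bit a u = P u)"
proof (induction m)
  case (Suc m)
  then obtain a :: nat where a: "a < 2 ^ m" "\<forall>u<m. bit a u = P u" by blast
  have na: "\<not> bit a m" using a(1) by (metis less_pow2_iff order_refl)
  show ?case
  proof (cases "P m")
    case True
    have "set_bit m a < 2 ^ Suc m"
      using a(1) unfolding less_pow2_iff by (auto simp: bit_set_bit_iff)
    moreover have "\<forall>u<Suc m. bit (set_bit m a) u = P u"
      using a True by (auto simp: bit_set_bit_iff less_Suc_eq)
    ultimately show ?thesis by blast
  next
    case False
    then show ?thesis using a na by (intro exI[of _ a]) (auto simp: less_Suc_eq)
  qed
qed simp

definition bits :: "nat \<Rightarrow> (nat \<Rightarrow> bool) \<Rightarrow> nat" where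
  "bits m P = (SOME a. a < 2 ^ m \<and> (\<forall>u<m. bit a u = P u))"

lemma bits: "bits m P < 2 ^ m" "u < m \<Longrightarrow> bit (bits m P) u = P u"
  using someI_ex[OF ex_bits[of m P]] unfolding bits_def by auto

fun vargs :: "val \<Rightarrow> val list" where
  "vargs (VCon c vs) = vs"
| "vargs _ = []"

text \<open>Values with a code chosen for each datum. The choice has to be recorded, since one datum
  may have several codes, for example as an input suffix and as a constant. Of a pair nothing is
  kept: patterns cannot take it apart.\<close>

datatype cval = CD nat | CP | CF string "cval list"

text \<open>\<open>ok\<close> collects what cons-freeness and well-formedness say about the constructors in a clause.\<close>

fun ok :: "(string \<Rightarrow> nat) \<Rightarrow> val set \<Rightarrow> clause \<Rightarrow> expr \<Rightarrow> bool" where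
  "ok ar B cl (Var x) = (x \<in> set (lhs_vars cl))"
| "ok ar B cl (Con c) = (ar c = 0 \<and> (dval (Con c) \<in> B \<or> (\<exists>l\<in>set (cpats cl). sub (pat_expr l) (Con c))))"
| "ok ar B cl (Fun f) = True"
| "ok ar B cl (If a b c) = (ok ar B cl a \<and> ok ar B cl b \<and> ok ar B cl c)"
| "ok ar B cl (Choose ss) = False"
| "ok ar B cl (Pair a b) = (ok ar B cl a \<and> ok ar B cl b)"
| "ok ar B cl (App s t) = (if conhead s then (\<exists>c ss. App s t = apps (Con c) ss \<and> length ss = ar c) \<and>
     (is_data (App s t) \<and> dval (App s t) \<in> B \<or> (\<exists>l\<in>set (cpats cl). sub (pat_expr l) (App s t)))
     else ok ar B cl s \<and> ok ar B cl t)"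

text \<open>\<open>cs\<close> lists the constants of the program. It is closed under immediate
  arguments so that matching never leaves the coded data, and it contains the booleans because they
  are the letters of the input.\<close>

locale typed_program = program p for p +
  fixes K :: nat and Fc Fd :: "string \<Rightarrow> sty" and \<Gamma> :: "clause \<Rightarrow> string \<Rightarrow> sty" and ct :: "clause \<Rightarrow> sty"
    and cs :: "val list"
  assumes con_args: "\<And>c s. s \<in> set (targs (Fc c)) \<Longrightarrow> ord s = 0"
    and con_res: "\<And>c. is_sort (tres (Fc c))"
    and ord_vars: "\<And>cl x. cl \<in> set p \<Longrightarrow> x \<in> set (lhs_vars cl) \<Longrightarrow> ord (\<Gamma> cl x) \<le> K"
    and linear: "\<And>cl. cl \<in> set p \<Longrightarrow> distinct (lhs_vars cl)"
    and ty_lhs: "\<And>cl. cl \<in> set p \<Longrightarrow> has_type Fc Fd (\<Gamma> cl) (lhs cl) (ct cl)"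
    and ty_rhs: "\<And>cl. cl \<in> set p \<Longrightarrow> has_type Fc Fd (\<Gamma> cl) (crhs cl) (ct cl)"
    and fa_lhs: "\<And>cl. cl \<in> set p \<Longrightarrow> fa (\<lambda>c. length (targs (Fc c))) 0 (lhs cl)"
    and ok_rhs: "\<And>cl. cl \<in> set p \<Longrightarrow> ok (\<lambda>c. length (targs (Fc c))) (set cs) cl (crhs cl)"
    and cs_bool: "bool_val b \<in> set cs"
    and cs_closed: "\<And>v. v \<in> set cs \<Longrightarrow> set (vargs v) \<subseteq> set cs"
begin

abbreviation "okc \<equiv> ok (\<lambda>c. length (targs (Fc c))) (set cs)"

section \<open>Codes of data values\<close>

definition D :: "bool list \<Rightarrow> nat" where "D w = Suc (length w + length cs)"

lemma D_pos [simp]: "0 < D w" by (simp add: D_def)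

abbreviation "m w \<equiv> msz K (D w)"
abbreviation "a w \<equiv> asz K (D w)"

text \<open>The code of an input suffix is the number of dropped letters, so 0 is the whole input
  and \<open>length w\<close> the empty list; the constants follow. From \<open>D w\<close> on the
  value is a function, which no constructor pattern matches.\<close>

definition den :: "bool list \<Rightarrow> nat \<Rightarrow> val" where
  "den w x = (if x \<le> length w then input_val (drop x w) else if x < D w then cs ! (x - Suc (length w))
     else VFun [] [])"

definition idx :: "val \<Rightarrow> nat" where "idx v = (SOME j. j < length cs \<and> cs ! j = v)"

lemma idx: "v \<in> set cs \<Longrightarrow> idx v < length cs \<and> cs ! idx v = v"
  unfolding idx_def by (rule someI_ex) (simp add: in_set_conv_nth)

definition code :: "bool list \<Rightarrow> val \<Rightarrow> nat" where "code w v = Suc (length w + idx v)"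

lemma code: "v \<in> set cs \<Longrightarrow> code w v < D w \<and> den w (code w v) = v"
  using idx[of v] by (simp add: code_def D_def den_def)

definition child :: "bool list \<Rightarrow> nat \<Rightarrow> nat \<Rightarrow> nat" where
  "child w x i = (if x < length w then (if i = 0 then code w (bool_val (w ! x)) else Suc x)
     else code w (vargs (den w x) ! i))"

lemma input_val_drop: "x < length w \<Longrightarrow> input_val (drop x w) = VCon ''cons'' [bool_val (w ! x), input_val (drop (Suc x) w)]"
  unfolding input_val_def by (simp add: Cons_nth_drop_Suc[symmetric])

lemma child:
  assumes "x < D w" "den w x = VCon c vs" "i < length vs"
  shows "child w x i < D w \<and> den w (child w x i) = vs ! i"
proof (cases "x < length w")
  case True
  then have vs: "vs = [bool_val (w ! x), input_val (drop (Suc x) w)]"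
    using assms(2) by (simp add: den_def input_val_drop)
  then consider "i = 0" | "i = 1" using assms(3) by fastforce
  then show ?thesis using True vs code[OF cs_bool, of w "w ! x"]
    by cases (auto simp: child_def D_def den_def)
next
  case False
  have "x \<noteq> length w" using assms(2,3) by (auto simp: den_def input_val_def)
  then have "den w x \<in> set cs" using False assms(1) by (auto simp: den_def D_def intro!: nth_mem)
  then have "vs ! i \<in> set cs" using cs_closed[of "den w x"] assms(2,3) by auto
  then show ?thesis using code False assms(2) by (simp add: child_def)
qed

definition root :: "bool list \<Rightarrow> nat \<Rightarrow> string \<Rightarrow> nat \<Rightarrow> bool" where
  "root w x c k \<longleftrightarrow> (\<exists>vs. den w x = VCon c vs \<and> length vs = k)"

text \<open>The expression \<open>e\<close> is the sub-pattern of \<open>l\<close> that is matched against the data with code \<open>y\<close> when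
  \<open>l\<close> is matched against the data with code \<open>x\<close>.\<close>

inductive occ :: "bool list \<Rightarrow> pat \<Rightarrow> nat \<Rightarrow> expr \<Rightarrow> nat \<Rightarrow> bool" for w where
  occ_here: "occ w l x (pat_expr l) x"
| occ_child: "i < length ls \<Longrightarrow> occ w (ls ! i) (child w x i) e y \<Longrightarrow> occ w (PCon c ls) x e y"

lemma inst_PCon_den: "inst g (PCon c ls) = den w x \<Longrightarrow> x < D w \<Longrightarrow> i < length ls \<Longrightarrow>
    child w x i < D w \<and> inst g (ls ! i) = den w (child w x i)"
  using child[of x w c "map (inst g) ls" i] by simp

lemma occ_sound:
  "occ w l x e y \<Longrightarrow> x < D w \<Longrightarrow> inst g l = den w x \<Longrightarrow>
    y < D w \<and> (\<exists>q. e = pat_expr q \<and> inst g q = den w y)"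
proof (induction rule: occ.induct)
  case (occ_child i ls x e y c)
  then show ?case using inst_PCon_den[of g c ls w x i] by simp
qed auto

lemma occ_complete:
  "sub (pat_expr l) e \<Longrightarrow> inst g l = den w x \<Longrightarrow> x < D w \<Longrightarrow>
    \<exists>y q. occ w l x e y \<and> y < D w \<and> e = pat_expr q \<and> inst g q = den w y"
proof (induction l arbitrary: x)
  case (PVar v)
  then have "e = pat_expr (PVar v)" using ssub_Var by (auto simp: sub_def)
  then show ?case using PVar occ_here[of w "PVar v" x] by blast
next
  case (PCon c ls)
  show ?case
  proof (cases "e = pat_expr (PCon c ls)")
    case True
    then show ?thesis using PCon.prems occ_here[of w "PCon c ls" x] by blast
  next
    case False
    then have "ssub (apps (Con c) (map pat_expr ls)) e" using PCon.prems(1) by (simp add: sub_def)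
    from ssub_apps_Con[OF this] obtain l where "l \<in> set ls" "sub (pat_expr l) e" by auto
    then obtain i where i: "i < length ls" "sub (pat_expr (ls ! i)) e" by (metis in_set_conv_nth)
    have c: "child w x i < D w" "inst g (ls ! i) = den w (child w x i)"
      using inst_PCon_den[OF PCon.prems(2,3) i(1)] by auto
    from PCon.IH[OF nth_mem[OF i(1)] i(2) c(2,1)] show ?thesis using occ_child[OF i(1)] by blast
  qed
qed

text \<open>\<open>E\<close> needs the type of the function part of an application in order to range
  over the codes of its argument. Without \<open>Choose\<close> an expression has at most one type
  in a given environment; the type given to \<open>Choose\<close> is a dummy.\<close>

fun ty :: "(string \<Rightarrow> sty) \<Rightarrow> expr \<Rightarrow> sty" where
  "ty G (Var x) = G x"
| "ty G (Con c) = Fc c"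
| "ty G (Fun f) = Fd f"
| "ty G (If x y z) = ty G y"
| "ty G (Choose ss) = TSort []"
| "ty G (Pair x y) = TProd (ty G x) (ty G y)"
| "ty G (App s t) = (case ty G s of TArr \<sigma> \<tau> \<Rightarrow> \<tau> | u \<Rightarrow> u)"

lemma ty: "has_type Fc Fd G e t \<Longrightarrow> \<not> has_choose e \<Longrightarrow> ty G e = t"
  by (induction rule: has_type.induct) auto

lemma okc_no_choose: "okc cl e \<Longrightarrow> \<not> has_choose e"
proof (induction e)
  case (App s t)
  have pat: "\<not> has_choose (pat_expr l)" for l
    by (induction l) (auto simp: has_choose_apps)
  have subs: "ssub x y \<Longrightarrow> \<not> has_choose x \<Longrightarrow> \<not> has_choose y" for x y
    by (induction rule: ssub.induct) auto
  have data: "is_data x \<Longrightarrow> \<not> has_choose x" for x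
    by (induction rule: is_data.induct) (auto simp: has_choose_apps)
  show ?case
  proof (cases "conhead s")
    case True
    then show ?thesis using App.prems pat subs data unfolding sub_def ok.simps
      by (metis (no_types, opaque_lifting))
  qed (use App in auto)
qed auto

text \<open>\<open>As\<close> are the codes of the arguments of the clause, \<open>L\<close> the
  call facts found so far. For a functional argument \<open>t\<close> the code \<open>A\<close> may
  be any set of observations of \<open>t\<close>, which keeps \<open>E\<close> monotone in
  \<open>L\<close>; observation 0 is demanded separately, because an empty \<open>A\<close> must not
  hide that \<open>t\<close> has no value.\<close>

fun E :: "bool list \<Rightarrow> (string \<Rightarrow> nat \<Rightarrow> bool) \<Rightarrow> clause \<Rightarrow> expr \<Rightarrow> nat list \<Rightarrow> nat \<Rightarrow> bool" and
  Ec :: "bool list \<Rightarrow> clause \<Rightarrow> expr \<Rightarrow> nat list \<Rightarrow> nat \<Rightarrow> bool" where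
  "Ec w cl e As u = (if is_data e \<and> dval e \<in> set cs then u = code w (dval e)
     else \<exists>i<length (cpats cl). occ w (cpats cl ! i) (As ! i) e u)"
| "E w L cl (Var x) As u = (case \<Gamma> cl x of
      TSort _ \<Rightarrow> Ec w cl (Var x) As u
    | TProd _ _ \<Rightarrow> u = 0
    | TArr _ _ \<Rightarrow> \<exists>i<length (cpats cl). cpats cl ! i = PVar x \<and> u < m w (\<Gamma> cl x) \<and> bit (As ! i) u)"
| "E w L cl (Con c) As u = Ec w cl (Con c) As u"
| "E w L cl (Fun f) As u = L f u"
| "E w L cl (If x y z) As u =
     ((\<exists>v<D w. root w v ''true'' 0 \<and> E w L cl x As v) \<and> E w L cl y As u \<or>
      (\<exists>v<D w. root w v ''false'' 0 \<and> E w L cl x As v) \<and> E w L cl z As u)"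
| "E w L cl (Choose ss) As u = False"
| "E w L cl (Pair x y) As u = (u = 0 \<and> (\<exists>v<m w (ty (\<Gamma> cl) x). E w L cl x As v) \<and> (\<exists>v<m w (ty (\<Gamma> cl) y). E w L cl y As v))"
| "E w L cl (App s t) As u = (if conhead s then Ec w cl (App s t) As u else
     (case ty (\<Gamma> cl) s of TArr \<sigma> \<tau> \<Rightarrow> ord \<sigma> \<le> K \<and> (\<exists>A<a w \<sigma>.
        (if is_arr \<sigma> then E w L cl t As 0 \<and> (\<forall>v<m w \<sigma>. bit A v \<longrightarrow> E w L cl t As v) else E w L cl t As A) \<and>
        E w L cl s As (pr K (D w) \<sigma> A u)) | _ \<Rightarrow> False))"

lemma E_mono: "(\<And>f u. L f u \<Longrightarrow> L' f u) \<Longrightarrow> E w L cl e As u \<Longrightarrow> E w L' cl e As u"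
proof (induction e arbitrary: u)
  case (App s t)
  show ?case
  proof (cases "conhead s")
    case False
    then show ?thesis using App.prems(2) App.IH(1)[OF App.prems(1)] App.IH(2)[OF App.prems(1)]
      by (fastforce split: sty.splits)
  qed (use App in auto)
next
  case (Pair x y)
  then show ?case by auto
next
  case (If x y z)
  then show ?case by auto
qed (auto split: sty.splits)

text \<open>For an argument of functional or product type \<open>As ! k\<close> does not code a
  datum; but there the pattern of a typed clause is a variable, which fits anything.\<close>

definition fits :: "bool list \<Rightarrow> clause \<Rightarrow> nat list \<Rightarrow> bool" where
  "fits w cl As \<longleftrightarrow> (\<forall>k<length (cpats cl). \<exists>g. inst g (cpats cl ! k) = den w (As ! k))"

text \<open>The negated tests for earlier clauses mention the argument codes but not
  \<open>L\<close>, so selecting the first match is compatible with monotonicity.\<close>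

definition body :: "bool list \<Rightarrow> (string \<Rightarrow> nat \<Rightarrow> bool) \<Rightarrow> string \<Rightarrow> nat list \<Rightarrow> nat \<Rightarrow> bool" where
  "body w L f As u \<longleftrightarrow> (\<exists>i<length p. cfun (p ! i) = f \<and> fits w (p ! i) As \<and>
     (\<forall>j<i. cfun (p ! j) = f \<longrightarrow> \<not> fits w (p ! j) As) \<and> E w L (p ! i) (crhs (p ! i)) As u)"

text \<open>Inverse of \<open>curry\<close>: the codes of the missing arguments are stripped off
  \<open>u\<close>, and the remaining observation goes to \<open>B\<close>. Observation 0 needs no
  body, since a partial application is already a value.\<close>

fun peel :: "bool list \<Rightarrow> nat \<Rightarrow> sty \<Rightarrow> (nat list \<Rightarrow> nat \<Rightarrow> bool) \<Rightarrow> nat list \<Rightarrow> nat \<Rightarrow> bool" where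
  "peel w 0 t B As u = B As u"
| "peel w (Suc k) (TArr s t) B As u = (u = 0 \<or> (\<exists>A<a w s. \<exists>v<u. u = pr K (D w) s A v \<and> peel w k t B (As @ [A]) v))"
| "peel w (Suc k) t B As u = False"

definition Phi :: "bool list \<Rightarrow> string \<Rightarrow> (string \<Rightarrow> nat \<Rightarrow> bool) \<Rightarrow> nat \<Rightarrow> bool" where
  "Phi w f L u \<longleftrightarrow> peel w (arity p f) (Fd f) (body w L f) [] u"

lemma body_mono: "(\<And>f u. L f u \<Longrightarrow> L' f u) \<Longrightarrow> body w L f As u \<Longrightarrow> body w L' f As u"
  unfolding body_def using E_mono[of L L'] by blast

lemma peel_mono: "(\<And>As u. B As u \<Longrightarrow> B' As u) \<Longrightarrow> peel w k t B As u \<Longrightarrow> peel w k t B' As u"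
proof (induction w k t B As u rule: peel.induct)
  case (2 w k s t B As u)
  then show ?case by (metis peel.simps(2))
qed auto

section \<open>Call facts as a least fixed point\<close>

definition fs :: "string list" where "fs = remdups (map cfun p)"

definition of_tracks :: "tracks \<Rightarrow> string \<Rightarrow> nat \<Rightarrow> bool" where
  "of_tracks M f u \<longleftrightarrow> (\<exists>i<length fs. fs ! i = f \<and> M i u)"

lemma Phi_mono: "(\<And>f u. L f u \<Longrightarrow> L' f u) \<Longrightarrow> Phi w f L u \<Longrightarrow> Phi w f L' u"
  unfolding Phi_def by (erule peel_mono[rotated]) (erule body_mono[rotated])

lemma fixpoint_iteration_Phi: "fixpoint_iteration (\<lambda>j M. Phi w (fs ! j) (of_tracks M))"
proof
  fix M M' :: tracks and j x
  assume "M \<le> M'" "Phi w (fs ! j) (of_tracks M) x"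
  moreover have "of_tracks M f u \<Longrightarrow> of_tracks M' f u" for f u
    using \<open>M \<le> M'\<close> unfolding of_tracks_def le_fun_def by auto
  ultimately show "Phi w (fs ! j) (of_tracks M') x" using Phi_mono by blast
qed

abbreviation "facts w \<equiv> fixpoint_iteration.derived (length fs) (\<lambda>j. m w (Fd (fs ! j))) (\<lambda>j M. Phi w (fs ! j) (of_tracks M))"

definition L :: "bool list \<Rightarrow> string \<Rightarrow> nat \<Rightarrow> bool" where
  "L w = of_tracks (facts w)"

lemma L_intro:
  assumes "f \<in> cfun ` set p" "u < m w (Fd f)" "Phi w f (L w) u"
  shows "L w f u"
proof -
  interpret fixpoint_iteration "length fs" "\<lambda>j. m w (Fd (fs ! j))" "\<lambda>j M. Phi w (fs ! j) (of_tracks M)"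
    by (rule fixpoint_iteration_Phi)
  have "f \<in> set fs" using assms(1) by (simp add: fs_def)
  then obtain i where i: "i < length fs" "fs ! i = f" by (metis in_set_conv_nth)
  have "facts w i u" using derivedI[OF i(1)] assms(2,3) i(2) by (simp add: L_def)
  then show ?thesis using i by (auto simp: L_def of_tracks_def)
qed

lemma L_induct:
  assumes "L w f u" "\<And>f M u. (\<And>f u. M f u \<Longrightarrow> S f u) \<Longrightarrow> Phi w f M u \<Longrightarrow> S f u"
  shows "S f u"
proof -
  interpret fixpoint_iteration "length fs" "\<lambda>j. m w (Fd (fs ! j))" "\<lambda>j M. Phi w (fs ! j) (of_tracks M)"
    by (rule fixpoint_iteration_Phi)
  have "facts w i v \<Longrightarrow> S (fs ! i) v" for i v
  proof (induction rule: derived.induct)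
    case (derived_intro j x M)
    have "of_tracks M f u \<Longrightarrow> S f u" for f u
      using derived_intro unfolding of_tracks_def by blast
    then show ?case using assms(2)[of "of_tracks M" "fs ! j" x] derived_intro by blast
  qed
  then show ?thesis using assms(1) unfolding L_def of_tracks_def by blast
qed

subsection \<open>Types of patterns and arguments\<close>

lemma fa_apps: "fa ar n (apps h ss) \<longleftrightarrow> fa ar (n + length ss) h \<and> (\<forall>s\<in>set ss. fa ar 0 s)"
  by (induction ss arbitrary: n rule: rev_induct) auto

lemma con_app_type:
  assumes "has_type Fc Fd G (apps (Con c) ss) t" "length ss = length (targs (Fc c))"
  shows "\<exists>n. t = TSort n"
proof -
  obtain \<sigma>s where s: "length \<sigma>s = length ss" "has_type Fc Fd G (Con c) (foldr TArr \<sigma>s t)"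
    using has_type_appsD[OF assms(1)] by blast
  then have f: "Fc c = foldr TArr \<sigma>s t" by (auto elim: has_type_ConE)
  then have "targs t = []" using s(1) assms(2) by (simp add: targs_foldr)
  then have "tres (Fc c) = t" using f by (simp add: tres_foldr is_sort_tres)
  then show ?thesis using con_res[of c] by (cases t) auto
qed

lemma con_app_args:
  assumes "has_type Fc Fd G (apps (Con c) ss) t" "i < length ss"
  shows "\<exists>s. has_type Fc Fd G (ss ! i) s \<and> ord s = 0"
proof -
  obtain \<sigma>s where s: "length \<sigma>s = length ss" "has_type Fc Fd G (Con c) (foldr TArr \<sigma>s t)"
    "\<forall>i<length ss. has_type Fc Fd G (ss ! i) (\<sigma>s ! i)"
    using has_type_appsD[OF assms(1)] by blast
  then have f: "Fc c = foldr TArr \<sigma>s t" by (auto elim: has_type_ConE)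
  have "\<sigma>s ! i \<in> set (targs (Fc c))" using f s(1) assms(2) by (simp add: targs_foldr)
  then show ?thesis using con_args s(3) assms(2) by blast
qed

text \<open>Arguments of constructors have order 0, so a function is never bound below a
  constructor.\<close>

lemma pat_var_ord:
  "has_type Fc Fd G (pat_expr l) t \<Longrightarrow> ord t = 0 \<Longrightarrow> x \<in> set (pat_vars l) \<Longrightarrow> ord (G x) = 0"
proof (induction l arbitrary: t)
  case (PVar v)
  then show ?case by (auto elim: has_type_VarE)
next
  case (PCon c ls)
  then obtain l where "l \<in> set ls" "x \<in> set (pat_vars l)" by auto
  then obtain i where i: "i < length ls" "x \<in> set (pat_vars (ls ! i))" by (metis in_set_conv_nth)
  obtain s where "has_type Fc Fd G (pat_expr (ls ! i)) s" "ord s = 0"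
    using con_app_args[of G c "map pat_expr ls" t i] PCon.prems(1) i by auto
  then show ?case using PCon.IH[OF nth_mem[OF i(1)]] i(2) by blast
qed

lemma clause_type:
  assumes "cl \<in> set p"
  shows "length (cpats cl) \<le> length (targs (Fd (cfun cl)))" "tdrop (length (cpats cl)) (Fd (cfun cl)) = ct cl"
    "i < length (cpats cl) \<Longrightarrow> has_type Fc Fd (\<Gamma> cl) (pat_expr (cpats cl ! i)) (targs (Fd (cfun cl)) ! i)"
    "i < length (cpats cl) \<Longrightarrow> cpats cl ! i = PCon c ls \<Longrightarrow> \<exists>n. targs (Fd (cfun cl)) ! i = TSort n"
    "i < length (cpats cl) \<Longrightarrow> ord (targs (Fd (cfun cl)) ! i) \<le> K"
proof -
  obtain \<sigma>s where s: "length \<sigma>s = length (cpats cl)" "has_type Fc Fd (\<Gamma> cl) (Fun (cfun cl)) (foldr TArr \<sigma>s (ct cl))"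
    "\<forall>i<length (cpats cl). has_type Fc Fd (\<Gamma> cl) (pat_expr (cpats cl ! i)) (\<sigma>s ! i)"
    using has_type_appsD[OF ty_lhs[OF assms, unfolded lhs_def]] by auto
  then have f: "Fd (cfun cl) = foldr TArr \<sigma>s (ct cl)" by (auto elim: has_type_FunE)
  show 1: "length (cpats cl) \<le> length (targs (Fd (cfun cl)))" using f s(1) by (simp add: targs_foldr)
  show "tdrop (length (cpats cl)) (Fd (cfun cl)) = ct cl" using f s(1) tdrop_foldr by metis
  show 2: "has_type Fc Fd (\<Gamma> cl) (pat_expr (cpats cl ! i)) (targs (Fd (cfun cl)) ! i)" if "i < length (cpats cl)" for i
    using f s(1,3) that by (simp add: targs_foldr nth_append)
  show 3: "\<exists>n. targs (Fd (cfun cl)) ! i = TSort n" if "i < length (cpats cl)" "cpats cl ! i = PCon c ls" for i c ls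
  proof -
    have "fa (\<lambda>c. length (targs (Fc c))) 0 (pat_expr (cpats cl ! i))"
      using fa_lhs[OF assms] that(1) unfolding lhs_def fa_apps by auto
    then have "length (map pat_expr ls) = length (targs (Fc c))" using that(2) by (simp add: fa_apps)
    then show ?thesis using con_app_type[of "\<Gamma> cl" c "map pat_expr ls"] 2[OF that(1)] that(2) by simp
  qed
  show "ord (targs (Fd (cfun cl)) ! i) \<le> K" if "i < length (cpats cl)"
  proof (cases "cpats cl ! i")
    case (PVar x)
    have "x \<in> set (lhs_vars cl)" using that PVar by (auto simp: lhs_vars_def intro!: bexI[OF _ nth_mem[OF that]])
    moreover have "targs (Fd (cfun cl)) ! i = \<Gamma> cl x" using 2[OF that] PVar by (auto elim: has_type_VarE)
    ultimately show ?thesis using ord_vars[OF assms] by simp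
  next
    case (PCon c ls)
    then show ?thesis using 3[OF that] by auto
  qed
qed

text \<open>An argument position within the arity occurs as a pattern of some clause: a variable
  there has order at most \<open>K\<close>, and a constructor pattern has a sort. So
  \<open>msz\<close> loses nothing by leaving out arguments of larger order.\<close>

lemma arg_ord: assumes "i < arity p f" shows "ord (targs (Fd f) ! i) \<le> K" "i < length (targs (Fd f))"
proof -
  obtain cl where cl: "cl \<in> set p" "cfun cl = f" using arity_pos assms by (metis not_less_zero gr0I)
  then have "i < length (cpats cl)" using arity_clause assms by auto
  then show "ord (targs (Fd f) ! i) \<le> K" "i < length (targs (Fd f))"
    using clause_type(1,5)[OF cl(1)] cl(2) by auto
qed

lemma var_arg:
  assumes "cl \<in> set p" "x \<in> set (lhs_vars cl)"
  shows "\<exists>i<length (cpats cl). x \<in> set (pat_vars (cpats cl ! i)) \<and>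
     (cpats cl ! i = PVar x \<and> targs (Fd (cfun cl)) ! i = \<Gamma> cl x \<or>
      (\<exists>c ls n. cpats cl ! i = PCon c ls \<and> targs (Fd (cfun cl)) ! i = TSort n \<and> \<not> is_arr (\<Gamma> cl x)))"
proof -
  obtain i where i: "i < length (cpats cl)" "x \<in> set (pat_vars (cpats cl ! i))"
  proof -
    obtain l where "l \<in> set (cpats cl)" "x \<in> set (pat_vars l)" using assms(2) by (auto simp: lhs_vars_def)
    then show ?thesis using that by (metis in_set_conv_nth)
  qed
  note t = clause_type(3)[OF assms(1) i(1)]
  show ?thesis
  proof (cases "cpats cl ! i")
    case (PVar y)
    then show ?thesis using i t by (intro exI[of _ i]) (auto elim: has_type_VarE)
  next
    case (PCon c ls)
    then obtain n where n: "targs (Fd (cfun cl)) ! i = TSort n" using clause_type(4)[OF assms(1) i(1)] by blast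
    have "ord (\<Gamma> cl x) = 0" using pat_var_ord[OF t _ i(2)] n by simp
    then have "\<not> is_arr (\<Gamma> cl x)" by (cases "\<Gamma> cl x") auto
    then show ?thesis using i PCon n by blast
  qed
qed

end

subsection \<open>Every value computed by the program is observed\<close>

context typed_program
begin

text \<open>Functions are compared through their stored arguments only, so the relation is syntactic
  and does not mention the call facts. Every value is accepted at a product type, as pairs are never
  inspected.\<close>

inductive crep :: "bool list \<Rightarrow> sty \<Rightarrow> cval \<Rightarrow> val \<Rightarrow> bool" for w where
  crep_sort: "x < D w \<Longrightarrow> den w x = v \<Longrightarrow> crep w (TSort n) (CD x) v"
| crep_prod: "crep w (TProd s t) CP v"
| crep_fun: "length cs' < arity p f \<Longrightarrow> length cs' = length vs \<Longrightarrow>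
    (\<forall>i<length vs. crep w (targs (Fd f) ! i) (cs' ! i) (vs ! i)) \<Longrightarrow> tdrop (length vs) (Fd f) = t \<Longrightarrow>
    crep w t (CF f cs') (VFun f vs)"

abbreviation "cur w f \<equiv> curry K (D w) (targs (Fd f))"

text \<open>A function is passed as the set of all observations that the fixed point contains for
  it, so whatever the callee tests is present.\<close>

fun ac :: "bool list \<Rightarrow> cval \<Rightarrow> nat" where
  "ac w (CD x) = x"
| "ac w CP = 0"
| "ac w (CF f cs') = bits (m w (tdrop (length cs') (Fd f))) (\<lambda>u. L w f (cur w f (map (ac w) cs') u))"

fun ob :: "bool list \<Rightarrow> cval \<Rightarrow> nat \<Rightarrow> bool" where
  "ob w (CD x) u = (u = x)"
| "ob w CP u = (u = 0)"
| "ob w (CF f cs') u = (u < m w (tdrop (length cs') (Fd f)) \<and> L w f (cur w f (map (ac w) cs') u))"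

definition args_rep :: "bool list \<Rightarrow> string \<Rightarrow> cval list \<Rightarrow> val list \<Rightarrow> bool" where
  "args_rep w f cs' vs \<longleftrightarrow> length cs' = length vs \<and> length vs \<le> arity p f \<and>
     (\<forall>i<length vs. crep w (targs (Fd f) ! i) (cs' ! i) (vs ! i))"

lemma arity_arr: "n < arity p f \<Longrightarrow> \<exists>s t. tdrop n (Fd f) = TArr s t"
  using tdrop_arr[OF arg_ord(2)] by blast

lemma crep_fun_arr: assumes "crep w t (CF f cs') v" shows "is_arr t"
  using assms
proof (cases rule: crep.cases)
  case (crep_fun vs)
  then show ?thesis using arity_arr[of "length vs" f] by auto
qed

lemma crep_arrE:
  assumes "crep w t c v" "is_arr t"
  obtains f cs' vs where "c = CF f cs'" "v = VFun f vs" "length cs' < arity p f" "args_rep w f cs' vs"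
    "tdrop (length vs) (Fd f) = t"
  using assms by (cases rule: crep.cases) (auto simp: args_rep_def)

lemma crep_sortE: assumes "crep w (TSort n) c v" obtains x where "c = CD x" "x < D w" "den w x = v"
  using assms
proof (cases rule: crep.cases)
  case (crep_fun cs' f vs)
  then show ?thesis using arity_arr[of "length vs" f] by auto
qed (use that in auto)

lemma ac_less: assumes "crep w t c v" shows "ac w c < a w t"
proof (cases "is_arr t")
  case True
  with assms show ?thesis
  proof (elim crep_arrE)
    fix f cs' vs assume "c = CF f cs'" "args_rep w f cs' vs" "tdrop (length vs) (Fd f) = t"
    then show ?thesis using True bits(1) by (simp add: asz_def args_rep_def)
  qed
next
  case False
  with assms show ?thesis
    by (cases rule: crep.cases) (use crep_fun_arr assms in \<open>auto simp: asz_def\<close>)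
qed

lemma ob_less: "crep w t c v \<Longrightarrow> ob w c u \<Longrightarrow> u < m w t"
  by (cases rule: crep.cases, assumption) auto

lemma bit_ac: "crep w t c v \<Longrightarrow> is_arr t \<Longrightarrow> u < m w t \<Longrightarrow> bit (ac w c) u \<longleftrightarrow> ob w c u"
  by (elim crep_arrE) (auto simp: args_rep_def bits(2))

lemma ob_ac: "crep w t c v \<Longrightarrow> \<not> is_arr t \<Longrightarrow> ob w c (ac w c)"
  by (cases rule: crep.cases, assumption) (auto dest: crep_fun_arr)

lemma peel_curry:
  "length As \<le> length (targs t) \<Longrightarrow> (\<forall>i<length As. As ! i < a w (targs t ! i)) \<Longrightarrow> B (pre @ As) u \<Longrightarrow>
    peel w (length As) t B pre (curry K (D w) (targs t) As u)"
proof (induction As arbitrary: t pre)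
  case (Cons A As)
  then obtain s r where t: "t = TArr s r" by (cases t) auto
  have "A < a w s" using Cons.prems(2) t by auto
  moreover have "peel w (length As) r B (pre @ [A]) (curry K (D w) (targs r) As u)"
    using Cons.prems t by (intro Cons.IH) auto
  ultimately show ?case using t less_pr[OF D_pos] by auto
qed simp

text \<open>With fewer codes than missing arguments \<open>peel\<close> meets observation 0 before
  it reaches \<open>B\<close>; so nothing about the body is required.\<close>

lemma peel_defined:
  "length As < k \<Longrightarrow> k \<le> length (targs t) \<Longrightarrow> (\<forall>i<length As. As ! i < a w (targs t ! i)) \<Longrightarrow>
    peel w k t B pre (curry K (D w) (targs t) As 0)"
proof (induction As arbitrary: t pre k)
  case Nil
  then obtain s r k' where "t = TArr s r" "k = Suc k'" by (cases t; cases k) auto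
  then show ?case by simp
next
  case (Cons A As)
  then obtain s r k' where t: "t = TArr s r" "k = Suc k'" by (cases t; cases k) auto
  have "A < a w s" using Cons.prems t by auto
  moreover have "peel w k' r B (pre @ [A]) (curry K (D w) (targs r) As 0)"
    using Cons.prems t by (intro Cons.IH) auto
  ultimately show ?case using t less_pr[OF D_pos] by auto
qed

lemma curry_less:
  "length As \<le> length (targs t) \<Longrightarrow> (\<forall>i<length As. As ! i < a w (targs t ! i) \<and> ord (targs t ! i) \<le> K) \<Longrightarrow>
    u < m w (tdrop (length As) t) \<Longrightarrow> curry K (D w) (targs t) As u < m w t"
proof (induction As arbitrary: t)
  case (Cons A As)
  then obtain s r where t: "t = TArr s r" by (cases t) auto
  have "A < a w s" "ord s \<le> K" using Cons.prems(2) t by auto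
  moreover have "curry K (D w) (targs r) As u < m w r"
    using Cons.prems t by (intro Cons.IH) auto
  ultimately show ?case using t pr_less by auto
qed simp

lemma args_rep_code: "args_rep w f cs' vs \<Longrightarrow> i < length cs' \<Longrightarrow> map (ac w) cs' ! i < a w (targs (Fd f) ! i)"
  using ac_less by (auto simp: args_rep_def)

lemma L_args:
  assumes "args_rep w f cs' vs" "0 < arity p f \<or> f \<in> cfun ` set p" "u < m w (tdrop (length vs) (Fd f))"
    "peel w (arity p f) (Fd f) (body w (L w) f) [] (cur w f (map (ac w) cs') u)"
  shows "L w f (cur w f (map (ac w) cs') u)"
proof (rule L_intro)
  show "f \<in> cfun ` set p" using assms(2) arity_pos by blast
  show "cur w f (map (ac w) cs') u < m w (Fd f)"
  proof (rule curry_less)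
    show "length (map (ac w) cs') \<le> length (targs (Fd f))"
      using assms(1) arg_ord(2)[of "length vs - 1" f] by (cases vs) (auto simp: args_rep_def)
    show "\<forall>i<length (map (ac w) cs'). map (ac w) cs' ! i < a w (targs (Fd f) ! i) \<and> ord (targs (Fd f) ! i) \<le> K"
      using args_rep_code[OF assms(1)] arg_ord(1) assms(1) by (auto simp: args_rep_def)
    show "u < m w (tdrop (length (map (ac w) cs')) (Fd f))" using assms(1,3) by (simp add: args_rep_def)
  qed
  show "Phi w f (L w) (cur w f (map (ac w) cs') u)" using assms(4) by (simp add: Phi_def)
qed

lemma ob_defined: assumes "crep w t c v" "is_arr t" shows "ob w c 0"
  using assms
proof (elim crep_arrE)
  fix f cs' vs assume *: "c = CF f cs'" "length cs' < arity p f" "args_rep w f cs' vs" "tdrop (length vs) (Fd f) = t"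
  have l: "length cs' = length vs" using *(3) by (simp add: args_rep_def)
  have "arity p f \<le> length (targs (Fd f))"
    using arg_ord(2)[of "arity p f - 1" f] *(2) by (cases "arity p f") auto
  then have "peel w (arity p f) (Fd f) (body w (L w) f) [] (cur w f (map (ac w) cs') 0)"
    using args_rep_code[OF *(3)] *(2) by (intro peel_defined) auto
  then have "L w f (cur w f (map (ac w) cs') 0)" using *(2) by (intro L_args[OF *(3)]) (auto simp: msz_pos)
  then show ?thesis using * l by (simp add: msz_pos)
qed

lemma matches_fits:
  assumes "cl \<in> set p" "length As = length vs" "length vs = length (cpats cl)"
    and "\<And>i n. i < length vs \<Longrightarrow> targs (Fd (cfun cl)) ! i = TSort n \<Longrightarrow> den w (As ! i) = vs ! i"
  shows "matches cl (cfun cl) vs \<longleftrightarrow> fits w cl As"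
proof -
  have "(\<exists>g. inst g (cpats cl ! k) = vs ! k) \<longleftrightarrow> (\<exists>g. inst g (cpats cl ! k) = den w (As ! k))"
    if k: "k < length vs" for k
  proof (cases "cpats cl ! k")
    case (PVar x)
    have "\<exists>g. inst g (PVar x) = v" for v by (rule exI[of _ "\<lambda>_. v"]) simp
    then show ?thesis using PVar by simp
  next
    case (PCon c ls)
    then show ?thesis using clause_type(4)[OF assms(1)] assms(3,4) k by metis
  qed
  then show ?thesis using matches_iff[OF linear[OF assms(1)]] assms(2,3) unfolding fits_def by auto
qed

lemma E_con: "conhead e \<Longrightarrow> E w M cl e As u \<longleftrightarrow> Ec w cl e As u"
  by (cases e) auto

lemma okc_con:
  assumes "conhead e" "okc cl e"
  shows "\<exists>c ss. e = apps (Con c) ss \<and> length ss = length (targs (Fc c))"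
    "is_data e \<and> dval e \<in> set cs \<or> (\<exists>l\<in>set (cpats cl). sub (pat_expr l) e)"
proof -
  have d: "is_data (Con c)" for c using is_data.intros(1)[of "[]" c] by simp
  show "\<exists>c ss. e = apps (Con c) ss \<and> length ss = length (targs (Fc c))"
  proof (cases e)
    case (Con c)
    then show ?thesis using assms(2) by (intro exI[of _ c] exI[of _ "[]"]) simp
  next
    case (App s t)
    then show ?thesis using assms by simp
  qed (use assms in auto)
  show "is_data e \<and> dval e \<in> set cs \<or> (\<exists>l\<in>set (cpats cl). sub (pat_expr l) e)"
  proof (cases e)
    case (Con c)
    then show ?thesis using assms(2) d by auto
  next
    case (App s t)
    then show ?thesis using assms by simp
  qed (use assms in auto)
qed

lemma not_data_Var [simp]: "\<not> is_data (Var x)"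
  by (auto elim: is_data.cases)

text \<open>The codes of the arguments are universally quantified, since a body is evaluated under
  whatever codes its caller has settled on; a code for the result is then found all of whose
  observations are derived.\<close>

definition CE :: "bool list \<Rightarrow> (string \<Rightarrow> val) \<Rightarrow> expr \<Rightarrow> val \<Rightarrow> bool" where
  "CE w g e v \<longleftrightarrow> (\<forall>cl cs' t. cl \<in> set p \<longrightarrow> args_rep w (cfun cl) cs' (map (inst g) (cpats cl)) \<longrightarrow>
     okc cl e \<longrightarrow> has_type Fc Fd (\<Gamma> cl) e t \<longrightarrow>
     (\<exists>c. crep w t c v \<and> (\<forall>u. ob w c u \<longrightarrow> E w (L w) cl e (map (ac w) cs') u)))"

definition CC :: "bool list \<Rightarrow> string \<Rightarrow> val list \<Rightarrow> val \<Rightarrow> bool" where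
  "CC w f vs v \<longleftrightarrow> (\<forall>cs'. args_rep w f cs' vs \<longrightarrow>
     (\<exists>c. crep w (tdrop (length vs) (Fd f)) c v \<and> (\<forall>u. ob w c u \<longrightarrow> L w f (cur w f (map (ac w) cs') u))))"

text \<open>Cons-freeness enters here, through \<open>okc\<close>: a constructor term is a listed
  constant or equal to a sub-pattern of the left-hand side, and in the second case its value gets a
  code from that of the matched argument.\<close>

lemma CE_con: assumes "eval p g e v" "conhead e" shows "CE w g e v"
  unfolding CE_def
proof (intro allI impI)
  fix cl cs' t
  assume cl: "cl \<in> set p" and r: "args_rep w (cfun cl) cs' (map (inst g) (cpats cl))" and ok: "okc cl e"
    and t: "has_type Fc Fd (\<Gamma> cl) e t"
  obtain c ss where e: "e = apps (Con c) ss" "length ss = length (targs (Fc c))" using okc_con(1)[OF assms(2) ok] by blast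
  obtain n where n: "t = TSort n" using con_app_type t e by blast
  show "\<exists>c. crep w t c v \<and> (\<forall>u. ob w c u \<longrightarrow> E w (L w) cl e (map (ac w) cs') u)"
  proof (cases "is_data e \<and> dval e \<in> set cs")
    case True
    then have "v = dval e" using eval_data_unique assms(1) by blast
    then show ?thesis using True code[of "dval e" w] n
      by (intro exI[of _ "CD (code w v)"]) (auto simp: E_con[OF assms(2)] intro: crep_sort)
  next
    case False
    then obtain l where "l \<in> set (cpats cl)" "sub (pat_expr l) e" using okc_con(2)[OF assms(2) ok] by blast
    then obtain i where i: "i < length (cpats cl)" "sub (pat_expr (cpats cl ! i)) e" by (metis in_set_conv_nth)
    have "cpats cl ! i \<noteq> PVar x" for x using i(2) ssub_Var assms(2) by (auto simp: sub_def)
    then obtain n' where n': "targs (Fd (cfun cl)) ! i = TSort n'"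
      using clause_type(4)[OF cl i(1)] by (cases "cpats cl ! i") auto
    have "crep w (TSort n') (cs' ! i) (inst g (cpats cl ! i))" using r i(1) n' by (auto simp: args_rep_def)
    then obtain x where x: "cs' ! i = CD x" "x < D w" "den w x = inst g (cpats cl ! i)" by (elim crep_sortE)
    obtain y q where y: "occ w (cpats cl ! i) x e y" "y < D w" "e = pat_expr q" "inst g q = den w y"
      using occ_complete[OF i(2) x(3)[symmetric] x(2)] by blast
    have "v = den w y" using eval_pat_unique assms(1) y(3,4) by metis
    moreover have "map (ac w) cs' ! i = x" using x(1) r i(1) by (auto simp: args_rep_def)
    ultimately show ?thesis using False y(1,2) i(1) n
      by (intro exI[of _ "CD y"]) (auto simp: E_con[OF assms(2)] intro: crep_sort)
  qed
qed

lemma CE_var: "CE w g (Var x) (g x)"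
  unfolding CE_def
proof (intro allI impI)
  fix cl cs' t
  assume cl: "cl \<in> set p" and r: "args_rep w (cfun cl) cs' (map (inst g) (cpats cl))" and ok: "okc cl (Var x)"
    and t: "has_type Fc Fd (\<Gamma> cl) (Var x) t"
  have t: "t = \<Gamma> cl x" using t by (auto elim: has_type_VarE)
  obtain i where i: "i < length (cpats cl)" "x \<in> set (pat_vars (cpats cl ! i))"
    "cpats cl ! i = PVar x \<and> targs (Fd (cfun cl)) ! i = \<Gamma> cl x \<or>
      (\<exists>c ls n. cpats cl ! i = PCon c ls \<and> targs (Fd (cfun cl)) ! i = TSort n \<and> \<not> is_arr (\<Gamma> cl x))"
    using var_arg[OF cl, of x] ok unfolding ok.simps by blast
  have ri: "crep w (targs (Fd (cfun cl)) ! i) (cs' ! i) (inst g (cpats cl ! i))" and l: "i < length cs'"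
    using r i(1) by (auto simp: args_rep_def)
  show "\<exists>c. crep w t c (g x) \<and> (\<forall>u. ob w c u \<longrightarrow> E w (L w) cl (Var x) (map (ac w) cs') u)"
  proof (cases "\<Gamma> cl x")
    case (TSort n)
    then obtain n' where "targs (Fd (cfun cl)) ! i = TSort n'" using i(3) by auto
    then obtain y where y: "cs' ! i = CD y" "y < D w" "den w y = inst g (cpats cl ! i)"
      using ri crep_sortE by metis
    obtain z q where z: "occ w (cpats cl ! i) y (Var x) z" "z < D w" "Var x = pat_expr q" "inst g q = den w z"
      using occ_complete[OF sub_pat_var[OF i(2)] y(3)[symmetric] y(2)] by blast
    have "g x = den w z" using z(3,4) by (cases q) auto
    then show ?thesis using TSort z(1,2) i(1) y(1) t l
      by (intro exI[of _ "CD z"]) (auto intro: crep_sort)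
  next
    case (TProd s r)
    then show ?thesis using t by (intro exI[of _ CP]) (auto intro: crep_prod)
  next
    case (TArr s r)
    then have i': "cpats cl ! i = PVar x" "targs (Fd (cfun cl)) ! i = \<Gamma> cl x" using i(3) by auto
    then have "crep w (\<Gamma> cl x) (cs' ! i) (g x)" using ri by simp
    moreover have "E w (L w) cl (Var x) (map (ac w) cs') u" if "ob w (cs' ! i) u" for u
    proof -
      have u: "u < m w (\<Gamma> cl x)" using ob_less[OF \<open>crep w (\<Gamma> cl x) (cs' ! i) (g x)\<close> that] .
      then have "bit (map (ac w) cs' ! i) u" using bit_ac[OF \<open>crep w (\<Gamma> cl x) (cs' ! i) (g x)\<close> _ u] that TArr l by simp
      then show ?thesis using u i' i(1) TArr by (simp del: msz.simps) blast
    qed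
    ultimately show ?thesis using t by blast
  qed
qed

lemma complete:
  "eval p g e v \<Longrightarrow> CE w g e v"
  "call p f vs v \<Longrightarrow> CC w f vs v"
proof (induction rule: eval_call.inducts)
  case (ev_var g x)
  show ?case by (rule CE_var)
next
  case (ev_fun f v g)
  then have "CC w f [] v" by blast
  then obtain c where "crep w (Fd f) c v" "\<forall>u. ob w c u \<longrightarrow> L w f u"
    unfolding CC_def by (auto simp: args_rep_def)
  then show ?case unfolding CE_def by (auto elim!: has_type_FunE)
next
  case (ev_con g ss bs c)
  have "eval p g (apps (Con c) ss) (VCon c bs)"
    by (rule eval_call.ev_con) (use ev_con in \<open>auto elim: list_all2_mono\<close>)
  then show ?case by (rule CE_con) (rule conhead_apps)
next
  case (ev_pair g s v t v')
  note IH = ev_pair.IH(2,4)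
  show ?case unfolding CE_def
  proof (intro allI impI)
    fix cl cs' tt
    assume a: "cl \<in> set p" "args_rep w (cfun cl) cs' (map (inst g) (cpats cl))" "okc cl (Pair s t)"
      "has_type Fc Fd (\<Gamma> cl) (Pair s t) tt"
    obtain s1 s2 where t: "tt = TProd s1 s2" "has_type Fc Fd (\<Gamma> cl) s s1" "has_type Fc Fd (\<Gamma> cl) t s2"
      using a(4) by (auto elim: has_type_PairE)
    \<comment> \<open>The components of a pair only have to be defined; some observation always
      exists, by \<open>ob_defined\<close> for functions and by \<open>ob_ac\<close>
      otherwise.\<close>
    have ob: "\<exists>u<m w r. E w (L w) cl e (map (ac w) cs') u"
      if h: "CE w g e y" "okc cl e" "has_type Fc Fd (\<Gamma> cl) e r" for e y r
    proof -
      obtain c where c: "crep w r c y" "\<forall>u. ob w c u \<longrightarrow> E w (L w) cl e (map (ac w) cs') u"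
        using h a(1,2) unfolding CE_def by blast
      then obtain u where "ob w c u" using ob_ac ob_defined by blast
      then show ?thesis using c ob_less by blast
    qed
    have "ty (\<Gamma> cl) s = s1" "ty (\<Gamma> cl) t = s2" using ty t okc_no_choose a(3) by auto
    then show "\<exists>c. crep w tt c (VPair v v') \<and> (\<forall>u. ob w c u \<longrightarrow> E w (L w) cl (Pair s t) (map (ac w) cs') u)"
      using ob[OF IH(1)] ob[OF IH(2)] a(3) t by (intro exI[of _ CP]) (auto intro: crep_prod)
  qed
next
  case (ev_choose i ss g v)
  show ?case unfolding CE_def by simp
next
  case (ev_if_true g s1 s2 v s3)
  note IH = ev_if_true.IH(2,4)
  show ?case unfolding CE_def
  proof (intro allI impI)
    fix cl cs' t
    assume a: "cl \<in> set p" "args_rep w (cfun cl) cs' (map (inst g) (cpats cl))" "okc cl (If s1 s2 s3)"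
      "has_type Fc Fd (\<Gamma> cl) (If s1 s2 s3) t"
    have t: "has_type Fc Fd (\<Gamma> cl) s1 (TSort ''bool'')" "has_type Fc Fd (\<Gamma> cl) s2 t"
      using a(4) by (auto elim: has_type_IfE)
    obtain c where c: "crep w (TSort ''bool'') c (VCon ''true'' [])" "\<forall>u. ob w c u \<longrightarrow> E w (L w) cl s1 (map (ac w) cs') u"
      using IH(1) a t(1) unfolding CE_def by fastforce
    then obtain x where x: "c = CD x" "x < D w" "den w x = VCon ''true'' []" by (elim crep_sortE)
    then have 1: "\<exists>x<D w. root w x ''true'' 0 \<and> E w (L w) cl s1 (map (ac w) cs') x"
      using c(2) by (auto simp: root_def)
    obtain c' where "crep w t c' v" "\<forall>u. ob w c' u \<longrightarrow> E w (L w) cl s2 (map (ac w) cs') u"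
      using IH(2) a t(2) unfolding CE_def by fastforce
    then show "\<exists>c. crep w t c v \<and> (\<forall>u. ob w c u \<longrightarrow> E w (L w) cl (If s1 s2 s3) (map (ac w) cs') u)"
      using 1 by auto
  qed
next
  case (ev_if_false g s1 s3 v s2)
  note IH = ev_if_false.IH(2,4)
  show ?case unfolding CE_def
  proof (intro allI impI)
    fix cl cs' t
    assume a: "cl \<in> set p" "args_rep w (cfun cl) cs' (map (inst g) (cpats cl))" "okc cl (If s1 s2 s3)"
      "has_type Fc Fd (\<Gamma> cl) (If s1 s2 s3) t"
    have t: "has_type Fc Fd (\<Gamma> cl) s1 (TSort ''bool'')" "has_type Fc Fd (\<Gamma> cl) s3 t"
      using a(4) by (auto elim: has_type_IfE)
    obtain c where c: "crep w (TSort ''bool'') c (VCon ''false'' [])" "\<forall>u. ob w c u \<longrightarrow> E w (L w) cl s1 (map (ac w) cs') u"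
      using IH(1) a t(1) unfolding CE_def by fastforce
    then obtain x where x: "c = CD x" "x < D w" "den w x = VCon ''false'' []" by (elim crep_sortE)
    then have 1: "\<exists>x<D w. root w x ''false'' 0 \<and> E w (L w) cl s1 (map (ac w) cs') x"
      using c(2) by (auto simp: root_def)
    obtain c' where "crep w t c' v" "\<forall>u. ob w c' u \<longrightarrow> E w (L w) cl s3 (map (ac w) cs') u"
      using IH(2) a t(2) unfolding CE_def by fastforce
    then show "\<exists>c. crep w t c v \<and> (\<forall>u. ob w c u \<longrightarrow> E w (L w) cl (If s1 s2 s3) (map (ac w) cs') u)"
      using 1 by auto
  qed
next
  case (ev_app g s f vs t v y)
  note IH = ev_app.IH(2,4,6) and nc = not_conhead_VFun[OF ev_app.IH(1)]
  show ?case unfolding CE_def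
  proof (intro allI impI)
    fix cl cs' \<tau>
    assume a: "cl \<in> set p" "args_rep w (cfun cl) cs' (map (inst g) (cpats cl))" "okc cl (App s t)"
      "has_type Fc Fd (\<Gamma> cl) (App s t) \<tau>"
    obtain \<sigma> where t: "has_type Fc Fd (\<Gamma> cl) s (TArr \<sigma> \<tau>)" "has_type Fc Fd (\<Gamma> cl) t \<sigma>"
      using a(4) by (auto elim: has_type_AppE)
    have ok: "okc cl s" "okc cl t" using a(3) nc by auto
    obtain c1 where c1: "crep w (TArr \<sigma> \<tau>) c1 (VFun f vs)" "\<forall>u. ob w c1 u \<longrightarrow> E w (L w) cl s (map (ac w) cs') u"
      using IH(1) a(1,2) ok t(1) unfolding CE_def by blast
    obtain c2 where c2: "crep w \<sigma> c2 v" "\<forall>u. ob w c2 u \<longrightarrow> E w (L w) cl t (map (ac w) cs') u"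
      using IH(2) a(1,2) ok t(2) unfolding CE_def by blast
    obtain ds where ds: "c1 = CF f ds" "length ds < arity p f" "args_rep w f ds vs" "tdrop (length vs) (Fd f) = TArr \<sigma> \<tau>"
      using c1(1) by (elim crep_arrE) auto
    have l: "length ds = length vs" using ds(3) by (simp add: args_rep_def)
    have ts: "length vs < length (targs (Fd f))" "targs (Fd f) ! length vs = \<sigma>" "tdrop (Suc (length vs)) (Fd f) = \<tau>"
      using tdrop_Suc[OF ds(4)] by auto
    have o: "ord \<sigma> \<le> K" using arg_ord(1)[of "length vs" f] ts(2) ds(2) l by simp
    have "args_rep w f (ds @ [c2]) (vs @ [v])"
      using ds(2,3) c2(1) ts(2) by (auto simp: args_rep_def nth_append less_Suc_eq)
    then obtain c where c: "crep w \<tau> c y" "\<forall>u. ob w c u \<longrightarrow> L w f (cur w f (map (ac w) (ds @ [c2])) u)"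
      using IH(3) ts(3) unfolding CC_def by fastforce
    have "E w (L w) cl (App s t) (map (ac w) cs') u" if u: "ob w c u" for u
    proof -
      let ?A = "ac w c2"
      have A: "?A < a w \<sigma>" by (rule ac_less[OF c2(1)])
      \<comment> \<open>An observation \<open>u\<close> of the call with one more argument is an
        observation of the function value, with the code \<open>?A\<close> paired in front; this is
        how facts about the callee become observations of \<open>s\<close>.\<close>
      have "cur w f (map (ac w) (ds @ [c2])) u = cur w f (map (ac w) ds) (pr K (D w) \<sigma> ?A u)"
        using ts(1,2) l curry_snoc[of "map (ac w) ds" "targs (Fd f)" K "D w" ?A u] by simp
      then have "L w f (cur w f (map (ac w) ds) (pr K (D w) \<sigma> ?A u))" using c(2) u by metis
      moreover have "pr K (D w) \<sigma> ?A u < m w (TArr \<sigma> \<tau>)"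
        by (rule pr_less[OF A ob_less[OF c(1) u] o])
      ultimately have 1: "E w (L w) cl s (map (ac w) cs') (pr K (D w) \<sigma> ?A u)"
        using c1(2) ds(1,4) l by simp
      have 2: "if is_arr \<sigma> then E w (L w) cl t (map (ac w) cs') 0 \<and>
          (\<forall>v<m w \<sigma>. bit ?A v \<longrightarrow> E w (L w) cl t (map (ac w) cs') v) else E w (L w) cl t (map (ac w) cs') ?A"
        using c2 ob_defined bit_ac ob_ac by (simp split: if_splits)
      have "ty (\<Gamma> cl) s = TArr \<sigma> \<tau>" using ty[OF t(1)] okc_no_choose[OF ok(1)] by simp
      then show ?thesis using nc o A 1 2 by auto
    qed
    then show "\<exists>c. crep w \<tau> c y \<and> (\<forall>u. ob w c u \<longrightarrow> E w (L w) cl (App s t) (map (ac w) cs') u)"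
      using c(1) by blast
  qed
next
  case (call_partial vs f)
  show ?case unfolding CC_def
  proof (intro allI impI)
    fix cs' assume r: "args_rep w f cs' vs"
    then have "crep w (tdrop (length vs) (Fd f)) (CF f cs') (VFun f vs)"
      using call_partial by (intro crep_fun) (auto simp: args_rep_def)
    then show "\<exists>c. crep w (tdrop (length vs) (Fd f)) c (VFun f vs) \<and>
        (\<forall>u. ob w c u \<longrightarrow> L w f (cur w f (map (ac w) cs') u))" by (intro exI[of _ "CF f cs'"]) simp
  qed
next
  case (call_clause f vs i d v)
  note fc = call_clause(1,2) and IH = call_clause(4)
  let ?cl = "p ! i"
  have cl: "i < length p" "?cl \<in> set p" "cfun ?cl = f" using fc(1) by (auto simp: first_clause_def matches_def)
  have len: "length (cpats ?cl) = length vs" using fc(2) by auto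
  have ar: "length vs = arity p f" using first_clause_arity[OF fc(1)] .
  show ?case unfolding CC_def
  proof (intro allI impI)
    fix cs' assume r: "args_rep w f cs' vs"
    have ty: "tdrop (length vs) (Fd f) = ct ?cl" using clause_type(2)[OF cl(2)] cl(3) len by simp
    have "args_rep w (cfun ?cl) cs' (map (inst d) (cpats ?cl))" using r cl(3) fc(2) by simp
    then obtain c where c: "crep w (ct ?cl) c v" "\<forall>u. ob w c u \<longrightarrow> E w (L w) ?cl (crhs ?cl) (map (ac w) cs') u"
      using IH cl(2) ok_rhs[OF cl(2)] ty_rhs[OF cl(2)] unfolding CE_def by blast
    have sortcode: "den w (map (ac w) cs' ! k) = vs ! k" if "k < length vs" "targs (Fd f) ! k = TSort n" for k n
    proof -
      have "crep w (TSort n) (cs' ! k) (vs ! k)" using r that by (auto simp: args_rep_def)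
      then show ?thesis using r that by (elim crep_sortE) (auto simp: args_rep_def)
    qed
    have fit: "fits w (p ! j) (map (ac w) cs') \<longleftrightarrow> matches (p ! j) f vs" if "j < length p" "cfun (p ! j) = f" for j
    proof -
      have j: "p ! j \<in> set p" using that by simp
      have "length vs = length (cpats (p ! j))" using arity_clause[OF j] that(2) ar by simp
      then show ?thesis using matches_fits[OF j, of "map (ac w) cs'" vs w] sortcode that(2) r
        by (auto simp: args_rep_def)
    qed
    have "L w f (cur w f (map (ac w) cs') u)" if u: "ob w c u" for u
    proof (rule L_args[OF r])
      show "0 < arity p f \<or> f \<in> cfun ` set p" using cl by auto
      show "u < m w (tdrop (length vs) (Fd f))" using ob_less[OF c(1) u] ty by simp
      have b: "body w (L w) f (map (ac w) cs') u"
        unfolding body_def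
      proof (intro exI[of _ i] conjI allI impI)
        show "i < length p" "cfun ?cl = f" using cl by blast+
        show "E w (L w) ?cl (crhs ?cl) (map (ac w) cs') u" using c(2) u by blast
        show "fits w ?cl (map (ac w) cs')" using fit[of i] cl fc(1) unfolding first_clause_def by blast
        fix j assume "j < i" "cfun (p ! j) = f"
        then show "\<not> fits w (p ! j) (map (ac w) cs')" using fit[of j] cl(1) fc(1) unfolding first_clause_def by simp
      qed
      have lt: "length vs \<le> length (targs (Fd f))" using clause_type(1)[OF cl(2)] unfolding cl(3) len .
      have lc: "length cs' = length vs" using r by (simp add: args_rep_def)
      have "peel w (length (map (ac w) cs')) (Fd f) (body w (L w) f) [] (cur w f (map (ac w) cs') u)"
      proof (intro peel_curry)
        show "length (map (ac w) cs') \<le> length (targs (Fd f))"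
          unfolding length_map lc by (rule lt)
        show "\<forall>i<length (map (ac w) cs'). map (ac w) cs' ! i < a w (targs (Fd f) ! i)"
          using args_rep_code[OF r] unfolding length_map by blast
        show "body w (L w) f ([] @ map (ac w) cs') u" using b unfolding append_Nil .
      qed
      then show "peel w (arity p f) (Fd f) (body w (L w) f) [] (cur w f (map (ac w) cs') u)"
        unfolding length_map lc ar .
    qed
    then show "\<exists>c. crep w (tdrop (length vs) (Fd f)) c v \<and>
        (\<forall>u. ob w c u \<longrightarrow> L w f (cur w f (map (ac w) cs') u))" unfolding ty using c(1) by blast
  qed
qed

subsection \<open>Every observation is realized\<close>

text \<open>A logical relation between observations and values. Observation 0 of a function type and
  all observations of a product hold of every value: that a value exists at all is asserted by the
  evaluation judgement that accompanies \<open>R\<close>.\<close>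

fun R :: "bool list \<Rightarrow> sty \<Rightarrow> nat \<Rightarrow> val \<Rightarrow> bool" where
  "R w (TSort n) u v = (u < D w \<and> den w u = v)"
| "R w (TProd s t) u v = True"
| "R w (TArr s t) u v = (\<forall>A u'. A < a w s \<longrightarrow> u = pr K (D w) s A u' \<longrightarrow>
     (\<forall>x. (if is_arr s then \<forall>b<m w s. bit A b \<longrightarrow> R w s b x else R w s A x) \<longrightarrow>
       (\<exists>f vs y. v = VFun f vs \<and> call p f (vs @ [x]) y \<and> R w t u' y)))"

definition V :: "bool list \<Rightarrow> sty \<Rightarrow> nat \<Rightarrow> val \<Rightarrow> bool" where
  "V w s A x \<longleftrightarrow> (if is_arr s then \<forall>b<m w s. bit A b \<longrightarrow> R w s b x else R w s A x)"

lemma R_arr: "R w (TArr s t) (pr K (D w) s A u) v \<Longrightarrow> A < a w s \<Longrightarrow> V w s A x \<Longrightarrow>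
    \<exists>f vs y. v = VFun f vs \<and> call p f (vs @ [x]) y \<and> R w t u y"
  unfolding V_def R.simps(3) by blast

lemma R_arrI:
  assumes "A < a w s" "\<And>x. V w s A x \<Longrightarrow> \<exists>f vs y. v = VFun f vs \<and> call p f (vs @ [x]) y \<and> R w t u y"
  shows "R w (TArr s t) (pr K (D w) s A u) v"
  unfolding R.simps(3)
proof (intro allI impI)
  fix B u' x assume *: "B < a w s" "pr K (D w) s A u = pr K (D w) s B u'"
    "if is_arr s then \<forall>b<m w s. bit B b \<longrightarrow> R w s b x else R w s B x"
  then have "B = A" "u' = u" using pr_inject[OF assms(1) *(1)] by auto
  then show "\<exists>f vs y. v = VFun f vs \<and> call p f (vs @ [x]) y \<and> R w t u' y"
    using assms(2)[of x] *(3) unfolding V_def by blast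
qed

lemma R_0: "R w (TArr s t) 0 v"
  by (simp add: pr_def)

definition sound :: "bool list \<Rightarrow> string \<Rightarrow> nat \<Rightarrow> bool" where
  "sound w f u \<longleftrightarrow> (\<exists>y. call p f [] y \<and> R w (Fd f) u y)"

lemma Ec_sound:
  assumes "cl \<in> set p" "\<And>i. i < length (cpats cl) \<Longrightarrow> V w (targs (Fd (cfun cl)) ! i) (As ! i) (inst g (cpats cl ! i))"
    "Ec w cl e As u" "conhead e \<or> e = Var x \<and> (\<exists>n. \<Gamma> cl x = TSort n)"
  shows "\<exists>y. eval p g e y \<and> u < D w \<and> den w u = y"
proof (cases "is_data e \<and> dval e \<in> set cs")
  case True
  then show ?thesis using assms(3) eval_data[of e p g] code[of "dval e" w] by auto
next
  case False
  then obtain i where i: "i < length (cpats cl)" "occ w (cpats cl ! i) (As ! i) e u" using assms(3) by auto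
  have "\<exists>n. targs (Fd (cfun cl)) ! i = TSort n"
  proof (cases "cpats cl ! i")
    case (PVar z)
    then have "e = Var z" using i(2) by (auto elim: occ.cases)
    then show ?thesis using assms(4) clause_type(3)[OF assms(1) i(1)] PVar by (auto elim: has_type_VarE)
  next
    case (PCon c ls)
    then show ?thesis using clause_type(4)[OF assms(1) i(1)] by blast
  qed
  then have "As ! i < D w" "inst g (cpats cl ! i) = den w (As ! i)" using assms(2)[OF i(1)] by (auto simp: V_def)
  from occ_sound[OF i(2) this] obtain q where "u < D w" "e = pat_expr q" "inst g q = den w u" by blast
  then show ?thesis using eval_pat[of p g q] by auto
qed

text \<open>\<open>M\<close> is an arbitrary set of sound facts and not the fixed point, so that the
  lemma can serve in the induction over the derivation of facts.\<close>

lemma E_sound: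
  assumes M: "\<And>f u. M f u \<Longrightarrow> sound w f u" and cl: "cl \<in> set p"
    and V: "\<And>i. i < length (cpats cl) \<Longrightarrow> V w (targs (Fd (cfun cl)) ! i) (As ! i) (inst g (cpats cl ! i))"
  shows "okc cl e \<Longrightarrow> has_type Fc Fd (\<Gamma> cl) e t \<Longrightarrow> E w M cl e As u \<Longrightarrow> \<exists>y. eval p g e y \<and> R w t u y"
proof (induction e arbitrary: t u)
  case (Var x)
  have t: "t = \<Gamma> cl x" using Var.prems(2) by (auto elim: has_type_VarE)
  show ?case
  proof (cases "\<Gamma> cl x")
    case (TSort n)
    then have "Ec w cl (Var x) As u" using Var.prems(3) by (simp del: Ec.simps)
    have "\<exists>y. eval p g (Var x) y \<and> u < D w \<and> den w u = y"
      by (rule Ec_sound[OF cl V \<open>Ec w cl (Var x) As u\<close>]) (use TSort in blast)+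
    then show ?thesis unfolding t TSort R.simps(1) by blast
  next
    case (TProd s r)
    then show ?thesis using t ev_var by auto
  next
    case (TArr s r)
    then obtain i where i: "i < length (cpats cl)" "cpats cl ! i = PVar x" "u < m w (\<Gamma> cl x)" "bit (As ! i) u"
      using Var.prems(3) by auto
    have ti: "targs (Fd (cfun cl)) ! i = \<Gamma> cl x"
      using clause_type(3)[OF cl i(1)] i(2) by (auto elim: has_type_VarE)
    have "V w (\<Gamma> cl x) (As ! i) (g x)" using V[OF i(1)] unfolding ti i(2) by simp
    then have "R w (\<Gamma> cl x) u (g x)" using i(3,4) TArr unfolding V_def by (simp del: R.simps msz.simps)
    then show ?thesis using ev_var unfolding t by blast
  qed
next
  case (Con c)
  then obtain n where "t = TSort n" using con_app_type[of "\<Gamma> cl" c "[]" t] by fastforce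
  have ec: "Ec w cl (Con c) As u" using Con.prems(3) by (simp del: Ec.simps)
  have "\<exists>y. eval p g (Con c) y \<and> u < D w \<and> den w u = y"
    by (rule Ec_sound[OF cl V ec]) simp_all
  then show ?case unfolding \<open>t = TSort n\<close> R.simps(1) by blast
next
  case (Fun f)
  then have "sound w f u" "t = Fd f" using M by (auto elim: has_type_FunE)
  then obtain y where "call p f [] y" "R w t u y" by (auto simp: sound_def)
  then show ?case using ev_fun by blast
next
  case (If x y z)
  have t: "has_type Fc Fd (\<Gamma> cl) x (TSort ''bool'')" "has_type Fc Fd (\<Gamma> cl) y t" "has_type Fc Fd (\<Gamma> cl) z t"
    using If.prems(2) by (auto elim: has_type_IfE)
  have okx: "okc cl x" and oky: "okc cl y" and okz: "okc cl z" using If.prems(1) by simp_all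
  from If.prems(3) consider (tr) v where "root w v ''true'' 0" "E w M cl x As v" "E w M cl y As u"
    | (fa) v where "root w v ''false'' 0" "E w M cl x As v" "E w M cl z As u" by auto
  then show ?case
  proof cases
    case tr
    have "den w v = VCon ''true'' []" using tr(1) by (simp add: root_def)
    then have "eval p g x (VCon ''true'' [])" using If.IH(1)[OF okx t(1) tr(2)] by auto
    then show ?thesis using If.IH(2)[OF oky t(2) tr(3)] ev_if_true by blast
  next
    case fa
    have "den w v = VCon ''false'' []" using fa(1) by (simp add: root_def)
    then have "eval p g x (VCon ''false'' [])" using If.IH(1)[OF okx t(1) fa(2)] by auto
    then show ?thesis using If.IH(3)[OF okz t(3) fa(3)] ev_if_false by blast
  qed
next
  case (Choose ss)
  then show ?case by simp
next
  case (Pair x y)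
  obtain s1 s2 where t: "t = TProd s1 s2" "has_type Fc Fd (\<Gamma> cl) x s1" "has_type Fc Fd (\<Gamma> cl) y s2"
    using Pair.prems(2) by (auto elim: has_type_PairE)
  obtain v1 v2 where "E w M cl x As v1" "E w M cl y As v2" using Pair.prems(3) by auto
  then obtain y1 y2 where "eval p g x y1" "eval p g y y2"
    using Pair.IH(1)[OF _ t(2)] Pair.IH(2)[OF _ t(3)] Pair.prems(1) by (meson ok.simps(6))
  then show ?case unfolding t(1) R.simps(2) using ev_pair by blast
next
  case (App s t')
  show ?case
  proof (cases "conhead s")
    case True
    then have c: "conhead (App s t')" by simp
    obtain n where "t = TSort n" using okc_con(1)[OF c App.prems(1)] con_app_type App.prems(2) by metis
    have ec: "Ec w cl (App s t') As u" using App.prems(3) True by (simp del: Ec.simps)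
    have "\<exists>y. eval p g (App s t') y \<and> u < D w \<and> den w u = y"
      by (rule Ec_sound[OF cl V ec]) (use c in blast)+
    then show ?thesis unfolding \<open>t = TSort n\<close> R.simps(1) by blast
  next
    case False
    obtain \<sigma> where ts: "has_type Fc Fd (\<Gamma> cl) s (TArr \<sigma> t)" "has_type Fc Fd (\<Gamma> cl) t' \<sigma>"
      using App.prems(2) by (auto elim: has_type_AppE)
    have ok: "okc cl s" "okc cl t'" using App.prems(1) False by auto
    have "ty (\<Gamma> cl) s = TArr \<sigma> t" using ty[OF ts(1)] okc_no_choose[OF ok(1)] by simp
    then obtain A where A: "A < a w \<sigma>" "E w M cl s As (pr K (D w) \<sigma> A u)"
      "if is_arr \<sigma> then E w M cl t' As 0 \<and> (\<forall>v<m w \<sigma>. bit A v \<longrightarrow> E w M cl t' As v) else E w M cl t' As A"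
      using App.prems(3) False by auto
    have "\<exists>x. eval p g t' x \<and> V w \<sigma> A x"
    proof (cases "is_arr \<sigma>")
      case True
      then have "E w M cl t' As 0" using A(3) by simp
      \<comment> \<open>Observation 0 supplies a run even if \<open>A\<close> is empty; the values
        of the runs behind the other observations are then identified with \<open>x\<close> by
        \<open>eval_det\<close>.\<close>
      then obtain x where x: "eval p g t' x" using App.IH(2)[OF ok(2) ts(2)] by blast
      have "R w \<sigma> b x" if "b < m w \<sigma>" "bit A b" for b
      proof -
        have "E w M cl t' As b" using A(3) True that by simp
        then obtain x' where "eval p g t' x'" "R w \<sigma> b x'" using App.IH(2)[OF ok(2) ts(2)] by blast
        then show ?thesis using eval_det[OF x _ okc_no_choose[OF ok(2)]] by blast
      qed
      then show ?thesis using x True unfolding V_def by auto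
    next
      case False
      then have "E w M cl t' As A" using A(3) by simp
      then show ?thesis using App.IH(2)[OF ok(2) ts(2)] False unfolding V_def by auto
    qed
    then obtain x where x: "eval p g t' x" "V w \<sigma> A x" by blast
    obtain y where y: "eval p g s y" "R w (TArr \<sigma> t) (pr K (D w) \<sigma> A u) y" using App.IH(1)[OF ok(1) ts(1) A(2)] by blast
    obtain f vs z where "y = VFun f vs" "call p f (vs @ [x]) z" "R w t u z" using R_arr[OF y(2) A(1) x(2)] by blast
    then show ?thesis using ev_app x(1) y(1) by blast
  qed
qed

lemma body_sound:
  assumes M: "\<And>f u. M f u \<Longrightarrow> sound w f u" and "length As = length vs" "length vs = arity p f"
    and V: "\<And>i. i < length vs \<Longrightarrow> V w (targs (Fd f) ! i) (As ! i) (vs ! i)"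
    and "body w M f As u"
  shows "\<exists>y. call p f vs y \<and> R w (tdrop (length vs) (Fd f)) u y"
proof -
  obtain i where i: "i < length p" "cfun (p ! i) = f" "fits w (p ! i) As"
    "\<And>j. j < i \<Longrightarrow> cfun (p ! j) = f \<Longrightarrow> \<not> fits w (p ! j) As" "E w M (p ! i) (crhs (p ! i)) As u"
    using assms(5) unfolding body_def by blast
  let ?cl = "p ! i"
  have fit: "fits w (p ! j) As \<longleftrightarrow> matches (p ! j) f vs" if "j < length p" "cfun (p ! j) = f" for j
  proof -
    have j: "p ! j \<in> set p" using that by simp
    have "length vs = length (cpats (p ! j))" using arity_clause[OF j] that(2) assms(3) by simp
    moreover have "den w (As ! k) = vs ! k" if "k < length vs" "targs (Fd f) ! k = TSort n" for k n
      using V[OF that(1)] that(2) by (simp add: V_def)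
    ultimately show ?thesis using matches_fits[OF j, of As vs w] that(2) assms(2) by auto
  qed
  have fc: "first_clause p f vs i"
    unfolding first_clause_def
  proof (intro conjI allI impI)
    show "matches ?cl f vs" using fit i by blast
    fix j assume "j < i"
    then show "\<not> matches (p ! j) f vs" using fit[of j] i by (metis matches_def order_less_trans)
  qed (rule i(1))
  then obtain g where g: "map (inst g) (cpats ?cl) = vs" by (auto simp: first_clause_def matches_def)
  have cl: "?cl \<in> set p" using i(1) by simp
  have len: "length (cpats ?cl) = length vs" using g by auto
  have "V w (targs (Fd (cfun ?cl)) ! k) (As ! k) (inst g (cpats ?cl ! k))" if "k < length (cpats ?cl)" for k
  proof -
    have "inst g (cpats ?cl ! k) = vs ! k" using g nth_map[OF that, of "inst g"] by simp
    then show ?thesis using V[of k] that unfolding len i(2) by simp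
  qed
  from E_sound[OF M cl this ok_rhs[OF cl] ty_rhs[OF cl] i(5)]
  obtain y where y: "eval p g (crhs ?cl) y" "R w (ct ?cl) u y" by blast
  have "tdrop (length vs) (Fd f) = ct ?cl" using clause_type(2)[OF cl] i(2) len by simp
  then show ?thesis using call_clause[OF fc g y(1)] y(2) by auto
qed

text \<open>A non-zero observation of a partial application makes a claim about every argument that
  realizes its code. The induction on the number of missing arguments supplies it, and
  \<open>body_sound\<close> takes over when none is missing.\<close>

lemma peel_sound:
  assumes M: "\<And>f u. M f u \<Longrightarrow> sound w f u"
  shows "peel w k t (body w M f) As u \<Longrightarrow> length As = length vs \<Longrightarrow> length vs + k = arity p f \<Longrightarrow>
    (\<And>i. i < length vs \<Longrightarrow> V w (targs (Fd f) ! i) (As ! i) (vs ! i)) \<Longrightarrow> t = tdrop (length vs) (Fd f) \<Longrightarrow>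
    \<exists>y. call p f vs y \<and> R w t u y"
proof (induction k arbitrary: t As u vs)
  case 0
  then show ?case using body_sound[of M w As vs f u] M by auto
next
  case (Suc k)
  then have l: "length vs < arity p f" by simp
  then obtain s r where t: "t = TArr s r" using arity_arr Suc.prems(5) by blast
  have td: "targs (Fd f) ! length vs = s" "tdrop (Suc (length vs)) (Fd f) = r"
    using tdrop_Suc t Suc.prems(5) by metis+
  have c: "call p f vs (VFun f vs)" using call_partial[OF l] .
  show ?case
  proof (cases "u = 0")
    case True
    then show ?thesis using c R_0 t by blast
  next
    case False
    then obtain A v where A: "A < a w s" "u = pr K (D w) s A v" "peel w k r (body w M f) (As @ [A]) v"
      using Suc.prems(1) t by auto
    have "\<exists>y. call p f (vs @ [x]) y \<and> R w r v y" if x: "V w s A x" for x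
    proof (rule Suc.IH[OF A(3)])
      fix i assume "i < length (vs @ [x])"
      then show "V w (targs (Fd f) ! i) ((As @ [A]) ! i) ((vs @ [x]) ! i)"
        using Suc.prems(2) Suc.prems(4)[of i] x td(1) by (auto simp: nth_append less_Suc_eq)
    qed (use Suc.prems td in auto)
    then have "R w t u (VFun f vs)" unfolding t A(2) by (intro R_arrI[OF A(1)]) blast
    then show ?thesis using c by blast
  qed
qed

lemma L_sound: "L w f u \<Longrightarrow> sound w f u"
proof (erule L_induct)
  fix f M u assume "\<And>f u. M f u \<Longrightarrow> sound w f u" "Phi w f M u"
  then show "sound w f u" using peel_sound[of M w "arity p f" "Fd f" f "[]" u "[]"]
    by (auto simp: Phi_def sound_def)
qed

lemma eval_App_inv:
  assumes "eval p g (App s t) v" "\<not> conhead s"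
  shows "\<exists>f vs u. eval p g s (VFun f vs) \<and> eval p g t u \<and> call p f (vs @ [u]) v"
  using assms(1)
proof cases
  case (ev_con ss bs c)
  then have "conhead (App s t)" using conhead_apps by metis
  then show ?thesis using assms(2) by simp
qed blast

text \<open>Code 0 is the whole input, so acceptance becomes a single call fact: the main function
  maps code 0 to a code \<open>y\<close> of \<open>true\<close>. Such a code need not be unique,
  hence the quantifier.\<close>

theorem accepts_iff:
  assumes F: "Fd (main_fun p) = TArr (TSort ''list'') (TSort ''bool'')"
  shows "accepts p w \<longleftrightarrow> (\<exists>y<D w. root w y ''true'' 0 \<and> L w (main_fun p) (pr K (D w) (TSort ''list'') 0 y))"
proof
  let ?f = "main_fun p" and ?x = "input_val w"
  have d0: "den w 0 = ?x" by (simp add: den_def)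
  have a0: "0 < a w (TSort ''list'')" by (simp add: asz_def)
  {
    assume "accepts p w"
    then have "eval p (\<lambda>_. ?x) (App (Fun ?f) (Var ''x'')) (VCon ''true'' [])" by (simp add: accepts_def)
    \<comment> \<open>Only the type of the main function is fixed. It may have arity 0 and return a
      partial application of another function, so \<open>f\<close> and \<open>vs\<close> are
      arbitrary here.\<close>
    then obtain f vs v where e: "eval p (\<lambda>_. ?x) (Fun ?f) (VFun f vs)" "eval p (\<lambda>_. ?x) (Var ''x'') v"
      "call p f (vs @ [v]) (VCon ''true'' [])"
      using eval_App_inv by fastforce
    have v: "v = ?x" using e(2) by (auto elim: eval_VarE)
    have "call p ?f [] (VFun f vs)" using e(1) by (auto elim: eval_FunE)
    then have "CC w ?f [] (VFun f vs)" by (rule complete(2))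
    then obtain c where c: "crep w (Fd ?f) c (VFun f vs)" "\<And>u. ob w c u \<Longrightarrow> L w ?f u"
      unfolding CC_def by (auto simp: args_rep_def)
    have "is_arr (Fd ?f)" by (simp add: F)
    then obtain ds where ds: "c = CF f ds" "length ds < arity p f" "args_rep w f ds vs" "tdrop (length vs) (Fd f) = Fd ?f"
      using c(1) by (elim crep_arrE) auto
    have ts: "length vs < length (targs (Fd f))" "targs (Fd f) ! length vs = TSort ''list''"
      "tdrop (Suc (length vs)) (Fd f) = TSort ''bool''" using tdrop_Suc ds(4) F by metis+
    have l: "length ds = length vs" using ds(3) by (simp add: args_rep_def)
    have "crep w (TSort ''list'') (CD 0) ?x" by (rule crep_sort) (simp_all add: d0)
    then have "args_rep w f (ds @ [CD 0]) (vs @ [v])"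
      using ds(2,3) ts(2) v by (auto simp: args_rep_def nth_append less_Suc_eq)
    moreover have "CC w f (vs @ [v]) (VCon ''true'' [])" by (rule complete(2)[OF e(3)])
    ultimately obtain c' where c': "crep w (TSort ''bool'') c' (VCon ''true'' [])"
      "\<And>u. ob w c' u \<Longrightarrow> L w f (cur w f (map (ac w) (ds @ [CD 0])) u)"
      unfolding CC_def using ts(3) by fastforce
    obtain y where y: "c' = CD y" "y < D w" "den w y = VCon ''true'' []" using c'(1) by (elim crep_sortE)
    have "cur w f (map (ac w) (ds @ [CD 0])) y = cur w f (map (ac w) ds) (pr K (D w) (TSort ''list'') 0 y)"
      using curry_snoc[of "map (ac w) ds" "targs (Fd f)" K "D w" 0 y] ts(1,2) l by simp
    then have "L w f (cur w f (map (ac w) ds) (pr K (D w) (TSort ''list'') 0 y))" using c'(2)[of y] y(1) by simp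
    moreover have "pr K (D w) (TSort ''list'') 0 y < m w (Fd ?f)"
      unfolding F by (rule pr_less[OF a0]) (simp_all add: y(2))
    ultimately have "ob w c (pr K (D w) (TSort ''list'') 0 y)" using ds(1,4) l by simp
    then show "\<exists>y<D w. root w y ''true'' 0 \<and> L w ?f (pr K (D w) (TSort ''list'') 0 y)"
      using c(2) y by (auto simp: root_def)
  }
  {
    assume "\<exists>y<D w. root w y ''true'' 0 \<and> L w ?f (pr K (D w) (TSort ''list'') 0 y)"
    then obtain y where y: "den w y = VCon ''true'' []" "L w ?f (pr K (D w) (TSort ''list'') 0 y)"
      by (auto simp: root_def)
    obtain g where g: "call p ?f [] g" "R w (Fd ?f) (pr K (D w) (TSort ''list'') 0 y) g"
      using L_sound[OF y(2)] by (auto simp: sound_def)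
    have "V w (TSort ''list'') 0 ?x" by (simp add: V_def d0)
    then obtain f vs z where z: "g = VFun f vs" "call p f (vs @ [?x]) z" "R w (TSort ''bool'') y z"
      using R_arr[OF _ a0] g(2) unfolding F by blast
    have "z = VCon ''true'' []" using z(3) y(1) by simp
    then show "accepts p w" unfolding accepts_def
      using ev_app[OF _ _ z(2)] ev_fun[OF g(1)] ev_var[of p "\<lambda>_. ?x" "''x''"] z(1) by blast
  }
qed

end

subsection \<open>The observations are computable within the growth rate\<close>

text \<open>The decisive count. A functional argument of order at most \<open>k\<close> has
  observations bounded one level below \<open>k\<close>, and coding sets of them costs one
  exponential; pairing with an observation of the result costs only a product. The second conjunct
  holds at every order because \<open>msz\<close> drops arguments of order above
  \<open>K\<close>.\<close>

lemma bnd_msz_aux: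
  assumes "bnd 0 DD"
  shows "(\<forall>k. ord s \<le> Suc k \<longrightarrow> bnd k (\<lambda>n. msz K (DD n) s)) \<and> bnd K (\<lambda>n. msz K (DD n) s)"
proof (induction s)
  case (TSort x)
  show ?case using bnd_lift[OF assms] by simp
next
  case (TProd s t)
  show ?case by simp
next
  case (TArr s t)
  note IH = TArr.IH(1)
  have asz: "bnd k (\<lambda>n. asz K (DD n) s)" if o: "ord s \<le> k" for k
  proof (cases s)
    case (TArr s1 s2)
    then obtain k' where k': "k = Suc k'" using o by (cases k) auto
    then have "bnd k' (\<lambda>n. msz K (DD n) s)" using IH o by auto
    then show ?thesis using bnd_pow2 k' TArr by (simp add: asz_def del: msz.simps)
  qed (use bnd_lift[OF assms] in \<open>auto simp: asz_def\<close>)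
  show ?case
  proof (intro conjI allI impI)
    fix k assume o: "ord (TArr s t) \<le> Suc k"
    then have "bnd k (\<lambda>n. Suc (asz K (DD n) s * msz K (DD n) t))"
      using asz TArr.IH(2) by (intro bnd_Suc bnd_mult) auto
    then show "bnd k (\<lambda>n. msz K (DD n) (TArr s t))"
      by (rule bnd_mono) (simp add: msz_arr del: msz.simps)
  next
    show "bnd K (\<lambda>n. msz K (DD n) (TArr s t))"
    proof (cases "ord s \<le> K")
      case True
      then have "bnd K (\<lambda>n. Suc (asz K (DD n) s * msz K (DD n) t))"
        using asz TArr.IH(2) by (intro bnd_Suc bnd_mult) auto
      then show ?thesis using True by (simp add: msz_arr del: msz.simps)
    qed simp
  qed
qed

lemma bnd_asz:
  assumes "bnd 0 DD" "ord s \<le> K" shows "bnd K (\<lambda>n. asz K (DD n) s)"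
proof (cases s)
  case (TArr s1 s2)
  then obtain k' where k': "K = Suc k'" using assms(2) by (cases K) auto
  then have "bnd k' (\<lambda>n. msz K (DD n) s)" using bnd_msz_aux[OF assms(1)] assms(2) by blast
  then show ?thesis using bnd_pow2 k' TArr by (simp add: asz_def del: msz.simps)
qed (use bnd_lift[OF assms(1)] in \<open>auto simp: asz_def\<close>)

context track_machine
begin

lemma pcomp_fin_ex: "(\<And>j. j < N \<Longrightarrow> pcomp k (P j)) \<Longrightarrow> pcomp k (\<lambda>w M xs. \<exists>j<(N::nat). P j w M xs)"
proof (induction N)
  case 0
  show ?case using pcomp_const[of k False] by simp
next
  case (Suc N)
  have "pcomp k (\<lambda>w M xs. (\<exists>j<N. P j w M xs) \<or> P N w M xs)"
    using Suc by (intro pcomp_disj) auto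
  then show ?case by (rule comp_cong) (auto simp: less_Suc_eq)
qed

lemma pcomp_fin_all: "(\<And>j. j < N \<Longrightarrow> pcomp k (P j)) \<Longrightarrow> pcomp k (\<lambda>w M xs. \<forall>j<(N::nat). P j w M xs)"
  using pcomp_not[OF pcomp_fin_ex[of N k "\<lambda>j w M xs. \<not> P j w M xs"]] pcomp_not by (simp del: of_bool_not_iff)

lemma pcomp_cong:
  assumes "pcomp a Q" "\<And>w M xs. w \<noteq> [] \<Longrightarrow> length xs = a \<Longrightarrow> P w M xs \<longleftrightarrow> Q w M xs"
  shows "pcomp a P"
  by (rule comp_cong[OF assms(1)]) (simp add: assms(2))

lemma pcomp_env:
  assumes "pcomp (Suc k) (\<lambda>w M xs. P w M (take k xs) (xs ! k))" "computable a f" "k \<le> a"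
  shows "pcomp a (\<lambda>w M xs. P w M (take k xs) (f w M xs))"
  by (rule comp_env[where h = "\<lambda>w M xs u. of_bool (P w M xs u)", OF assms])

lemma comp_nth_take: "i < k \<Longrightarrow> k \<le> a \<Longrightarrow> computable a (\<lambda>w M xs. take k xs ! i)"
  using comp_var[of i a] by simp

end

context typed_program
begin

interpretation tm: track_machine K "length fs" .

lemma D_bnd: "bnd 0 (\<lambda>n. Suc (n + length cs))"
  by (intro tm.bnd_rules)

lemma c_D: "tm.computable k (\<lambda>w M xs. D w)"
  unfolding D_def by (intro tm.comp_suc tm.comp_add tm.comp_length tm.comp_const)

lemma c_code: "tm.computable k (\<lambda>w M xs. code w v)"
  unfolding code_def by (intro tm.comp_suc tm.comp_add tm.comp_length tm.comp_const)

lemma c_msz_asz: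
  "tm.computable k (\<lambda>w M xs. m w s) \<and> (ord s \<le> K \<longrightarrow> tm.computable k (\<lambda>w M xs. a w s))"
proof (induction s)
  case (TSort x)
  show ?case using c_D by (simp add: asz_def)
next
  case (TProd s t)
  show ?case using tm.comp_const[of k 1] by (simp add: asz_def)
next
  case (TArr s t)
  have 1: "tm.computable k (\<lambda>w M xs. m w (TArr s t))"
  proof (cases "ord s \<le> K")
    case True
    then have "tm.computable k (\<lambda>w M xs. Suc (a w s * m w t))"
      using TArr.IH by (intro tm.comp_suc tm.comp_mult) auto
    then show ?thesis using True by (simp add: msz_arr del: msz.simps)
  next
    case False
    then show ?thesis using tm.comp_const[of k "Suc 0"] by (simp add: msz_arr del: msz.simps)
  qed
  have "tm.computable k (\<lambda>w M xs. a w (TArr s t))" if "ord (TArr s t) \<le> K"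
  proof -
    have "bnd K (\<lambda>n. 2 ^ msz K (Suc (n + length cs)) (TArr s t))"
      using bnd_asz[OF D_bnd that] by (simp add: asz_def del: msz.simps)
    then have "tm.computable k (\<lambda>w M xs. 2 ^ m w (TArr s t))"
      by (rule tm.comp_pow2[OF 1, where B = "\<lambda>n. msz K (Suc (n + length cs)) (TArr s t)"]) (simp_all only: D_def)
    then show ?thesis by (simp add: asz_def del: msz.simps)
  qed
  with 1 show ?case by blast
qed

lemmas c_msz = conjunct1[OF c_msz_asz] and c_asz = mp[OF conjunct2[OF c_msz_asz]]

lemma c_pr: "ord s \<le> K \<Longrightarrow> tm.computable k f \<Longrightarrow> tm.computable k g \<Longrightarrow>
    tm.computable k (\<lambda>w M xs. pr K (D w) s (f w M xs) (g w M xs))"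
  unfolding pr_def by (intro tm.comp_suc tm.comp_add tm.comp_mult c_asz)

text \<open>Turns a question about a value into comparisons on its code and a finite case
  distinction over \<open>cs\<close>, both of which the machine can perform.\<close>

lemma root_iff: "root w x c n \<longleftrightarrow> (x < length w \<and> c = ''cons'' \<and> n = 2) \<or> (x = length w \<and> c = ''nil'' \<and> n = 0) \<or>
    (\<exists>j<length cs. x = Suc (length w + j) \<and> (\<exists>vs. cs ! j = VCon c vs \<and> length vs = n))"
proof -
  consider "x < length w" | "x = length w" | j where "j < length cs" "x = Suc (length w + j)" | "D w \<le> x"
    unfolding D_def by (metis add_Suc_right less_iff_Suc_add linorder_neqE_nat nat_add_left_cancel_less not_le_imp_less not_less_eq)
  then show ?thesis
  proof cases
    case 1
    then show ?thesis by (auto simp: root_def den_def input_val_drop)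
  next
    case 2
    then show ?thesis by (auto simp: root_def den_def input_val_def)
  next
    case 3
    then show ?thesis by (auto simp: root_def den_def D_def)
  next
    case 4
    then show ?thesis by (auto simp: root_def den_def D_def)
  qed
qed

lemma c_root: "tm.computable k f \<Longrightarrow> tm.pcomp k (\<lambda>w M xs. root w (f w M xs) c n)"
  unfolding root_iff
  by (intro tm.pcomp_disj tm.pcomp_conj tm.pcomp_less tm.pcomp_eq tm.pcomp_fin_ex tm.pcomp_const tm.comp_length
      tm.comp_suc tm.comp_add tm.comp_const)

lemma c_child: assumes f: "tm.computable k f" shows "tm.computable k (\<lambda>w M xs. child w (f w M xs) i)"
proof -
  \<comment> \<open>\<open>[] ! i\<close> is the unspecified entry that \<open>child\<close> meets
    when the value has no arguments; using the same term makes the finite table agree with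
    \<open>child\<close> on every code.\<close>
  let ?d = "\<lambda>w. code w ([] ! i)"
  have tab: "tm.computable k (\<lambda>w M xs. if \<exists>j<N. f w M xs = Suc (length w + j)
      then code w (vargs (cs ! (f w M xs - Suc (length w))) ! i) else ?d w)" for N
  proof (induction N)
    case 0
    show ?case using c_code by simp
  next
    case (Suc N)
    have "tm.pcomp k (\<lambda>w M xs. f w M xs = Suc (length w + N))"
      by (intro tm.pcomp_eq f tm.comp_suc tm.comp_add tm.comp_length tm.comp_const)
    from tm.comp_ite[OF this c_code[of _ "vargs (cs ! N) ! i"] Suc]
    show ?case by (rule tm.comp_cong) (auto simp: less_Suc_eq)
  qed
  have l: "tm.pcomp k (\<lambda>w M xs. f w M xs < length w)" by (intro tm.pcomp_less f tm.comp_length)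
  have b: "tm.computable k (\<lambda>w M xs. if f w M xs < length w \<and> w ! f w M xs then code w (bool_val True) else code w (bool_val False))"
    by (rule tm.comp_ite[OF tm.pcomp_input[OF f] c_code c_code])
  have "tm.computable k (\<lambda>w M xs. if f w M xs < length w then
      (if i = 0 then (if f w M xs < length w \<and> w ! f w M xs then code w (bool_val True) else code w (bool_val False)) else Suc (f w M xs))
      else (if \<exists>j<length cs. f w M xs = Suc (length w + j)
      then code w (vargs (cs ! (f w M xs - Suc (length w))) ! i) else ?d w))"
    by (rule tm.comp_ite[OF l _ tab]) (cases "i = 0"; simp add: b tm.comp_suc[OF f])
  then show ?thesis
  proof (rule tm.comp_cong)
    fix w :: "bool list" and M :: tracks and xs :: "nat list"
    let ?x = "f w M xs"
    have "vargs (den w ?x) = (if \<exists>j<length cs. ?x = Suc (length w + j) then vargs (cs ! (?x - Suc (length w))) else [])"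
      if "\<not> ?x < length w"
    proof (cases "?x = length w")
      case True
      then show ?thesis by (auto simp: den_def input_val_def)
    next
      case False
      then have "(\<exists>j<length cs. ?x = Suc (length w + j)) \<longleftrightarrow> ?x < D w"
        using that by (auto simp: D_def intro!: exI[of _ "?x - Suc (length w)"])
      then show ?thesis using that False by (simp add: den_def)
    qed
    then show "child w ?x i = (if ?x < length w then
      (if i = 0 then (if ?x < length w \<and> w ! ?x then code w (bool_val True) else code w (bool_val False)) else Suc ?x)
      else (if \<exists>j<length cs. ?x = Suc (length w + j)
      then code w (vargs (cs ! (?x - Suc (length w))) ! i) else ?d w))"
      by (auto simp: child_def)
  qed
qed

lemma den_VCon_less: "den w x = VCon c vs \<Longrightarrow> x < D w"
  by (auto simp: den_def D_def split: if_splits)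

lemma c_match:
  "distinct (pat_vars l) \<Longrightarrow> tm.computable k f \<Longrightarrow> tm.pcomp k (\<lambda>w M xs. \<exists>g. inst g l = den w (f w M xs))"
proof (induction l arbitrary: f)
  case (PVar v)
  have "\<exists>g. inst g (PVar v) = y" for y by (rule exI[of _ "\<lambda>_. y"]) simp
  then show ?case using tm.pcomp_const[of k True] by simp
next
  case (PCon c ls)
  have "tm.pcomp k (\<lambda>w M xs. root w (f w M xs) c (length ls) \<and>
      (\<forall>i<length ls. \<exists>g. inst g (ls ! i) = den w (child w (f w M xs) i)))"
  proof (intro tm.pcomp_conj c_root tm.pcomp_fin_all PCon.prems)
    fix i assume i: "i < length ls"
    have "distinct (pat_vars (ls ! i))" using PCon.prems(1) i by (auto simp: distinct_concat_iff)
    then show "tm.pcomp k (\<lambda>w M xs. \<exists>g. inst g (ls ! i) = den w (child w (f w M xs) i))"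
      by (rule PCon.IH[OF nth_mem[OF i] _ c_child[OF PCon.prems(2)]])
  qed
  then show ?case
  proof (rule tm.pcomp_cong)
    fix w :: "bool list" and M :: tracks and xs :: "nat list"
    let ?x = "f w M xs"
    have "(\<exists>g. inst g (PCon c ls) = den w ?x) \<longleftrightarrow> (\<exists>vs. den w ?x = VCon c vs \<and> (\<exists>g. map (inst g) ls = vs))"
      by (metis inst.simps(2))
    also have "\<dots> \<longleftrightarrow> (\<exists>vs. den w ?x = VCon c vs \<and> length ls = length vs \<and> (\<forall>i<length ls. \<exists>g. inst g (ls ! i) = vs ! i))"
      using ex_inst_iff[of ls] PCon.prems(1) by simp
    also have "\<dots> \<longleftrightarrow> root w ?x c (length ls) \<and> (\<forall>i<length ls. \<exists>g. inst g (ls ! i) = den w (child w ?x i))"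
    proof (cases "\<exists>vs. den w ?x = VCon c vs \<and> length ls = length vs")
      case True
      then obtain vs where vs: "den w ?x = VCon c vs" "length ls = length vs" by blast
      have "den w (child w ?x i) = vs ! i" if "i < length ls" for i
        using child[OF den_VCon_less[OF vs(1)] vs(1)] that vs(2) by simp
      then show ?thesis using vs by (auto simp: root_def)
    next
      case False
      then show ?thesis by (auto simp: root_def)
    qed
    finally show "(\<exists>g. inst g (PCon c ls) = den w ?x) \<longleftrightarrow>
      root w ?x c (length ls) \<and> (\<forall>i<length ls. \<exists>g. inst g (ls ! i) = den w (child w ?x i))" .
  qed
qed

lemma occ_PVar: "occ w (PVar v) x e y \<longleftrightarrow> e = Var v \<and> x = y"
  using occ_here[of w "PVar v" x] by (auto elim: occ.cases)

lemma occ_PCon: "occ w (PCon c ls) x e y \<longleftrightarrow> (e = pat_expr (PCon c ls) \<and> x = y) \<or>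
    (\<exists>i<length ls. occ w (ls ! i) (child w x i) e y)"
  using occ_here[of w "PCon c ls" x] by (auto elim: occ.cases intro: occ_child)

lemma c_occ: "tm.computable k f \<Longrightarrow> tm.computable k g \<Longrightarrow> tm.pcomp k (\<lambda>w M xs. occ w l (f w M xs) e (g w M xs))"
proof (induction l arbitrary: f)
  case (PVar v)
  then show ?case unfolding occ_PVar by (intro tm.pcomp_conj tm.pcomp_const tm.pcomp_eq)
next
  case (PCon c ls)
  show ?case unfolding occ_PCon
    by (intro tm.pcomp_disj tm.pcomp_conj tm.pcomp_const tm.pcomp_eq tm.pcomp_fin_ex PCon.prems
        PCon.IH[OF nth_mem] c_child)
qed

lemma c_Ec: assumes "length (cpats cl) \<le> n"
  shows "tm.pcomp (Suc n) (\<lambda>w M xs. Ec w cl e (take n xs) (xs ! n))"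
proof (cases "is_data e \<and> dval e \<in> set cs")
  case True
  then show ?thesis by (simp add: tm.pcomp_eq[OF tm.comp_var c_code])
next
  case False
  have "tm.pcomp (Suc n) (\<lambda>w M xs. \<exists>i<length (cpats cl). occ w (cpats cl ! i) (take n xs ! i) e (xs ! n))"
    by (intro tm.pcomp_fin_ex c_occ tm.comp_nth_take tm.comp_var) (use assms in auto)
  then show ?thesis using False by (simp only: Ec.simps if_False)
qed

lemma c_of_tracks: "tm.computable k g \<Longrightarrow> tm.pcomp k (\<lambda>w M xs. of_tracks M f (g w M xs))"
  unfolding of_tracks_def
  by (intro tm.pcomp_fin_ex tm.pcomp_conj tm.pcomp_const tm.pcomp_mem)

text \<open>Positions below \<open>n\<close> hold the argument codes and position \<open>n\<close>
  the observation. Variables bound by the quantifiers inside \<open>E\<close> come behind, which is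
  why the arguments are written \<open>take n xs\<close>.\<close>

lemma c_E:
  assumes n: "length (cpats cl) \<le> n"
  shows "tm.pcomp (Suc n) (\<lambda>w M xs. E w (of_tracks M) cl e (take n xs) (xs ! n))"
proof (induction e)
  case (Var x)
  show ?case
  proof (cases "\<Gamma> cl x")
    case (TSort s)
    then show ?thesis using c_Ec[OF n, of "Var x"] by (simp only: E.simps sty.case)
  next
    case (TProd s t)
    then show ?thesis by (simp add: tm.pcomp_eq[OF tm.comp_var tm.comp_zero])
  next
    case (TArr s t)
    have "tm.pcomp (Suc n) (\<lambda>w M xs. \<exists>i<length (cpats cl). cpats cl ! i = PVar x \<and> xs ! n < m w (\<Gamma> cl x) \<and> bit (take n xs ! i) (xs ! n))"
      by (intro tm.pcomp_fin_ex tm.pcomp_conj tm.pcomp_const tm.pcomp_less tm.pcomp_bit c_msz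
          tm.comp_nth_take tm.comp_var) (use n in auto)
    then show ?thesis using TArr by (simp only: E.simps sty.case)
  qed
next
  case (Con c)
  then show ?case using c_Ec[OF n, of "Con c"] by (simp only: E.simps)
next
  case (Fun f)
  then show ?case by (simp only: E.simps) (intro c_of_tracks tm.comp_var, simp)
next
  case (If x y z)
  have ex: "tm.pcomp (Suc n) (\<lambda>w M xs. \<exists>v<D w. root w v c 0 \<and> E w (of_tracks M) cl x (take n xs) v)" for c
  proof (rule tm.pcomp_ex[OF c_D])
    show "tm.pcomp (Suc (Suc n)) (\<lambda>w M xs. root w (xs ! Suc n) c 0 \<and>
        E w (of_tracks M) cl x (take n (take (Suc n) xs)) (xs ! Suc n))"
      using tm.pcomp_env[OF If.IH(1) tm.comp_var[of "Suc n" "Suc (Suc n)"]]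
      by (intro tm.pcomp_conj c_root tm.comp_var) (simp_all add: min_absorb1)
  qed
  show ?case unfolding E.simps by (intro tm.pcomp_disj tm.pcomp_conj ex If.IH)
next
  case (Choose ss)
  show ?case using tm.pcomp_const[of _ False] by simp
next
  case (Pair x y)
  have ex: "tm.pcomp (Suc n) (\<lambda>w M xs. \<exists>v<m w t. E w (of_tracks M) cl x (take n xs) v)"
    if IH: "tm.pcomp (Suc n) (\<lambda>w M xs. E w (of_tracks M) cl x (take n xs) (xs ! n))" for x t
  proof (rule tm.pcomp_ex[OF c_msz])
    show "tm.pcomp (Suc (Suc n)) (\<lambda>w M xs. E w (of_tracks M) cl x (take n (take (Suc n) xs)) (xs ! Suc n))"
      using tm.pcomp_env[OF IH tm.comp_var[of "Suc n" "Suc (Suc n)"]] by (simp add: min_absorb1)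
  qed
  show ?case unfolding E.simps
    by (intro tm.pcomp_conj ex Pair.IH tm.pcomp_eq tm.comp_var tm.comp_zero) simp
next
  case (App s t)
  show ?case
  proof (cases "conhead s")
    case True
    then show ?thesis using c_Ec[OF n, of "App s t"] by (simp only: E.simps if_True)
  next
    case False
    show ?thesis
    proof (cases "\<exists>\<sigma> \<tau>. ty (\<Gamma> cl) s = TArr \<sigma> \<tau> \<and> ord \<sigma> \<le> K")
      case True
      then obtain \<sigma> \<tau> where t: "ty (\<Gamma> cl) s = TArr \<sigma> \<tau>" "ord \<sigma> \<le> K" by blast
      let ?L = "\<lambda>M. of_tracks M"
      have env: "tm.pcomp k (\<lambda>w M xs. E w (of_tracks M) cl e (take n xs) (g w M xs))"
        if "e = s \<or> e = t" "tm.computable k g" "n \<le> k" for e k g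
        using that tm.pcomp_env[OF App.IH(1)] tm.pcomp_env[OF App.IH(2)] by blast
      have "tm.pcomp (Suc n) (\<lambda>w M xs. \<exists>A<a w \<sigma>.
        (if is_arr \<sigma> then E w (?L M) cl t (take n xs) 0 \<and> (\<forall>v<m w \<sigma>. bit A v \<longrightarrow> E w (?L M) cl t (take n xs) v)
         else E w (?L M) cl t (take n xs) A) \<and> E w (?L M) cl s (take n xs) (pr K (D w) \<sigma> A (xs ! n)))"
      proof (rule tm.pcomp_ex[OF c_asz[OF t(2)]])
        let ?Q = "\<lambda>w M xs. if is_arr \<sigma> then E w (?L M) cl t (take n xs) 0 \<and>
            (\<forall>v<m w \<sigma>. bit (xs ! Suc n) v \<longrightarrow> E w (?L M) cl t (take n xs) v)
            else E w (?L M) cl t (take n xs) (xs ! Suc n)"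
        have all: "tm.pcomp (Suc (Suc n)) (\<lambda>w M xs. \<forall>v<m w \<sigma>. bit (xs ! Suc n) v \<longrightarrow> E w (?L M) cl t (take n xs) v)"
        proof (rule tm.pcomp_all[OF c_msz])
          have "tm.pcomp (Suc (Suc (Suc n))) (\<lambda>w M xs. bit (xs ! Suc n) (xs ! Suc (Suc n)) \<longrightarrow>
              E w (?L M) cl t (take n xs) (xs ! Suc (Suc n)))"
            by (intro tm.pcomp_imp tm.pcomp_bit tm.comp_var env) simp_all
          then show "tm.pcomp (Suc (Suc (Suc n))) (\<lambda>w M xs. bit (take (Suc (Suc n)) xs ! Suc n) (xs ! Suc (Suc n)) \<longrightarrow>
              E w (?L M) cl t (take n (take (Suc (Suc n)) xs)) (xs ! Suc (Suc n)))"
            by (simp add: min_absorb1)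
        qed
        have Q: "tm.pcomp (Suc (Suc n)) ?Q"
        proof (cases "is_arr \<sigma>")
          case True
          show ?thesis unfolding if_P[OF True]
            by (intro tm.pcomp_conj all env tm.comp_zero) simp_all
        next
          case False
          show ?thesis unfolding if_not_P[OF False] by (intro env tm.comp_var) simp_all
        qed
        have "tm.pcomp (Suc (Suc n)) (\<lambda>w M xs. ?Q w M xs \<and>
            E w (?L M) cl s (take n xs) (pr K (D w) \<sigma> (xs ! Suc n) (xs ! n)))"
          by (intro tm.pcomp_conj Q env c_pr t tm.comp_var) simp_all
        then show "tm.pcomp (Suc (Suc n)) (\<lambda>w M xs. (if is_arr \<sigma> then E w (?L M) cl t (take n (take (Suc n) xs)) 0 \<and>
            (\<forall>v<m w \<sigma>. bit (xs ! Suc n) v \<longrightarrow> E w (?L M) cl t (take n (take (Suc n) xs)) v)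
            else E w (?L M) cl t (take n (take (Suc n) xs)) (xs ! Suc n)) \<and>
            E w (?L M) cl s (take n (take (Suc n) xs)) (pr K (D w) \<sigma> (xs ! Suc n) (take (Suc n) xs ! n)))"
          by (simp add: min_absorb1 cong del: if_weak_cong)
      qed
      then show ?thesis using False t by (simp only: E.simps sty.case if_False simp_thms)
    next
      case no: False
      have "\<not> E w (of_tracks M) cl (App s t) As u" for w M As u
        using no False by (auto split: sty.splits)
      then show ?thesis using tm.pcomp_const[of _ False] by simp
    qed
  qed
qed

lemma c_body:
  assumes "n = arity p f"
  shows "tm.pcomp (Suc n) (\<lambda>w M xs. body w (of_tracks M) f (take n xs) (xs ! n))"
proof -
  have fits: "tm.pcomp (Suc n) (\<lambda>w M xs. cfun (p ! i) = f \<and> fits w (p ! i) (take n xs))" if "i < length p" for i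
  proof (cases "cfun (p ! i) = f")
    case True
    have cl: "p ! i \<in> set p" using that by simp
    have len: "length (cpats (p ! i)) = n" using arity_clause[OF cl] True assms by simp
    have "distinct (pat_vars (cpats (p ! i) ! k))" if "k < length (cpats (p ! i))" for k
      using linear[OF cl] that by (auto simp: lhs_vars_def distinct_concat_iff)
    then have "tm.pcomp (Suc n) (\<lambda>w M xs. fits w (p ! i) (take n xs))"
      unfolding fits_def by (intro tm.pcomp_fin_all c_match tm.comp_nth_take) (simp_all add: len)
    then show ?thesis using True by simp
  next
    case False
    then show ?thesis using tm.pcomp_const[of _ False] by simp
  qed
  have E: "tm.pcomp (Suc n) (\<lambda>w M xs. cfun (p ! i) = f \<and> E w (of_tracks M) (p ! i) (crhs (p ! i)) (take n xs) (xs ! n))"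
    if "i < length p" for i
  proof (cases "cfun (p ! i) = f")
    case True
    have cl: "p ! i \<in> set p" using that by simp
    show ?thesis using c_E[of "p ! i" n] arity_clause[OF cl] True assms by simp
  next
    case False
    then show ?thesis using tm.pcomp_const[of _ False] by simp
  qed
  have "tm.pcomp (Suc n) (\<lambda>w M xs. \<exists>i<length p. (cfun (p ! i) = f \<and> fits w (p ! i) (take n xs)) \<and>
     (\<forall>j<i. \<not> (cfun (p ! j) = f \<and> fits w (p ! j) (take n xs))) \<and>
     (cfun (p ! i) = f \<and> E w (of_tracks M) (p ! i) (crhs (p ! i)) (take n xs) (xs ! n)))"
    by (intro tm.pcomp_fin_ex tm.pcomp_conj fits E tm.pcomp_fin_all tm.pcomp_not) auto
  then show ?thesis by (rule tm.pcomp_cong) (auto simp: body_def)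
qed

lemma c_peel:
  "n + k = arity p f \<Longrightarrow> t = tdrop n (Fd f) \<Longrightarrow>
    tm.pcomp (Suc n) (\<lambda>w M xs. peel w k t (body w (of_tracks M) f) (take n xs) (xs ! n))"
proof (induction k arbitrary: n t)
  case 0
  then show ?case using c_body[of n f] by simp
next
  case (Suc k)
  then have l: "n < arity p f" by simp
  then obtain s r where t: "t = TArr s r" using arity_arr Suc.prems(2) by blast
  have s: "s = targs (Fd f) ! n" "r = tdrop (Suc n) (Fd f)" using tdrop_Suc t Suc.prems(2) by metis+
  have o: "ord s \<le> K" using arg_ord(1)[OF l] s(1) by simp
  let ?P = "\<lambda>w M xs. peel w k r (body w (of_tracks M) f) xs"
  have IH: "tm.pcomp (Suc (Suc n)) (\<lambda>w M xs. ?P w M (take (Suc n) xs) (xs ! Suc n))"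
    using Suc.IH[of "Suc n" r] Suc.prems(1) s(2) by simp
  \<comment> \<open>The induction hypothesis expects the new code directly behind the prefix, but
    position \<open>n\<close> is taken by the observation being decoded; the renaming skips
    it.\<close>
  have IH': "tm.pcomp (Suc (Suc (Suc n))) (\<lambda>w M xs. ?P w M (take n xs @ [xs ! Suc n]) (xs ! Suc (Suc n)))"
  proof (rule tm.pcomp_cong[OF tm.comp_rename[OF IH, of "[0..<n] @ [Suc n, Suc (Suc n)]"]])
    fix w :: "bool list" and M :: tracks and xs :: "nat list" assume "length xs = Suc (Suc (Suc n))"
    then have "take n xs = map ((!) xs) [0..<n]" by (intro nth_equalityI) auto
    then show "?P w M (take n xs @ [xs ! Suc n]) (xs ! Suc (Suc n)) \<longleftrightarrow>
      ?P w M (take (Suc n) (map ((!) xs) ([0..<n] @ [Suc n, Suc (Suc n)])))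
        (map ((!) xs) ([0..<n] @ [Suc n, Suc (Suc n)]) ! Suc n)"
      by (simp add: nth_append)
  qed auto
  have "tm.pcomp (Suc n) (\<lambda>w M xs. xs ! n = 0 \<or> (\<exists>A<a w s. \<exists>v<xs ! n. xs ! n = pr K (D w) s A v \<and>
      ?P w M (take n xs @ [A]) v))"
  proof (intro tm.pcomp_disj tm.pcomp_eq tm.comp_var tm.comp_zero lessI tm.pcomp_ex[OF c_asz[OF o]])
    have "tm.pcomp (Suc (Suc n)) (\<lambda>w M xs. \<exists>v<xs ! n. xs ! n = pr K (D w) s (xs ! Suc n) v \<and>
        ?P w M (take n xs @ [xs ! Suc n]) v)"
    proof (rule tm.pcomp_ex)
      have "tm.pcomp (Suc (Suc (Suc n))) (\<lambda>w M xs. xs ! n = pr K (D w) s (xs ! Suc n) (xs ! Suc (Suc n)) \<and>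
        ?P w M (take n xs @ [xs ! Suc n]) (xs ! Suc (Suc n)))"
        by (intro tm.pcomp_conj IH' tm.pcomp_eq tm.comp_var c_pr o) simp_all
      then show "tm.pcomp (Suc (Suc (Suc n))) (\<lambda>w M xs. take (Suc (Suc n)) xs ! n =
          pr K (D w) s (take (Suc (Suc n)) xs ! Suc n) (xs ! Suc (Suc n)) \<and>
          ?P w M (take n (take (Suc (Suc n)) xs) @ [take (Suc (Suc n)) xs ! Suc n]) (xs ! Suc (Suc n)))"
        by (simp add: min_absorb1)
    qed (simp add: tm.comp_var)
    then show "tm.pcomp (Suc (Suc n)) (\<lambda>w M xs. \<exists>v<take (Suc n) xs ! n. take (Suc n) xs ! n = pr K (D w) s (xs ! Suc n) v \<and>
        ?P w M (take n (take (Suc n) xs) @ [xs ! Suc n]) v)"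
      by (simp add: min_absorb1)
  qed
  then show ?case unfolding t peel.simps .
qed

theorem lang_EXPTIME:
  assumes F: "Fd (main_fun p) = TArr (TSort ''list'') (TSort ''bool'')"
  shows "{w. w \<noteq> [] \<and> accepts p w} \<in> EXPTIME K"
proof -
  have "{w. w \<noteq> [] \<and> (\<exists>y<D w. root w y ''true'' 0 \<and> of_tracks (facts w) (main_fun p) (pr K (D w) (TSort ''list'') 0 y))} \<in> EXPTIME K"
  proof (rule tm.fixpoint_EXPTIME[where m = "\<lambda>j w. m w (Fd (fs ! j))" and \<Phi> = "\<lambda>j w M u. Phi w (fs ! j) (of_tracks M) u"
        and acc = "\<lambda>w M. \<exists>y<D w. root w y ''true'' 0 \<and> of_tracks M (main_fun p) (pr K (D w) (TSort ''list'') 0 y)"])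
    fix w M M' j u assume "M \<le> M'" "Phi w (fs ! j) (of_tracks M) u"
    then show "Phi w (fs ! j) (of_tracks M') u" using fixpoint_iteration.mono[OF fixpoint_iteration_Phi] by blast
  next
    fix j
    show "tm.computable 0 (\<lambda>w M xs. m w (Fd (fs ! j)))" by (rule c_msz)
    have "tm.pcomp (Suc 0) (\<lambda>w M xs. peel w (arity p (fs ! j)) (Fd (fs ! j)) (body w (of_tracks M) (fs ! j)) (take 0 xs) (xs ! 0))"
      by (rule c_peel) simp_all
    then show "tm.pcomp 1 (\<lambda>w M xs. Phi w (fs ! j) (of_tracks M) (xs ! 0))" by (simp add: Phi_def)
  next
    show "tm.pcomp 0 (\<lambda>w M xs. \<exists>y<D w. root w y ''true'' 0 \<and> of_tracks M (main_fun p) (pr K (D w) (TSort ''list'') 0 y))"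
      by (rule tm.pcomp_ex[OF c_D], intro tm.pcomp_conj c_root c_of_tracks c_pr tm.comp_var tm.comp_zero) simp_all
  qed
  then show ?thesis unfolding accepts_iff[OF F] L_def .
qed

end

subsection \<open>Cons-free programs stay within the growth rate\<close>

fun svals :: "val \<Rightarrow> val set" where
  "svals (VCon c vs) = insert (VCon c vs) (\<Union>v\<in>set vs. svals v)"
| "svals v = {v}"

lemma svals_self: "v \<in> svals v" by (cases v) auto

lemma finite_svals: "finite (svals v)" by (induction v) auto

lemma svals_closed: "u \<in> svals v \<Longrightarrow> set (vargs u) \<subseteq> svals v"
proof (induction v)
  case (VCon c vs)
  show ?case
  proof (cases "u = VCon c vs")
    case True
    then show ?thesis using svals_self by fastforce
  next
    case False
    then obtain v where "v \<in> set vs" "u \<in> svals v" using VCon.prems by auto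
    then show ?thesis using VCon.IH[of v] by auto
  qed
qed auto

text \<open>A finite superset of the constructor terms that matter: function parts of applications
  are kept as well, and \<open>dval\<close> of an expression that is not data merely adds a further
  constant.\<close>

fun nodes :: "expr \<Rightarrow> expr set" where
  "nodes (If a b c) = insert (If a b c) (nodes a \<union> nodes b \<union> nodes c)"
| "nodes (Pair a b) = insert (Pair a b) (nodes a \<union> nodes b)"
| "nodes (App a b) = insert (App a b) (nodes a \<union> nodes b)"
| "nodes e = {e}"

lemma finite_nodes: "finite (nodes e)" by (induction e) auto

lemma nodes_self: "e \<in> nodes e" by (cases e) auto

lemma fa_apps_Con: "fa ar n (apps h ss) \<Longrightarrow> fa ar (n + length ss) h"
  by (induction ss arbitrary: n rule: rev_induct) (auto, metis add_Suc)

text \<open>\<open>n\<close> counts the arguments still to come. The head of an application is not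
  one of its sub-expressions, so cons-freeness speaks about \<open>e\<close> itself only if
  \<open>n = 0\<close>.\<close>

lemma ok_intro:
  assumes "fa ar n e" "\<not> has_choose e" "expr_vars e \<subseteq> set (lhs_vars cl)" "dval ` nodes e \<subseteq> B"
    "n = 0 \<or> \<not> conhead e"
    "\<And>t c ss. ssub e t \<or> n = 0 \<and> e = t \<Longrightarrow> t = apps (Con c) ss \<Longrightarrow>
        is_data t \<or> (\<exists>l\<in>set (cpats cl). sub (pat_expr l) t)"
  shows "ok ar B cl e"
  using assms
proof (induction e arbitrary: n)
  case (Con c)
  then have "n = 0" by simp
  then show ?case using Con.prems(1,4) Con.prems(6)[of "Con c" c "[]"] by auto
next
  case (If x y z)
  have "ok ar B cl x" by (rule If.IH(1)[of 0]) (use If.prems in \<open>auto intro: ssub.intros\<close>)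
  moreover have "ok ar B cl y" by (rule If.IH(2)[of 0]) (use If.prems in \<open>auto intro: ssub.intros\<close>)
  moreover have "ok ar B cl z" by (rule If.IH(3)[of 0]) (use If.prems in \<open>auto intro: ssub.intros\<close>)
  ultimately show ?case by simp
next
  case (Pair x y)
  have "ok ar B cl x" by (rule Pair.IH(1)[of 0]) (use Pair.prems in \<open>auto intro: ssub.intros\<close>)
  moreover have "ok ar B cl y" by (rule Pair.IH(2)[of 0]) (use Pair.prems in \<open>auto intro: ssub.intros\<close>)
  ultimately show ?case by simp
next
  case (App s t)
  show ?case
  proof (cases "conhead s")
    case True
    then have n: "n = 0" using App.prems(5) by simp
    have "conhead (App s t)" using True by simp
    then obtain c ss where e: "App s t = apps (Con c) ss" using conheadE by blast
    have "length ss = ar c" using fa_apps_Con[of ar 0 "Con c" ss] App.prems(1) n e by simp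
    moreover have "is_data (App s t) \<or> (\<exists>l\<in>set (cpats cl). sub (pat_expr l) (App s t))"
      using App.prems(6)[of "App s t" c ss] n e by blast
    moreover have "dval (App s t) \<in> B" using App.prems(4) nodes_self by blast
    ultimately show ?thesis unfolding ok.simps if_P[OF True] using e by blast
  next
    case False
    have "ok ar B cl s"
    proof (rule App.IH(1)[of "Suc n"])
      fix x c ss assume "ssub s x \<or> Suc n = 0 \<and> s = x" "x = apps (Con c) ss"
      then show "is_data x \<or> (\<exists>l\<in>set (cpats cl). sub (pat_expr l) x)"
        using App.prems(6)[of x c ss] ssub.intros(7)[of s x t] by blast
    qed (use App.prems(1-4) False in auto)
    moreover have "ok ar B cl t"
    proof (rule App.IH(2)[of 0])
      fix x c ss assume "ssub t x \<or> 0 = (0::nat) \<and> t = x" "x = apps (Con c) ss"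
      then show "is_data x \<or> (\<exists>l\<in>set (cpats cl). sub (pat_expr l) x)"
        using App.prems(6)[of x c ss] ssub.intros(8)[of t x s] by blast
    qed (use App.prems(1-4) in auto)
    ultimately show ?thesis using False by simp
  qed
qed auto

theorem program_EXPTIME:
  assumes "det_wf_cf_prog K p" "\<forall>w\<in>lang p. w \<noteq> []"
  shows "lang p \<in> EXPTIME K"
proof -
  obtain Fc Fd where d: "deterministic p" "cons_free p" "typed_data_order Fc Fd p K" "well_formed Fc p" "io_signature Fc Fd p"
    using assms(1) unfolding det_wf_cf_prog_def by blast
  have cl: "\<forall>cl\<in>set p. \<exists>G t. (\<forall>x\<in>set (lhs_vars cl). ord (G x) \<le> K) \<and> has_type Fc Fd G (lhs cl) t \<and> has_type Fc Fd G (crhs cl) t"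
    using d(3) unfolding typed_data_order_def by blast
  obtain \<Gamma> where "\<forall>cl\<in>set p. \<exists>t. (\<forall>x\<in>set (lhs_vars cl). ord (\<Gamma> cl x) \<le> K) \<and>
      has_type Fc Fd (\<Gamma> cl) (lhs cl) t \<and> has_type Fc Fd (\<Gamma> cl) (crhs cl) t"
    using bchoice[OF cl] by blast
  from bchoice[OF this] obtain ct where ct: "\<And>cl. cl \<in> set p \<Longrightarrow> (\<forall>x\<in>set (lhs_vars cl). ord (\<Gamma> cl x) \<le> K) \<and>
      has_type Fc Fd (\<Gamma> cl) (lhs cl) (ct cl) \<and> has_type Fc Fd (\<Gamma> cl) (crhs cl) (ct cl)" by blast
  define B where "B = (\<Union>cl\<in>set p. \<Union>e\<in>nodes (crhs cl). svals (dval e)) \<union> range bool_val"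
  have "finite B" unfolding B_def by (auto simp: finite_svals finite_nodes)
  then obtain cs where cs: "set cs = B" using finite_list by blast
  have closed: "set (vargs v) \<subseteq> B" if "v \<in> B" for v
  proof -
    consider b where "v = bool_val b" | cl e where "cl \<in> set p" "e \<in> nodes (crhs cl)" "v \<in> svals (dval e)"
      using \<open>v \<in> B\<close> unfolding B_def by blast
    then show ?thesis
    proof cases
      case 1
      then show ?thesis by (simp add: bool_val_def)
    next
      case 2
      then show ?thesis using svals_closed[OF 2(3)] unfolding B_def by blast
    qed
  qed
  interpret typed_program p K Fc Fd \<Gamma> ct cs
  proof
    fix cl assume c: "cl \<in> set p"
    show nc: "\<not> has_choose (crhs cl)" using d(1) c unfolding deterministic_def by blast
    show ev: "expr_vars (crhs cl) \<subseteq> set (lhs_vars cl)" and "distinct (lhs_vars cl)"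
      using d(3) c unfolding typed_data_order_def by blast+
    show "length (cpats cl) = length (cpats cl')" if "cl' \<in> set p" "cfun cl = cfun cl'" for cl'
      using d(4) c that unfolding well_formed_def by blast
    show "ord (\<Gamma> cl x) \<le> K" if "x \<in> set (lhs_vars cl)" for x using ct[OF c] that by blast
    show "has_type Fc Fd (\<Gamma> cl) (lhs cl) (ct cl)" "has_type Fc Fd (\<Gamma> cl) (crhs cl) (ct cl)" using ct[OF c] by blast+
    show "fa (\<lambda>c. length (targs (Fc c))) 0 (lhs cl)" using d(4) c unfolding well_formed_def by blast
    show "ok (\<lambda>c. length (targs (Fc c))) (set cs) cl (crhs cl)"
    proof (rule ok_intro)
      show "fa (\<lambda>c. length (targs (Fc c))) 0 (crhs cl)" using d(4) c unfolding well_formed_def by blast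
      show "dval ` nodes (crhs cl) \<subseteq> set cs" unfolding cs B_def using c svals_self by blast
      show "is_data t \<or> (\<exists>l\<in>set (cpats cl). sub (pat_expr l) t)"
        if "ssub (crhs cl) t \<or> 0 = 0 \<and> crhs cl = t" "t = apps (Con x) ss" for t x ss
        using d(2) c that unfolding cons_free_def cons_free_clause_def sub_def by blast
    qed (use nc ev in auto)
  next
    show "ord s = 0" if "s \<in> set (targs (Fc c))" for s c using d(3) that unfolding typed_data_order_def by blast
    show "is_sort (tres (Fc c))" for c using d(3) unfolding typed_data_order_def by blast
    show "bool_val b \<in> set cs" for b unfolding cs B_def by blast
    show "set (vargs v) \<subseteq> set cs" if "v \<in> set cs" for v using closed that cs by blast
  qed
  have "Fd (main_fun p) = TArr (TSort ''list'') (TSort ''bool'')" using d(5) unfolding io_signature_def by blast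
  from lang_EXPTIME[OF this] have "{w. w \<noteq> [] \<and> accepts p w} \<in> EXPTIME K" .
  moreover have "lang p = {w. w \<noteq> [] \<and> accepts p w}" using assms(2) by (auto simp: lang_def)
  ultimately show ?thesis by simp
qed

subsection \<open>A cons-free program for a cellular automaton\<close>

text \<open>The automaton computes the cell at position \<open>i\<close> and time \<open>t + 1\<close> from the cells at positions \<open>i - 2\<close>,
  \<open>i - 1\<close> and \<open>i\<close> at time \<open>t\<close>, so that the program only has to count down. Numbers of level 0
  are \<open>b\<close> digits, each a suffix of the input and passed as a separate argument; a number of level
  \<open>k + 1\<close> is the function that maps the numbers of level \<open>k\<close> to its binary digits.\<close>

datatype fn = Main | IsAcc | Rule | Init0 | Initw | Init | Cell | Cellp
  | Isz nat | Zlow nat | Prd nat | Ones nat | Digit nat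

instance fn :: countable by countable_datatype

text \<open>Names are unary numbers, so \<open>Fd\<close> can recover the symbol from the length of
  its name.\<close>

definition nm :: "fn \<Rightarrow> string" where "nm f = replicate (to_nat f) CHR ''f''"

lemma nm_inject [simp]: "nm f = nm g \<longleftrightarrow> f = g"
  by (simp add: nm_def replicate_eq_replicate)

definition vn :: "nat \<Rightarrow> string" where "vn i = replicate i CHR ''x''"

lemma length_vn [simp]: "length (vn i) = i" by (simp add: vn_def)
lemma vn_inject [simp]: "vn i = vn j \<longleftrightarrow> i = j" by (metis length_vn)

definition cn :: "nat \<Rightarrow> string" where "cn i = CHR ''#'' # replicate i CHR ''a''"

lemma cn_inject [simp]: "cn i = cn j \<longleftrightarrow> i = j"
  by (simp add: cn_def replicate_eq_replicate)

lemma cn_neq [simp]: "cn i \<noteq> ''true''" "cn i \<noteq> ''false''" "cn i \<noteq> ''nil''" "cn i \<noteq> ''cons''"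
  by (simp_all add: cn_def)

abbreviation "LI \<equiv> TSort ''list''"
abbreviation "BO \<equiv> TSort ''bool''"
abbreviation "CE \<equiv> TSort ''cell''"
abbreviation "X i \<equiv> Var (vn i)"
abbreviation "PX i \<equiv> PVar (vn i)"
abbreviation "Fn f \<equiv> Fun (nm f)"
abbreviation "cc i \<equiv> Con (cn i)"
abbreviation "pnil \<equiv> PCon ''nil'' []"
abbreviation "pcons x y \<equiv> PCon ''cons'' [x, y]"

definition pxs :: "nat \<Rightarrow> nat \<Rightarrow> pat list" where "pxs i n = map (\<lambda>j. PX (i + j)) [0..<n]"
definition xs :: "nat \<Rightarrow> nat \<Rightarrow> expr list" where "xs i n = map (\<lambda>j. X (i + j)) [0..<n]"

text \<open>Variables are numbered by the length of their name, which lets a list of values serve as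
  an environment.\<close>

definition en :: "val list \<Rightarrow> string \<Rightarrow> val" where "en L s = L ! length s"

definition Fc :: "string \<Rightarrow> sty" where
  "Fc c = (if c = ''true'' \<or> c = ''false'' then BO else if c = ''nil'' then LI
     else if c = ''cons'' then TArr BO (TArr LI LI) else CE)"

lemma Fc_simps [simp]: "Fc ''true'' = BO" "Fc ''false'' = BO" "Fc ''nil'' = LI" "Fc ''cons'' = TArr BO (TArr LI LI)"
  "Fc (cn i) = CE"
  by (simp_all add: Fc_def)

text \<open>\<open>h0\<close> and \<open>h1\<close> are the possible initial cells at position 0,
  where the head starts; \<open>y0\<close> and \<open>y1\<close> are those for the letters at later
  positions.\<close>

locale ca_program =
  fixes K b C :: nat and \<delta> :: "nat \<Rightarrow> nat \<Rightarrow> nat \<Rightarrow> nat" and blank acc h0 h1 y0 y1 :: nat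
  assumes b: "0 < b" and \<delta>: "\<And>i j k. i < C \<Longrightarrow> j < C \<Longrightarrow> k < C \<Longrightarrow> \<delta> i j k < C"
    and cells: "blank < C" "acc < C" "h0 < C" "h1 < C" "y0 < C" "y1 < C"
begin

definition wd :: "nat \<Rightarrow> nat" where "wd k = (if k = 0 then b else 1)"

lemma wd_pos [simp]: "0 < wd k" using b by (simp add: wd_def)

fun nty :: "nat \<Rightarrow> sty list" where
  "nty 0 = replicate b LI"
| "nty (Suc k) = [foldr TArr (nty k) BO]"

abbreviation "aty k \<equiv> foldr TArr (nty k) BO"

lemma length_nty [simp]: "length (nty k) = wd k" by (cases k) (auto simp: wd_def)

fun maxE :: "nat \<Rightarrow> expr \<Rightarrow> expr list" where
  "maxE 0 e = replicate b e"
| "maxE (Suc k) e = [Fn (Ones k)]"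

fun predE :: "nat \<Rightarrow> expr \<Rightarrow> expr list \<Rightarrow> expr list" where
  "predE 0 e ts = map (\<lambda>j. apps (Fn (Digit j)) (e # ts)) [0..<b]"
| "predE (Suc k) e ts = [apps (Fn (Prd k)) (e # ts)]"

abbreviation "isz k e ts \<equiv> apps (Fn (Isz k)) (e # ts)"
abbreviation "TR \<equiv> Con ''true''"
abbreviation "FA \<equiv> Con ''false''"

text \<open>\<open>X 0\<close> is the input in every function that needs large digits, because none
  can be built. \<open>Zlow k\<close> asks whether all binary digits strictly below an index vanish;
  exactly then a predecessor flips the digit at that index, which is what \<open>Prd k\<close> does.
  \<open>Digit j\<close> is the same borrow rule for base \<open>length w + 1\<close>: if all lower
  digits are \<open>nil\<close>, digit \<open>j\<close> loses one element, or wraps from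
  \<open>nil\<close> to the whole input, and otherwise it is kept.\<close>

fun cls :: "fn \<Rightarrow> clause list" where
  "cls Main = [Clause (nm Main) [pnil] FA,
     Clause (nm Main) (pxs 0 1) (apps (Fn IsAcc) [apps (Fn Cell) (X 0 # maxE K (X 0) @ maxE K (X 0))])]"
| "cls IsAcc = [Clause (nm IsAcc) [PCon (cn acc) []] TR, Clause (nm IsAcc) (pxs 0 1) FA]"
| "cls Rule = concat (map (\<lambda>i. concat (map (\<lambda>j. map (\<lambda>k.
     Clause (nm Rule) [PCon (cn i) [], PCon (cn j) [], PCon (cn k) []] (cc (\<delta> i j k))) [0..<C]) [0..<C])) [0..<C])"
| "cls Init0 = [Clause (nm Init0) [pcons (PCon ''true'' []) (PX 0)] (cc h1),
     Clause (nm Init0) [pcons (PCon ''false'' []) (PX 0)] (cc h0)]"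
| "cls Initw = [Clause (nm Initw) (PX 0 # pnil # pxs 2 (wd K)) (cc blank),
     Clause (nm Initw) (PX 0 # pcons (PX 1) (PX (2 + wd K)) # pxs 2 (wd K))
       (If (isz K (X 0) (xs 2 (wd K))) (If (X 1) (cc y1) (cc y0))
         (apps (Fn Initw) (X 0 # X (2 + wd K) # predE K (X 0) (xs 2 (wd K)))))]"
| "cls Init = [Clause (nm Init) (pxs 0 (1 + wd K)) (If (isz K (X 0) (xs 1 (wd K))) (apps (Fn Init0) [X 0])
     (apps (Fn Initw) (X 0 # X 0 # xs 1 (wd K))))]"
| "cls Cell = [Clause (nm Cell) (pxs 0 (1 + wd K + wd K)) (let t = xs 1 (wd K); i = xs (1 + wd K) (wd K) in
     If (isz K (X 0) t) (apps (Fn Init) (X 0 # i))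
      (apps (Fn Rule) [If (isz K (X 0) i) (cc blank) (apps (Fn Cellp) (X 0 # predE K (X 0) t @ predE K (X 0) i)),
        apps (Fn Cellp) (X 0 # predE K (X 0) t @ i), apps (Fn Cell) (X 0 # predE K (X 0) t @ i)]))]"
| "cls Cellp = [Clause (nm Cellp) (pxs 0 (1 + wd K + wd K)) (let t = xs 1 (wd K); i = xs (1 + wd K) (wd K) in
     If (isz K (X 0) i) (cc blank) (apps (Fn Cell) (X 0 # t @ predE K (X 0) i)))]"
| "cls (Isz 0) = [Clause (nm (Isz 0)) (PX 0 # replicate b pnil) TR, Clause (nm (Isz 0)) (pxs 0 (1 + b)) FA]"
| "cls (Isz (Suc k)) = [Clause (nm (Isz (Suc k))) (pxs 0 2) (If (apps (X 1) (maxE k (X 0))) FA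
     (apps (Fn (Zlow k)) (X 0 # X 1 # maxE k (X 0))))]"
| "cls (Zlow k) = [Clause (nm (Zlow k)) (pxs 0 (2 + wd k)) (let i = xs 2 (wd k) in If (isz k (X 0) i) TR
     (If (apps (X 1) (predE k (X 0) i)) FA (apps (Fn (Zlow k)) (X 0 # X 1 # predE k (X 0) i))))]"
| "cls (Prd k) = [Clause (nm (Prd k)) (pxs 0 (2 + wd k)) (let i = xs 2 (wd k) in
     If (apps (Fn (Zlow k)) (X 0 # X 1 # i)) (If (apps (X 1) i) FA TR) (apps (X 1) i))]"
| "cls (Ones k) = [Clause (nm (Ones k)) (pxs 0 (wd k)) TR]"
| "cls (Digit j) = [
     Clause (nm (Digit j)) (PX 0 # replicate j pnil @ pcons (PX (b + 1)) (PX (b + 2)) # pxs (j + 2) (b - 1 - j)) (X (b + 2)),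
     Clause (nm (Digit j)) (PX 0 # replicate j pnil @ pnil # pxs (j + 2) (b - 1 - j)) (X 0),
     Clause (nm (Digit j)) (pxs 0 (1 + b)) (X (1 + j))]"

definition fns :: "fn list" where
  "fns = [Main, IsAcc, Rule, Init0, Initw, Init, Cell, Cellp] @ map Isz [0..<Suc K] @ map Zlow [0..<K]
     @ map Prd [0..<K] @ map Ones [0..<K] @ map Digit [0..<b]"

definition prog :: program where "prog = concat (map cls fns)"

fun fty :: "fn \<Rightarrow> sty" where
  "fty Main = TArr LI BO"
| "fty IsAcc = TArr CE BO"
| "fty Rule = foldr TArr [CE, CE, CE] CE"
| "fty Init0 = TArr LI CE"
| "fty Initw = foldr TArr (LI # LI # nty K) CE"
| "fty Init = foldr TArr (LI # nty K) CE"
| "fty Cell = foldr TArr (LI # nty K @ nty K) CE"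
| "fty Cellp = foldr TArr (LI # nty K @ nty K) CE"
| "fty (Isz k) = foldr TArr (LI # nty k) BO"
| "fty (Zlow k) = foldr TArr (LI # aty k # nty k) BO"
| "fty (Prd k) = foldr TArr (LI # aty k # nty k) BO"
| "fty (Ones k) = foldr TArr (nty k) BO"
| "fty (Digit j) = foldr TArr (LI # nty 0) LI"

definition Fd :: "string \<Rightarrow> sty" where "Fd s = fty (from_nat (length s))"

lemma Fd_nm [simp]: "Fd (nm f) = fty f" by (simp add: Fd_def nm_def)

lemma distinct_fns: "distinct fns"
  by (auto simp: fns_def distinct_map inj_on_def)

lemma cls_cfun: "cl \<in> set (cls f) \<Longrightarrow> cfun cl = nm f"
  by (induction f rule: cls.induct) auto

lemma filter_prog: assumes "f \<in> set fns" shows "filter (\<lambda>cl. cfun cl = nm f) prog = cls f"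
proof -
  have "filter (\<lambda>cl. cfun cl = nm f) (concat (map cls fs)) = (if f \<in> set fs then cls f else [])" if "distinct fs" for fs
    using that
  proof (induction fs)
    case (Cons g fs)
    have "filter (\<lambda>cl. cfun cl = nm f) (cls g) = (if g = f then cls f else [])"
      using cls_cfun[of _ g] by (auto simp: filter_id_conv filter_empty_conv)
    then show ?case using Cons by auto
  qed simp
  from this[OF distinct_fns] show ?thesis using assms by (simp add: prog_def)
qed

lemma prog_clause: "cl \<in> set prog \<Longrightarrow> \<exists>f\<in>set fns. cl \<in> set (cls f)"
  by (auto simp: prog_def)

subsection \<open>Static conditions\<close>

text \<open>Right-hand sides use only constructors without arguments. These are data, so
  cons-freeness is immediate.\<close>

fun plain :: "string set \<Rightarrow> expr \<Rightarrow> bool" where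
  "plain V (Var x) = (x \<in> V)"
| "plain V (Con c) = (targs (Fc c) = [])"
| "plain V (Fun f) = True"
| "plain V (If x y z) = (plain V x \<and> plain V y \<and> plain V z)"
| "plain V (App s t) = (\<not> conhead s \<and> plain V s \<and> plain V t)"
| "plain V e = False"

lemma conhead_apps_iff: "conhead (apps h ss) \<longleftrightarrow> conhead h"
  by (induction ss rule: rev_induct) auto

lemma plain_apps: "\<not> conhead h \<Longrightarrow> plain V (apps h ss) \<longleftrightarrow> plain V h \<and> (\<forall>s\<in>set ss. plain V s)"
  by (induction ss rule: rev_induct) (auto simp: conhead_apps_iff)

lemma plain_fa: "plain V e \<Longrightarrow> n = 0 \<or> \<not> conhead e \<Longrightarrow> fa (\<lambda>c. length (targs (Fc c))) n e"
  by (induction e arbitrary: n) auto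

lemma plain_choose: "plain V e \<Longrightarrow> \<not> has_choose e"
  by (induction e) auto

lemma plain_vars: "plain V e \<Longrightarrow> expr_vars e \<subseteq> V"
  by (induction e) auto

lemma plain_ssub: "ssub e t \<Longrightarrow> plain V e \<Longrightarrow> plain V t"
  by (induction rule: ssub.induct) auto

lemma plain_cons_free: assumes "plain V (crhs cl)" shows "cons_free_clause cl"
  unfolding cons_free_clause_def
proof (intro allI impI)
  fix t c ss assume "sub (crhs cl) t \<and> t = apps (Con c) ss"
  then have "plain V (apps (Con c) ss)" "t = apps (Con c) ss"
    using plain_ssub assms by (auto simp: sub_def)
  moreover from this have "ss = []" by (cases ss rule: rev_cases) (auto simp: conhead_apps)
  ultimately show "is_data t \<or> (\<exists>l\<in>set (cpats cl). sub (pat_expr l) t)"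
    using is_data.intros(1)[of "[]" c] by simp
qed

section \<open>Typing of the clauses\<close>

lemma has_type_apps:
  assumes "has_type Fc Fd G h (foldr TArr ts t)" "list_all2 (has_type Fc Fd G) ss ts"
  shows "has_type Fc Fd G (apps h ss) t"
proof -
  have "has_type Fc Fd G (apps h ss) (foldr TArr ts' t)" if "ts = ts1 @ ts'" "list_all2 (has_type Fc Fd G) ss ts1"
    "has_type Fc Fd G h (foldr TArr ts t)" for ts1 ts'
    using that(2,1,3)
  proof (induction ss arbitrary: ts1 ts' rule: rev_induct)
    case (snoc s ss)
    obtain r ts2 where r: "ts1 = ts2 @ [r]" "list_all2 (has_type Fc Fd G) ss ts2" "has_type Fc Fd G s r"
      using snoc.prems(1) by (auto simp: list_all2_append1 list_all2_Cons1)
    have "has_type Fc Fd G (apps h ss) (foldr TArr (r # ts') t)"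
      using snoc.IH[OF r(2)] snoc.prems(2,3) r(1) by simp
    then show ?case using has_type.intros(7) r(3) by fastforce
  qed auto
  from this[of ts "[]"] show ?thesis using assms by simp
qed

lemma has_type_Fn: "list_all2 (has_type Fc Fd G) ss ts \<Longrightarrow> fty f = foldr TArr ts t \<Longrightarrow> has_type Fc Fd G (apps (Fn f) ss) t"
  using has_type_apps[of G "Fn f" ts t ss] has_type.intros(3)[of Fc Fd G "nm f"] by simp

lemma has_type_X: "G (vn i) = t \<Longrightarrow> has_type Fc Fd G (X i) t"
  using has_type.intros(1) by metis

lemma has_type_Con: "Fc c = t \<Longrightarrow> has_type Fc Fd G (Con c) t"
  using has_type.intros(2) by metis

lemma has_type_xs:
  "length ts = n \<Longrightarrow> (\<And>j. j < n \<Longrightarrow> G (vn (i + j)) = ts ! j) \<Longrightarrow> list_all2 (has_type Fc Fd G) (xs i n) ts"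
  by (auto simp: xs_def list_all2_conv_all_nth intro: has_type_X)

lemma type_max: "has_type Fc Fd G e LI \<Longrightarrow> list_all2 (has_type Fc Fd G) (maxE k e) (nty k)"
  using has_type.intros(3)[of Fc Fd G "nm (Ones _)"] by (cases k) (auto simp: list_all2_conv_all_nth)

lemma type_pred: "has_type Fc Fd G e LI \<Longrightarrow> list_all2 (has_type Fc Fd G) ts (nty k) \<Longrightarrow>
    list_all2 (has_type Fc Fd G) (predE k e ts) (nty k)"
proof (cases k)
  case 0
  assume "has_type Fc Fd G e LI" "list_all2 (has_type Fc Fd G) ts (nty k)"
  then show ?thesis using 0 by (auto simp: list_all2_conv_all_nth[of _ "map _ _"] intro!: has_type_Fn[of G _ "LI # nty 0"])
next
  case (Suc j)
  assume "has_type Fc Fd G e LI" "list_all2 (has_type Fc Fd G) ts (nty k)"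
  then have "has_type Fc Fd G (apps (Fn (Prd j)) (e # ts)) (aty j)"
    using Suc by (intro has_type_Fn[of G _ "[LI, aty j]"]) auto
  then show ?thesis using Suc by simp
qed

lemma type_isz: "has_type Fc Fd G e LI \<Longrightarrow> list_all2 (has_type Fc Fd G) ts (nty k) \<Longrightarrow> has_type Fc Fd G (isz k e ts) BO"
  by (rule has_type_Fn[of G _ "LI # nty k"]) auto

definition ten :: "sty list \<Rightarrow> string \<Rightarrow> sty" where "ten T s = T ! length s"

lemma ten_vn [simp]: "ten T (vn i) = T ! i" by (simp add: ten_def)

text \<open>Passing to the next level adds one arrow, so level \<open>K\<close> is the highest whose
  numbers a variable may hold at data order \<open>K\<close>.\<close>

lemma ord_nty: "t \<in> set (nty k) \<Longrightarrow> ord t \<le> k" and ord_aty: "ord (aty k) \<le> Suc k"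
proof (induction k arbitrary: t)
  have fold: "(\<And>t. t \<in> set ts \<Longrightarrow> ord t \<le> n) \<Longrightarrow> ord (foldr TArr ts BO) \<le> Suc n" for ts n
    by (induction ts) auto
  case 0
  { case 1 then show ?case by simp }
  { case 2 show ?case by (rule fold) simp }
next
  have fold: "(\<And>t. t \<in> set ts \<Longrightarrow> ord t \<le> n) \<Longrightarrow> ord (foldr TArr ts BO) \<le> Suc n" for ts n
    by (induction ts) auto
  case (Suc k)
  { case 1 then show ?case using Suc by simp }
  { case 2 show ?case using Suc by (intro fold) simp }
qed

text \<open>The variable numbered \<open>i\<close> in a clause of \<open>f\<close> has type \<open>tys f ! i\<close>.\<close>

fun tys :: "fn \<Rightarrow> sty list" where
  "tys Initw = LI # BO # nty K @ [LI]"
| "tys (Digit j) = LI # nty 0 @ [BO, LI]"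
| "tys IsAcc = [CE]"
| "tys f = targs (fty f)"

definition typed_clause :: "fn \<Rightarrow> (string \<Rightarrow> sty) \<Rightarrow> clause \<Rightarrow> bool" where
  "typed_clause f G cl \<longleftrightarrow> (\<exists>ts t. fty f = foldr TArr ts t \<and> list_all2 (has_type Fc Fd G) (map pat_expr (cpats cl)) ts \<and>
     has_type Fc Fd G (crhs cl) t) \<and> (\<forall>x\<in>set (lhs_vars cl). ord (G x) \<le> K) \<and> plain (set (lhs_vars cl)) (crhs cl) \<and>
     distinct (lhs_vars cl) \<and> (\<forall>l\<in>set (cpats cl). fa (\<lambda>c. length (targs (Fc c))) 0 (pat_expr l))"

lemma map_pat_pxs: "map pat_expr (pxs i n) = xs i n"
  by (simp add: pxs_def xs_def)

lemma vars_pxs: "concat (map pat_vars (pxs i n)) = map vn [i..<i + n]"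
proof -
  have "map (\<lambda>j. vn (i + j)) [0..<n] = map vn [i..<i + n]"
    by (intro nth_equalityI) auto
  moreover have "concat (map pat_vars (pxs i n)) = map (\<lambda>j. vn (i + j)) [0..<n]"
    by (simp add: pxs_def comp_def concat_map_singleton)
  ultimately show ?thesis by simp
qed

lemma fa_pxs: "\<forall>l\<in>set (pxs i n). fa ar 0 (pat_expr l)"
  by (auto simp: pxs_def)

lemma plain_xs: "e \<in> set (xs i n) \<Longrightarrow> vn ` {i..<i + n} \<subseteq> V \<Longrightarrow> plain V e"
  by (force simp: xs_def)

lemma plain_max: "plain V e \<Longrightarrow> s \<in> set (maxE k e) \<Longrightarrow> plain V s"
  by (cases k) auto

lemma plain_pred: "plain V e \<Longrightarrow> (\<And>t. t \<in> set ts \<Longrightarrow> plain V t) \<Longrightarrow> s \<in> set (predE k e ts) \<Longrightarrow> plain V s"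
  by (cases k) (auto simp: plain_apps)

lemma simple_typed_clause:
  assumes "fty f = foldr TArr ts t" "\<And>s. s \<in> set ts \<Longrightarrow> ord s \<le> K" "n = length ts"
    "has_type Fc Fd (ten ts) e t" "plain (vn ` {0..<n}) e"
  shows "typed_clause f (ten ts) (Clause (nm f) (pxs 0 n) e)"
proof -
  have "list_all2 (has_type Fc Fd (ten ts)) (map pat_expr (pxs 0 n)) ts"
    unfolding map_pat_pxs using assms(3) by (intro has_type_xs) auto
  then show ?thesis
    unfolding typed_clause_def lhs_vars_def clause.sel vars_pxs
    using assms fa_pxs by (auto simp: distinct_map inj_on_def)
qed

lemma ten_xs: "length ts = n \<Longrightarrow> (\<And>j. j < n \<Longrightarrow> T ! (i + j) = ts ! j) \<Longrightarrow> list_all2 (has_type Fc Fd (ten T)) (xs i n) ts"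
  by (intro has_type_xs) auto

lemma ten_X: "T ! i = t \<Longrightarrow> has_type Fc Fd (ten T) (X i) t"
  by (intro has_type_X) auto

lemmas has_type_If = has_type.intros(4)

lemma typed_Cell:
  assumes "f = Cell \<or> f = Cellp" "cl \<in> set (cls f)"
  shows "typed_clause f (ten (LI # nty K @ nty K)) cl"
proof -
  let ?T = "LI # nty K @ nty K" and ?t = "xs 1 (wd K)" and ?i = "xs (1 + wd K) (wd K)"
  let ?ty = "has_type Fc Fd (ten ?T)"
  have x: "?ty (X 0) LI" by (intro ten_X) simp
  have t: "list_all2 ?ty ?t (nty K)" and i: "list_all2 ?ty ?i (nty K)"
    by (auto intro!: ten_xs simp: nth_append)
  note pt = type_pred[OF x t] and pi = type_pred[OF x i]
  have app: "?ty (apps (Fn g) (X 0 # u @ v)) CE" if "g = Cell \<or> g = Cellp" "list_all2 ?ty u (nty K)" "list_all2 ?ty v (nty K)" for g u v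
    by (rule has_type_Fn[of _ _ "LI # nty K @ nty K"]) (use that x in \<open>auto intro: list_all2_appendI\<close>)
  have init: "?ty (apps (Fn Init) (X 0 # ?i)) CE"
    by (rule has_type_Fn[of _ _ "LI # nty K"]) (use i x in auto)
  have bl: "?ty (cc blank) CE" by (intro has_type_Con) simp
  have rule: "?ty (apps (Fn Rule) [u, v, z]) CE" if "?ty u CE" "?ty v CE" "?ty z CE" for u v z
    by (rule has_type_Fn[of _ _ "[CE, CE, CE]"]) (use that in auto)
  let ?V = "vn ` {0..<1 + wd K + wd K}"
  have px: "plain ?V (X 0)" by simp
  have pt': "\<And>e. e \<in> set ?t \<Longrightarrow> plain ?V e" by (erule plain_xs) auto
  have pi': "\<And>e. e \<in> set ?i \<Longrightarrow> plain ?V e" by (erule plain_xs) auto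
  have pl: "\<And>e. e \<in> set (predE K (X 0) ?t) \<Longrightarrow> plain ?V e" "\<And>e. e \<in> set (predE K (X 0) ?i) \<Longrightarrow> plain ?V e"
    by (erule plain_pred[OF px, rotated], erule pt') (erule plain_pred[OF px, rotated], erule pi')
  have o: "s \<in> set ?T \<Longrightarrow> ord s \<le> K" for s using ord_nty by auto
  show ?thesis
    using assms(1)
  proof
    assume f: "f = Cell"
    have "typed_clause Cell (ten ?T) (Clause (nm Cell) (pxs 0 (1 + wd K + wd K)) (let t = ?t; i = ?i in
     If (isz K (X 0) t) (apps (Fn Init) (X 0 # i))
      (apps (Fn Rule) [If (isz K (X 0) i) (cc blank) (apps (Fn Cellp) (X 0 # predE K (X 0) t @ predE K (X 0) i)),
        apps (Fn Cellp) (X 0 # predE K (X 0) t @ i), apps (Fn Cell) (X 0 # predE K (X 0) t @ i)])))"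
      unfolding Let_def
      by (rule simple_typed_clause, simp, erule o, simp)
        (intro has_type_If type_isz rule app init bl x t i pt pi disjI1 disjI2 refl,
          use pt' pi' pl in \<open>auto simp: plain_apps\<close>)
    then show ?thesis using assms(2) f by simp
  next
    assume f: "f = Cellp"
    have "typed_clause Cellp (ten ?T) (Clause (nm Cellp) (pxs 0 (1 + wd K + wd K)) (let t = ?t; i = ?i in
     If (isz K (X 0) i) (cc blank) (apps (Fn Cell) (X 0 # t @ predE K (X 0) i))))"
      unfolding Let_def
      by (rule simple_typed_clause, simp, erule o, simp)
        (intro has_type_If type_isz app bl x t i pi disjI1 refl, use pt' pi' pl in \<open>auto simp: plain_apps\<close>)
    then show ?thesis using assms(2) f by simp
  qed
qed

lemma typed_level:
  assumes "k < K" "f = Zlow k \<or> f = Prd k" "cl \<in> set (cls f)"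
  shows "typed_clause f (ten (LI # aty k # nty k)) cl"
proof -
  let ?T = "LI # aty k # nty k" and ?i = "xs 2 (wd k)"
  let ?ty = "has_type Fc Fd (ten ?T)"
  have x: "?ty (X 0) LI" and F: "?ty (X 1) (aty k)" by (intro ten_X; simp)+
  have i: "list_all2 ?ty ?i (nty k)" by (auto intro!: ten_xs)
  note pi = type_pred[OF x i]
  have app: "?ty (apps (X 1) u) BO" if "list_all2 ?ty u (nty k)" for u
    by (rule has_type_apps[OF F that])
  have zl: "?ty (apps (Fn (Zlow k)) (X 0 # X 1 # u)) BO" if "list_all2 ?ty u (nty k)" for u
    by (rule has_type_Fn[of _ _ "LI # aty k # nty k"]) (use that x F in auto)
  have bl: "?ty TR BO" "?ty FA BO" by (intro has_type_Con; simp)+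
  let ?V = "vn ` {0..<2 + wd k}"
  have px: "plain ?V (X 0)" by simp
  have pi': "\<And>e. e \<in> set ?i \<Longrightarrow> plain ?V e" by (erule plain_xs) auto
  have pl: "\<And>e. e \<in> set (predE k (X 0) ?i) \<Longrightarrow> plain ?V e"
    by (erule plain_pred[OF px, rotated], erule pi')
  have o: "s \<in> set ?T \<Longrightarrow> ord s \<le> K" for s using ord_nty[of s k] ord_aty[of k] assms(1) by auto
  show ?thesis
    using assms(2)
  proof
    assume f: "f = Zlow k"
    have "typed_clause (Zlow k) (ten ?T) (Clause (nm (Zlow k)) (pxs 0 (2 + wd k)) (let i = ?i in If (isz k (X 0) i) TR
     (If (apps (X 1) (predE k (X 0) i)) FA (apps (Fn (Zlow k)) (X 0 # X 1 # predE k (X 0) i)))))"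
      unfolding Let_def
      by (rule simple_typed_clause, simp, erule o, simp)
        (intro has_type_If type_isz app zl bl x i pi, use pi' pl in \<open>auto simp: plain_apps\<close>)
    then show ?thesis using assms(3) f by simp
  next
    assume f: "f = Prd k"
    have "typed_clause (Prd k) (ten ?T) (Clause (nm (Prd k)) (pxs 0 (2 + wd k)) (let i = ?i in
     If (apps (Fn (Zlow k)) (X 0 # X 1 # i)) (If (apps (X 1) i) FA TR) (apps (X 1) i)))"
      unfolding Let_def
      by (rule simple_typed_clause, simp, erule o, simp)
        (intro has_type_If type_isz app zl bl x i pi, use pi' pl in \<open>auto simp: plain_apps\<close>)
    then show ?thesis using assms(3) f by simp
  qed
qed

lemma typed_Isz:
  assumes "k \<le> K" "cl \<in> set (cls (Isz k))"
  shows "\<exists>G. typed_clause (Isz k) G cl"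
proof (cases k)
  case 0
  have 1: "typed_clause (Isz 0) (ten [LI]) (Clause (nm (Isz 0)) (PX 0 # replicate b pnil) TR)"
    unfolding typed_clause_def lhs_vars_def
    by (intro conjI exI[of _ "LI # nty 0"] exI[of _ BO])
      (auto simp: list_all2_conv_all_nth nth_Cons' intro!: ten_X has_type_Con)
  have 2: "typed_clause (Isz 0) (ten (LI # nty 0)) (Clause (nm (Isz 0)) (pxs 0 (1 + b)) FA)"
    by (rule simple_typed_clause) (auto intro: has_type_Con)
  show ?thesis using assms(2) 0 1 2 by auto
next
  case (Suc k')
  let ?T = "LI # nty k"
  let ?ty = "has_type Fc Fd (ten ?T)"
  have x: "?ty (X 0) LI" and F: "?ty (X 1) (aty k')" by (intro ten_X; simp add: Suc)+
  have "typed_clause (Isz (Suc k')) (ten ?T) (Clause (nm (Isz (Suc k'))) (pxs 0 2) (If (apps (X 1) (maxE k' (X 0))) FA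
     (apps (Fn (Zlow k')) (X 0 # X 1 # maxE k' (X 0)))))"
  proof (rule simple_typed_clause)
    show "?ty (If (apps (X 1) (maxE k' (X 0))) FA (apps (Fn (Zlow k')) (X 0 # X 1 # maxE k' (X 0)))) BO"
    proof (intro has_type_If has_type_apps[OF F] type_max x)
      show "?ty (apps (Fn (Zlow k')) (X 0 # X 1 # maxE k' (X 0))) BO"
        by (rule has_type_Fn[of _ _ "LI # aty k' # nty k'"]) (use x F type_max[OF x] in auto)
    qed (intro has_type_Con, simp)
    show "plain (vn ` {0..<2}) (If (apps (X 1) (maxE k' (X 0))) FA (apps (Fn (Zlow k')) (X 0 # X 1 # maxE k' (X 0))))"
      using plain_max[of "vn ` {0..<2}" "X 0" _ k'] by (auto simp: plain_apps)
    show "ord s \<le> K" if "s \<in> set (LI # nty k)" for s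
      using that ord_nty[of s k] assms(1) by auto
  qed (simp_all add: Suc)
  then show ?thesis using assms(2) Suc by auto
qed

lemma typed_Digit:
  assumes "j < b" "cl \<in> set (cls (Digit j))"
  shows "\<exists>G. typed_clause (Digit j) G cl"
proof -
  let ?T = "LI # nty 0 @ [BO, LI]"
  let ?ty = "has_type Fc Fd (ten ?T)"
  have nth: "(replicate j a @ c # xs (j + 2) (b - 1 - j)) ! i = (if i < j then a else if i = j then c else X (i + 1))"
    if "i < b" for i a c using that assms(1) by (auto simp: nth_append nth_Cons' xs_def)
  have T: "?T ! Suc i = LI" if "i < b" for i using that by (simp add: nth_append)
  have pats: "list_all2 ?ty (X 0 # replicate j (Con ''nil'') @ c # xs (j + 2) (b - 1 - j)) (LI # nty 0)"
    if c: "?ty c LI" for c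
  proof -
    have "list_all2 ?ty (replicate j (Con ''nil'') @ c # xs (j + 2) (b - 1 - j)) (nty 0)"
      unfolding list_all2_conv_all_nth
    proof (intro conjI allI impI)
      show "length (replicate j (Con ''nil'') @ c # xs (j + 2) (b - 1 - j)) = length (nty 0)"
        using assms(1) by (simp add: xs_def)
      fix i assume i0: "i < length (replicate j (Con ''nil'') @ c # xs (j + 2) (b - 1 - j))"
      then have i: "i < b" using assms(1) by (auto simp: xs_def)
      show "?ty ((replicate j (Con ''nil'') @ c # xs (j + 2) (b - 1 - j)) ! i) (nty 0 ! i)"
        unfolding nth[OF i] using c T[OF i] i by (auto intro!: has_type_Con ten_X)
    qed
    moreover have "?ty (X 0) LI" by (intro ten_X) simp
    ultimately show ?thesis by simp
  qed
  have mp: "map pat_expr (PX 0 # replicate j pnil @ q # pxs (j + 2) (b - 1 - j))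
      = X 0 # replicate j (Con ''nil'') @ pat_expr q # xs (j + 2) (b - 1 - j)" for q
    by (simp add: map_pat_pxs)
  have cons: "?ty (pat_expr (pcons (PX (b + 1)) (PX (b + 2)))) LI"
    unfolding pat_expr.simps
    by (rule has_type_apps[of _ _ "[BO, LI]"]) (auto intro!: has_type_Con ten_X simp: nth_append)
  have nilt: "?ty (pat_expr pnil) LI" by (auto intro: has_type_Con)
  have vars: "lhs_vars (Clause f (PX 0 # replicate j pnil @ q # pxs (j + 2) (b - 1 - j)) e) =
      vn 0 # pat_vars q @ map vn [j + 2..<b + 1]" for f q e
  proof -
    have "concat (map pat_vars (replicate j pnil)) = []" by (induction j) auto
    then show ?thesis using vars_pxs[of "j + 2" "b - 1 - j"] assms(1) by (simp add: lhs_vars_def)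
  qed
  have o: "ord (ten ?T (vn i)) = 0" if "i < b + 3" for i
    using that by (auto simp: nth_append nth_Cons')
  have 1: "typed_clause (Digit j) (ten ?T)
     (Clause (nm (Digit j)) (PX 0 # replicate j pnil @ pcons (PX (b + 1)) (PX (b + 2)) # pxs (j + 2) (b - 1 - j)) (X (b + 2)))"
    unfolding typed_clause_def vars
  proof (intro conjI exI[of _ "LI # nty 0"] exI[of _ LI])
    show "has_type Fc Fd (ten ?T) (crhs (Clause (nm (Digit j)) (PX 0 # replicate j pnil @ pcons (PX (b + 1)) (PX (b + 2)) # pxs (j + 2) (b - 1 - j)) (X (b + 2)))) LI"
      by (auto intro!: ten_X simp: nth_append)
    show "\<forall>x\<in>set (vn 0 # pat_vars (pcons (PX (b + 1)) (PX (b + 2))) @ map vn [j + 2..<b + 1]). ord (ten ?T x) \<le> K"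
      using o by (auto simp del: ten_vn)
  qed (use pats[OF cons] mp fa_pxs in \<open>auto simp: distinct_map inj_on_def apps_def\<close>)
  have 2: "typed_clause (Digit j) (ten ?T) (Clause (nm (Digit j)) (PX 0 # replicate j pnil @ pnil # pxs (j + 2) (b - 1 - j)) (X 0))"
    unfolding typed_clause_def vars
  proof (intro conjI exI[of _ "LI # nty 0"] exI[of _ LI])
    show "has_type Fc Fd (ten ?T) (crhs (Clause (nm (Digit j)) (PX 0 # replicate j pnil @ pnil # pxs (j + 2) (b - 1 - j)) (X 0))) LI"
      by (auto intro!: ten_X)
    show "\<forall>x\<in>set (vn 0 # pat_vars pnil @ map vn [j + 2..<b + 1]). ord (ten ?T x) \<le> K"
      using o by (auto simp del: ten_vn)
  qed (use pats[OF nilt] mp fa_pxs in \<open>auto simp: distinct_map inj_on_def\<close>)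
  have 3: "typed_clause (Digit j) (ten (LI # nty 0)) (Clause (nm (Digit j)) (pxs 0 (1 + b)) (X (1 + j)))"
    by (rule simple_typed_clause) (use assms(1) in \<open>auto intro!: ten_X\<close>)
  show ?thesis using assms(2) 1 2 3 by auto
qed

lemma typed_Initw:
  assumes "cl \<in> set (cls Initw)"
  shows "typed_clause Initw (ten (LI # BO # nty K @ [LI])) cl"
proof -
  let ?T = "LI # BO # nty K @ [LI]" and ?i = "xs 2 (wd K)"
  let ?ty = "has_type Fc Fd (ten ?T)"
  have x: "?ty (X 0) LI" and x1: "?ty (X 1) BO" and x2: "?ty (X (2 + wd K)) LI"
    by (intro ten_X; simp add: nth_append)+
  have i: "list_all2 ?ty ?i (nty K)" by (auto intro!: ten_xs simp: nth_append)
  have o: "ord (ten ?T (vn j)) \<le> K" if "j < 3 + wd K" for j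
  proof -
    have "?T ! j \<in> set ?T" using that by (intro nth_mem) simp
    then show ?thesis using ord_nty by fastforce
  qed
  have vx: "concat (map pat_vars (pxs 2 (wd K))) = map vn [2..<2 + wd K]" by (rule vars_pxs)
  have pats: "list_all2 ?ty (map pat_expr (PX 0 # q # pxs 2 (wd K))) (LI # LI # nty K)" if "?ty (pat_expr q) LI" for q
    using that x i by (simp add: map_pat_pxs)
  have cons: "?ty (pat_expr (pcons (PX 1) (PX (2 + wd K)))) LI"
    unfolding pat_expr.simps
    by (rule has_type_apps[of _ _ "[BO, LI]"]) (use x1 x2 in \<open>auto intro!: has_type_Con\<close>)
  have nilt: "?ty (pat_expr pnil) LI" by (auto intro: has_type_Con)
  have 1: "typed_clause Initw (ten ?T) (Clause (nm Initw) (PX 0 # pnil # pxs 2 (wd K)) (cc blank))"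
    unfolding typed_clause_def lhs_vars_def clause.sel list.map concat.simps vx
  proof (intro conjI exI[of _ "LI # LI # nty K"] exI[of _ CE])
    show "\<forall>x\<in>set (pat_vars (PX 0) @ pat_vars pnil @ map vn [2..<2 + wd K]). ord (ten ?T x) \<le> K"
      using o by (auto simp del: ten_vn)
  qed (use pats[OF nilt] fa_pxs in \<open>auto simp: distinct_map inj_on_def intro: has_type_Con\<close>)
  let ?e = "If (isz K (X 0) ?i) (If (X 1) (cc y1) (cc y0)) (apps (Fn Initw) (X 0 # X (2 + wd K) # predE K (X 0) ?i))"
  have e: "?ty ?e CE"
  proof (intro has_type_If type_isz x x1 i)
    show "?ty (apps (Fn Initw) (X 0 # X (2 + wd K) # predE K (X 0) ?i)) CE"
      by (rule has_type_Fn[of _ _ "LI # LI # nty K"]) (use x x2 type_pred[OF x i] in auto)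
  qed (intro has_type_Con, simp)+
  let ?V = "vn ` {0..<3 + wd K}"
  have pi': "\<And>e. e \<in> set ?i \<Longrightarrow> plain ?V e" by (erule plain_xs) auto
  have pl: "\<And>e. e \<in> set (predE K (X 0) ?i) \<Longrightarrow> plain ?V e"
    by (erule plain_pred[rotated 2], simp, erule pi')
  have V: "set (pat_vars (PX 0) @ pat_vars (pcons (PX 1) (PX (2 + wd K))) @ map vn [2..<2 + wd K]) = ?V"
  proof -
    have "{0..<3 + wd K} = {0, 1, 2 + wd K} \<union> {2..<2 + wd K}" by auto
    then have "?V = vn ` ({0, 1, 2 + wd K} \<union> {2..<2 + wd K})" by (simp only:)
    then show ?thesis by (simp only: image_Un) auto
  qed
  have 2: "typed_clause Initw (ten ?T) (Clause (nm Initw) (PX 0 # pcons (PX 1) (PX (2 + wd K)) # pxs 2 (wd K)) ?e)"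
    unfolding typed_clause_def lhs_vars_def clause.sel list.map concat.simps vx V
  proof (intro conjI exI[of _ "LI # LI # nty K"] exI[of _ CE])
    show "\<forall>x\<in>?V. ord (ten ?T x) \<le> K" using o by (auto simp del: ten_vn)
    show "plain ?V ?e" using pi' pl by (auto simp: plain_apps)
    show "list_all2 ?ty (pat_expr (PX 0) # pat_expr (pcons (PX 1) (PX (2 + wd K))) # map pat_expr (pxs 2 (wd K))) (LI # LI # nty K)"
      using pats[OF cons] by simp
  qed (use e fa_pxs in \<open>auto simp: distinct_map inj_on_def apps_def\<close>)
  show ?thesis using assms 1 2 by auto
qed

lemma typed_all:
  assumes "f \<in> set fns" "cl \<in> set (cls f)"
  shows "\<exists>G. typed_clause f G cl"
proof (cases f)
  case Main
  have 1: "typed_clause Main (ten []) (Clause (nm Main) [pnil] FA)"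
    unfolding typed_clause_def lhs_vars_def
    by (intro conjI exI[of _ "[LI]"] exI[of _ BO]) (auto intro: has_type_Con)
  have x: "has_type Fc Fd (ten [LI]) (X 0) LI" by (intro ten_X) simp
  have "typed_clause Main (ten [LI]) (Clause (nm Main) (pxs 0 1) (apps (Fn IsAcc) [apps (Fn Cell) (X 0 # maxE K (X 0) @ maxE K (X 0))]))"
  proof (rule simple_typed_clause)
    have "has_type Fc Fd (ten [LI]) (apps (Fn Cell) (X 0 # maxE K (X 0) @ maxE K (X 0))) CE"
      by (rule has_type_Fn[of _ _ "LI # nty K @ nty K"]) (use x type_max[OF x] in \<open>auto intro: list_all2_appendI\<close>)
    then show "has_type Fc Fd (ten [LI]) (apps (Fn IsAcc) [apps (Fn Cell) (X 0 # maxE K (X 0) @ maxE K (X 0))]) BO"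
      by (intro has_type_Fn[of _ _ "[CE]"]) auto
    show "plain (vn ` {0..<1}) (apps (Fn IsAcc) [apps (Fn Cell) (X 0 # maxE K (X 0) @ maxE K (X 0))])"
      using plain_max[of "vn ` {0..<1}" "X 0" _ K] by (auto simp: plain_apps)
  qed auto
  then show ?thesis using 1 assms Main by auto
next
  case IsAcc
  have 1: "typed_clause IsAcc (ten []) (Clause (nm IsAcc) [PCon (cn acc) []] TR)"
    unfolding typed_clause_def lhs_vars_def
    by (intro conjI exI[of _ "[CE]"] exI[of _ BO]) (auto intro: has_type_Con)
  have "typed_clause IsAcc (ten [CE]) (Clause (nm IsAcc) (pxs 0 1) FA)"
    by (rule simple_typed_clause) (auto intro: has_type_Con)
  then show ?thesis using 1 assms IsAcc by auto
next
  case Rule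
  then obtain i j k where "cl = Clause (nm Rule) [PCon (cn i) [], PCon (cn j) [], PCon (cn k) []] (cc (\<delta> i j k))"
    using assms(2) by auto
  then have "typed_clause Rule (ten []) cl"
    unfolding typed_clause_def lhs_vars_def
    by (intro conjI exI[of _ "[CE, CE, CE]"] exI[of _ CE]) (auto intro: has_type_Con)
  then show ?thesis using Rule by blast
next
  case Init0
  have t: "has_type Fc Fd (ten [LI]) (pat_expr (pcons (PCon c []) (PX 0))) LI" if "Fc c = BO" for c
    unfolding pat_expr.simps
    by (rule has_type_apps[of _ _ "[BO, LI]"]) (use that in \<open>auto intro!: has_type_Con ten_X\<close>)
  have "typed_clause Init0 (ten [LI]) (Clause (nm Init0) [pcons (PCon c []) (PX 0)] (cc h))" if "Fc c = BO" for c h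
    unfolding typed_clause_def lhs_vars_def
    by (intro conjI exI[of _ "[LI]"] exI[of _ CE]) (use t[OF that] that in \<open>auto intro: has_type_Con simp: apps_def\<close>)
  from this[of "''true''" h1] this[of "''false''" h0] show ?thesis using assms Init0 by auto
next
  case Initw
  then show ?thesis using typed_Initw assms by blast
next
  case Init
  let ?T = "LI # nty K"
  have x: "has_type Fc Fd (ten ?T) (X 0) LI" by (intro ten_X) simp
  have i: "list_all2 (has_type Fc Fd (ten ?T)) (xs 1 (wd K)) (nty K)" by (auto intro!: ten_xs)
  have "typed_clause Init (ten ?T) (Clause (nm Init) (pxs 0 (1 + wd K)) (If (isz K (X 0) (xs 1 (wd K))) (apps (Fn Init0) [X 0])
     (apps (Fn Initw) (X 0 # X 0 # xs 1 (wd K)))))"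
  proof (rule simple_typed_clause)
    show "has_type Fc Fd (ten ?T) (If (isz K (X 0) (xs 1 (wd K))) (apps (Fn Init0) [X 0])
     (apps (Fn Initw) (X 0 # X 0 # xs 1 (wd K)))) CE"
    proof (intro has_type_If type_isz x i)
      show "has_type Fc Fd (ten ?T) (apps (Fn Init0) [X 0]) CE" by (rule has_type_Fn[of _ _ "[LI]"]) (use x in auto)
      show "has_type Fc Fd (ten ?T) (apps (Fn Initw) (X 0 # X 0 # xs 1 (wd K))) CE"
        by (rule has_type_Fn[of _ _ "LI # LI # nty K"]) (use x i in auto)
    qed
    have "\<And>e. e \<in> set (xs 1 (wd K)) \<Longrightarrow> plain (vn ` {0..<1 + wd K}) e" by (erule plain_xs) auto
    then show "plain (vn ` {0..<1 + wd K}) (If (isz K (X 0) (xs 1 (wd K))) (apps (Fn Init0) [X 0])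
     (apps (Fn Initw) (X 0 # X 0 # xs 1 (wd K))))" by (auto simp: plain_apps)
  qed (use ord_nty in auto)
  then show ?thesis using assms Init by auto
next
  case (Ones k)
  have "typed_clause (Ones k) (ten (nty k)) (Clause (nm (Ones k)) (pxs 0 (wd k)) TR)"
  proof (rule simple_typed_clause)
    have "k < K" using assms(1) Ones by (auto simp: fns_def)
    then show "ord s \<le> K" if "s \<in> set (nty k)" for s using ord_nty[OF that] by simp
  qed (auto intro: has_type_Con)
  then show ?thesis using assms Ones by auto
qed (use assms typed_Cell typed_level typed_Isz typed_Digit in \<open>(auto simp: fns_def, blast+)?\<close>)

end

section \<open>Membership of the program in the class\<close>

context ca_program
begin

lemma cls_nonempty: "cls f \<noteq> []"
  using cells by (induction f rule: cls.induct) (auto intro!: exI[of _ blank])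

lemma cls_length: "cl \<in> set (cls f) \<Longrightarrow> cl' \<in> set (cls f) \<Longrightarrow> length (cpats cl) = length (cpats cl')"
  if "f \<in> set fns" for f
  using that by (cases f rule: cls.cases) (auto simp: pxs_def fns_def)

lemma typed_clauseD:
  assumes "cl \<in> set prog"
  shows "\<not> has_choose (crhs cl)" "expr_vars (crhs cl) \<subseteq> set (lhs_vars cl)" "distinct (lhs_vars cl)"
    "cons_free_clause cl" "fa (\<lambda>c. length (targs (Fc c))) 0 (crhs cl)" "fa (\<lambda>c. length (targs (Fc c))) 0 (lhs cl)"
    "\<exists>G t. (\<forall>x\<in>set (lhs_vars cl). ord (G x) \<le> K) \<and> has_type Fc Fd G (lhs cl) t \<and> has_type Fc Fd G (crhs cl) t"
proof -
  obtain f where f: "f \<in> set fns" "cl \<in> set (cls f)" using prog_clause assms by blast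
  obtain G where G: "typed_clause f G cl" using typed_all f by blast
  then have p: "plain (set (lhs_vars cl)) (crhs cl)" by (simp add: typed_clause_def)
  show "\<not> has_choose (crhs cl)" "expr_vars (crhs cl) \<subseteq> set (lhs_vars cl)" "cons_free_clause cl"
    "fa (\<lambda>c. length (targs (Fc c))) 0 (crhs cl)"
    using plain_choose plain_vars plain_cons_free plain_fa p by blast+
  show "distinct (lhs_vars cl)" using G by (simp add: typed_clause_def)
  have c: "cfun cl = nm f" using cls_cfun f(2) by blast
  have fa: "fa ar n (apps h ss) \<longleftrightarrow> fa ar (n + length ss) h \<and> (\<forall>s\<in>set ss. fa ar 0 s)" for ar n h ss
    by (induction ss arbitrary: n rule: rev_induct) auto
  show "fa (\<lambda>c. length (targs (Fc c))) 0 (lhs cl)"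
    using G unfolding lhs_def fa by (auto simp: typed_clause_def)
  obtain ts t where t: "fty f = foldr TArr ts t" "list_all2 (has_type Fc Fd G) (map pat_expr (cpats cl)) ts"
    "has_type Fc Fd G (crhs cl) t" using G by (auto simp: typed_clause_def)
  then have "has_type Fc Fd G (lhs cl) t" unfolding lhs_def c using has_type_Fn by blast
  then show "\<exists>G t. (\<forall>x\<in>set (lhs_vars cl). ord (G x) \<le> K) \<and> has_type Fc Fd G (lhs cl) t \<and> has_type Fc Fd G (crhs cl) t"
    using G t(3) by (auto simp: typed_clause_def)
qed

lemma same_arity_prog:
  assumes "cl \<in> set prog" "cl' \<in> set prog" "cfun cl = cfun cl'" shows "length (cpats cl) = length (cpats cl')"
proof -
  obtain f g where "f \<in> set fns" "cl \<in> set (cls f)" "cl' \<in> set (cls g)" using prog_clause assms by meson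
  moreover from this have "g = f" using cls_cfun assms(3) nm_inject by metis
  ultimately show ?thesis using cls_length by blast
qed

sublocale program prog
  by standard (use typed_clauseD(1,2) same_arity_prog in blast)+

lemma main_prog: "main_fun prog = nm Main" "prog \<noteq> []"
  by (simp_all add: main_fun_def prog_def fns_def)

lemma prog_in_class: "det_wf_cf_prog K prog"
proof -
  have "typed_data_order Fc Fd prog K"
    unfolding typed_data_order_def main_prog(1)
    using main_prog(2) typed_clauseD(2,3,7) by (auto simp: Fc_def)
  moreover have "well_formed Fc prog"
    unfolding well_formed_def using typed_clauseD(5,6) same_arity_prog by blast
  moreover have "io_signature Fc Fd prog"
    unfolding io_signature_def main_prog(1) by simp
  ultimately show ?thesis unfolding det_wf_cf_prog_def deterministic_def cons_free_def
    using typed_clauseD(1,4) by blast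
qed

subsection \<open>Evaluation of the program\<close>

abbreviation ev :: "(string \<Rightarrow> val) \<Rightarrow> expr \<Rightarrow> val \<Rightarrow> bool" where "ev \<equiv> eval prog"
abbreviation "cl_arity f \<equiv> arity prog (nm f)"

lemma arity_fn: "f \<in> set fns \<Longrightarrow> cl \<in> set (cls f) \<Longrightarrow> cl_arity f = length (cpats cl)"
  using arity_clause[of cl] cls_cfun[of cl f] by (auto simp: prog_def)

lemma filter_split:
  "filter P l = pre @ x # post \<Longrightarrow> \<exists>i<length l. l ! i = x \<and> (\<forall>j<i. P (l ! j) \<longrightarrow> l ! j \<in> set pre)"
proof (induction l arbitrary: pre)
  case (Cons y l)
  show ?case
  proof (cases "P y \<and> pre = []")
    case True
    then show ?thesis using Cons.prems by (intro exI[of _ 0]) auto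
  next
    case False
    obtain pre' where pre': "filter P l = pre' @ x # post" "P y \<Longrightarrow> pre = y # pre'"
      "\<not> P y \<Longrightarrow> pre = pre'"
      using Cons.prems False by (cases pre; cases "P y") auto
    from Cons.IH[OF pre'(1)] obtain i where i: "i < length l" "l ! i = x" "\<forall>j<i. P (l ! j) \<longrightarrow> l ! j \<in> set pre'" by blast
    have "P ((y # l) ! j) \<Longrightarrow> (y # l) ! j \<in> set pre" if "j < Suc i" for j
      using i(3) pre'(2,3) that by (cases j; cases "P y") auto
    then show ?thesis using i(1,2) by (intro exI[of _ "Suc i"]) auto
  qed
qed simp

text \<open>All clauses of \<open>f\<close> stem from \<open>cls f\<close> and keep their order in
  \<open>prog\<close>, so only the clauses listed there before \<open>cl\<close> have to be
  refuted.\<close>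

lemma call_sel:
  assumes f: "f \<in> set fns" and "cls f = pre @ cl # post" "\<And>c g. c \<in> set pre \<Longrightarrow> map (inst g) (cpats c) \<noteq> vs"
    and "map (inst d) (cpats cl) = vs" "ev d (crhs cl) v"
  shows "call prog (nm f) vs v"
proof -
  obtain i where i: "i < length prog" "prog ! i = cl" "\<forall>j<i. cfun (prog ! j) = nm f \<longrightarrow> prog ! j \<in> set pre"
    using filter_split[of "\<lambda>cl. cfun cl = nm f" prog pre cl post] filter_prog[OF f] assms(2) by auto
  have "cfun cl = nm f" using cls_cfun[of cl f] assms(2) by simp
  then have "first_clause prog (nm f) vs i"
    using i assms(3,4) unfolding first_clause_def matches_def by auto
  then show ?thesis using call_clause[of prog "nm f" vs i d v] i(2) assms(4,5) by simp
qed

lemma call_uniq: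
  assumes "f \<in> set fns" "cl \<in> set (cls f)" "\<And>c g. c \<in> set (cls f) \<Longrightarrow> map (inst g) (cpats c) = vs \<Longrightarrow> c = cl"
    and "map (inst d) (cpats cl) = vs" "ev d (crhs cl) v"
  shows "call prog (nm f) vs v"
proof -
  obtain pre post where s: "cls f = pre @ cl # post" "cl \<notin> set pre" using split_list_first[OF assms(2)] by blast
  show ?thesis by (rule call_sel[OF assms(1) s(1) _ assms(4,5)]) (use assms(3) s in auto)
qed

lemma inst_pxs: "map (inst (en L)) (pxs i n) = map (\<lambda>j. L ! (i + j)) [0..<n]"
  by (simp add: pxs_def en_def)

lemma inst_pxs0: "length L = n \<Longrightarrow> map (inst (en L)) (pxs 0 n) = L"
  by (drule sym) (simp add: inst_pxs map_nth)

lemma call_simple: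
  assumes "f \<in> set fns" "cls f = [Clause (nm f) (pxs 0 n) e]" "length L = n" "ev (en L) e v"
  shows "call prog (nm f) L v"
  by (rule call_sel[of f "[]" _ "[]" _ "en L"]) (use assms inst_pxs0 in auto)

lemma ev_X: "ev (en L) (X i) (L ! i)"
  using ev_var[of prog "en L" "vn i"] by (simp add: en_def)

lemma ev_xs: "length vs = n \<Longrightarrow> (\<And>j. j < n \<Longrightarrow> L ! (i + j) = vs ! j) \<Longrightarrow> list_all2 (ev (en L)) (xs i n) vs"
  using ev_X by (auto simp: xs_def list_all2_conv_all_nth) metis

lemma ev_Con: "ev g (Con c) (VCon c [])"
  using ev_con[of prog g "[]" "[]" c] by simp

lemma ev_If: "ev g c (bool_val x) \<Longrightarrow> (x \<Longrightarrow> ev g s v) \<Longrightarrow> (\<not> x \<Longrightarrow> ev g t v) \<Longrightarrow> ev g (If c s t) v"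
  using ev_if_true ev_if_false by (cases x) (auto simp: bool_val_def)

lemma ev_TR: "ev g TR (bool_val True)" and ev_FA: "ev g FA (bool_val False)"
  using ev_Con by (auto simp: bool_val_def)

lemma ev_apps_partial:
  "ev g h (VFun f ws) \<Longrightarrow> list_all2 (ev g) ss vs \<Longrightarrow> length ws + length vs < arity prog f \<Longrightarrow>
    ev g (apps h ss) (VFun f (ws @ vs))"
proof (induction ss arbitrary: vs rule: rev_induct)
  case (snoc s ss)
  then obtain vs' v where vs: "vs = vs' @ [v]" "list_all2 (ev g) ss vs'" "ev g s v"
    by (auto simp: list_all2_append1 list_all2_Cons1)
  then have "ev g (apps h ss) (VFun f (ws @ vs'))" using snoc by auto
  moreover have "call prog f ((ws @ vs') @ [v]) (VFun f ((ws @ vs') @ [v]))"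
    using snoc.prems(3) vs(1) by (intro call_partial) simp
  ultimately show ?case using ev_app vs by fastforce
qed auto

lemma ev_apps:
  assumes "ev g h (VFun f ws)" "list_all2 (ev g) ss vs" "length ws + length vs = arity prog f" "vs \<noteq> []"
    "call prog f (ws @ vs) v"
  shows "ev g (apps h ss) v"
proof -
  obtain vs' u where vs: "vs = vs' @ [u]" using assms(4) by (metis rev_exhaust)
  then obtain ss' s where ss: "ss = ss' @ [s]" "list_all2 (ev g) ss' vs'" "ev g s u"
    using assms(2) by (auto simp: list_all2_append2 list_all2_Cons2)
  have "ev g (apps h ss') (VFun f (ws @ vs'))"
    using assms(1,3) ss(2) vs by (intro ev_apps_partial) auto
  then show ?thesis using ev_app[of prog g "apps h ss'" f "ws @ vs'" s u v] ss assms(5) vs by simp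
qed

lemma ev_Fn_partial: "list_all2 (ev g) ss vs \<Longrightarrow> length vs < cl_arity f \<Longrightarrow> ev g (apps (Fn f) ss) (VFun (nm f) vs)"
proof -
  assume "list_all2 (ev g) ss vs" "length vs < cl_arity f"
  moreover from this have "ev g (Fn f) (VFun (nm f) [])" by (intro ev_fun call_partial) auto
  ultimately show ?thesis using ev_apps_partial by fastforce
qed

lemma ev_Fn:
  assumes "list_all2 (ev g) ss vs" "length vs = cl_arity f" "vs \<noteq> []" "call prog (nm f) vs v"
  shows "ev g (apps (Fn f) ss) v"
proof -
  have "ev g (Fn f) (VFun (nm f) [])"
    by (intro ev_fun call_partial) (use assms(2,3) in \<open>metis length_greater_0_conv list.size(3)\<close>)
  then show ?thesis using ev_apps assms by fastforce
qed

subsection \<open>Numbers\<close>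

abbreviation "base w \<equiv> Suc (length w)"

fun P :: "bool list \<Rightarrow> nat \<Rightarrow> nat" where
  "P w 0 = base w ^ b"
| "P w (Suc k) = 2 ^ P w k"

definition lst :: "bool list \<Rightarrow> nat \<Rightarrow> val" where "lst w d = input_val (drop (length w - d) w)"

definition dig :: "nat \<Rightarrow> nat \<Rightarrow> nat \<Rightarrow> nat" where "dig B x j = x div B ^ j mod B"

text \<open>Above level 0 the representation is extensional: any function value with the right
  digits will do, and \<open>ws\<close> are arguments it already holds. So repeated predecessors may
  pile up as nested partial applications.\<close>

fun Rep :: "bool list \<Rightarrow> nat \<Rightarrow> nat \<Rightarrow> val list \<Rightarrow> bool" where
  "Rep w 0 x vs = (x < P w 0 \<and> vs = map (\<lambda>j. lst w (dig (base w) x j)) [0..<b])"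
| "Rep w (Suc k) x vs = (x < P w (Suc k) \<and> (\<exists>f ws. vs = [VFun f ws] \<and> arity prog f = length ws + wd k \<and>
     (\<forall>i is. Rep w k i is \<longrightarrow> call prog f (ws @ is) (bool_val (bit x i)))))"

lemma Rep_less: "Rep w k x vs \<Longrightarrow> x < P w k" by (cases k) auto

lemma Rep_length: "Rep w k x vs \<Longrightarrow> length vs = wd k" by (cases k) (auto simp: wd_def)

lemma Rep_nonempty: "Rep w k x vs \<Longrightarrow> vs \<noteq> []" using Rep_length wd_pos by (metis length_0_conv less_irrefl)

lemma lst_0: "lst w 0 = VCon ''nil'' []" by (simp add: lst_def input_val_def)

lemma lst_Suc: "d < length w \<Longrightarrow> lst w (Suc d) = VCon ''cons'' [bool_val (w ! (length w - Suc d)), lst w d]"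
  unfolding lst_def input_val_def by (simp add: Cons_nth_drop_Suc[symmetric] Suc_diff_Suc)

lemma lst_full: "lst w (length w) = input_val w" by (simp add: lst_def)

lemma pow_dvd_dig: "0 < B \<Longrightarrow> (\<forall>i<j. dig B x i = 0) \<longleftrightarrow> B ^ j dvd x"
proof (induction j)
  case (Suc j)
  have "B ^ Suc j dvd x \<longleftrightarrow> B ^ j dvd x \<and> x div B ^ j mod B = 0"
  proof
    assume *: "B ^ Suc j dvd x"
    then have "B ^ j dvd x" by (metis dvd_mult_left power_Suc2)
    moreover have "x div B ^ j mod B = 0" using * Suc.prems by (auto simp: dvd_def)
    ultimately show "B ^ j dvd x \<and> x div B ^ j mod B = 0" by simp
  next
    assume *: "B ^ j dvd x \<and> x div B ^ j mod B = 0"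
    then obtain q where "x div B ^ j = B * q" by (auto simp: mod_eq_0_iff_dvd dvd_def)
    then have "x = B ^ j * (B * q)" using * by (metis dvd_mult_div_cancel)
    then show "B ^ Suc j dvd x" by (simp add: dvd_def)
  qed
  then show ?case using Suc by (auto simp: less_Suc_eq dig_def)
qed simp

text \<open>The borrow reaches digit \<open>j\<close> iff all lower digits are 0, that is, iff
  \<open>B ^ j\<close> divides \<open>x\<close>.\<close>

lemma dig_pred:
  assumes "0 < B" "0 < x"
  shows "dig B (x - 1) j = (if B ^ j dvd x then (if dig B x j = 0 then B - 1 else dig B x j - 1) else dig B x j)"
proof -
  obtain y where y: "x = Suc y" using assms(2) by (cases x) auto
  have d: "x div B ^ j = (if B ^ j dvd x then Suc (y div B ^ j) else y div B ^ j)"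
    using div_Suc[of y "B ^ j"] y by (simp add: mod_eq_0_iff_dvd)
  have "Suc z mod B = (if Suc (z mod B) = B then 0 else Suc (z mod B))" for z by (rule mod_Suc)
  moreover have "z mod B < B" for z using assms(1) by simp
  ultimately show ?thesis using d y unfolding dig_def
    by (auto split: if_splits)
qed

lemma bit_dig: "bit x i \<longleftrightarrow> dig 2 x i \<noteq> 0"
  by (simp add: bit_iff_odd dig_def odd_iff_mod_2_eq_one)

lemma bit_pred: assumes "0 < (x::nat)"
  shows "bit (x - 1) i \<longleftrightarrow> (if \<forall>j<i. \<not> bit x j then \<not> bit x i else bit x i)"
proof -
  have "dig 2 x i < 2" unfolding dig_def by simp
  then have "dig 2 x i = 0 \<or> dig 2 x i = 1" by linarith
  then show ?thesis using dig_pred[of 2 x i] assms pow_dvd_dig[of 2 i x] by (auto simp: bit_dig)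
qed

lemma dig_zero: "0 < B \<Longrightarrow> x < B ^ m \<Longrightarrow> (\<forall>j<m. dig B x j = 0) \<longleftrightarrow> x = 0"
  using pow_dvd_dig[of B m x] by (auto dest: dvd_imp_le simp: dig_def)

lemma fns_mem [simp]: "Main \<in> set fns" "IsAcc \<in> set fns" "Rule \<in> set fns" "Init0 \<in> set fns" "Initw \<in> set fns" "Init \<in> set fns"
  "Cell \<in> set fns" "Cellp \<in> set fns" "k \<le> K \<Longrightarrow> Isz k \<in> set fns" "k < K \<Longrightarrow> Zlow k \<in> set fns" "k < K \<Longrightarrow> Prd k \<in> set fns"
  "k < K \<Longrightarrow> Ones k \<in> set fns" "j < b \<Longrightarrow> Digit j \<in> set fns"
  by (auto simp: fns_def)

lemma length_pxs [simp]: "length (pxs i n) = n" by (simp add: pxs_def)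

lemma cl_arities [simp]:
  "cl_arity IsAcc = 1" "cl_arity Rule = 3" "cl_arity Init0 = 1" "cl_arity Initw = 2 + wd K" "cl_arity Init = 1 + wd K"
  "cl_arity Cell = 1 + wd K + wd K" "cl_arity Cellp = 1 + wd K + wd K" "k \<le> K \<Longrightarrow> cl_arity (Isz k) = 1 + wd k"
  "k < K \<Longrightarrow> cl_arity (Zlow k) = 2 + wd k" "k < K \<Longrightarrow> cl_arity (Prd k) = 2 + wd k" "k < K \<Longrightarrow> cl_arity (Ones k) = wd k"
  "j < b \<Longrightarrow> cl_arity (Digit j) = 1 + b" "cl_arity Main = 1"
proof -
  note a = arity_fn[OF _ list.set_sel(1)[OF cls_nonempty]]
  show "cl_arity IsAcc = 1" "cl_arity Init0 = 1" "cl_arity Initw = 2 + wd K" "cl_arity Init = 1 + wd K"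
    "cl_arity Cell = 1 + wd K + wd K" "cl_arity Cellp = 1 + wd K + wd K" "cl_arity Main = 1"
    by (subst a; simp)+
  have "Clause (nm Rule) [PCon (cn blank) [], PCon (cn blank) [], PCon (cn blank) []] (cc (\<delta> blank blank blank)) \<in> set (cls Rule)"
    using cells(1) by (auto intro!: bexI[of _ blank] image_eqI[where x = blank])
  from arity_fn[OF _ this] show "cl_arity Rule = 3" by simp
  show "k \<le> K \<Longrightarrow> cl_arity (Isz k) = 1 + wd k" by (subst a; cases k; simp add: wd_def)
  show "k < K \<Longrightarrow> cl_arity (Zlow k) = 2 + wd k" "k < K \<Longrightarrow> cl_arity (Prd k) = 2 + wd k" "k < K \<Longrightarrow> cl_arity (Ones k) = wd k"
    by (subst a; simp)+
  show "j < b \<Longrightarrow> cl_arity (Digit j) = 1 + b" by (subst a; simp)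
qed

lemma map_inst_Digit:
  assumes "j < b" "length ds = b"
  shows "map (inst g) (PX 0 # replicate j pnil @ q # pxs (j + 2) (b - 1 - j)) = u # ds \<longleftrightarrow>
    g (vn 0) = u \<and> (\<forall>i<j. ds ! i = VCon ''nil'' []) \<and> inst g q = ds ! j \<and> (\<forall>i. j < i \<and> i < b \<longrightarrow> g (vn (Suc i)) = ds ! i)"
proof -
  let ?l = "map (inst g) (replicate j pnil @ q # pxs (j + 2) (b - 1 - j))"
  have nth: "?l ! i = (if i < j then VCon ''nil'' [] else if i = j then inst g q else g (vn (Suc i)))" if "i < b" for i
    using that assms(1) by (auto simp: nth_append nth_Cons' pxs_def)
  have len: "length ?l = b" using assms(1) by simp
  have "?l = ds \<longleftrightarrow> (\<forall>i<b. ?l ! i = ds ! i)" using assms(2) len by (simp add: list_eq_iff_nth_eq del: map_append)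
  also have "\<dots> \<longleftrightarrow> (\<forall>i<b. (if i < j then VCon ''nil'' [] else if i = j then inst g q else g (vn (Suc i))) = ds ! i)"
    using nth by auto
  also have "\<dots> \<longleftrightarrow> (\<forall>i<j. ds ! i = VCon ''nil'' []) \<and> inst g q = ds ! j \<and> (\<forall>i. j < i \<and> i < b \<longrightarrow> g (vn (Suc i)) = ds ! i)"
    (is "(\<forall>i<b. ?Q i) \<longleftrightarrow> ?R")
  proof
    assume *: "\<forall>i<b. ?Q i"
    then have Q: "?Q i" if "i < b" for i using that by blast
    show ?R
    proof (intro conjI allI impI)
      show "ds ! i = VCon ''nil'' []" if "i < j" for i using Q[of i] that assms(1) by simp
      show "inst g q = ds ! j" using Q[OF assms(1)] by simp
      show "g (vn (Suc i)) = ds ! i" if "j < i \<and> i < b" for i using Q[of i] that by simp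
    qed
  next
    assume ?R
    then show "\<forall>i<b. ?Q i" by simp
  qed
  finally show ?thesis by auto
qed

lemma call_Digit:
  assumes "Rep w 0 x ds" "0 < x" "j < b"
  shows "call prog (nm (Digit j)) (input_val w # ds) (lst w (dig (base w) (x - 1) j))"
proof -
  let ?B = "base w"
  let ?N = "VCon ''nil'' []"
  have len: "length ds = b" using assms(1) Rep_length by (simp add: wd_def)
  have ds: "ds ! i = lst w (dig ?B x i)" if "i < b" for i using assms(1) that by simp
  have dl: "dig ?B x i \<le> length w" for i by (simp add: dig_def less_Suc_eq_le[symmetric])
  have nil_iff: "ds ! i = ?N \<longleftrightarrow> dig ?B x i = 0" if "i < b" for i
    using ds[OF that] dl[of i] lst_0 lst_Suc[of "dig ?B x i - 1" w] by (cases "dig ?B x i") auto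
  have low: "(\<forall>i<j. ds ! i = ?N) \<longleftrightarrow> ?B ^ j dvd x"
    using pow_dvd_dig[of ?B j x] nil_iff assms(3) by auto
  note mi = map_inst_Digit[OF assms(3) len]
  let ?q1 = "pcons (PX (b + 1)) (PX (b + 2))"
  let ?cl = "\<lambda>q e. Clause (nm (Digit j)) (PX 0 # replicate j pnil @ q # pxs (j + 2) (b - 1 - j)) e"
  let ?c3 = "Clause (nm (Digit j)) (pxs 0 (1 + b)) (X (1 + j))"
  have cls: "cls (Digit j) = [?cl ?q1 (X (b + 2)), ?cl pnil (X 0), ?c3]" by simp
  have res: "dig ?B (x - 1) j = (if ?B ^ j dvd x then (if dig ?B x j = 0 then length w else dig ?B x j - 1) else dig ?B x j)"
    using dig_pred[of ?B x j] assms(2) by simp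
  show ?thesis
  proof (cases "?B ^ j dvd x")
    case True
    show ?thesis
    proof (cases "dig ?B x j")
      case 0
      then have dj: "ds ! j = ?N" using nil_iff assms(3) by simp
      let ?g = "en (input_val w # ds)"
      have m: "map (inst ?g) (cpats (?cl pnil (X 0))) = input_val w # ds"
        unfolding clause.sel mi using low True dj by (simp add: en_def)
      have n: "map (inst g) (cpats c) \<noteq> input_val w # ds" if "c \<in> set [?cl ?q1 (X (b + 2))]" for c g
        using that mi[of g ?q1 "input_val w"] dj by auto
      show ?thesis
        by (rule call_sel[of _ "[?cl ?q1 (X (b + 2))]" "?cl pnil (X 0)" "[?c3]" _ ?g, OF _ _ n m])
          (use assms(3) ev_X[of "input_val w # ds" 0] res True 0 lst_full in auto)
    next
      case (Suc d)
      then have d: "d < length w" using dl[of j] by simp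
      have dj: "ds ! j = VCon ''cons'' [bool_val (w ! (length w - Suc d)), lst w d]"
        using ds[OF assms(3)] Suc lst_Suc[OF d] by simp
      let ?g = "en ((input_val w # ds) @ [bool_val (w ! (length w - Suc d)), lst w d])"
      have nth: "((input_val w # ds) @ ys) ! (b + 1) = ys ! 0" "((input_val w # ds) @ ys) ! (b + 2) = ys ! 1" for ys
        using len by (auto simp: nth_append)
      have g: "?g (vn (b + 1)) = bool_val (w ! (length w - Suc d))" "?g (vn (b + 2)) = lst w d"
        unfolding en_def length_vn nth by simp_all
      have m: "map (inst ?g) (cpats (?cl ?q1 (X (b + 2)))) = input_val w # ds"
        unfolding clause.sel mi using low True dj g len by (auto simp: en_def nth_append)
      have e: "ev ?g (X (b + 2)) (lst w (dig ?B (x - 1) j))"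
        using ev_var[of prog ?g "vn (b + 2)"] g(2) res True Suc by simp
      show ?thesis
        by (rule call_sel[of _ "[]" "?cl ?q1 (X (b + 2))" "[?cl pnil (X 0), ?c3]" _ ?g, OF _ _ _ m])
          (use assms(3) e in auto)
    qed
  next
    case False
    let ?g = "en (input_val w # ds)"
    have m: "map (inst ?g) (cpats ?c3) = input_val w # ds" using inst_pxs0[of "input_val w # ds" "1 + b"] len by simp
    have nq: "map (inst g) (cpats (?cl q e)) \<noteq> input_val w # ds" for g q e
      unfolding clause.sel mi using low False by blast
    have n: "map (inst g) (cpats c) \<noteq> input_val w # ds" if "c \<in> set [?cl ?q1 (X (b + 2)), ?cl pnil (X 0)]" for c g
    proof -
      have "c = ?cl ?q1 (X (b + 2)) \<or> c = ?cl pnil (X 0)" using that by (simp only: list.set insert_iff empty_iff simp_thms)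
      then show ?thesis
      proof
        assume c: "c = ?cl ?q1 (X (b + 2))" show ?thesis unfolding c by (rule nq)
      next
        assume c: "c = ?cl pnil (X 0)" show ?thesis unfolding c by (rule nq)
      qed
    qed
    show ?thesis
      by (rule call_sel[of _ "[?cl ?q1 (X (b + 2)), ?cl pnil (X 0)]" ?c3 "[]" _ ?g, OF _ _ n m])
        (use assms(3) ev_X[of "input_val w # ds" "1 + j"] res False ds[OF assms(3)] in auto)
  qed
qed

text \<open>The zero test is a function to be called, but \<open>predE\<close> and
  \<open>maxE\<close> are expressions spliced into clause bodies; so they are treated for every
  environment \<open>g\<close> and every \<open>e\<close> that yields the input.\<close>

definition level_ok :: "bool list \<Rightarrow> nat \<Rightarrow> bool" where
  "level_ok w k \<longleftrightarrow>
    (\<forall>x vs. Rep w k x vs \<longrightarrow> call prog (nm (Isz k)) (input_val w # vs) (bool_val (x = 0))) \<and>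
    (\<forall>x vs g e ts. Rep w k x vs \<longrightarrow> 0 < x \<longrightarrow> ev g e (input_val w) \<longrightarrow> list_all2 (ev g) ts vs \<longrightarrow>
       (\<exists>vs'. list_all2 (ev g) (predE k e ts) vs' \<and> Rep w k (x - 1) vs')) \<and>
    (\<forall>g e. ev g e (input_val w) \<longrightarrow> (\<exists>vs. list_all2 (ev g) (maxE k e) vs \<and> Rep w k (P w k - 1) vs))"

lemma level_0: "level_ok w 0"
  unfolding level_ok_def
proof (intro conjI allI impI)
  fix x vs assume R: "Rep w 0 x vs"
  let ?N = "VCon ''nil'' []"
  let ?c1 = "Clause (nm (Isz 0)) (PX 0 # replicate b pnil) TR" and ?c2 = "Clause (nm (Isz 0)) (pxs 0 (1 + b)) FA"
  have len: "length vs = b" using R by simp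
  have "vs ! i = ?N \<longleftrightarrow> dig (base w) x i = 0" if "i < b" for i
  proof -
    have "dig (base w) x i \<le> length w" by (simp add: dig_def less_Suc_eq_le[symmetric])
    then show ?thesis using R that lst_0 lst_Suc[of "dig (base w) x i - 1" w] by (cases "dig (base w) x i") auto
  qed
  then have z: "x = 0 \<longleftrightarrow> vs = replicate b ?N"
    using dig_zero[of "base w" x b] R len by (auto simp: list_eq_iff_nth_eq)
  show "call prog (nm (Isz 0)) (input_val w # vs) (bool_val (x = 0))"
  proof (cases "x = 0")
    case True
    show ?thesis
      by (rule call_sel[of _ "[]" ?c1 "[?c2]" _ "en [input_val w]"]) (use True z ev_TR in \<open>auto simp: en_def vn_def\<close>)
  next
    case False
    show ?thesis
      by (rule call_sel[of _ "[?c1]" ?c2 "[]" _ "en (input_val w # vs)"])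
        (use False z ev_FA inst_pxs0[of "input_val w # vs" "Suc b"] len in \<open>auto\<close>)
  qed
next
  fix x vs g e ts assume R: "Rep w 0 x vs" "0 < x" "ev g e (input_val w)" "list_all2 (ev g) ts vs"
  have "ev g (apps (Fn (Digit j)) (e # ts)) (lst w (dig (base w) (x - 1) j))" if "j < b" for j
    by (rule ev_Fn[of _ _ "input_val w # vs"]) (use R that call_Digit in auto)
  then show "\<exists>vs'. list_all2 (ev g) (predE 0 e ts) vs' \<and> Rep w 0 (x - 1) vs'"
    using R(1) by (intro exI[of _ "map (\<lambda>j. lst w (dig (base w) (x - 1) j)) [0..<b]"]) (auto simp: list_all2_conv_all_nth)
next
  fix g e assume e: "ev g e (input_val w)"
  \<comment> \<open>Seen as the predecessor of \<open>base w ^ b\<close>, whose lowest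
    \<open>b\<close> digits are all 0: the borrow passes through every one of them.\<close>
  have "dig (base w) (P w 0 - 1) j = length w" if "j < b" for j
  proof -
    have d: "base w ^ j dvd base w ^ b" using that by (simp add: le_imp_power_dvd)
    have "base w ^ b div base w ^ j = base w * base w ^ (b - j - 1)"
      using that by (simp add: power_diff[symmetric] Suc_diff_Suc flip: power_Suc)
    then have "dig (base w) (base w ^ b) j = 0" unfolding dig_def by (metis mod_mult_self1_is_0)
    then show ?thesis using dig_pred[of "base w" "base w ^ b" j] d by simp
  qed
  then show "\<exists>vs. list_all2 (ev g) (maxE 0 e) vs \<and> Rep w 0 (P w 0 - 1) vs"
    using e lst_full by (intro exI[of _ "replicate b (input_val w)"]) (auto simp: list_all2_conv_all_nth list_eq_iff_nth_eq)
qed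

lemma level_okD:
  assumes "level_ok w k"
  shows "Rep w k x vs \<Longrightarrow> call prog (nm (Isz k)) (input_val w # vs) (bool_val (x = 0))"
    "Rep w k x vs \<Longrightarrow> 0 < x \<Longrightarrow> ev g e (input_val w) \<Longrightarrow> list_all2 (ev g) ts vs \<Longrightarrow>
       \<exists>vs'. list_all2 (ev g) (predE k e ts) vs' \<and> Rep w k (x - 1) vs'"
    "ev g e (input_val w) \<Longrightarrow> \<exists>vs. list_all2 (ev g) (maxE k e) vs \<and> Rep w k (P w k - 1) vs"
  using assms unfolding level_ok_def by blast+

lemma ev_isz:
  assumes "level_ok w k" "k \<le> K" "Rep w k x vs" "ev g e (input_val w)" "list_all2 (ev g) ts vs"
  shows "ev g (isz k e ts) (bool_val (x = 0))"
  by (rule ev_Fn[of _ _ "input_val w # vs"]) (use assms level_okD(1) Rep_length in auto)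

lemma ev_bit:
  assumes "Rep w (Suc k) x [F]" "Rep w k i is" "ev g e F" "list_all2 (ev g) ts is"
  shows "ev g (apps e ts) (bool_val (bit x i))"
proof -
  obtain f ws where f: "F = VFun f ws" "arity prog f = length ws + wd k" "call prog f (ws @ is) (bool_val (bit x i))"
    using assms(1,2) by auto
  show ?thesis by (rule ev_apps[of _ _ f ws _ "is"]) (use f assms Rep_length Rep_nonempty in auto)
qed

lemma call_Zlow:
  assumes ok: "level_ok w k" and k: "k < K" and F: "Rep w (Suc k) x [F]"
  shows "Rep w k i is \<Longrightarrow> call prog (nm (Zlow k)) (input_val w # F # is) (bool_val (\<forall>j<i. \<not> bit x j))"
proof (induction i arbitrary: "is")
  case (0 "is")
  let ?L = "input_val w # F # is"
  have i: "list_all2 (ev (en ?L)) (xs 2 (wd k)) is" by (rule ev_xs) (use 0 Rep_length in auto)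
  have x0: "ev (en ?L) (X 0) (input_val w)" using ev_X[of ?L 0] by simp
  have z: "ev (en ?L) (isz k (X 0) (xs 2 (wd k))) (bool_val True)"
    using ev_isz[OF ok _ 0 x0 i] k by simp
  show ?case
    by (rule call_simple[of _ "2 + wd k"]) (use k 0 Rep_length ev_If[OF z] ev_TR in \<open>auto simp: Let_def\<close>)
next
  case (Suc i "is")
  let ?L = "input_val w # F # is"
  have i: "list_all2 (ev (en ?L)) (xs 2 (wd k)) is" by (rule ev_xs) (use Suc.prems Rep_length in auto)
  have x0: "ev (en ?L) (X 0) (input_val w)" and x1: "ev (en ?L) (X 1) F"
    using ev_X[of ?L 0] ev_X[of ?L 1] by simp_all
  have z: "ev (en ?L) (isz k (X 0) (xs 2 (wd k))) (bool_val False)"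
    using ev_isz[OF ok _ Suc.prems x0 i] k by simp
  obtain js where js: "list_all2 (ev (en ?L)) (predE k (X 0) (xs 2 (wd k))) js" "Rep w k i js"
    using level_okD(2)[OF ok Suc.prems _ x0 i] by auto
  have t: "ev (en ?L) (apps (X 1) (predE k (X 0) (xs 2 (wd k)))) (bool_val (bit x i))"
    by (rule ev_bit[OF F js(2) x1 js(1)])
  have rec: "ev (en ?L) (apps (Fn (Zlow k)) (X 0 # X 1 # predE k (X 0) (xs 2 (wd k)))) (bool_val (\<forall>j<i. \<not> bit x j))"
    by (rule ev_Fn[of _ _ "input_val w # F # js"]) (use x0 x1 js Suc.IH k Rep_length in auto)
  have e1: "bit x i \<Longrightarrow> (\<forall>j<Suc i. \<not> bit x j) = False" and e2: "\<not> bit x i \<Longrightarrow> (\<forall>j<Suc i. \<not> bit x j) = (\<forall>j<i. \<not> bit x j)"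
    by (auto simp: less_Suc_eq)
  have "ev (en ?L) (If (isz k (X 0) (xs 2 (wd k))) TR (If (apps (X 1) (predE k (X 0) (xs 2 (wd k)))) FA
      (apps (Fn (Zlow k)) (X 0 # X 1 # predE k (X 0) (xs 2 (wd k)))))) (bool_val (\<forall>j<Suc i. \<not> bit x j))"
    by (rule ev_If[OF z], simp, rule ev_If[OF t]) (simp only: e1 ev_FA, simp only: e2 rec)
  then show ?case
    by (intro call_simple[of _ "2 + wd k"]) (use k Suc.prems Rep_length in \<open>auto simp: Let_def\<close>)
qed

lemma level_Suc:
  assumes ok: "level_ok w k" and k: "k < K"
  shows "level_ok w (Suc k)"
  unfolding level_ok_def
proof (intro conjI allI impI)
  fix x vs assume R: "Rep w (Suc k) x vs"
  then obtain F where F: "vs = [F]" by auto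
  let ?L = "[input_val w, F]"
  have x0: "ev (en ?L) (X 0) (input_val w)" and x1: "ev (en ?L) (X 1) F"
    using ev_X[of ?L 0] ev_X[of ?L 1] by simp_all
  obtain ms where ms: "list_all2 (ev (en ?L)) (maxE k (X 0)) ms" "Rep w k (P w k - 1) ms"
    using level_okD(3)[OF ok x0] by blast
  have t: "ev (en ?L) (apps (X 1) (maxE k (X 0))) (bool_val (bit x (P w k - 1)))"
    by (rule ev_bit[OF _ ms(2) x1 ms(1)]) (use R F in simp)
  have zl: "ev (en ?L) (apps (Fn (Zlow k)) (X 0 # X 1 # maxE k (X 0))) (bool_val (\<forall>j<P w k - 1. \<not> bit x j))"
    by (rule ev_Fn[of _ _ "input_val w # F # ms"]) (use x0 x1 ms call_Zlow[OF ok k] R F k Rep_length in auto)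
  have pos: "0 < P w k" using Rep_less[OF ms(2)] by simp
  \<comment> \<open>\<open>Zlow\<close> looks strictly below its index, so the top digit, with index
    \<open>P w k - 1\<close>, is tested on its own.\<close>
  have "x = 0 \<longleftrightarrow> (\<forall>j<P w k. \<not> bit x j)"
    using Rep_less[OF R] dig_zero[of 2 x "P w k"] by (simp add: bit_dig)
  also have "\<dots> \<longleftrightarrow> \<not> bit x (P w k - 1) \<and> (\<forall>j<P w k - 1. \<not> bit x j)"
    using pos by (cases "P w k") (auto simp: less_Suc_eq)
  finally have "ev (en ?L) (If (apps (X 1) (maxE k (X 0))) FA (apps (Fn (Zlow k)) (X 0 # X 1 # maxE k (X 0)))) (bool_val (x = 0))"
    using ev_If[OF t] ev_FA zl by auto
  then show "call prog (nm (Isz (Suc k))) (input_val w # vs) (bool_val (x = 0))"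
    unfolding F by (intro call_simple[of _ 2]) (use k in auto)
next
  fix x vs g e ts assume a: "Rep w (Suc k) x vs" "0 < x" "ev g e (input_val w)" "list_all2 (ev g) ts vs"
  then obtain F where F: "vs = [F]" by auto
  have c: "call prog (nm (Prd k)) ([input_val w, F] @ is) (bool_val (bit (x - 1) i))" if R: "Rep w k i is" for i "is"
  proof -
    let ?L = "input_val w # F # is"
    have i: "list_all2 (ev (en ?L)) (xs 2 (wd k)) is" by (rule ev_xs) (use R Rep_length in auto)
    have x0: "ev (en ?L) (X 0) (input_val w)" and x1: "ev (en ?L) (X 1) F"
      using ev_X[of ?L 0] ev_X[of ?L 1] by simp_all
    have zl: "ev (en ?L) (apps (Fn (Zlow k)) (X 0 # X 1 # xs 2 (wd k))) (bool_val (\<forall>j<i. \<not> bit x j))"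
      by (rule ev_Fn[of _ _ ?L]) (use x0 x1 i call_Zlow[OF ok k] a(1) F k R Rep_length in auto)
    have t: "ev (en ?L) (apps (X 1) (xs 2 (wd k))) (bool_val (bit x i))"
      by (rule ev_bit[OF _ R x1 i]) (use a(1) F in simp)
    have "ev (en ?L) (If (apps (X 1) (xs 2 (wd k))) FA TR) (bool_val (\<not> bit x i))"
      using ev_If[OF t] ev_FA ev_TR by (cases "bit x i") auto
    then have "ev (en ?L) (If (apps (Fn (Zlow k)) (X 0 # X 1 # xs 2 (wd k))) (If (apps (X 1) (xs 2 (wd k))) FA TR)
        (apps (X 1) (xs 2 (wd k)))) (bool_val (bit (x - 1) i))"
      using ev_If[OF zl] t bit_pred[OF a(2), of i] by auto
    then have "call prog (nm (Prd k)) ?L (bool_val (bit (x - 1) i))"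
      by (intro call_simple[of _ "2 + wd k"]) (use k R Rep_length in \<open>auto simp: Let_def\<close>)
    then show ?thesis by simp
  qed
  have "ev g (apps (Fn (Prd k)) (e # ts)) (VFun (nm (Prd k)) [input_val w, F])"
    by (rule ev_Fn_partial) (use a F k in auto)
  moreover have "Rep w (Suc k) (x - 1) [VFun (nm (Prd k)) [input_val w, F]]"
    using c k Rep_less[OF a(1)] by auto
  ultimately show "\<exists>vs'. list_all2 (ev g) (predE (Suc k) e ts) vs' \<and> Rep w (Suc k) (x - 1) vs'"
    by (intro exI[of _ "[VFun (nm (Prd k)) [input_val w, F]]"]) auto
next
  fix g e
  have c: "call prog (nm (Ones k)) is (bool_val (bit (P w (Suc k) - 1) i))" if R: "Rep w k i is" for i "is"
  proof -
    have "bit ((2::nat) ^ P w k - 1) i" using Rep_less[OF R] unfolding mask_eq_exp_minus_1[symmetric] by (simp add: bit_mask_iff)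
    then show ?thesis by (intro call_simple[of _ "wd k"]) (use k R Rep_length ev_TR in auto)
  qed
  have "ev g (Fn (Ones k)) (VFun (nm (Ones k)) [])" by (intro ev_fun call_partial) (use k in simp)
  moreover have "Rep w (Suc k) (P w (Suc k) - 1) [VFun (nm (Ones k)) []]"
    using c k by auto
  ultimately show "\<exists>vs. list_all2 (ev g) (maxE (Suc k) e) vs \<and> Rep w (Suc k) (P w (Suc k) - 1) vs"
    by (intro exI[of _ "[VFun (nm (Ones k)) []]"]) auto
qed

lemma level_K: "level_ok w K"
proof -
  have "k \<le> K \<Longrightarrow> level_ok w k" for k
    by (induction k) (auto intro: level_0 level_Suc)
  then show ?thesis by simp
qed

end

section \<open>Correctness of the cell computation\<close>

context ca_program
begin

text \<open>Missing neighbours left of position 0 count as \<open>blank\<close>; for the machine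
  this is justified by \<open>square_left\<close>.\<close>

fun cv :: "bool list \<Rightarrow> nat \<Rightarrow> nat \<Rightarrow> nat" where
  "cv w 0 i = (if i = 0 then if w ! 0 then h1 else h0 else if i < length w then if w ! i then y1 else y0 else blank)"
| "cv w (Suc t) i = \<delta> (if i < 2 then blank else cv w t (i - 2)) (if i < 1 then blank else cv w t (i - 1)) (cv w t i)"

lemma cv_less: "cv w t i < C"
  by (induction t arbitrary: i) (use cells \<delta> in auto)

abbreviation "cell i \<equiv> VCon (cn i) []"

lemma input_val_simps [simp]: "input_val [] = VCon ''nil'' []" "input_val (a # l) = VCon ''cons'' [bool_val a, input_val l]"
  by (simp_all add: input_val_def)

lemma call_Rule:
  assumes "i < C" "j < C" "k < C"
  shows "call prog (nm Rule) [cell i, cell j, cell k] (cell (\<delta> i j k))"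
proof (rule call_uniq[of _ "Clause (nm Rule) [PCon (cn i) [], PCon (cn j) [], PCon (cn k) []] (cc (\<delta> i j k))" _ "en []"])
  show "Clause (nm Rule) [PCon (cn i) [], PCon (cn j) [], PCon (cn k) []] (cc (\<delta> i j k)) \<in> set (cls Rule)"
    by (simp, rule bexI[of _ i], rule bexI[of _ j], rule image_eqI[where x = k]) (use assms in auto)
qed (use ev_Con in auto)

lemma call_Init0: "w \<noteq> [] \<Longrightarrow> call prog (nm Init0) [input_val w] (cell (cv w 0 0))"
proof -
  assume "w \<noteq> []"
  then obtain a l where w: "w = a # l" by (cases w) auto
  show ?thesis
    by (rule call_uniq[of _ "Clause (nm Init0) [pcons (PCon (if a then ''true'' else ''false'') []) (PX 0)] (cc (if a then h1 else h0))"
          _ "en [input_val l]"])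
      (use ev_Con w in \<open>auto simp: bool_val_def en_def vn_def split: if_splits\<close>)
qed

lemma inst_pxs_eq: "length vs = n \<Longrightarrow> (\<And>j. j < n \<Longrightarrow> L ! (i + j) = vs ! j) \<Longrightarrow> map (inst (en L)) (pxs i n) = vs"
  by (simp add: inst_pxs list_eq_iff_nth_eq)

lemma ev_bool: "ev g e (bool_val x) \<Longrightarrow> ev g (If e (cc i) (cc j)) (cell (if x then i else j))"
  using ev_If[of g e x "cc i" "cell (if x then i else j)" "cc j"] ev_Con by simp

text \<open>Generalised from the input to any list \<open>l\<close>, because the recursion drops a
  letter each time it decrements \<open>i\<close>.\<close>

lemma call_Initw:
  "Rep w K i is \<Longrightarrow> call prog (nm Initw) (input_val w # input_val l # is)
     (cell (if i < length l then if l ! i then y1 else y0 else blank))"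
proof (induction l arbitrary: i "is")
  case Nil
  let ?L = "input_val w # VCon ''nil'' [] # is"
  have "map (inst (en ?L)) (pxs 2 (wd K)) = is"
    by (rule inst_pxs_eq) (use Nil Rep_length in auto)
  then show ?case
    by (intro call_sel[of _ "[]" _ _ _ "en ?L"]) (use ev_Con in \<open>auto simp: en_def vn_def\<close>)
next
  case (Cons a l)
  let ?L = "input_val w # bool_val a # is @ [input_val l]"
  have len: "length is = wd K" using Cons.prems Rep_length by simp
  have e: "ev (en ?L) (X 0) (input_val w)" "ev (en ?L) (X 1) (bool_val a)" "ev (en ?L) (X (2 + wd K)) (input_val l)"
    using ev_X[of ?L 0] ev_X[of ?L 1] ev_X[of ?L "2 + wd K"] len by (simp_all add: nth_append)
  have i: "list_all2 (ev (en ?L)) (xs 2 (wd K)) is"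
    by (rule ev_xs) (use len in \<open>auto simp: nth_append\<close>)
  have z: "ev (en ?L) (isz K (X 0) (xs 2 (wd K))) (bool_val (i = 0))"
    using ev_isz[OF level_K _ Cons.prems e(1) i] by simp
  have m: "map (inst (en ?L)) (pxs 2 (wd K)) = is"
    by (rule inst_pxs_eq) (use len in \<open>auto simp: nth_append\<close>)
  have v: "en ?L (vn 0) = input_val w" "en ?L (vn 1) = bool_val a" "en ?L (vn (2 + wd K)) = input_val l"
    using len by (simp_all add: en_def nth_append)
  let ?c1 = "Clause (nm Initw) (PX 0 # pnil # pxs 2 (wd K)) (cc blank)"
  let ?c2 = "Clause (nm Initw) (PX 0 # pcons (PX 1) (PX (2 + wd K)) # pxs 2 (wd K))
       (If (isz K (X 0) (xs 2 (wd K))) (If (X 1) (cc y1) (cc y0))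
         (apps (Fn Initw) (X 0 # X (2 + wd K) # predE K (X 0) (xs 2 (wd K)))))"
  have r: "ev (en ?L) (apps (Fn Initw) (X 0 # X (2 + wd K) # predE K (X 0) (xs 2 (wd K))))
      (cell (if i < length (a # l) then if (a # l) ! i then y1 else y0 else blank))" if pos: "0 < i"
  proof -
    obtain js where js: "list_all2 (ev (en ?L)) (predE K (X 0) (xs 2 (wd K))) js" "Rep w K (i - 1) js"
      using level_okD(2)[OF level_K Cons.prems pos e(1) i] by blast
    have "call prog (nm Initw) (input_val w # input_val l # js)
       (cell (if i < length (a # l) then if (a # l) ! i then y1 else y0 else blank))"
      using Cons.IH[OF js(2)] pos by (cases i) auto
    then show ?thesis
      by (intro ev_Fn[of _ _ "input_val w # input_val l # js"]) (use e(1,3) js Rep_length in auto)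
  qed
  show ?case
  proof (rule call_sel[of _ "[?c1]" ?c2 "[]" _ "en ?L"])
    show "map (inst (en ?L)) (cpats ?c2) = input_val w # input_val (a # l) # is"
      using m v by simp
    show "ev (en ?L) (crhs ?c2) (cell (if i < length (a # l) then if (a # l) ! i then y1 else y0 else blank))"
      unfolding clause.sel by (rule ev_If[OF z]) (use ev_bool[OF e(2), of y1 y0] r in auto)
  qed auto
qed

lemma call_Init:
  assumes "w \<noteq> []" "Rep w K i is" shows "call prog (nm Init) (input_val w # is) (cell (cv w 0 i))"
proof -
  let ?L = "input_val w # is"
  have x: "ev (en ?L) (X 0) (input_val w)" using ev_X[of ?L 0] by simp
  have i: "list_all2 (ev (en ?L)) (xs 1 (wd K)) is" by (rule ev_xs) (use assms Rep_length in auto)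
  have z: "ev (en ?L) (isz K (X 0) (xs 1 (wd K))) (bool_val (i = 0))"
    using ev_isz[OF level_K _ assms(2) x i] by simp
  have a: "ev (en ?L) (apps (Fn Init0) [X 0]) (cell (cv w 0 0))"
    by (rule ev_Fn[of _ _ "[input_val w]"]) (use x call_Init0 assms in auto)
  have c: "ev (en ?L) (apps (Fn Initw) (X 0 # X 0 # xs 1 (wd K))) (cell (cv w 0 i))" if "i \<noteq> 0"
    by (rule ev_Fn[of _ _ "input_val w # input_val w # is"])
      (use x i call_Initw[OF assms(2), of w] Rep_length[OF assms(2)] that in auto)
  show ?thesis
    by (rule call_simple[of _ "1 + wd K"])
      (use Rep_length[OF assms(2)] ev_If[OF z, of "apps (Fn Init0) [X 0]"] a c in \<open>auto simp del: cv.simps\<close>)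
qed

definition cell_ok :: "bool list \<Rightarrow> nat \<Rightarrow> bool" where
  "cell_ok w t \<longleftrightarrow> (\<forall>ts i is. Rep w K t ts \<longrightarrow> Rep w K i is \<longrightarrow>
     call prog (nm Cell) (input_val w # ts @ is) (cell (cv w t i)))"

lemma cell_env:
  assumes "Rep w K t ts" "Rep w K i is"
  shows "ev (en (input_val w # ts @ is)) (X 0) (input_val w)"
    "list_all2 (ev (en (input_val w # ts @ is))) (xs 1 (wd K)) ts"
    "list_all2 (ev (en (input_val w # ts @ is))) (xs (1 + wd K) (wd K)) is"
    "length (input_val w # ts @ is) = 1 + wd K + wd K"
proof -
  have l: "length ts = wd K" "length is = wd K" using assms Rep_length by auto
  show "ev (en (input_val w # ts @ is)) (X 0) (input_val w)" using ev_X[of "input_val w # ts @ is" 0] by simp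
  show "list_all2 (ev (en (input_val w # ts @ is))) (xs 1 (wd K)) ts"
    "list_all2 (ev (en (input_val w # ts @ is))) (xs (1 + wd K) (wd K)) is"
    by (rule ev_xs; use l in \<open>auto simp: nth_append\<close>)+
  show "length (input_val w # ts @ is) = 1 + wd K + wd K" using l by simp
qed

lemma call_Cellp:
  assumes "cell_ok w t" and ts: "Rep w K t ts" and "is": "Rep w K i is"
  shows "call prog (nm Cellp) (input_val w # ts @ is) (cell (if i < 1 then blank else cv w t (i - 1)))"
proof -
  let ?L = "input_val w # ts @ is" and ?t = "xs 1 (wd K)" and ?i = "xs (1 + wd K) (wd K)"
  note env = cell_env[OF ts "is"]
  have z: "ev (en ?L) (isz K (X 0) ?i) (bool_val (i = 0))"
    using ev_isz[OF level_K _ "is" env(1,3)] by simp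
  have c: "ev (en ?L) (apps (Fn Cell) (X 0 # ?t @ predE K (X 0) ?i)) (cell (cv w t (i - 1)))" if pos: "0 < i"
  proof -
    obtain js where js: "list_all2 (ev (en ?L)) (predE K (X 0) ?i) js" "Rep w K (i - 1) js"
      using level_okD(2)[OF level_K "is" pos env(1,3)] by blast
    show ?thesis
      by (rule ev_Fn[of _ _ "input_val w # ts @ js"])
        (use env js ts assms(1) Rep_length in \<open>auto simp: cell_ok_def intro: list_all2_appendI\<close>)
  qed
  have "ev (en ?L) (If (isz K (X 0) ?i) (cc blank) (apps (Fn Cell) (X 0 # ?t @ predE K (X 0) ?i)))
      (cell (if i < 1 then blank else cv w t (i - 1)))"
    by (rule ev_If[OF z]) (use c ev_Con in auto)
  then show ?thesis
    by (intro call_simple[of _ "1 + wd K + wd K"]) (use env(4) in \<open>auto simp: Let_def\<close>)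
qed

lemma cell_ok: assumes "w \<noteq> []" shows "cell_ok w t"
proof (induction t)
  case 0
  show ?case unfolding cell_ok_def
  proof (intro allI impI)
    fix ts i "is" assume ts: "Rep w K 0 ts" and "is": "Rep w K i is"
    let ?L = "input_val w # ts @ is" and ?t = "xs 1 (wd K)" and ?i = "xs (1 + wd K) (wd K)"
    note env = cell_env[OF ts "is"]
    have z: "ev (en ?L) (isz K (X 0) ?t) (bool_val True)"
      using ev_isz[OF level_K _ ts env(1,2)] by simp
    have "ev (en ?L) (apps (Fn Init) (X 0 # ?i)) (cell (cv w 0 i))"
      by (rule ev_Fn[of _ _ "input_val w # is"]) (use env call_Init[OF assms "is"] Rep_length[OF "is"] in auto)
    then have e: "ev (en ?L) (If (isz K (X 0) ?t) (apps (Fn Init) (X 0 # ?i)) e) (cell (cv w 0 i))" for e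
      by (intro ev_If[OF z]) auto
    show "call prog (nm Cell) ?L (cell (cv w 0 i))"
      by (rule call_simple[OF _ cls.simps(7)[unfolded Let_def] _ e]) (use env(4) in auto)
  qed
next
  case (Suc t)
  show ?case unfolding cell_ok_def
  proof (intro allI impI)
    fix ts i "is" assume ts: "Rep w K (Suc t) ts" and "is": "Rep w K i is"
    let ?L = "input_val w # ts @ is" and ?t = "xs 1 (wd K)" and ?i = "xs (1 + wd K) (wd K)"
    note env = cell_env[OF ts "is"]
    have z: "ev (en ?L) (isz K (X 0) ?t) (bool_val False)"
      using ev_isz[OF level_K _ ts env(1,2)] by simp
    have zi: "ev (en ?L) (isz K (X 0) ?i) (bool_val (i = 0))"
      using ev_isz[OF level_K _ "is" env(1,3)] by simp
    obtain us where us: "list_all2 (ev (en ?L)) (predE K (X 0) ?t) us" "Rep w K t us"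
      using level_okD(2)[OF level_K ts _ env(1,2)] by auto
    have c: "ev (en ?L) (apps (Fn Cell) (X 0 # predE K (X 0) ?t @ ?i)) (cell (cv w t i))"
      by (rule ev_Fn[of _ _ "input_val w # us @ is"])
        (use env us "is" Suc Rep_length in \<open>auto simp: cell_ok_def intro: list_all2_appendI\<close>)
    have cp: "ev (en ?L) (apps (Fn Cellp) (X 0 # predE K (X 0) ?t @ ?i)) (cell (if i < 1 then blank else cv w t (i - 1)))"
      by (rule ev_Fn[of _ _ "input_val w # us @ is"])
        (use env us "is" call_Cellp[OF Suc us(2) "is"] Rep_length in \<open>auto intro: list_all2_appendI\<close>)
    have cpp: "ev (en ?L) (apps (Fn Cellp) (X 0 # predE K (X 0) ?t @ predE K (X 0) ?i)) (cell (if i < 2 then blank else cv w t (i - 2)))"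
      if pos: "0 < i"
    proof -
      obtain js where js: "list_all2 (ev (en ?L)) (predE K (X 0) ?i) js" "Rep w K (i - 1) js"
        using level_okD(2)[OF level_K "is" pos env(1,3)] by blast
      have "i - 1 < 1 \<longleftrightarrow> i < 2" and "i - 1 - 1 = i - 2" using pos by auto
      with call_Cellp[OF Suc us(2) js(2)]
      have *: "call prog (nm Cellp) (input_val w # us @ js) (cell (if i < 2 then blank else cv w t (i - 2)))" by (simp only:)
      show ?thesis
        by (rule ev_Fn[of _ _ "input_val w # us @ js"]) (use env us js * Rep_length in \<open>auto intro: list_all2_appendI\<close>)
    qed
    have l: "ev (en ?L) (If (isz K (X 0) ?i) (cc blank) (apps (Fn Cellp) (X 0 # predE K (X 0) ?t @ predE K (X 0) ?i)))
        (cell (if i < 2 then blank else cv w t (i - 2)))"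
      by (rule ev_If[OF zi]) (use cpp ev_Con in auto)
    let ?vs = "[cell (if i < 2 then blank else cv w t (i - 2)), cell (if i < 1 then blank else cv w t (i - 1)), cell (cv w t i)]"
    have "call prog (nm Rule) ?vs (cell (cv w (Suc t) i))"
      unfolding cv.simps by (rule call_Rule) (use cells cv_less in auto)
    then have "ev (en ?L) (apps (Fn Rule) [If (isz K (X 0) ?i) (cc blank) (apps (Fn Cellp) (X 0 # predE K (X 0) ?t @ predE K (X 0) ?i)),
        apps (Fn Cellp) (X 0 # predE K (X 0) ?t @ ?i), apps (Fn Cell) (X 0 # predE K (X 0) ?t @ ?i)]) (cell (cv w (Suc t) i))"
      by (intro ev_Fn[of _ _ ?vs]) (use l cp c in \<open>auto simp del: cv.simps\<close>)
    then have e: "ev (en ?L) (If (isz K (X 0) ?t) e (apps (Fn Rule) [If (isz K (X 0) ?i) (cc blank) (apps (Fn Cellp) (X 0 # predE K (X 0) ?t @ predE K (X 0) ?i)),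
        apps (Fn Cellp) (X 0 # predE K (X 0) ?t @ ?i), apps (Fn Cell) (X 0 # predE K (X 0) ?t @ ?i)])) (cell (cv w (Suc t) i))" for e
      by (intro ev_If[OF z]) auto
    show "call prog (nm Cell) ?L (cell (cv w (Suc t) i))"
      by (rule call_simple[OF _ cls.simps(7)[unfolded Let_def] _ e]) (use env(4) in auto)
  qed
qed

lemma call_IsAcc: "call prog (nm IsAcc) [cell i] (bool_val (i = acc))"
proof (cases "i = acc")
  case True
  then show ?thesis using ev_TR
    by (intro call_sel[of _ "[]" "Clause (nm IsAcc) [PCon (cn acc) []] TR" _ _ "en []"]) auto
next
  case False
  then show ?thesis using ev_FA inst_pxs0[of "[cell i]" 1]
    by (intro call_sel[of _ "[Clause (nm IsAcc) [PCon (cn acc) []] TR]" "Clause (nm IsAcc) (pxs 0 1) FA" "[]" _ "en [cell i]"]) auto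
qed

abbreviation "halt w \<equiv> P w K - 1"

lemma call_Main: "call prog (nm Main) [input_val w] (bool_val (w \<noteq> [] \<and> cv w (halt w) (halt w) = acc))"
proof (cases "w = []")
  case True
  then show ?thesis using ev_FA
    by (intro call_sel[of _ "[]" "Clause (nm Main) [pnil] FA" _ _ "en []"]) auto
next
  case False
  let ?L = "[input_val w]"
  have x: "ev (en ?L) (X 0) (input_val w)" using ev_X[of ?L 0] by simp
  obtain ms where ms: "list_all2 (ev (en ?L)) (maxE K (X 0)) ms" "Rep w K (halt w) ms"
    using level_okD(3)[OF level_K x] by blast
  have c: "ev (en ?L) (apps (Fn Cell) (X 0 # maxE K (X 0) @ maxE K (X 0))) (cell (cv w (halt w) (halt w)))"
    by (rule ev_Fn[of _ _ "input_val w # ms @ ms"])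
      (use x ms cell_ok[OF False] Rep_length in \<open>auto simp: cell_ok_def intro: list_all2_appendI\<close>)
  have e: "ev (en ?L) (apps (Fn IsAcc) [apps (Fn Cell) (X 0 # maxE K (X 0) @ maxE K (X 0))])
      (bool_val (w \<noteq> [] \<and> cv w (halt w) (halt w) = acc))"
    by (rule ev_Fn[of _ _ "[cell (cv w (halt w) (halt w))]"]) (use c call_IsAcc False in auto)
  obtain a l where w: "w = a # l" using False by (cases w) auto
  show ?thesis
    by (rule call_sel[of _ "[Clause (nm Main) [pnil] FA]" "Clause (nm Main) (pxs 0 1)
          (apps (Fn IsAcc) [apps (Fn Cell) (X 0 # maxE K (X 0) @ maxE K (X 0))])" "[]" _ "en ?L"])
      (use e inst_pxs0[of ?L 1] w in auto)
qed

text \<open>The program always yields one of the two booleans; by determinism there is no other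
  result, which gives the direction from acceptance.\<close>

theorem accepts_prog: "accepts prog w \<longleftrightarrow> w \<noteq> [] \<and> cv w (halt w) (halt w) = acc"
proof -
  let ?e = "App (Fun (main_fun prog)) (Var ''x'')"
  have "ev (\<lambda>_. input_val w) (apps (Fn Main) [Var ''x'']) (bool_val (w \<noteq> [] \<and> cv w (halt w) (halt w) = acc))"
    by (rule ev_Fn[of _ _ "[input_val w]"]) (use call_Main ev_var[of prog "\<lambda>_. input_val w" "''x''"] in auto)
  then have e: "ev (\<lambda>_. input_val w) ?e (bool_val (w \<noteq> [] \<and> cv w (halt w) (halt w) = acc))"
    by (simp add: main_prog apps_def)
  have b': "bool_val b' = VCon ''true'' [] \<longleftrightarrow> b'" for b' by (simp add: bool_val_def)
  have "accepts prog w \<longleftrightarrow> bool_val (w \<noteq> [] \<and> cv w (halt w) (halt w) = acc) = VCon ''true'' []"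
    unfolding accepts_def
  proof
    assume "ev (\<lambda>_. input_val w) ?e (VCon ''true'' [])"
    from eval_det[OF this e] show "bool_val (w \<noteq> [] \<and> cv w (halt w) (halt w) = acc) = VCon ''true'' []" by simp
  next
    assume "bool_val (w \<noteq> [] \<and> cv w (halt w) (halt w) = acc) = VCon ''true'' []"
    then show "ev (\<lambda>_. input_val w) ?e (VCon ''true'' [])" using e by (simp only:)
  qed
  then show ?thesis unfolding b' .
qed

end

subsection \<open>Turing machines as cellular automata\<close>

text \<open>Cell \<open>i\<close> at time \<open>t\<close> holds the tape square \<open>i - t\<close>; in these skewed coordinates a square only depends
  on cells at positions at most its own. The content \<open>0\<close> records acceptance and spreads to the neighbours.\<close>

definition enc :: "nat \<Rightarrow> nat option \<times> nat \<Rightarrow> nat" where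
  "enc qa x = (if fst x = Some qa then 0 else Suc (to_nat x))"

definition dec :: "nat \<Rightarrow> nat option \<times> nat" where "dec c = from_nat (c - 1)"

lemma dec_enc: "enc qa x \<noteq> 0 \<Longrightarrow> dec (enc qa x) = x"
  by (auto simp: enc_def dec_def split: if_splits)

definition square :: "config \<Rightarrow> int \<Rightarrow> nat option \<times> nat" where
  "square c z = (case c of (q, T, h) \<Rightarrow> (if z = h then Some q else None, T z))"

locale machine =
  fixes M :: tm
  assumes valid: "valid_tm M"
begin

text \<open>The rejecting state idles here, as it does in \<open>tm_step\<close>. Only acceptance
  ends the local simulation, through the content 0.\<close>

definition move :: "nat \<Rightarrow> nat \<Rightarrow> nat \<times> nat \<times> dir" where
  "move q a = (if q = tm_rej M then (q, a, Stay) else tm_delta M q a)"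

definition arrive :: "dir \<Rightarrow> nat option \<times> nat \<Rightarrow> nat option" where
  "arrive d x = (case x of (None, a) \<Rightarrow> None
     | (Some q, a) \<Rightarrow> (case move q a of (q', a', d') \<Rightarrow> if d' = d then Some q' else None))"

definition written :: "nat option \<times> nat \<Rightarrow> nat" where
  "written x = (case x of (None, a) \<Rightarrow> a | (Some q, a) \<Rightarrow> fst (snd (move q a)))"

text \<open>A configuration has one head, so at most one of the three squares sends it here and the
  order of the tests does not matter on a run.\<close>

definition local_rule :: "nat option \<times> nat \<Rightarrow> nat option \<times> nat \<Rightarrow> nat option \<times> nat \<Rightarrow> nat option \<times> nat" where
  "local_rule l s r =
    (if arrive Rgt l \<noteq> None then arrive Rgt l else if arrive Stay s \<noteq> None then arrive Stay s else arrive Lft r, written s)"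

lemma step_move:
  "q \<noteq> tm_acc M \<Longrightarrow> tm_step M (q, T, h) = (case move q (T h) of (q', a, d) \<Rightarrow> (q', T(h := a), h + shift d))"
  by (auto simp: tm_step_def move_def split: prod.splits)

lemma square_step:
  assumes "fst c \<noteq> tm_acc M"
  shows "square (tm_step M c) z = local_rule (square c (z - 1)) (square c z) (square c (z + 1))"
proof -
  obtain q T h where c: "c = (q, T, h)" by (cases c) auto
  obtain q' a d where m: "move q (T h) = (q', a, d)" by (cases "move q (T h)") auto
  have "z = h \<or> z = h + 1 \<or> z = h - 1 \<or> z \<noteq> h \<and> z \<noteq> h + 1 \<and> z \<noteq> h - 1" by blast
  then show ?thesis using assms
    unfolding c fst_conv local_rule_def square_def step_move[of q T h, unfolded m prod.case]
    by (elim disjE; cases d) (auto simp: step_move m arrive_def written_def)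
qed

definition contents :: "(nat option \<times> nat) set" where
  "contents = insert None (Some ` tm_states M) \<times> tm_syms M"

abbreviation "code \<equiv> enc (tm_acc M)"

definition ncells :: nat where "ncells = Suc (Max (code ` contents))"

lemma finite_contents: "finite contents" "(None, 0) \<in> contents"
  using valid by (auto simp: contents_def valid_tm_def)

lemma code_less: "x \<in> contents \<Longrightarrow> code x < ncells"
  unfolding ncells_def using finite_contents by (simp add: less_Suc_eq_le)

text \<open>The test \<open>ncells \<le> x\<close> makes the rule closed on the cells also for
  triples that no run produces.\<close>

definition ca_rule :: "nat \<Rightarrow> nat \<Rightarrow> nat \<Rightarrow> nat" where
  "ca_rule i j k = (let x = code (local_rule (dec i) (dec j) (dec k)) in
     if i = 0 \<or> j = 0 \<or> k = 0 \<or> ncells \<le> x then 0 else x)"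

definition config_at :: "bool list \<Rightarrow> nat \<Rightarrow> config" where "config_at w t = (tm_step M ^^ t) (tm_init M w)"

lemma config_at_simps: "config_at w 0 = tm_init M w" "config_at w (Suc t) = tm_step M (config_at w t)"
  by (simp_all add: config_at_def)

lemma config_at_inv:
  "case config_at w t of (q, T, h) \<Rightarrow> q \<in> tm_states M \<and> (\<forall>z. T z \<in> tm_syms M) \<and> \<bar>h\<bar> \<le> int t \<and> (\<forall>z. z < - int t \<longrightarrow> T z = 0)"
proof (induction t)
  case 0
  show ?case using valid by (auto simp: config_at_simps tm_init_def valid_tm_def)
next
  case (Suc t)
  obtain q T h where c: "config_at w t = (q, T, h)" by (cases "config_at w t") auto
  obtain q' a d where m: "tm_delta M q (T h) = (q', a, d)" by (cases "tm_delta M q (T h)") auto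
  have i: "q \<in> tm_states M" "\<forall>z. T z \<in> tm_syms M" "\<bar>h\<bar> \<le> int t" "\<forall>z. z < - int t \<longrightarrow> T z = 0"
    using Suc c by auto
  have "q' \<in> tm_states M \<and> a \<in> tm_syms M"
    using valid i(1,2) m unfolding valid_tm_def by (metis (mono_tags, lifting) case_prod_conv)
  then show ?case using i by (cases d) (auto simp: config_at_simps c tm_step_def m)
qed

lemma square_contents: "square (config_at w t) z \<in> contents"
  using config_at_inv[of t w] by (auto simp: square_def contents_def split: prod.splits)

text \<open>In skewed coordinates these squares are exactly the positions left of 0 at time
  \<open>t\<close>.\<close>

lemma square_left: "z < - int t \<Longrightarrow> square (config_at w t) z = (None, 0)"
  using config_at_inv[of t w] by (auto simp: square_def split: prod.splits)

lemma code_nonzero: "fst c \<noteq> tm_acc M \<Longrightarrow> code (square c z) \<noteq> 0"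
  by (auto simp: enc_def square_def split: prod.splits)

lemma ca_rule_code:
  assumes "fst (config_at w t) \<noteq> tm_acc M"
  shows "ca_rule (code (square (config_at w t) (z - 1))) (code (square (config_at w t) z)) (code (square (config_at w t) (z + 1)))
    = code (square (config_at w (Suc t)) z)"
proof -
  note nz = code_nonzero[OF assms]
  have "code (square (config_at w (Suc t)) z) < ncells" using code_less square_contents by blast
  then show ?thesis
    unfolding ca_rule_def dec_enc[OF nz] config_at_simps(2) square_step[OF assms] by (simp add: Let_def nz)
qed

lemma halted: "fst (config_at w t) \<in> {tm_acc M, tm_rej M} \<Longrightarrow> t \<le> u \<Longrightarrow> fst (config_at w u) = fst (config_at w t)"
proof (induction u)
  case (Suc u)
  show ?case
  proof (cases "t = Suc u")
    case False
    then have "fst (config_at w u) = fst (config_at w t)" using Suc by simp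
    then show ?thesis using Suc.prems(1) by (cases "config_at w u") (auto simp: config_at_simps tm_step_def)
  qed simp
qed simp

text \<open>The program inspects the single cell \<open>halt w\<close> at time
  \<open>halt w\<close>, which acceptance must have reached by then. At time \<open>t\<close> the
  head is at position at most \<open>2 * t\<close>, and the content 0 gains two positions per step
  on its right; so \<open>2 * t \<le> halt w\<close> suffices, which is where
  \<open>2 * t + 1\<close> comes from.\<close>

lemma program_of_machine:
  assumes "0 < b"
    and time: "\<And>w. w \<noteq> [] \<Longrightarrow> \<exists>t. 2 * t + 1 \<le> exp2 K (Suc (length w) ^ b) \<and>
      fst (config_at w t) = (if w \<in> L then tm_acc M else tm_rej M)"
  shows "\<exists>p. det_wf_cf_prog K p \<and> lang p = {w \<in> L. w \<noteq> []}"
proof -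
  let ?s = "tm_start M"
  have st: "?s \<in> tm_states M" "{0, 1, 2} \<subseteq> tm_syms M" and ar: "tm_acc M \<noteq> tm_rej M"
    using valid by (auto simp: valid_tm_def)
  interpret ca_program K b ncells ca_rule "code (None, 0)" 0 "code (Some ?s, Suc 0)" "code (Some ?s, 2)" "code (None, Suc 0)" "code (None, 2)"
  proof
    show "0 < b" by fact
    show "0 < ncells" by (simp add: ncells_def)
    then show "ca_rule i j k < ncells" for i j k by (simp add: ca_rule_def Let_def)
  qed (use st in \<open>auto intro!: code_less simp: contents_def\<close>)
  have P: "P w k = exp2 k (Suc (length w) ^ b)" for w k
    by (induction k) auto
  have sim: "cv w t i = code (square (config_at w t) (int i - int t))"
    if "w \<noteq> []" "\<forall>u<t. fst (config_at w u) \<noteq> tm_acc M" for w t i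
    using that
  proof (induction t arbitrary: i)
    case 0
    then show ?case by (auto simp: config_at_simps tm_init_def square_def)
  next
    case (Suc t)
    have IH: "cv w t i = code (square (config_at w t) (int i - int t))" for i by (rule Suc.IH) (use Suc.prems in auto)
    let ?z = "int i - int (Suc t)"
    have "(if i < 2 then code (None, 0) else cv w t (i - 2)) = code (square (config_at w t) (?z - 1))"
    proof (cases "i < 2")
      case True
      then show ?thesis using square_left[of "?z - 1" t w] by simp
    next
      case False
      then have "int (i - 2) - int t = ?z - 1" by (simp add: of_nat_diff)
      then show ?thesis using False IH[of "i - 2"] by (simp only: if_False)
    qed
    moreover have "(if i < 1 then code (None, 0) else cv w t (i - 1)) = code (square (config_at w t) ?z)"
    proof (cases "i < 1")
      case True
      then show ?thesis using square_left[of "?z" t w] by simp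
    next
      case False
      then have "int (i - 1) - int t = ?z" by (simp add: of_nat_diff)
      then show ?thesis using False IH[of "i - 1"] by (simp only: if_False)
    qed
    moreover have "cv w t i = code (square (config_at w t) (?z + 1))" by (simp add: IH)
    ultimately show ?case using ca_rule_code[of w t ?z] Suc.prems(2) unfolding cv.simps by simp
  qed
  have rule0: "ca_rule 0 j k = 0" "ca_rule i 0 k = 0" "ca_rule i j 0 = 0" for i j k
    by (simp_all add: ca_rule_def)
  \<comment> \<open>The rule reads a position and the two on its left, so one step also carries 0 to
    the two positions on the right. The three cases tell from which cell the new one inherits
    it.\<close>
  have flood: "cv w (t + s) (i + j) = 0" if "cv w t i = 0" "j \<le> 2 * s" for w t s i j
    using that(2)
  proof (induction s arbitrary: j)
    case 0
    then show ?case using that(1) by simp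
  next
    case (Suc s)
    consider "j \<le> 2 * s" | "0 < j" "j - 1 \<le> 2 * s" | "2 \<le> j" "j - 2 \<le> 2 * s" using Suc.prems by fastforce
    then show ?case
    proof cases
      case 1
      then show ?thesis using Suc.IH[of j] by (simp add: rule0)
    next
      case 2
      then show ?thesis using Suc.IH[of "j - 1"] by (simp add: rule0)
    next
      case 3
      then show ?thesis using Suc.IH[of "j - 2"] by (simp add: rule0)
    qed
  qed
  have "accepts prog w \<longleftrightarrow> w \<in> L" if w: "w \<noteq> []" for w
  proof -
    obtain t where t: "2 * t + 1 \<le> P w K" "fst (config_at w t) = (if w \<in> L then tm_acc M else tm_rej M)"
      using time[OF w] by (auto simp: P)
    show ?thesis
    proof (cases "w \<in> L")
      case True
      then have acc: "fst (config_at w t) = tm_acc M" using t by simp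
      \<comment> \<open>The simulation is exact only as long as no earlier configuration accepts, so
        it is applied at the first accepting time.\<close>
      define u where "u = (LEAST u. fst (config_at w u) = tm_acc M)"
      have u: "fst (config_at w u) = tm_acc M" unfolding u_def by (rule LeastI[where P = "\<lambda>u. fst (config_at w u) = tm_acc M", OF acc])
      have ut: "u \<le> t" unfolding u_def by (rule Least_le[where P = "\<lambda>u. fst (config_at w u) = tm_acc M", OF acc])
      have before: "\<forall>v<u. fst (config_at w v) \<noteq> tm_acc M" unfolding u_def using not_less_Least by blast
      obtain T h where c: "config_at w u = (tm_acc M, T, h)" using u by (cases "config_at w u") auto
      have h: "\<bar>h\<bar> \<le> int u" using config_at_inv[of u w] c by simp
      have "cv w u (nat (h + int u)) = 0"
        using sim[OF w before] h c by (simp add: square_def enc_def)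
      moreover define i where "i = nat (h + int u)"
      moreover have "i \<le> 2 * u" using h by (simp add: i_def)
      ultimately have "cv w (u + (halt w - u)) (i + (halt w - i)) = 0"
        using ut t(1) by (intro flood) auto
      then have "cv w (halt w) (halt w) = 0" using \<open>i \<le> 2 * u\<close> ut t(1) by simp
      then show ?thesis using True w by (simp add: accepts_prog)
    next
      case False
      then have rej: "fst (config_at w t) = tm_rej M" using t by simp
      have "fst (config_at w u) \<noteq> tm_acc M" for u
        using halted[of w t u] halted[of w u t] rej ar by (cases "t \<le> u") auto
      then have "cv w (halt w) (halt w) \<noteq> 0"
        using sim[OF w] code_nonzero by simp
      then show ?thesis using False by (simp add: accepts_prog)
    qed
  qed
  then have acc: "accepts prog w \<longleftrightarrow> w \<in> L \<and> w \<noteq> []" for w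
    using accepts_prog[of "[]"] by (cases "w = []") simp_all
  have "lang prog = {w \<in> L. w \<noteq> []}" unfolding lang_def acc ..
  then show ?thesis using prog_in_class by blast
qed

end

theorem EXPTIME_program:
  assumes "L \<in> EXPTIME K" shows "\<exists>p. det_wf_cf_prog K p \<and> lang p = L"
proof -
  obtain a' b' M a where L: "\<forall>w\<in>L. w \<noteq> []" and M: "valid_tm M"
    and t: "\<And>w. w \<noteq> [] \<Longrightarrow> \<exists>t\<le>a * exp2 K (a' * length w ^ b'). fst ((tm_step M ^^ t) (tm_init M w)) = (if w \<in> L then tm_acc M else tm_rej M)"
    using assms unfolding EXPTIME_def TIME_def by blast
  interpret machine M by standard (rule M)
  have "bnd K (\<lambda>n. exp2 K (a' * n ^ b'))" unfolding bnd_def by blast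
  then have "bnd K (\<lambda>n. 2 * (a * exp2 K (a' * n ^ b')) + 1)" by (intro bnd_add bnd_mult bnd_const)
  then obtain c d where cd: "\<And>n. 1 \<le> n \<Longrightarrow> 2 * (a * exp2 K (a' * n ^ b')) + 1 \<le> exp2 K (c * n ^ d)"
    unfolding bnd_def by blast
  \<comment> \<open>The factor \<open>c\<close> is absorbed by
    \<open>c \<le> 2 ^ c \<le> Suc ?n ^ c\<close>, for \<open>?n\<close> at least 1; the extra 1
    makes the number of digits positive.\<close>
  let ?b = "c + d + 1"
  have "\<exists>t. 2 * t + 1 \<le> exp2 K (Suc (length w) ^ ?b) \<and> fst (config_at w t) = (if w \<in> L then tm_acc M else tm_rej M)"
    if w: "w \<noteq> []" for w
  proof -
    let ?n = "length w"
    have n: "1 \<le> ?n" using w by (cases w) auto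
    obtain t where t: "t \<le> a * exp2 K (a' * ?n ^ b')" "fst (config_at w t) = (if w \<in> L then tm_acc M else tm_rej M)"
      using t[OF w] unfolding config_at_def by blast
    have "c \<le> 2 ^ c" by (rule less_imp_le[OF less_exp])
    also have "\<dots> \<le> Suc ?n ^ c" using n by (intro power_mono) auto
    finally have "c * ?n ^ d \<le> Suc ?n ^ c * Suc ?n ^ d" by (intro mult_mono power_mono) auto
    also have "\<dots> \<le> Suc ?n ^ ?b" by (simp add: power_add)
    finally have "exp2 K (c * ?n ^ d) \<le> exp2 K (Suc ?n ^ ?b)" by (rule exp2_mono)
    moreover have "2 * t + 1 \<le> exp2 K (c * ?n ^ d)" using cd[OF n] t(1) by linarith
    ultimately show ?thesis using t(2) by (intro exI[of _ t]) simp
  qed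
  from program_of_machine[OF _ this] have "\<exists>p. det_wf_cf_prog K p \<and> lang p = {w \<in> L. w \<noteq> []}" by simp
  moreover have "{w \<in> L. w \<noteq> []} = L" using L by blast
  ultimately show ?thesis by simp
qed

theorem theorem1:
  fixes K :: nat and X :: "bool list set"
  assumes "\<forall>w\<in>X. w \<noteq> []"
  shows "(\<exists>p. det_wf_cf_prog K p \<and> lang p = X) \<longleftrightarrow> X \<in> EXPTIME K"
  using program_EXPTIME EXPTIME_program assms by metis

end
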